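(* Let $L_1,L_2,d,K>0$, $\Omega=(-L_1,L_1)\times(-L_2,L_2)\times(0,d)\subset\mathbb{R}^3$ with coordinates $(x,y,z)$, $$I(n)=\int_\Omega|\nabla n|^2\,dx+K\mathcal{H}^2(S_n),\qquad \mathcal{A}=\left\{n\in SBV^2(\Omega,\mathbb{S}^2\cup\{0\}) : n|_{z=0}=e_1,\ n|_{z=d}=e_3\right\}.$$ If $K>\frac{\pi^2}{4d}$, then the unique global minimiser of $I$ over $\mathcal{A}$ is $$n^*=\left(\cos\left(\tfrac{\pi z}{2d}\right),\,0,\,\sin\left(\tfrac{\pi z}{2d}\right)\right)^T.$$ If $K<\frac{\pi^2}{4d}$, then the global minimisers are given by the one-parameter family $$n'_\alpha=\begin{cases}e_1& z\in(0,\alpha),\\ e_3& z\in(\alpha,d),\end{cases}$$ for $\alpha\in(0,d)$. In the critical case $K=\frac{\pi^2}{4d}$, both $n'_\alpha$ and $n^*$ are global minimisers.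
   Context: $e_1,e_2,e_3$ are the standard basis vectors of $\mathbb{R}^3$. $S_n$ is the approximate discontinuity set and $SBV^2$ denotes functions in $SBV$ (special functions of bounded variation) with approximate gradient $\nabla n\in L^2$ and $\mathcal{H}^{2}(S_n)<\infty$. The boundary conditions are imposed in the weak (extended domain) sense: for a fixed $\epsilon>0$, $n$ is extended by $e_1$ to $-\epsilon<z<0$ and by $e_3$ to $d<z<d+\epsilon$, and $S_n$ is the discontinuity set of the extended map in $(-L_1,L_1)\times(-L_2,L_2)\times(-\epsilon,d+\epsilon)$, so the jump set may lie on the faces $z=0$, $z=d$ where the boundary conditions are applied.
   Formalization: For K<π²/(4d) the full set of minimisers is n'_α with α in the closed interval [0,d], not (0,d): the constants e_3 (α=0) and e_1 (α=d) are admissible with their jump on a face and have the same energy; minimisers are identified a.e. *)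

theory Defs
  imports "HOL-Analysis.Analysis"
begin

subsection \<open>Hausdorff measure\<close>

text \<open>The \<open>k\<close>-dimensional Hausdorff measure with the normalisation for which it agrees with
  Lebesgue measure in \<open>\<real>\<^sup>k\<close>.  Boundedness of the covering sets is explicit because
  \<^const>\<open>diameter\<close> is meaningless on unbounded sets; the test for the empty set only matters
  for \<open>k = 0\<close>.\<close>

definition hausdorff_pre :: "nat \<Rightarrow> real \<Rightarrow> 'a::metric_space set \<Rightarrow> ennreal" where
  "hausdorff_pre k \<delta> A =
     (INF C \<in> {C :: nat \<Rightarrow> 'a set. A \<subseteq> (\<Union>i. C i) \<and> (\<forall>i. bounded (C i) \<and> diameter (C i) \<le> \<delta>)}.
        \<Sum>i. if C i = {} then 0
            else ennreal (unit_ball_vol (real k) * (diameter (C i) / 2) ^ k))"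

definition hausdorff :: "nat \<Rightarrow> 'a::metric_space set \<Rightarrow> ennreal" where
  "hausdorff k A = (SUP \<delta> \<in> {0<..}. hausdorff_pre k \<delta> A)"


subsection \<open>Approximate limits and approximate gradients\<close>

definition has_approx_limit :: "(real ^ 'n \<Rightarrow> real ^ 'm) \<Rightarrow> real ^ 'n \<Rightarrow> real ^ 'm \<Rightarrow> bool" where
  "has_approx_limit u x z \<longleftrightarrow>
     ((\<lambda>r. (LINT y : ball x r | lebesgue. norm (u y - z)) / measure lebesgue (ball x r))
        \<longlongrightarrow> 0) (at_right 0)"

definition approx_discontinuity_set ::
    "(real ^ 'n) set \<Rightarrow> (real ^ 'n \<Rightarrow> real ^ 'm) \<Rightarrow> (real ^ 'n) set" where
  "approx_discontinuity_set \<Omega> u = {x \<in> \<Omega>. \<not> (\<exists>z. has_approx_limit u x z)}"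

definition has_approx_gradient ::
    "(real ^ 'n \<Rightarrow> real ^ 'm) \<Rightarrow> real ^ 'n \<Rightarrow> real ^ 'n ^ 'm \<Rightarrow> bool" where
  "has_approx_gradient u x G \<longleftrightarrow>
     (\<exists>z. has_approx_limit u x z \<and>
       ((\<lambda>r. (LINT y : ball x r | lebesgue. norm (u y - z - G *v (y - x)) / r)
               / measure lebesgue (ball x r)) \<longlongrightarrow> 0) (at_right 0))"

definition approx_gradient :: "(real ^ 'n \<Rightarrow> real ^ 'm) \<Rightarrow> real ^ 'n \<Rightarrow> real ^ 'n ^ 'm" where
  "approx_gradient u x = (THE G. has_approx_gradient u x G)"


subsection \<open>Functions of bounded variation\<close>

text \<open>\<open>\<phi>\<close> is a compactly supported \<open>C\<^sup>1\<close> function on \<open>\<Omega>\<close> with gradient \<open>g\<close>.\<close>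

definition test_function :: "(real ^ 'n) set \<Rightarrow> (real ^ 'n \<Rightarrow> real) \<Rightarrow> (real ^ 'n \<Rightarrow> real ^ 'n) \<Rightarrow> bool" where
  "test_function \<Omega> \<phi> g \<longleftrightarrow>
     (\<forall>x. (\<phi> has_derivative (\<lambda>h. g x \<bullet> h)) (at x)) \<and> continuous_on UNIV g \<and>
     compact (closure {x. \<phi> x \<noteq> 0}) \<and> closure {x. \<phi> x \<noteq> 0} \<subseteq> \<Omega>"

text \<open>The distributional derivative of \<open>u\<close> in \<open>\<Omega>\<close> is the finite matrix-valued Borel measure
  \<open>Du = \<sigma> \<mu>\<close>, given through its polar decomposition: \<open>\<mu> = |Du|\<close> is the total variation
  measure and \<open>\<sigma>\<close> is the density of \<open>Du\<close> with respect to it.  The measure \<open>\<mu>\<close> lives on the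
  whole space and is carried by \<open>\<Omega>\<close>; the norm of a matrix is the Euclidean (Frobenius) norm.\<close>

definition has_measure_derivative ::
    "(real ^ 'n) set \<Rightarrow> (real ^ 'n \<Rightarrow> real ^ 'm) \<Rightarrow>
     (real ^ 'n) measure \<Rightarrow> (real ^ 'n \<Rightarrow> real ^ 'n ^ 'm) \<Rightarrow> bool" where
  "has_measure_derivative \<Omega> u \<mu> \<sigma> \<longleftrightarrow>
     sets \<mu> = sets borel \<and> finite_measure \<mu> \<and> - \<Omega> \<in> null_sets \<mu> \<and>
     \<sigma> \<in> borel_measurable borel \<and> (AE x in \<mu>. norm (\<sigma> x) = 1) \<and>
     (\<forall>\<phi> g i j. test_function \<Omega> \<phi> g \<longrightarrow>
        (LINT x : \<Omega> | lebesgue. u x $ i * g x $ j) = - (LINT x | \<mu>. \<phi> x * \<sigma> x $ i $ j))"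

definition BV :: "(real ^ 'n) set \<Rightarrow> (real ^ 'n \<Rightarrow> real ^ 'm) set" where
  "BV \<Omega> = {u. set_integrable lebesgue \<Omega> u \<and> (\<exists>\<mu> \<sigma>. has_measure_derivative \<Omega> u \<mu> \<sigma>)}"

definition lebesgue_decomposition ::
    "'a::euclidean_space measure \<Rightarrow> 'a measure \<Rightarrow> 'a measure \<Rightarrow> bool" where
  "lebesgue_decomposition \<mu> \<mu>\<^sub>a \<mu>\<^sub>s \<longleftrightarrow>
     sets \<mu>\<^sub>a = sets borel \<and> sets \<mu>\<^sub>s = sets borel \<and>
     (\<forall>A \<in> sets borel. emeasure \<mu> A = emeasure \<mu>\<^sub>a A + emeasure \<mu>\<^sub>s A) \<and>
     absolutely_continuous lborel \<mu>\<^sub>a \<and> (\<exists>N \<in> null_sets lborel. - N \<in> null_sets \<mu>\<^sub>s)"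

text \<open>\<open>SBV\<close>: the Cantor part \<open>D\<^sup>cu = D\<^sup>su \<llcorner> (\<Omega> - S\<^sub>u)\<close> vanishes, where \<open>D\<^sup>su\<close> is the part of
  \<open>Du\<close> singular to Lebesgue measure.  If \<open>\<mu>\<^sub>s\<close> is the singular part of \<open>|Du|\<close>, then
  \<open>|D\<^sup>cu| = \<mu>\<^sub>s \<llcorner> (\<Omega> - S\<^sub>u)\<close>.  The measures below are uniquely determined by \<open>u\<close>, and \<open>\<sigma>\<close> up to \<open>\<mu>\<close>-null sets.\<close>

definition SBV :: "(real ^ 'n) set \<Rightarrow> (real ^ 'n \<Rightarrow> real ^ 'm) set" where
  "SBV \<Omega> = {u \<in> BV \<Omega>. \<exists>\<mu> \<sigma> \<mu>\<^sub>a \<mu>\<^sub>s. has_measure_derivative \<Omega> u \<mu> \<sigma> \<and>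
      lebesgue_decomposition \<mu> \<mu>\<^sub>a \<mu>\<^sub>s \<and> \<Omega> - approx_discontinuity_set \<Omega> u \<in> null_sets \<mu>\<^sub>s}"

text \<open>\<open>SBV\<^sup>2(\<Omega>, T)\<close>.  Almost everywhere approximate differentiability (automatic for
  \<open>BV\<close> functions by the theorem of Calderon and Zygmund) is recorded because
  \<^const>\<open>approx_gradient\<close> is unspecified at points where it fails.  Maps are not quotiented by
  equality almost everywhere, so their values are constrained almost everywhere only.\<close>

definition SBV2 :: "(real ^ 'n) set \<Rightarrow> (real ^ 'm) set \<Rightarrow> (real ^ 'n \<Rightarrow> real ^ 'm) set" where
  "SBV2 \<Omega> T = {u \<in> SBV \<Omega>.
      (AE x in lebesgue_on \<Omega>. u x \<in> T) \<and>
      (AE x in lebesgue_on \<Omega>. \<exists>G. has_approx_gradient u x G) \<and>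
      set_integrable lebesgue \<Omega> (\<lambda>x. (norm (approx_gradient u x))\<^sup>2) \<and>
      hausdorff (CARD('n) - 1) (approx_discontinuity_set \<Omega> u) < \<infinity>}"


subsection \<open>The variational problem\<close>

definition cell :: "real \<Rightarrow> real \<Rightarrow> real \<Rightarrow> (real ^ 3) set" where
  "cell L1 L2 d = box (vector [- L1, - L2, 0]) (vector [L1, L2, d])"

definition extended_cell :: "real \<Rightarrow> real \<Rightarrow> real \<Rightarrow> real \<Rightarrow> (real ^ 3) set" where
  "extended_cell L1 L2 d \<epsilon> = box (vector [- L1, - L2, - \<epsilon>]) (vector [L1, L2, d + \<epsilon>])"

definition extend_director :: "real \<Rightarrow> (real ^ 3 \<Rightarrow> real ^ 3) \<Rightarrow> real ^ 3 \<Rightarrow> real ^ 3" where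
  "extend_director d n p =
     (if p $ 3 \<le> 0 then axis 1 1 else if p $ 3 \<ge> d then axis 3 1 else n p)"

text \<open>The boundary conditions enter only through the extension: a map that violates them pays
  for a jump on the faces \<open>z = 0\<close> or \<open>z = d\<close>.\<close>

definition admissible :: "real \<Rightarrow> real \<Rightarrow> real \<Rightarrow> real \<Rightarrow> (real ^ 3 \<Rightarrow> real ^ 3) set" where
  "admissible L1 L2 d \<epsilon> =
     {n \<in> SBV2 (cell L1 L2 d) (sphere 0 1 \<union> {0}).
        extend_director d n \<in> SBV2 (extended_cell L1 L2 d \<epsilon>) (sphere 0 1 \<union> {0})}"

definition energy ::
    "real \<Rightarrow> real \<Rightarrow> real \<Rightarrow> real \<Rightarrow> real \<Rightarrow> (real ^ 3 \<Rightarrow> real ^ 3) \<Rightarrow> ennreal" where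
  "energy L1 L2 d \<epsilon> K n =
     (\<integral>\<^sup>+ x \<in> cell L1 L2 d. ennreal ((norm (approx_gradient n x))\<^sup>2) \<partial>lebesgue) +
     ennreal K *
       hausdorff 2 (approx_discontinuity_set (extended_cell L1 L2 d \<epsilon>) (extend_director d n))"

definition global_minimiser ::
    "real \<Rightarrow> real \<Rightarrow> real \<Rightarrow> real \<Rightarrow> real \<Rightarrow> (real ^ 3 \<Rightarrow> real ^ 3) \<Rightarrow> bool" where
  "global_minimiser L1 L2 d \<epsilon> K n \<longleftrightarrow>
     n \<in> admissible L1 L2 d \<epsilon> \<and>
     (\<forall>m \<in> admissible L1 L2 d \<epsilon>. energy L1 L2 d \<epsilon> K n \<le> energy L1 L2 d \<epsilon> K m)"

definition n_star :: "real \<Rightarrow> real ^ 3 \<Rightarrow> real ^ 3" where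
  "n_star d p = vector [cos (pi * p $ 3 / (2 * d)), 0, sin (pi * p $ 3 / (2 * d))]"

text \<open>The value on the null set \<open>z = \<alpha>\<close> is immaterial.  On the cell the map is constantly
  \<open>e\<^sub>3\<close> for \<open>\<alpha> = 0\<close> and constantly \<open>e\<^sub>1\<close> for \<open>\<alpha> = d\<close>.\<close>

definition n_jump :: "real \<Rightarrow> real ^ 3 \<Rightarrow> real ^ 3" where
  "n_jump \<alpha> p = (if p $ 3 < \<alpha> then axis 1 1 else axis 3 1)"

end

(* Slice the extended cell by vertical lines.  Almost every line either meets the jump set or carries an
   absolutely continuous curve on the sphere from e1 to e3.  A curve costs at least pi^2/(4d), with an excess
   of at least a multiple of its squared L2 distance to n_star (complete the square).  The H^2 measure of the
   jump set bounds the area of its projection (isodiametric inequality and Fatou's lemma on coverings), so the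
   remaining lines cost at least K per unit area.  This gives the lower bound and uniqueness for
   K > pi^2/(4d).  For K < pi^2/(4d) a minimiser has zero gradient and one jump on almost every line.
   Projecting along the tilted directions (s1, s2, 1) and letting s tend to 0, the jump set has no room for a
   flux through vertical planes: the horizontal derivatives of the map vanish, so the jump height is constant. *)
theory Submission
 imports Defs
begin

text \<open>The map is known only almost everywhere and its jump set D is an arbitrary set, so
  neither traces on lines nor projections of D can be used directly. Lines are reached by testing
  the distributional derivative with a cutoff in the foot times a function of the height. The
  singular measure is carried by a sigma-compact S inside D, so projections of S are Borel; D enters
  only through covers whose projections are closed up.

  The excess stems from the constraint: for unit vectors v and N, (v - N) . N = - |v - N|^2 / 2. The
  linear term of the expansion around \<open>n_star\<close> is thus a negative multiple of the
  squared distance, and the Poincare inequality for functions vanishing at both ends more than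
  repays it.

  The tilt works because the projection along (s1, s2, 1) has squared Lipschitz constant 1 + s1^2 +
  s2^2: areas grow only quadratically in s, while a flux of horizontal derivatives enters linearly.
  The layers force a vertical flux that uses up the whole area of a minimal jump set, so the linear
  term must vanish.\<close>

lemmas integrable_dominated = Bochner_Integration.integrable_bound
lemmas continuous_borel = borel_measurable_continuous_onI
lemmas lint_cong = Bochner_Integration.integral_cong

section \<open>Density of a measure on a set that it does not charge\<close>

text \<open>Outer regularity puts A into an open V of arbitrarily small \<nu>-measure. Balls inside
  V that carry too much \<nu> are thinned out by the fivefold Vitali lemma, so the Lebesgue measure
  of the bad points is at most a constant times \<nu>(V). It serves twice: for the singular part of
  a derivative, and for Lebesgue points.\<close>

lemma measure_ball_density_zero:
 fixes \<nu> :: "'a::euclidean_space measure"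
 assumes sets: "sets \<nu> = sets borel" and fin: "finite_measure \<nu>"
  and A: "A \<in> sets borel" and zero: "emeasure \<nu> A = 0"
 shows "AE x in lborel. x \<in> A --> ((%r. measure \<nu> (ball x r) / r ^ DIM('a)) \<longlongrightarrow> 0) (at_right 0)"
proof -
 interpret finite_measure \<nu> by (rule fin)
 note [simp] = sets
 define bad where "bad t = {x \<in> A. \<exists>\<^sub>F r in at_right 0. measure \<nu> (ball x r) > t * r ^ DIM('a)}" for t :: real
 have neg: "negligible (bad t)" if t: "t > 0" for t unfolding negligible_outer_le
 proof (intro allI impI)
  fix e :: real assume e: "e > 0"
  \<comment> \<open>Volume of a ball of radius 5 r divided by t r^n: the Lebesgue measure of an
    enlarged ball per unit of \<nu> in the original one.\<close>
  define c where "c = unit_ball_vol (real DIM('a)) * 5 ^ DIM('a) / t"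
  have c: "c > 0" using t by (simp add: c_def)
  have "emeasure \<nu> A < ennreal (e / c)" using zero e c by simp
  then obtain V where V: "open V" "A \<subseteq> V" "emeasure \<nu> V < ennreal (e / c)"
   using outer_regular[OF sets _ A] emeasure_finite by (auto simp: INF_less_iff)
  have mV: "measure \<nu> V <= e / c" using V(3) e c by (simp add: emeasure_eq_measure ennreal_less_iff)
  \<comment> \<open>Radii are capped at 1 because the Vitali lemma asks for a bound;
    \<open>bad\<close> is defined by arbitrarily small radii, so enough balls remain.\<close>
  define K where "K = {(x, r). x \<in> bad t & 0 < r & r <= 1 & ball x r \<subseteq> V & measure \<nu> (ball x r) > t * r ^ DIM('a)}"
  have cov: "bad t \<subseteq> (\<Union>i\<in>K. ball (fst i) (snd i))"
  proof
   fix x assume x: "x \<in> bad t"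
   then have "x \<in> V" using V by (auto simp: bad_def)
   then obtain d where d: "d > 0" "ball x d \<subseteq> V" using V(1) open_contains_ball by blast
   have "\<forall>\<^sub>F r in at_right (0::real). 0 < r & r < min d 1" using d by (auto simp: eventually_at_right intro!: exI[of _ "min d 1"])
   with x have "\<exists>\<^sub>F r in at_right 0. measure \<nu> (ball x r) > t * r ^ DIM('a) & 0 < r & r < min d 1"
    unfolding bad_def by (auto intro: frequently_eventually_frequently)
   then obtain r where "measure \<nu> (ball x r) > t * r ^ DIM('a)" "0 < r" "r < min d 1" by (auto dest: frequently_ex)
   then have "(x, r) \<in> K" using x d by (auto simp: K_def)
   then show "x \<in> (\<Union>i\<in>K. ball (fst i) (snd i))" using \<open>0 < r\<close> by force
  qed
  have rK: "0 < snd i & snd i <= 1" if "i \<in> K" for i using that by (auto simp: K_def)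
  obtain C where C: "countable C" "C \<subseteq> K"
   "pairwise (%i j. disjnt (ball (fst i) (snd i)) (ball (fst j) (snd j))) C"
   "bad t \<subseteq> (\<Union>i\<in>C. ball (fst i) (5 * snd i))" by (rule Vitali_covering_lemma_balls[OF cov rK])
  have bd: "measure lebesgue (\<Union>i\<in>F. ball (fst i) (5 * snd i)) <= e" if F: "F \<subseteq> C" "finite F" for F
  proof -
   have "measure lebesgue (\<Union>i\<in>F. ball (fst i) (5 * snd i)) <= (\<Sum>i\<in>F. measure lebesgue (ball (fst i) (5 * snd i)))"
    using F by (intro measure_UNION_le) auto
   also have "... <= (\<Sum>i\<in>F. c * measure \<nu> (ball (fst i) (snd i)))"
   proof (rule sum_mono)
    fix i assume i: "i \<in> F"
    then have k: "snd i > 0" "measure \<nu> (ball (fst i) (snd i)) > t * snd i ^ DIM('a)" using F C by (auto simp: K_def)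
    have "measure lebesgue (ball (fst i) (5 * snd i)) = c * (t * snd i ^ DIM('a))" using k t by (simp add: c_def content_ball power_mult_distrib)
    also have "... <= c * measure \<nu> (ball (fst i) (snd i))" using k c by (intro mult_left_mono) auto
    finally show "measure lebesgue (ball (fst i) (5 * snd i)) <= c * measure \<nu> (ball (fst i) (snd i))" .
   qed
   also have "... = c * measure \<nu> (\<Union>i\<in>F. ball (fst i) (snd i))"
   proof -
    have "disjoint_family_on (%i. ball (fst i) (snd i)) F" using C(3) F(1) unfolding disjoint_family_on_def pairwise_def disjnt_def by blast
    then show ?thesis using F by (subst finite_measure_finite_Union) (auto simp: sum_distrib_left)
   qed
   also have "... <= c * measure \<nu> V"
   proof -
    have "ball (fst i) (snd i) \<subseteq> V" if "i \<in> K" for i using that by (auto simp: K_def)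
    then have "(\<Union>i\<in>F. ball (fst i) (snd i)) \<subseteq> V" using F C(2) by blast
    then show ?thesis using c V(1) by (intro mult_left_mono finite_measure_mono) auto
   qed
   also have "... <= e" using mV c by (simp add: field_simps)
   finally show ?thesis .
  qed
  show "\<exists>T. bad t \<subseteq> T & T \<in> lmeasurable & measure lebesgue T <= e"
   by (intro exI[of _ "\<Union>i\<in>C. ball (fst i) (5 * snd i)"] conjI C(4) fmeasurable_UN_bound[OF C(1) _ bd]
     measure_UN_bound[OF C(1) _ bd]) simp_all
 qed
 have "negligible (\<Union>n. bad (1 / real (Suc n)))" by (intro negligible_Union_nat neg) auto
 then have "AE x in lebesgue. x \<notin> (\<Union>n. bad (1 / real (Suc n)))" unfolding negligible_iff_null_sets by (rule AE_not_in)
 then have "AE x in lborel. x \<notin> (\<Union>n. bad (1 / real (Suc n)))" by (simp add: AE_completion_iff)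
 then show ?thesis
 proof (eventually_elim, intro impI)
  fix x assume nb: "x \<notin> (\<Union>n. bad (1 / real (Suc n)))" and x: "x \<in> A"
  show "((%r. measure \<nu> (ball x r) / r ^ DIM('a)) \<longlongrightarrow> 0) (at_right 0)"
  proof (rule tendstoI)
   fix e :: real assume "e > 0"
   then obtain n where n: "1 / real (Suc n) < e" by (metis nat_approx_posE)
   have "\<forall>\<^sub>F r in at_right 0. measure \<nu> (ball x r) <= 1 / real (Suc n) * r ^ DIM('a)"
    using nb x by (auto simp: bad_def not_frequently not_less)
   moreover have "\<forall>\<^sub>F r in at_right (0::real). 0 < r" by (simp add: eventually_at_right_less)
   ultimately show "\<forall>\<^sub>F r in at_right 0. dist (measure \<nu> (ball x r) / r ^ DIM('a)) 0 < e"
   proof eventually_elim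
    case (elim r)
    then have "measure \<nu> (ball x r) / r ^ DIM('a) <= 1 / real (Suc n)" by (simp add: divide_le_eq)
    then show ?case using n elim by simp
   qed
  qed
 qed
qed

section \<open>The isodiametric inequality in the plane\<close>

lemma dist_Pair_sq: "(dist (a::real, b::real) (c, d))\<^sup>2 = (a - c)\<^sup>2 + (b - d)\<^sup>2" by (simp add: dist_Pair_Pair dist_real_def)

text \<open>The vertical chord over x is paired with the chord over the mirror image x' of x in the
  midpoint c of the projection. Top and bottom ends of opposite chords are at distance at most D and
  horizontally 2 |x - c| apart, which bounds the two chord lengths together by twice the chord of
  the disc of diameter D over x. Integration over x compares the areas.\<close>

lemma isodiametric_plane_convex:
 fixes C :: "(real \<times> real) set"
 assumes comp: "compact C" and conv: "convex C" and D: "!!p q. p \<in> C ==> q \<in> C ==> dist p q <= D"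
  and D0: "D \<ge> 0"
 shows "emeasure lborel C <= ennreal (pi * (D / 2)\<^sup>2)"
proof (cases "C = {}")
 case False
 define l where "l x = emeasure lborel (Pair x -` C)" for x
 have borC: "C \<in> sets (lborel \<Otimes>\<^sub>M lborel)" unfolding lborel_prod using borel_compact[OF comp] by simp
 have lm[measurable]: "l \<in> borel_measurable borel" unfolding l_def using lborel.measurable_emeasure_Pair[OF borC] by simp
 have eC: "emeasure lborel C = (\<integral>\<^sup>+x. l x \<partial>lborel)"
  unfolding l_def using lborel.emeasure_pair_measure_alt[OF borC] by (simp add: lborel_prod)
 have "compact (fst ` C)" "convex (fst ` C)"
  using comp conv by (auto intro!: compact_continuous_image continuous_intros convex_linear_image linear_fst)
 then obtain a b where ab: "fst ` C = {a..b}" using connected_compact_interval_1[THEN iffD1, OF conjI, OF convex_connected] by metis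
 define c where "c = (a + b) / 2"
 define B where "B = cball (c, 0::real) (D / 2)"
 have borB: "B \<in> sets (lborel \<Otimes>\<^sub>M lborel)" unfolding lborel_prod B_def by simp
 have key: "l x + l (2 * c - x) <= 2 * emeasure lborel (Pair x -` B)" for x
 proof (cases "x \<in> {a..b}")
  case False
  then have "2 * c - x \<notin> {a..b}" by (auto simp: c_def field_simps)
  with False have "Pair x -` C = {}" "Pair (2 * c - x) -` C = {}" using ab by (force simp: set_eq_iff)+
  then show ?thesis by (simp add: l_def)
 next
  case True
  define x' where "x' = 2 * c - x"
  have "x' \<in> {a..b}" using True by (auto simp: c_def x'_def field_simps)
  have sec: "\<exists>u v. Pair y -` C \<subseteq> {u..v} & (y, u) \<in> C & (y, v) \<in> C & u <= v" if "y \<in> {a..b}" for y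
  proof -
   have ne: "Pair y -` C ~= {}" using that ab[symmetric] by auto
   have "compact (Pair y -` C)"
   proof -
    have "Pair y -` C = snd ` (C \<inter> {y} \<times> UNIV)" by force
    moreover have "compact (C \<inter> {y} \<times> UNIV)" using comp by (intro compact_Int_closed closed_Times) auto
    ultimately show ?thesis by (auto intro!: compact_continuous_image continuous_intros)
   qed
   then obtain u v where "u \<in> Pair y -` C" "\<forall>t\<in>Pair y -` C. u <= t" "v \<in> Pair y -` C" "\<forall>t\<in>Pair y -` C. t <= v"
    using compact_attains_inf compact_attains_sup ne by metis
   then show ?thesis by (intro exI[of _ u] exI[of _ v]) auto
  qed
  obtain u v where uv: "Pair x -` C \<subseteq> {u..v}" "(x, u) \<in> C" "(x, v) \<in> C" "u <= v" using sec[OF True] by blast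
  obtain u' v' where uv': "Pair x' -` C \<subseteq> {u'..v'}" "(x', u') \<in> C" "(x', v') \<in> C" "u' <= v'"
   using sec[OF \<open>x' \<in> {a..b}\<close>] by blast
  define s where "s = sqrt ((D / 2)\<^sup>2 - (x - c)\<^sup>2)"
  \<comment> \<open>2 s is the length of the chord of the disc over x. The second claim only says
    that the root defining s has a nonnegative argument.\<close>
  have dd: "\<bar>p - q\<bar> <= 2 * s" "(x - c)\<^sup>2 <= (D / 2)\<^sup>2" if "(x, p) \<in> C" "(x', q) \<in> C" for p q
  proof -
   have "(dist (x, p) (x', q))\<^sup>2 <= D\<^sup>2" using D[OF that] by (intro power_mono) auto
   then have *: "(x - x')\<^sup>2 + (p - q)\<^sup>2 <= D\<^sup>2" by (simp add: dist_Pair_sq)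
   moreover have "x - x' = 2 * (x - c)" by (simp add: x'_def)
   ultimately have pq: "(p - q)\<^sup>2 <= 4 * ((D / 2)\<^sup>2 - (x - c)\<^sup>2)" by (simp add: power2_eq_square algebra_simps)
   then have "0 <= 4 * ((D / 2)\<^sup>2 - (x - c)\<^sup>2)" by (rule order_trans[rotated]) simp
   then show "(x - c)\<^sup>2 <= (D / 2)\<^sup>2" by (simp only: zero_le_mult_iff) simp
   have "\<bar>p - q\<bar> = sqrt ((p - q)\<^sup>2)" by simp
   also have "... <= sqrt (4 * ((D / 2)\<^sup>2 - (x - c)\<^sup>2))" using pq by (rule real_sqrt_le_mono)
   finally show "\<bar>p - q\<bar> <= 2 * s" unfolding s_def real_sqrt_mult by simp
  qed
  have s0: "s \<ge> 0" using dd(2)[OF uv(2) uv'(2)] by (simp add: s_def)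
  have "l x <= emeasure lborel {u..v}" "l x' <= emeasure lborel {u'..v'}" unfolding l_def using uv(1) uv'(1) by (intro emeasure_mono; simp)+
  then have "l x + l x' <= ennreal (v - u) + ennreal (v' - u')" using uv uv' by (auto intro!: add_mono)
  also have "... = ennreal ((v - u) + (v' - u'))" using uv uv' by (simp add: ennreal_plus)
  \<comment> \<open>(v - u) + (v' - u') regrouped as (v - u') + (v' - u): each bracket joins points
    over different abscissae, so \<open>dd\<close> applies.\<close>
  also have "... <= ennreal (2 * (2 * s))" using dd(1)[OF uv(3) uv'(2)] dd(1)[OF uv(2) uv'(3)] by (intro ennreal_leI) linarith
  also have "... = 2 * emeasure lborel {- s .. s}" using s0 by (simp add: ennreal_mult)
  also have "... <= 2 * emeasure lborel (Pair x -` B)"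
  proof (intro mult_left_mono emeasure_mono subsetI)
   fix t assume t: "t \<in> {- s..s}"
   then have "t\<^sup>2 <= s\<^sup>2" using s0 by (auto simp: abs_le_square_iff[symmetric])
   also have "s\<^sup>2 = (D / 2)\<^sup>2 - (x - c)\<^sup>2" using dd(2)[OF uv(2) uv'(2)] by (simp add: s_def)
   finally have "(dist (c, 0) (x, t))\<^sup>2 <= (D / 2)\<^sup>2" by (simp add: dist_Pair_sq power2_commute[of c x])
   then have "dist (c, 0) (x, t) <= D / 2" by (rule power2_le_imp_le) (use D0 in simp)
   then show "t \<in> Pair x -` B" by (simp add: B_def)
  next
   show "Pair x -` B \<in> sets lborel" by (rule sets_Pair1[OF borB])
  qed simp_all
  finally show ?thesis by (simp add: x'_def)
 qed
 \<comment> \<open>Both chords of a pair contribute the same integral, hence the factor 2 on the two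
   sides of the final comparison.\<close>
 have reflection: "(\<integral>\<^sup>+x. l (2 * c - x) \<partial>lborel) = (\<integral>\<^sup>+x. l x \<partial>lborel)"
  using nn_integral_real_affine[of l "-1" "2 * c"] by simp
 have "(\<integral>\<^sup>+x. l x + l (2 * c - x) \<partial>lborel) = (\<integral>\<^sup>+x. l x \<partial>lborel) + (\<integral>\<^sup>+x. l (2 * c - x) \<partial>lborel)"
  by (intro nn_integral_add) simp_all
 then have "2 * emeasure lborel C = (\<integral>\<^sup>+x. l x + l (2 * c - x) \<partial>lborel)"
  using reflection eC mult_2[of "emeasure lborel C"] by presburger
 also have "... <= (\<integral>\<^sup>+x. 2 * emeasure lborel (Pair x -` B) \<partial>lborel)" by (intro nn_integral_mono key)
 also have "... = 2 * (\<integral>\<^sup>+x. emeasure lborel (Pair x -` B) \<partial>lborel)"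
  using lborel.measurable_emeasure_Pair[OF borB] by (intro nn_integral_cmult) simp
 also have "... = 2 * emeasure lborel B" using lborel.emeasure_pair_measure_alt[OF borB] by (simp add: lborel_prod)
 also have "emeasure lborel B = ennreal (pi * (D / 2)\<^sup>2)" using D0 by (simp add: B_def emeasure_cball unit_ball_vol_2 power2_eq_square)
 finally show ?thesis by (simp add: ennreal_mult_le_mult_iff)
qed simp

text \<open>Closure and convex hull stay inside every closed ball of radius D that contains the set,
  so neither increases the diameter bound. The conclusion is about the closure because A need not be
  measurable.\<close>

lemma isodiametric_plane:
 fixes A :: "(real \<times> real) set"
 assumes "bounded A" and D: "!!p q. p \<in> A ==> q \<in> A ==> dist p q <= D" and D0: "D \<ge> 0"
 shows "emeasure lborel (closure A) <= ennreal (pi * (D / 2)\<^sup>2)"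
proof -
 define C where "C = convex hull (closure A)"
 have 1: "closure A \<subseteq> cball p D" if "p \<in> A" for p by (intro closure_minimal subsetI, unfold mem_cball) (blast intro: D[OF that], simp)
 have 2: "closure A \<subseteq> cball q D" if "q \<in> closure A" for q
  using 1 that by (intro closure_minimal subsetI) (auto simp: subset_iff dist_commute simp del: split_paired_All)
 have 3: "C \<subseteq> cball p D" if "p \<in> closure A" for p unfolding C_def using 2[OF that] by (intro hull_minimal) auto
 have "C \<subseteq> cball q D" if "q \<in> C" for q using 3 that unfolding C_def
  by (intro hull_minimal subsetI) (auto simp: subset_iff dist_commute simp del: split_paired_All)
 then have 4: "dist p q <= D" if "p \<in> C" "q \<in> C" for p q using that by (metis mem_cball subsetD)
 have cC: "compact C" unfolding C_def using assms(1) by (intro compact_convex_hull) auto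
 have "emeasure lborel (closure A) <= emeasure lborel C" using cC by (intro emeasure_mono) (auto simp: C_def hull_subset borel_compact)
 also have "... <= ennreal (pi * (D / 2)\<^sup>2)" by (rule isodiametric_plane_convex[OF cC _ 4 D0]) (auto simp: C_def)
 finally show ?thesis .
qed

section \<open>Signed integrals that vanish on boxes\<close>

text \<open>Dynkin's argument with open boxes as the intersection-stable generator, run for a sum of
  two signed integrals over different spaces. The two terms are later a volume integral and an
  integral against the singular measure; each alone need not vanish on boxes.\<close>

lemma integral_indicator_eq_0_borel:
 fixes X1 :: "'a => 'e::euclidean_space" and f1 :: "'a => real"
  and X2 :: "'b => 'e" and f2 :: "'b => real"
 assumes [measurable]: "X1 \<in> M1 \<rightarrow>\<^sub>M borel" "X2 \<in> M2 \<rightarrow>\<^sub>M borel"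
  and int: "integrable M1 f1" "integrable M2 f2"
  and box: "!!a b. (LINT x|M1. indicator (box a b) (X1 x) * f1 x) + (LINT x|M2. indicator (box a b) (X2 x) * f2 x) = 0"
  and A: "A \<in> sets borel"
 shows "(LINT x|M1. indicator A (X1 x) * f1 x) + (LINT x|M2. indicator A (X2 x) * f2 x) = 0"
proof -
 define \<Lambda> where "\<Lambda> A = (LINT x|M1. indicator A (X1 x) * f1 x) + (LINT x|M2. indicator A (X2 x) * f2 x)" for A
 have [measurable]: "f1 \<in> borel_measurable M1" "f2 \<in> borel_measurable M2" using int by auto
 have I1: "integrable M1 (%x. indicator A (X1 x) * f1 x)" if [measurable]: "A \<in> sets borel" for A
  by (rule integrable_dominated[OF int(1)]) (auto simp: indicator_def)
 have I2: "integrable M2 (%x. indicator A (X2 x) * f2 x)" if [measurable]: "A \<in> sets borel" for A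
  by (rule integrable_dominated[OF int(2)]) (auto simp: indicator_def)
 \<comment> \<open>Pointwise eventual agreement of the sets makes the integrands eventually
   constant; this one limit serves both for exhausting the space and for countable unions.\<close>
 have lim: "(%n. \<Lambda> (S n)) \<longlonglongrightarrow> \<Lambda> T"
  if [measurable]: "!!n. S n \<in> sets borel" "T \<in> sets borel"
   and ev: "!!x. eventually (%n. x \<in> S n \<longleftrightarrow> x \<in> T) sequentially" for S T unfolding \<Lambda>_def
 proof (intro tendsto_add)
  show "(%n. LINT x|M1. indicator (S n) (X1 x) * f1 x) \<longlonglongrightarrow> (LINT x|M1. indicator T (X1 x) * f1 x)"
  proof (rule integral_dominated_convergence[where w="%x. norm (f1 x)"])
   show "AE x in M1. (%n. indicator (S n) (X1 x) * f1 x) \<longlonglongrightarrow> indicator T (X1 x) * f1 x"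
    by (intro AE_I2 tendsto_eventually eventually_mono[OF ev]) (auto simp: indicator_def)
  qed (use int in \<open>auto simp: indicator_def\<close>)
  show "(%n. LINT x|M2. indicator (S n) (X2 x) * f2 x) \<longlonglongrightarrow> (LINT x|M2. indicator T (X2 x) * f2 x)"
  proof (rule integral_dominated_convergence[where w="%x. norm (f2 x)"])
   show "AE x in M2. (%n. indicator (S n) (X2 x) * f2 x) \<longlonglongrightarrow> indicator T (X2 x) * f2 x"
    by (intro AE_I2 tendsto_eventually eventually_mono[OF ev]) (auto simp: indicator_def)
  qed (use int in \<open>auto simp: indicator_def\<close>)
 qed
 \<comment> \<open>Complements need the value on the whole space, which is not a box but an
   increasing union of boxes.\<close>
 have UN0: "\<Lambda> UNIV = 0"
 proof -
  have "(%n. \<Lambda> (box (- real n *\<^sub>R One) (real n *\<^sub>R One))) \<longlonglongrightarrow> \<Lambda> (UNIV :: 'e set)"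
  proof (rule lim)
   fix x :: 'e
   obtain N :: nat where N: "norm x < N" using reals_Archimedean2 by blast
   have "x \<in> box (- real n *\<^sub>R One) (real n *\<^sub>R One)" if "n \<ge> N" for n
   proof -
    have "\<bar>x \<bullet> i\<bar> < real n" if "i \<in> Basis" for i using Basis_le_norm[OF that, of x] N \<open>n \<ge> N\<close> by linarith
    then show ?thesis unfolding mem_box by (simp add: abs_less_iff) (metis minus_less_iff)
   qed
   then show "\<forall>\<^sub>F n in sequentially. (x \<in> box (- real n *\<^sub>R One) (real n *\<^sub>R One)) = (x \<in> UNIV)"
    by (auto simp: eventually_sequentially)
  qed auto
  moreover have "\<Lambda> (box (- real n *\<^sub>R One) (real n *\<^sub>R One)) = 0" for n using box by (simp add: \<Lambda>_def)
  ultimately show ?thesis by (simp add: LIMSEQ_const_iff)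
 qed
 have "Int_stable (range (%(a, b). box a b :: 'e set))" "range (%(a, b). box a b :: 'e set) \<subseteq> Pow UNIV"
  "A \<in> sigma_sets UNIV (range (%(a, b). box a b))" using A by (auto simp: Int_stable_def box_Int_box borel_eq_box)
 then have "\<Lambda> A = 0"
 proof (induction rule: sigma_sets_induct_disjoint)
  case (basic A) then show ?case using box by (auto simp: \<Lambda>_def)
 next
  case empty then show ?case by (simp add: \<Lambda>_def)
 next
  case (compl A)
  have [measurable]: "A \<in> sets borel" using compl by (auto simp: borel_eq_box)
  have "\<Lambda> UNIV = \<Lambda> A + \<Lambda> (UNIV - A)"
  proof -
   have "indicator (UNIV :: 'e set) x = (indicator A x + indicator (UNIV - A) x :: real)" for x by (auto simp: indicator_def)
   then show ?thesis
    unfolding \<Lambda>_def using I1[of A] I1[of "UNIV - A"] I2[of A] I2[of "UNIV - A"] by (simp only: distrib_right Bochner_Integration.integral_add) simp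
  qed
  with compl UN0 show ?case by simp
 next
  case (union A)
  have bor: "A i \<in> sets borel" for i using union by (auto simp: borel_eq_box)
  have fin: "\<Lambda> (\<Union>i<n. A i) = 0" for n
  proof (induction n)
   case 0 then show ?case by (simp add: \<Lambda>_def)
  next
   case (Suc n)
   have "\<Lambda> (\<Union>i<Suc n. A i) = \<Lambda> (\<Union>i<n. A i) + \<Lambda> (A n)"
   proof -
    have [measurable]: "(\<Union>i<n. A i) \<in> sets borel" "A n \<in> sets borel" using bor by auto
    have "indicator (\<Union>i<Suc n. A i) x = (indicator (\<Union>i<n. A i) x + indicator (A n) x :: real)" for x
    proof -
     have "A i \<inter> A n = {}" if "i < n" for i using union(1) that by (auto simp: disjoint_family_on_def)
     then show ?thesis by (auto simp: indicator_def lessThan_Suc)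
    qed
    then show ?thesis unfolding \<Lambda>_def using I1[of "\<Union>i<n. A i"] I1[of "A n"] I2[of "\<Union>i<n. A i"] I2[of "A n"]
     by (simp only: distrib_right Bochner_Integration.integral_add) simp
   qed
   then show ?case using Suc union by simp
  qed
  have "(%n. \<Lambda> (\<Union>i<n. A i)) \<longlonglongrightarrow> \<Lambda> (\<Union>i. A i)"
  proof (rule lim)
   fix x
   show "\<forall>\<^sub>F n in sequentially. (x \<in> (\<Union>i<n. A i)) = (x \<in> (\<Union>i. A i))"
   proof (cases "x \<in> (\<Union>i. A i)")
    case True
    then obtain k where "x \<in> A k" by auto
    then have "x \<in> (\<Union>i<n. A i)" if "n \<ge> Suc k" for n using that by auto
    with True show ?thesis by (auto simp: eventually_sequentially)
   qed auto
  qed (use bor in auto)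
  then show ?case by (simp add: fin LIMSEQ_const_iff)
 qed
 then show ?thesis by (simp add: \<Lambda>_def)
qed

lemma AE_0_if_integral_box_0:
 fixes f :: "'e::euclidean_space => real"
 assumes int: "integrable lborel f" and box: "!!a b. (LBINT x. indicator (box a b) x * f x) = 0"
 shows "AE x in lborel. f x = 0"
proof -
 have all: "(LBINT x. indicator A x * f x) = 0" if "A \<in> sets borel" for A
 proof -
  have "(LBINT x. indicator A x * f x) + (LINT x|(lborel :: 'e measure). indicator A x * 0) = 0"
   by (rule integral_indicator_eq_0_borel) (use int box that in simp_all)
  then show ?thesis by simp
 qed
 show ?thesis by (rule density_unique_real[OF int]) (use all in \<open>simp_all add: set_lebesgue_integral_def\<close>)
qed

section \<open>Integration by parts for primitives of integrable functions\<close>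

lemma lborel_product_integrable:
 fixes f g :: "real => real"
 assumes f: "integrable lborel f" and g: "integrable lborel g"
 shows "integrable (lborel \<Otimes>\<^sub>M lborel) (%(s, t). f s * g t)"
proof (rule lborel_pair.Fubini_integrable)
 have [measurable]: "f \<in> borel_measurable borel" "g \<in> borel_measurable borel" using f g by auto
 show "(%(s, t). f s * g t) \<in> borel_measurable (lborel \<Otimes>\<^sub>M lborel)" by measurable
 show "integrable lborel (%x. LBINT y. norm (case (x, y) of (s, t) => f s * g t))" using f by (simp add: abs_mult)
 show "AE x in lborel. integrable lborel (%y. case (x, y) of (s, t) => f s * g t)" using g by simp
qed

text \<open>Fubini for f s * g t on the two triangles s <= t and t <= s. They cover the plane and
  overlap only in the diagonal, which is null.\<close>

lemma primitive_product:
 fixes f g :: "real => real"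
 assumes f: "integrable lborel f" and g: "integrable lborel g"
 defines "F \<equiv> %t. LBINT s. (if s <= t then f s else 0)"
  and "G \<equiv> %t. LBINT s. (if s <= t then g s else 0)"
 shows "integrable lborel (%t. F t * g t)" "integrable lborel (%t. f t * G t)"
  "(LBINT t. F t * g t) + (LBINT t. f t * G t) = (LBINT t. f t) * (LBINT t. g t)"
proof -
 have [measurable]: "f \<in> borel_measurable borel" "g \<in> borel_measurable borel" using f g by auto
 define P where "P = (%(s, t). f s * g t)"
 have P: "integrable (lborel \<Otimes>\<^sub>M lborel) P" unfolding P_def by (rule lborel_product_integrable[OF f g])
 define P1 where "P1 = (%(s, t). if s <= t then f s * g t else 0)"
 define P2 where "P2 = (%(s, t). if t <= s then f s * g t else 0)"
 have [measurable]: "P1 \<in> borel_measurable (lborel \<Otimes>\<^sub>M lborel)" "P2 \<in> borel_measurable (lborel \<Otimes>\<^sub>M lborel)"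
  unfolding P1_def P2_def by measurable
 have P1: "integrable (lborel \<Otimes>\<^sub>M lborel) P1" by (rule integrable_dominated[OF P]) (auto simp: P1_def P_def)
 have P2: "integrable (lborel \<Otimes>\<^sub>M lborel) P2" by (rule integrable_dominated[OF P]) (auto simp: P2_def P_def)
 have F: "(LBINT s. P1 (s, t)) = F t * g t" for t
 proof -
  have "(LBINT s. P1 (s, t)) = (LBINT s. (if s <= t then f s else 0) * g t)" by (intro lint_cong) (auto simp: P1_def)
  also have "... = F t * g t" unfolding F_def by (rule integral_mult_left_zero)
  finally show ?thesis .
 qed
 have G: "(LBINT t. P2 (s, t)) = f s * G s" for s
 proof -
  have "(LBINT t. P2 (s, t)) = (LBINT t. f s * (if t <= s then g t else 0))" by (intro lint_cong) (auto simp: P2_def)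
  also have "... = f s * G s" unfolding G_def by (rule integral_mult_right_zero)
  finally show ?thesis .
 qed
 show "integrable lborel (%t. F t * g t)" using lborel_pair.integrable_snd[of "%s t. P1 (s, t)"] P1 by (simp add: F)
 show "integrable lborel (%t. f t * G t)" using lborel_pair.integrable_fst'[OF P2] by (simp add: G)
 have "(LBINT t. F t * g t) = (LINT z|(lborel \<Otimes>\<^sub>M lborel). P1 z)"
  using lborel_pair.integral_snd[of "%s t. P1 (s, t)"] P1 by (simp add: F)
 moreover have "(LBINT t. f t * G t) = (LINT z|(lborel \<Otimes>\<^sub>M lborel). P2 z)" using lborel_pair.integral_fst'[OF P2] by (simp add: G)
 moreover have "(LINT z|(lborel \<Otimes>\<^sub>M lborel). P1 z) + (LINT z|(lborel \<Otimes>\<^sub>M lborel). P2 z) = (LINT z|(lborel \<Otimes>\<^sub>M lborel). P z)"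
 proof -
  have ae: "AE z in lborel \<Otimes>\<^sub>M lborel. P1 z + P2 z = P z"
  proof (rule lborel_pair.AE_pair_measure)
   show "{z \<in> space (lborel \<Otimes>\<^sub>M lborel). P1 z + P2 z = P z} \<in> sets (lborel \<Otimes>\<^sub>M lborel)" using P by measurable
   show "AE x in lborel. AE y in lborel. P1 (x, y) + P2 (x, y) = P (x, y)"
   proof (rule AE_I2)
    fix x :: real
    show "AE y in lborel. P1 (x, y) + P2 (x, y) = P (x, y)" using AE_lborel_singleton[of x] by eventually_elim (auto simp: P1_def P2_def P_def)
   qed
  qed
  have "(LINT z|(lborel \<Otimes>\<^sub>M lborel). P1 z + P2 z) = (LINT z|(lborel \<Otimes>\<^sub>M lborel). P z)"
   using P ae by (intro integral_cong_AE) auto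
  then show ?thesis using P1 P2 by simp
 qed
 moreover have "(LINT z|(lborel \<Otimes>\<^sub>M lborel). P z) = (LBINT t. f t) * (LBINT t. g t)"
  using lborel_pair.integral_fst'[OF P] by (simp add: P_def)
 ultimately show "(LBINT t. F t * g t) + (LBINT t. f t * G t) = (LBINT t. f t) * (LBINT t. g t)" by simp
qed

text \<open>Cutting f and g off outside [a, b] reduces this to \<open>primitive_product\<close>; the
  constants A and B add the boundary terms. Only integrable weak derivatives occur, which is all
  that almost every line provides.\<close>

lemma integral_by_parts_primitive:
 fixes f g F G :: "real => real"
 assumes ab: "a <= b"
  and f: "integrable lborel (%t. indicator {a..b} t * f t)"
  and g: "integrable lborel (%t. indicator {a..b} t * g t)"
  and F: "!!t. a <= t ==> t <= b ==> F t = A + (LBINT s. indicator {a..t} s * f s)"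
  and G: "!!t. a <= t ==> t <= b ==> G t = B + (LBINT s. indicator {a..t} s * g s)"
 shows "integrable lborel (%t. indicator {a..b} t * (F t * g t + f t * G t))"
  and "(LBINT t. indicator {a..b} t * (F t * g t + f t * G t)) = F b * G b - A * B"
  and "integrable lborel (%t. indicator {a..b} t * (F t * g t))"
  and "integrable lborel (%t. indicator {a..b} t * (f t * G t))"
proof -
 define f' where "f' = (%t. indicator {a..b} t * f t)"
 define g' where "g' = (%t. indicator {a..b} t * g t)"
 define F' where "F' = (%t. LBINT s. (if s <= t then f' s else 0))"
 define G' where "G' = (%t. LBINT s. (if s <= t then g' s else 0))"
 have f': "integrable lborel f'" and g': "integrable lborel g'" using f g by (simp_all add: f'_def g'_def)
 have pp: "integrable lborel (%t. F' t * g' t)" "integrable lborel (%t. f' t * G' t)"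
  "(LBINT t. F' t * g' t) + (LBINT t. f' t * G' t) = (LBINT t. f' t) * (LBINT t. g' t)" unfolding F'_def G'_def by (rule primitive_product[OF f' g'])+
 have FF: "F t = A + F' t" "G t = B + G' t" if "a <= t" "t <= b" for t
 proof -
  have "(LBINT s. indicator {a..t} s * f s) = F' t" "(LBINT s. indicator {a..t} s * g s) = G' t" unfolding F'_def G'_def f'_def g'_def using that
   by (auto intro!: lint_cong simp: indicator_def)
  then show "F t = A + F' t" "G t = B + G' t" using F[OF that] G[OF that] by auto
 qed
 have e1: "indicator {a..b} t * (F t * g t) = A * g' t + F' t * g' t" for t using FF(1)[of t] by (auto simp: g'_def indicator_def distrib_right)
 have e2: "indicator {a..b} t * (f t * G t) = B * f' t + f' t * G' t" for t
  using FF(2)[of t] by (auto simp: f'_def indicator_def distrib_left mult.commute)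
 show i1: "integrable lborel (%t. indicator {a..b} t * (F t * g t))" unfolding e1 using pp(1) g' by auto
 show i2: "integrable lborel (%t. indicator {a..b} t * (f t * G t))" unfolding e2 using pp(2) f' by auto
 show "integrable lborel (%t. indicator {a..b} t * (F t * g t + f t * G t))" unfolding distrib_left using i1 i2 by auto
 have Fb: "F b = A + (LBINT t. f' t)" "G b = B + (LBINT t. g' t)" using F[of b] G[of b] ab by (auto simp: f'_def g'_def)
 have "(LBINT t. indicator {a..b} t * (F t * g t + f t * G t))
   = (LBINT t. A * g' t + F' t * g' t) + (LBINT t. B * f' t + f' t * G' t)"
  unfolding distrib_left using i1 i2 by (subst Bochner_Integration.integral_add) (auto simp: e1 e2)
 also have "... = A * (LBINT t. g' t) + B * (LBINT t. f' t) + ((LBINT t. F' t * g' t) + (LBINT t. f' t * G' t))" using pp(1,2) f' g' by simp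
 also have "... = F b * G b - A * B" unfolding pp(3) Fb by (simp add: algebra_simps)
 finally show "(LBINT t. indicator {a..b} t * (F t * g t + f t * G t)) = F b * G b - A * B" .
qed

lemma primitive_of_deriv:
 fixes G g :: "real => real"
 assumes "a <= t" "!!x. a <= x ==> x <= t ==> (G has_real_derivative g x) (at x)" "continuous_on {a..t} g"
 shows "G t = G a + (LBINT s. indicator {a..t} s * g s)"
  and "integrable lborel (%s. indicator {a..t} s * g s)"
proof -
 have "(LBINT s. indicator {a..t} s *\<^sub>R g s) = G t - G a" using assms by (intro integral_FTC_atLeastAtMost)
   (auto simp: has_real_derivative_iff_has_vector_derivative[symmetric] intro: has_field_derivative_at_within)
 then show "G t = G a + (LBINT s. indicator {a..t} s * g s)" by simp
 show "integrable lborel (%s. indicator {a..t} s * g s)" using borel_integrable_compact[OF compact_Icc assms(3)] by simp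
qed

section \<open>The energy of a unit-length curve from e1 to e3\<close>

definition Icc_int :: "real => (real => real) => real" where
 "Icc_int d f = (LBINT t. indicator {0..d} t * f t)"

definition Icc_integrable :: "real => (real => real) => bool" where
 "Icc_integrable d f \<longleftrightarrow> integrable lborel (%t. indicator {0..d} t * f t)"

lemma Icc_int_add: "Icc_integrable d f ==> Icc_integrable d g ==> Icc_int d (%t. f t + g t) = Icc_int d f + Icc_int d g"
 unfolding Icc_int_def Icc_integrable_def by (simp add: distrib_left)

lemma Icc_integrable_add: "Icc_integrable d f ==> Icc_integrable d g ==> Icc_integrable d (%t. f t + g t)"
 unfolding Icc_integrable_def by (simp add: distrib_left)

lemma Icc_int_cmult: "Icc_int d (%t. c * f t) = c * Icc_int d f"
 unfolding Icc_int_def by (subst integral_mult_right_zero[symmetric]) (simp add: mult_ac)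

lemma Icc_integrable_cmult: "Icc_integrable d f ==> Icc_integrable d (%t. c * f t)" unfolding Icc_integrable_def
proof -
 assume "integrable lborel (%t. indicator {0..d} t * f t)"
 then have "integrable lborel (%t. c * (indicator {0..d} t * f t))" by simp
 moreover have "(%t. c * (indicator {0..d} t * f t)) = (%t. indicator {0..d} t * (c * f t))" by (simp add: fun_eq_iff)
 ultimately show "integrable lborel (%t. indicator {0..d} t * (c * f t))" by simp
qed

lemma Icc_integrable_cont: "continuous_on {0..d} f ==> Icc_integrable d f"
 unfolding Icc_integrable_def using borel_integrable_compact[OF compact_Icc, of 0 d f] by simp

lemma Icc_int_cong: "(!!t. 0 <= t ==> t <= d ==> f t = g t) ==> Icc_int d f = Icc_int d g"
 unfolding Icc_int_def by (intro lint_cong) (auto simp: indicator_def)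

lemma Icc_int_nonneg: "(!!t. 0 <= t ==> t <= d ==> f t \<ge> 0) ==> Icc_int d f \<ge> 0"
 unfolding Icc_int_def by (intro Bochner_Integration.integral_nonneg) (auto simp: indicator_def)

lemma Icc_integrable_L2_L1:
 assumes [measurable]: "f \<in> borel_measurable borel" and "Icc_integrable d (%t. (f t)\<^sup>2)"
 shows "Icc_integrable d f" unfolding Icc_integrable_def
proof (rule integrable_dominated)
 have "Icc_integrable d (%t. 1 + (f t)\<^sup>2)" by (intro Icc_integrable_add assms Icc_integrable_cont) auto
 then show "integrable lborel (%t. indicator {0..d} t * (1 + (f t)\<^sup>2))" by (simp add: Icc_integrable_def)
 have "\<bar>x\<bar> <= 1 + x\<^sup>2" for x :: real using sum_power2_ge_zero[of "\<bar>x\<bar> - 1" 0] by (simp add: power2_diff)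
 then show "AE t in lborel. norm (indicator {0..d} t * f t) <= norm (indicator {0..d} t * (1 + (f t)\<^sup>2))" by (auto simp: indicator_def)
qed simp

text \<open>Completing the square with \<open>\<phi> = - c tan (c (t - d / 2))\<close>, which solves \<open>\<phi>' = - c\<^sup>2 - \<phi>\<^sup>2\<close>.\<close>

lemma poincare_Icc:
 fixes k w :: "real => real"
 assumes d: "d > 0" and c: "0 < c" "c * d < pi"
  and [measurable]: "k \<in> borel_measurable borel" and k2: "Icc_integrable d (%t. (k t)\<^sup>2)"
  and w: "!!t. 0 <= t ==> t <= d ==> w t = (LBINT s. indicator {0..t} s * k s)"
  and wd: "w d = 0"
 shows "Icc_int d (%t. (k t)\<^sup>2) \<ge> c\<^sup>2 * Icc_int d (%t. (w t)\<^sup>2)"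
  and "Icc_integrable d (%t. (w t)\<^sup>2)"
proof -
 have k: "Icc_integrable d k" by (rule Icc_integrable_L2_L1) (use k2 in auto)
 have kt: "integrable lborel (%s. indicator {0..t} s * k s)" if "t <= d" for t
 proof (rule integrable_dominated[OF k[unfolded Icc_integrable_def]])
  show "AE x in lborel. norm (indicat_real {0..t} x * k x) <= norm (indicat_real {0..d} x * k x)" using that by (auto simp: indicator_def)
 qed simp
 define \<phi> where "\<phi> t = - c * tan (c * (t - d / 2))" for t
 define \<phi>' where "\<phi>' t = - c\<^sup>2 - (\<phi> t)\<^sup>2" for t
 \<comment> \<open>c d < pi keeps the argument strictly inside (- pi / 2, pi / 2), so \<phi> has no
   pole on the closed interval.\<close>
 have cosn: "cos (c * (t - d / 2)) ~= 0" if "0 <= t" "t <= d" for t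
 proof -
  have "\<bar>t - d / 2\<bar> <= d / 2" using that by (simp add: abs_le_iff field_simps)
  then have "\<bar>c * (t - d / 2)\<bar> <= c * (d / 2)" using c by (simp add: abs_mult mult_left_mono)
  then have "\<bar>c * (t - d / 2)\<bar> < pi / 2" using c by linarith
  then have "0 < cos (c * (t - d / 2))" by (intro cos_gt_zero_pi) (simp_all add: abs_less_iff)
  then show ?thesis by simp
 qed
 have der: "(\<phi> has_real_derivative \<phi>' t) (at t)" if "0 <= t" "t <= d" for t
 proof -
  define u where "u = c * (t - d / 2)"
  have u: "cos u ~= 0" using cosn[OF that] by (simp add: u_def)
  have "(\<phi> has_real_derivative - c * (inverse ((cos u)\<^sup>2) * c)) (at t)"
   unfolding \<phi>_def using u unfolding u_def by (auto intro!: derivative_eq_intros)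
  also have "inverse ((cos u)\<^sup>2) = 1 + (tan u)\<^sup>2" using tan_sec[OF u] by (simp add: power_inverse)
  also have "- c * ((1 + (tan u)\<^sup>2) * c) = \<phi>' t"
   by (simp add: \<phi>'_def \<phi>_def u_def power_mult_distrib power2_eq_square algebra_simps)
  finally show ?thesis .
 qed
 have cont\<phi>: "continuous_on {0..d} \<phi>" using der by (auto intro!: continuous_at_imp_continuous_on DERIV_isCont)
 have cont: "continuous_on {0..d} \<phi>'" unfolding \<phi>'_def by (intro continuous_intros cont\<phi>)
 have \<phi>i: "\<phi> t = \<phi> 0 + (LBINT s. indicator {0..t} s * \<phi>' s)" if "0 <= t" "t <= d" for t
  by (rule primitive_of_deriv) (use that der cont in \<open>auto intro: continuous_on_subset\<close>)
 have wk: "Icc_integrable d (%t. 2 * (w t * k t))"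
 proof -
  have "integrable lborel (%t. indicator {0..d} t * (w t * k t))"
   by (rule integral_by_parts_primitive(3)[OF _ kt kt, where A=0 and B=0]) (use d w in auto)
  then have "Icc_integrable d (%t. w t * k t)" by (simp add: Icc_integrable_def)
  then show ?thesis by (rule Icc_integrable_cmult)
 qed
 have w2: "(w t)\<^sup>2 = 0 + (LBINT s. indicator {0..t} s * (2 * (w s * k s)))" if "0 <= t" "t <= d" for t
 proof -
  have "(LBINT s. indicator {0..t} s * (w s * k s + k s * w s)) = w t * w t - 0 * 0"
   by (rule integral_by_parts_primitive(2)[OF _ kt kt, where A=0 and B=0]) (use that w in auto)
  then show ?thesis by (simp add: power2_eq_square algebra_simps)
 qed
 note bp = integral_by_parts_primitive[where F="%t. (w t)\<^sup>2" and f="%t. 2 * (w t * k t)" and G=\<phi> and g=\<phi>' and a=0 and b=d,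
  OF _ wk[unfolded Icc_integrable_def] _ w2 \<phi>i]
 have \<phi>'int: "integrable lborel (%t. indicator {0..d} t * \<phi>' t)" using Icc_integrable_cont[OF cont] by (simp add: Icc_integrable_def)
 have i1: "Icc_integrable d (%t. (w t)\<^sup>2 * \<phi>' t)" "Icc_integrable d (%t. 2 * (w t * k t) * \<phi> t)"
  using bp(3,4) d \<phi>'int by (auto simp: Icc_integrable_def)
 \<comment> \<open>w vanishes at both ends, so integrating the derivative of w^2 \<phi> gives 0.
   This trades the cross term of the square for the integral of w^2 \<phi>'.\<close>
 have i0: "Icc_int d (%t. (w t)\<^sup>2 * \<phi>' t) + Icc_int d (%t. 2 * (w t * k t) * \<phi> t) = 0"
  using bp(2) d \<phi>'int wd by (subst Icc_int_add[OF i1, symmetric]) (simp add: Icc_int_def)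
 have wcont: "continuous_on {0..d} w"
 proof -
  have "continuous_on {0..d} (%t. integral {0..t} k)" using k by (intro indefinite_integral_continuous_1 set_borel_integral_eq_integral(1))
    (auto simp: Icc_integrable_def set_integrable_def)
  moreover have "w t = integral {0..t} k" if "t \<in> {0..d}" for t using w[of t] that set_borel_integral_eq_integral(2)[of "{0..t}" k] kt[of t]
   by (auto simp: set_integrable_def set_lebesgue_integral_def)
  ultimately show ?thesis by (subst continuous_on_cong[OF refl, of _ w "%t. integral {0..t} k"]) auto
 qed
 show w2i: "Icc_integrable d (%t. (w t)\<^sup>2)" by (intro Icc_integrable_cont continuous_intros wcont)
 have i2: "Icc_integrable d (%t. (w t)\<^sup>2 * (\<phi> t)\<^sup>2)" by (intro Icc_integrable_cont continuous_intros wcont cont\<phi>)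
 have "0 <= Icc_int d (%t. (k t - \<phi> t * w t)\<^sup>2)" by (rule Icc_int_nonneg) simp
 also have "... = Icc_int d (%t. (k t)\<^sup>2 + ((-1) * (2 * (w t * k t) * \<phi> t) + (w t)\<^sup>2 * (\<phi> t)\<^sup>2))"
  by (rule Icc_int_cong) (simp add: power2_eq_square algebra_simps)
 also have "... = Icc_int d (%t. (k t)\<^sup>2) + (- Icc_int d (%t. 2 * (w t * k t) * \<phi> t) + Icc_int d (%t. (w t)\<^sup>2 * (\<phi> t)\<^sup>2))"
 proof -
  note neg = Icc_integrable_cmult[OF i1(2), of "- 1"]
  show ?thesis unfolding Icc_int_add[OF k2 Icc_integrable_add[OF neg i2]] Icc_int_add[OF neg i2] unfolding Icc_int_cmult[of d "- 1"] by simp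
 qed
 also have "- Icc_int d (%t. 2 * (w t * k t) * \<phi> t) = Icc_int d (%t. (w t)\<^sup>2 * \<phi>' t)" using i0 by simp
 also have "Icc_int d (%t. (w t)\<^sup>2 * \<phi>' t) + Icc_int d (%t. (w t)\<^sup>2 * (\<phi> t)\<^sup>2) = Icc_int d (%t. - c\<^sup>2 * (w t)\<^sup>2)"
  by (subst Icc_int_add[symmetric, OF i1(1) i2]) (auto intro!: Icc_int_cong simp: \<phi>'_def algebra_simps)
 also have "... = - c\<^sup>2 * Icc_int d (%t. (w t)\<^sup>2)" by (rule Icc_int_cmult)
 finally show "Icc_int d (%t. (k t)\<^sup>2) \<ge> c\<^sup>2 * Icc_int d (%t. (w t)\<^sup>2)" by simp
qed

text \<open>With w = v - N, which vanishes at both ends, and k = H - N', expand (N' + k)^2. The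
  equation N'' = - l N turns the cross term into 2 l times the integral of w N, and
  \<open>poincare_Icc\<close> bounds the integral of k^2 from below. The linear term is kept because
  for unit vectors it becomes quadratic.\<close>

lemma oscillator_comparison_Icc:
 fixes H v N N' :: "real => real"
 assumes d: "d > 0" and c: "0 < c" "c * d < pi"
  and [measurable]: "H \<in> borel_measurable borel" and H2: "Icc_integrable d (%t. (H t)\<^sup>2)"
  and v: "!!t. 0 <= t ==> t <= d ==> v t = N 0 + (LBINT s. indicator {0..t} s * H s)"
  and vd: "v d = N d"
  and N: "!!t. (N has_real_derivative N' t) (at t)" and N': "!!t. (N' has_real_derivative - l * N t) (at t)"
 shows "Icc_int d (%t. (H t)\<^sup>2) \<ge> c\<^sup>2 * Icc_int d (%t. (v t - N t)\<^sup>2)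
   + 2 * l * Icc_int d (%t. (v t - N t) * N t) + Icc_int d (%t. (N' t)\<^sup>2)"
  and "Icc_integrable d (%t. (v t - N t)\<^sup>2)" "Icc_integrable d (%t. (v t - N t) * N t)"
proof -
 have contN: "continuous_on A N" "continuous_on A N'" for A using N N' by (auto intro!: continuous_at_imp_continuous_on DERIV_isCont)
 have [measurable]: "N' \<in> borel_measurable borel" using contN by (intro continuous_borel)
 define w where "w t = v t - N t" for t
 define k where "k t = H t - N' t" for t
 have [measurable]: "k \<in> borel_measurable borel" unfolding k_def by simp
 have Hi: "Icc_integrable d H" by (rule Icc_integrable_L2_L1) (use H2 in auto)
 have N'i: "Icc_integrable d N'" "Icc_integrable d (%t. (N' t)\<^sup>2)" by (intro Icc_integrable_cont continuous_intros contN)+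
 have ki: "Icc_integrable d k" unfolding k_def using Icc_integrable_add[OF Hi Icc_integrable_cmult[OF N'i(1), of "-1"]] by simp
 have kt: "integrable lborel (%s. indicator {0..t} s * f s)" if "Icc_integrable d f" "t <= d" "f \<in> borel_measurable borel" for t f
 proof (rule integrable_dominated[OF that(1)[unfolded Icc_integrable_def]])
  show "AE x in lborel. norm (indicat_real {0..t} x * f x) <= norm (indicat_real {0..d} x * f x)" using that by (auto simp: indicator_def)
 qed (use that(3) in simp)
 have w: "w t = (LBINT s. indicator {0..t} s * k s)" if "0 <= t" "t <= d" for t
 proof -
  have "N t = N 0 + (LBINT s. indicator {0..t} s * N' s)" by (rule primitive_of_deriv) (use that N contN in auto)
  then show ?thesis unfolding w_def k_def v[OF that] right_diff_distrib using kt[OF Hi that(2)] kt[OF N'i(1) that(2)] by simp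
 qed
 \<comment> \<open>Products of square-integrable functions are integrable by |x y| <= x^2 +
   y^2.\<close>
 have HN: "Icc_integrable d (%t. H t * N' t)" unfolding Icc_integrable_def
 proof (rule integrable_dominated)
  show "integrable lborel (%t. indicator {0..d} t * ((H t)\<^sup>2 + (N' t)\<^sup>2))"
   using Icc_integrable_add[OF H2 N'i(2)] by (simp add: Icc_integrable_def)
  have "\<bar>x * y\<bar> <= x\<^sup>2 + y\<^sup>2" for x y :: real
  proof -
   have "2 * (\<bar>x\<bar> * \<bar>y\<bar>) <= x\<^sup>2 + y\<^sup>2" using sum_squares_bound[of "\<bar>x\<bar>" "\<bar>y\<bar>"] by simp
   moreover have "0 <= \<bar>x\<bar> * \<bar>y\<bar>" by simp
   ultimately show ?thesis unfolding abs_mult by linarith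
  qed
  then show "AE t in lborel. norm (indicator {0..d} t * (H t * N' t)) <= norm (indicator {0..d} t * ((H t)\<^sup>2 + (N' t)\<^sup>2))"
   by (auto simp: indicator_def)
 qed simp
 have k2: "Icc_integrable d (%t. (k t)\<^sup>2)" using Icc_integrable_add[OF Icc_integrable_add[OF H2 N'i(2)] Icc_integrable_cmult[OF HN, of "-2"]]
  by (simp add: k_def power2_diff mult.assoc)
 note P = poincare_Icc[OF d c _ k2 w]
 have wd: "w d = 0" using vd by (simp add: w_def)
 have bp: "integrable lborel (%t. indicator {0..d} t * (w t * (- l * N t)))" "integrable lborel (%t. indicator {0..d} t * (k t * N' t))"
  "(LBINT t. indicator {0..d} t * (w t * (- l * N t) + k t * N' t)) = w d * N' d - 0 * N' 0"
 proof -
  have g: "integrable lborel (%t. indicator {0..d} t * (- l * N t))"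
   by (rule Icc_integrable_cont[unfolded Icc_integrable_def]) (intro continuous_intros contN)
  have G: "N' t = N' 0 + (LBINT s. indicator {0..t} s * (- l * N s))" if "0 <= t" "t <= d" for t
   by (rule primitive_of_deriv) (use that N' contN in \<open>auto intro!: continuous_intros\<close>)
  have w': "w t = 0 + (LBINT s. indicator {0..t} s * k s)" if "0 <= t" "t <= d" for t using w[OF that] by simp
  show "integrable lborel (%t. indicator {0..d} t * (w t * (- l * N t)))" "integrable lborel (%t. indicator {0..d} t * (k t * N' t))"
   "(LBINT t. indicator {0..d} t * (w t * (- l * N t) + k t * N' t)) = w d * N' d - 0 * N' 0"
   using integral_by_parts_primitive(2,3,4)[OF less_imp_le[OF d] ki[unfolded Icc_integrable_def] g w' G] by auto
 qed
 have wNi: "Icc_integrable d (%t. (- l) * (w t * N t))" and kNi: "Icc_integrable d (%t. k t * N' t)"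
  using bp(1,2) by (simp_all add: Icc_integrable_def mult_ac)
 have wcont: "continuous_on {0..d} w"
 proof -
  have "continuous_on {0..d} (%t. integral {0..t} k)" using ki by (intro indefinite_integral_continuous_1 set_borel_integral_eq_integral(1))
    (auto simp: Icc_integrable_def set_integrable_def)
  moreover have "w t = integral {0..t} k" if "t \<in> {0..d}" for t
   using w[of t] that set_borel_integral_eq_integral(2)[of "{0..t}" k] kt[OF ki, of t] by (auto simp: set_integrable_def set_lebesgue_integral_def)
  ultimately show ?thesis by (subst continuous_on_cong[OF refl, of _ w "%t. integral {0..t} k"]) auto
 qed
 have "Icc_int d (%t. (- l) * (w t * N t)) + Icc_int d (%t. k t * N' t) = 0"
  using bp(3) wd by (subst Icc_int_add[OF wNi kNi, symmetric]) (simp add: Icc_int_def mult_ac)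
 then have kN: "Icc_int d (%t. k t * N' t) = l * Icc_int d (%t. w t * N t)" unfolding Icc_int_cmult by simp
 have "Icc_int d (%t. (H t)\<^sup>2) = Icc_int d (%t. (k t)\<^sup>2 + (2 * (k t * N' t) + (N' t)\<^sup>2))"
  by (rule Icc_int_cong) (simp add: k_def power2_eq_square algebra_simps)
 also have "... = Icc_int d (%t. (k t)\<^sup>2) + (2 * Icc_int d (%t. k t * N' t) + Icc_int d (%t. (N' t)\<^sup>2))"
  using Icc_int_add[OF k2 Icc_integrable_add[OF Icc_integrable_cmult[OF kNi, of 2] N'i(2)]]
   Icc_int_add[OF Icc_integrable_cmult[OF kNi, of 2] N'i(2)] by (simp add: Icc_int_cmult)
 finally show "Icc_int d (%t. (H t)\<^sup>2) \<ge> c\<^sup>2 * Icc_int d (%t. (v t - N t)\<^sup>2)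
   + 2 * l * Icc_int d (%t. (v t - N t) * N t) + Icc_int d (%t. (N' t)\<^sup>2)" using P(1) wd kN by (simp add: w_def)
 show "Icc_integrable d (%t. (v t - N t)\<^sup>2)" "Icc_integrable d (%t. (v t - N t) * N t)"
  using wcont contN unfolding w_def by (auto intro!: Icc_integrable_cont continuous_intros)
qed

text \<open>\<open>oscillator_comparison_Icc\<close> in each coordinate with l = \<omega>^2, added
  up. The linear terms sum to - \<omega>^2 times the squared distance by the unit length of both
  curves, the Poincare terms to 9/4 \<omega>^2 times it; the difference is the factor 5/4.\<close>

lemma unit_arc_energy_Icc:
 fixes H v :: "real => real^3"
 assumes d: "d > 0"
  and H: "!!i. (%t. H t $ i) \<in> borel_measurable borel" and H2: "!!i. Icc_integrable d (%t. (H t $ i)\<^sup>2)"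
  and v: "!!t i. 0 <= t ==> t <= d ==> v t $ i = axis 1 1 $ i + (LBINT s. indicator {0..t} s * H s $ i)"
  and nv: "!!t. 0 <= t ==> t <= d ==> norm (v t) = 1" and vd: "v d = axis 3 1"
 defines "\<omega> \<equiv> pi / (2 * d)"
 defines "N \<equiv> %t. vector [cos (\<omega> * t), 0, sin (\<omega> * t)] :: real^3"
 shows "Icc_int d (%t. (norm (H t))\<^sup>2) \<ge> \<omega>\<^sup>2 * d + 5 / 4 * \<omega>\<^sup>2 * Icc_int d (%t. (norm (v t - N t))\<^sup>2)"
  and "Icc_integrable d (%t. (norm (v t - N t))\<^sup>2)"
proof -
 define N' where "N' t = (vector [- \<omega> * sin (\<omega> * t), 0, \<omega> * cos (\<omega> * t)] :: real^3)" for t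
 have \<omega>: "\<omega> > 0" using d by (simp add: \<omega>_def)
 \<comment> \<open>Any c strictly between \<omega> and 2 \<omega> would do: c < 2 \<omega> is the
   condition c d < pi, and c > \<omega> leaves a positive excess.\<close>
 define c where "c = 3 / 2 * \<omega>"
 have c: "0 < c" "c * d < pi" using d pi_gt_zero by (auto simp: c_def \<omega>_def)
 have norm3: "(norm (x :: real^3))\<^sup>2 = (x $ 1)\<^sup>2 + (x $ 2)\<^sup>2 + (x $ 3)\<^sup>2" for x by (simp add: norm_vec_def L2_set_def sum_3)
 have 13: "(i :: 3) = 1 \<or> i = 2 \<or> i = 3" for i by (rule exhaust_3)
 have N0: "N 0 = axis 1 1" and Nd: "N d = axis 3 1" using d by (auto simp: N_def vec_eq_iff forall_3 axis_def \<omega>_def)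
 have dN: "((%t. N t $ i) has_real_derivative N' t $ i) (at t)" for t i
  using 13[of i] by (elim disjE) (auto simp: N_def N'_def intro!: derivative_eq_intros)
 have dN': "((%t. N' t $ i) has_real_derivative - (\<omega>\<^sup>2) * N t $ i) (at t)" for t i
  using 13[of i] by (elim disjE) (auto simp: N_def N'_def power2_eq_square intro!: derivative_eq_intros)
 note C = oscillator_comparison_Icc[OF d c H H2 _ _ dN dN', where v="%t. v t $ i" for i]
 have v0: "v t $ i = N 0 $ i + (LBINT s. indicator {0..t} s * H s $ i)" if "0 <= t" "t <= d" for t i using v[OF that] by (simp add: N0)
 have vdi: "v d $ i = N d $ i" for i by (simp add: vd Nd)
 note C1 = C(1)[OF v0 vdi] and C2 = C(2)[OF v0 vdi] and C3 = C(3)[OF v0 vdi]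
 have N'i: "Icc_integrable d (%t. (N' t $ i)\<^sup>2)" for i
 proof -
  have "continuous_on {0..d} (%t. N' t $ i)" using DERIV_isCont[OF dN'[of i]] by (intro continuous_at_imp_continuous_on) simp
  then show ?thesis by (intro Icc_integrable_cont continuous_on_power)
 qed
 have sum3: "Icc_int d (%t. f 1 t + f 2 t + f 3 t) = Icc_int d (f 1) + Icc_int d (f 2) + Icc_int d (f (3 :: 3))"
  if "!!i. Icc_integrable d (f i)" for f using that by (simp add: Icc_int_add Icc_integrable_add)
 have e1: "Icc_int d (%t. (norm (H t))\<^sup>2) = Icc_int d (%t. (H t $ 1)\<^sup>2) + Icc_int d (%t. (H t $ 2)\<^sup>2) + Icc_int d (%t. (H t $ 3)\<^sup>2)"
  unfolding norm3 by (rule sum3[OF H2])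
 have e2: "Icc_int d (%t. (norm (v t - N t))\<^sup>2) = Icc_int d (%t. (v t $ 1 - N t $ 1)\<^sup>2) + Icc_int d (%t. (v t $ 2 - N t $ 2)\<^sup>2) + Icc_int d (%t. (v t $ 3 - N t $ 3)\<^sup>2)"
  unfolding norm3 vector_minus_component by (rule sum3[OF C2])
 \<comment> \<open>For unit vectors (v - N) . N = v . N - 1 = - |v - N|^2 / 2.\<close>
 have e3: "Icc_int d (%t. (v t $ 1 - N t $ 1) * N t $ 1) + Icc_int d (%t. (v t $ 2 - N t $ 2) * N t $ 2)
   + Icc_int d (%t. (v t $ 3 - N t $ 3) * N t $ 3) = - 1 / 2 * Icc_int d (%t. (norm (v t - N t))\<^sup>2)"
 proof -
  have "Icc_int d (%t. - 1 / 2 * (norm (v t - N t))\<^sup>2)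
   = Icc_int d (%t. (v t $ 1 - N t $ 1) * N t $ 1 + (v t $ 2 - N t $ 2) * N t $ 2 + (v t $ 3 - N t $ 3) * N t $ 3)"
  proof (rule Icc_int_cong)
   fix t assume t: "0 <= t" "t <= d"
   have 1: "(v t $ 1)\<^sup>2 + (v t $ 2)\<^sup>2 + (v t $ 3)\<^sup>2 = 1" using nv[OF t] norm3[of "v t"] by simp
   have 2: "(N t $ 1)\<^sup>2 + (N t $ 2)\<^sup>2 + (N t $ 3)\<^sup>2 = 1" by (simp add: N_def)
   show "- 1 / 2 * (norm (v t - N t))\<^sup>2 = (v t $ 1 - N t $ 1) * N t $ 1 + (v t $ 2 - N t $ 2) * N t $ 2 + (v t $ 3 - N t $ 3) * N t $ 3"
    unfolding norm3 vector_minus_component using 1 2 by (simp add: power2_eq_square field_simps)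
  qed
  moreover have "Icc_int d (%t. (v t $ 1 - N t $ 1) * N t $ 1 + (v t $ 2 - N t $ 2) * N t $ 2 + (v t $ 3 - N t $ 3) * N t $ 3)
   = Icc_int d (%t. (v t $ 1 - N t $ 1) * N t $ 1) + Icc_int d (%t. (v t $ 2 - N t $ 2) * N t $ 2)
   + Icc_int d (%t. (v t $ 3 - N t $ 3) * N t $ 3)" by (rule sum3[of "%i t. (v t $ i - N t $ i) * N t $ i", OF C3])
  ultimately show ?thesis unfolding Icc_int_cmult by simp
 qed
 have e4: "Icc_int d (%t. (N' t $ 1)\<^sup>2) + Icc_int d (%t. (N' t $ 2)\<^sup>2) + Icc_int d (%t. (N' t $ 3)\<^sup>2) = \<omega>\<^sup>2 * d"
 proof -
  have "Icc_int d (%t. (N' t $ 1)\<^sup>2 + (N' t $ 2)\<^sup>2 + (N' t $ 3)\<^sup>2) = Icc_int d (%t. \<omega>\<^sup>2)"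
  proof (rule Icc_int_cong)
   fix t
   show "(N' t $ 1)\<^sup>2 + (N' t $ 2)\<^sup>2 + (N' t $ 3)\<^sup>2 = \<omega>\<^sup>2" by (simp add: N'_def power_mult_distrib flip: distrib_left)
  qed
  also have "... = \<omega>\<^sup>2 * d" using d by (simp add: Icc_int_def)
  also have "Icc_int d (%t. (N' t $ 1)\<^sup>2 + (N' t $ 2)\<^sup>2 + (N' t $ 3)\<^sup>2)
   = Icc_int d (%t. (N' t $ 1)\<^sup>2) + Icc_int d (%t. (N' t $ 2)\<^sup>2) + Icc_int d (%t. (N' t $ 3)\<^sup>2)"
   by (rule sum3[of "%i t. (N' t $ i)\<^sup>2", OF N'i])
  finally show ?thesis .
 qed
 have c2: "c\<^sup>2 = 9 / 4 * \<omega>\<^sup>2" by (simp add: c_def power2_eq_square)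
 define W where "W = Icc_int d (%t. (norm (v t - N t))\<^sup>2)"
 have "Icc_int d (%t. (norm (H t))\<^sup>2) \<ge> c\<^sup>2 * W + 2 * \<omega>\<^sup>2 * (- 1 / 2 * W) + \<omega>\<^sup>2 * d"
  unfolding e1 W_def e3[symmetric] e4[symmetric] unfolding e2 using C1[of 1] C1[of 2] C1[of 3] unfolding distrib_left by linarith
 then show "Icc_int d (%t. (norm (H t))\<^sup>2) \<ge> \<omega>\<^sup>2 * d + 5 / 4 * \<omega>\<^sup>2 * Icc_int d (%t. (norm (v t - N t))\<^sup>2)"
  unfolding c2 W_def[symmetric] by (simp add: algebra_simps)
 show "Icc_integrable d (%t. (norm (v t - N t))\<^sup>2)" unfolding norm3 vector_minus_component by (intro Icc_integrable_add C2)
qed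

section \<open>Continuously differentiable cutoffs on the line\<close>

text \<open>A rational smooth step: squares of positive parts are continuously differentiable, and
  the two squares in the denominator never vanish together.\<close>

definition step01 :: "real => real" where
 "step01 x = (max 0 x)\<^sup>2 / ((max 0 x)\<^sup>2 + (max 0 (1 - x))\<^sup>2)"

definition step01' :: "real => real" where
 "step01' x = (2 * max 0 x * ((max 0 x)\<^sup>2 + (max 0 (1 - x))\<^sup>2) - (max 0 x)\<^sup>2 * (2 * max 0 x - 2 * max 0 (1 - x)))
   / ((max 0 x)\<^sup>2 + (max 0 (1 - x))\<^sup>2)\<^sup>2"

lemma max0_square_deriv: "((%x. (max 0 x)\<^sup>2) has_real_derivative 2 * max 0 x) (at (x :: real))"
proof (cases "x = 0")
 case False
 show ?thesis
 proof (cases "x > 0")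
  case True
  have "((%x. x\<^sup>2) has_real_derivative 2 * max 0 x) (at x)" using True by (auto intro!: derivative_eq_intros)
  then show ?thesis by (rule has_field_derivative_transform_within[where d=x]) (use True in \<open>auto simp: dist_real_def\<close>)
 next
  case F: False
  have "((%x. 0) has_real_derivative 2 * max 0 x) (at x)" using F False by simp
  then show ?thesis by (rule has_field_derivative_transform_within[where d="- x"]) (use F False in \<open>auto simp: dist_real_def\<close>)
 qed
next
 case True
 have "(%h. (max 0 (0 + h))\<^sup>2 / h :: real) \<midarrow>0\<rightarrow> 0"
 proof (rule Lim_null_comparison)
  show "\<forall>\<^sub>F h in at 0. norm ((max 0 (0 + h))\<^sup>2 / h) <= \<bar>h :: real\<bar>"
   by (auto simp: eventually_at_filter power2_eq_square max_def)
  show "((%h. \<bar>h\<bar>) \<longlongrightarrow> (0 :: real)) (at 0)" by (rule tendsto_rabs_zero) (rule tendsto_ident_at)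
 qed
 then show ?thesis using True by (simp add: DERIV_def)
qed

lemma step01_denom_pos: "(max 0 x)\<^sup>2 + (max 0 (1 - x))\<^sup>2 > (0 :: real)"
proof (cases "x > 0")
 case True then show ?thesis by (intro add_pos_nonneg) auto
next
 case False then show ?thesis by (intro add_nonneg_pos) auto
qed

lemma step01_deriv: "(step01 has_real_derivative step01' x) (at x)"
proof -
 have 1: "((%x. (max 0 (1 - x))\<^sup>2) has_real_derivative 2 * max 0 (1 - x) * (- 1)) (at x)"
  by (rule DERIV_chain'[OF _ max0_square_deriv]) (auto intro!: derivative_eq_intros)
 have "((%x. (max 0 x)\<^sup>2 / ((max 0 x)\<^sup>2 + (max 0 (1 - x))\<^sup>2)) has_real_derivative
   (2 * max 0 x * ((max 0 x)\<^sup>2 + (max 0 (1 - x))\<^sup>2) - (max 0 x)\<^sup>2 * (2 * max 0 x + 2 * max 0 (1 - x) * (- 1)))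
   / (((max 0 x)\<^sup>2 + (max 0 (1 - x))\<^sup>2) * ((max 0 x)\<^sup>2 + (max 0 (1 - x))\<^sup>2))) (at x)"
  by (rule DERIV_divide[OF max0_square_deriv DERIV_add[OF max0_square_deriv 1]]) (use step01_denom_pos[of x] in linarith)
 then show ?thesis unfolding step01_def[abs_def] step01'_def by (simp add: power2_eq_square)
qed

lemma step01'_continuous: "continuous_on A step01'" unfolding step01'_def[abs_def] using step01_denom_pos
 by (intro continuous_intros) (metis power_zero_numeral zero_neq_one less_irrefl power_eq_0_iff)

lemma step01_simps: "x <= 0 ==> step01 x = 0" "x \<ge> 1 ==> step01 x = 1" "step01 x \<ge> 0" "step01 x <= 1"
 using step01_denom_pos[of x] by (auto simp: step01_def divide_le_eq)

text \<open>A \<open>C\<^sup>1\<close> plateau function: \<open>1\<close> on \<open>[l + 2/m, u - 2/m]\<close>, supported in \<open>[l + 1/m, u - 1/m]\<close>.\<close>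

definition plateau :: "real => real => real => real => real" where
 "plateau m l u t = step01 (m * (t - l) - 1) * step01 (m * (u - t) - 1)"

definition plateau' :: "real => real => real => real => real" where
 "plateau' m l u t = m * step01' (m * (t - l) - 1) * step01 (m * (u - t) - 1)
   - m * step01 (m * (t - l) - 1) * step01' (m * (u - t) - 1)"

lemma step01_continuous: "continuous_on A step01" using step01_deriv by (auto intro!: continuous_at_imp_continuous_on DERIV_isCont)

lemma plateau_deriv: "(plateau m l u has_real_derivative plateau' m l u t) (at t)"
proof -
 have 1: "((%t. step01 (m * (t - l) - 1)) has_real_derivative step01' (m * (t - l) - 1) * m) (at t)"
  by (rule DERIV_chain'[OF _ step01_deriv]) (auto intro!: derivative_eq_intros)
 have 2: "((%t. step01 (m * (u - t) - 1)) has_real_derivative step01' (m * (u - t) - 1) * (- m)) (at t)"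
  by (rule DERIV_chain'[OF _ step01_deriv]) (auto intro!: derivative_eq_intros)
 show ?thesis unfolding plateau_def[abs_def] plateau'_def using DERIV_mult[OF 1 2] by (simp add: algebra_simps)
qed

lemma plateau'_continuous: "continuous_on A (plateau' m l u)" unfolding plateau'_def[abs_def]
 by (intro continuous_intros continuous_on_compose2[OF step01'_continuous[of UNIV]] continuous_on_compose2[OF step01_continuous[of UNIV]]) auto

lemma plateau_continuous: "continuous_on A (plateau m l u)" using plateau_deriv by (auto intro!: continuous_at_imp_continuous_on DERIV_isCont)

lemma plateau_range: "0 <= plateau m l u t" "plateau m l u t <= 1" using step01_simps(3,4) by (auto simp: plateau_def intro!: mult_le_one)

lemma plateau_support: "m > 0 ==> plateau m l u t ~= 0 ==> l + 1 / m <= t & t <= u - 1 / m"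
proof -
 assume m: "m > 0" and ne: "plateau m l u t ~= 0"
 have "m * (t - l) - 1 > 0" "m * (u - t) - 1 > 0" using ne step01_simps(1)[of "m * (t - l) - 1"] step01_simps(1)[of "m * (u - t) - 1"]
  unfolding plateau_def by fastforce+
 then show "l + 1 / m <= t & t <= u - 1 / m" using m by (simp add: field_simps)
qed

lemma plateau_eq_1: "m > 0 ==> l + 2 / m <= t ==> t <= u - 2 / m ==> plateau m l u t = 1"
 unfolding plateau_def by (subst (1 2) step01_simps(2)) (auto simp: field_simps)

lemma plateau_tendsto: "(%n. plateau (real (Suc n)) l u t) \<longlonglongrightarrow> indicator {l<..<u} t"
proof (cases "t \<in> {l<..<u}")
 case True
 obtain N where N: "2 / (t - l) < real N" "2 / (u - t) < real N" by (metis max_less_iff_conj reals_Archimedean2)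
 have "plateau (real (Suc n)) l u t = 1" if "n \<ge> N" for n
 proof (rule plateau_eq_1)
  have "2 / (t - l) <= real (Suc n)" "2 / (u - t) <= real (Suc n)" using N that by linarith+
  then have "2 / real (Suc n) <= t - l" "2 / real (Suc n) <= u - t" using True by (simp_all add: divide_le_eq mult.commute del: of_nat_Suc)
  then show "l + 2 / real (Suc n) <= t" "t <= u - 2 / real (Suc n)" by linarith+
 qed simp
 then show ?thesis using True by (intro tendsto_eventually) (auto simp: eventually_sequentially)
next
 case False
 have "plateau (real (Suc n)) l u t = 0" for n
 proof (rule ccontr)
  assume "plateau (real (Suc n)) l u t ~= 0"
  from plateau_support[OF _ this] have "l + 1 / real (Suc n) <= t" "t <= u - 1 / real (Suc n)" by auto
  moreover have "1 / real (Suc n) > 0" by simp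
  ultimately show False using False unfolding greaterThanLessThan_iff by linarith
 qed
 then show ?thesis using False by simp
qed

section \<open>Mean-zero weights and piecewise constant functions of one variable\<close>

text \<open>Mean zero is exactly what makes the primitive vanish again to the right of the support.
  It turns identities tested with a derivative into identities tested with any mean-zero
  weight.\<close>

lemma antiderivative_compact_support:
 fixes \<rho> :: "real => real"
 assumes cont: "continuous_on UNIV \<rho>" and supp: "!!t. \<rho> t ~= 0 ==> c <= t & t <= c'"
  and zero: "(LBINT t. \<rho> t) = 0" and cc: "c <= c'"
 obtains \<eta> where "!!t. (\<eta> has_real_derivative \<rho> t) (at t)" "!!t. \<eta> t ~= 0 ==> c <= t & t <= c'"
proof -
 \<comment> \<open>Starting at c - 1 instead of c makes every t >= c an interior point of the
   interval used for the fundamental theorem.\<close>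
 define \<eta> where "\<eta> t = integral {c - 1..t} \<rho>" for t
 have int: "\<rho> integrable_on {a..b}" for a b by (rule integrable_continuous_real) (rule continuous_on_subset[OF cont], simp)
 have left: "\<eta> t = 0" if "t < c" for t
 proof -
  have "integral {c - 1..t} \<rho> = integral {c - 1..t} (%_. 0)" using supp that by (intro Henstock_Kurzweil_Integration.integral_cong) fastforce
  then show ?thesis by (simp add: \<eta>_def)
 qed
 have tot: "integral {c - 1..c' + 1} \<rho> = 0"
 proof -
  have "integral {c - 1..c' + 1} \<rho> = (LINT t:{c - 1..c' + 1}|lborel. \<rho> t)"
   using borel_integrable_compact[OF compact_Icc continuous_on_subset[OF cont]]
   by (intro set_borel_integral_eq_integral(2)[symmetric]) (auto simp: set_integrable_def)
  also have "... = (LBINT t. \<rho> t)" unfolding set_lebesgue_integral_def using supp by (intro lint_cong) (fastforce simp: indicator_def)+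
  finally show ?thesis using zero by simp
 qed
 have right: "\<eta> t = 0" if "t > c'" for t
 proof -
  have *: "integral {c' ..s} \<rho> = 0" for s
  proof -
   have "integral {c'..s} \<rho> = integral {c'..s} (%_. 0)" by (rule integral_spike[of "{c'}"]) (use supp in fastforce)+
   then show ?thesis by simp
  qed
  have "integral {c - 1..c'} \<rho> + integral {c'..c' + 1} \<rho> = integral {c - 1..c' + 1} \<rho>"
   using cc int by (intro Henstock_Kurzweil_Integration.integral_combine) auto
  moreover have "integral {c - 1..c'} \<rho> + integral {c'..t} \<rho> = integral {c - 1..t} \<rho>"
   using cc int that by (intro Henstock_Kurzweil_Integration.integral_combine) auto
  ultimately show ?thesis using * tot by (simp add: \<eta>_def)
 qed
 have der: "(\<eta> has_real_derivative \<rho> t) (at t)" for t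
 proof (cases "t < c")
  case True
  have "((%_. 0) has_real_derivative \<rho> t) (at t)" using True supp[of t] by (cases "\<rho> t = 0") auto
  then show ?thesis by (rule has_field_derivative_transform_within[where d="c - t"]) (use True left in \<open>auto simp: dist_real_def\<close>)
 next
  case False
  have "((%x. integral {c - 1..x} \<rho>) has_real_derivative \<rho> t) (at t within {c - 1..t + 1})"
   by (rule integral_has_real_derivative) (use False continuous_on_subset[OF cont] in auto)
  then show ?thesis unfolding \<eta>_def[abs_def] using False by (subst (asm) at_within_interior) (auto simp: interior_atLeastAtMost_real)
 qed
 show thesis by (rule that[OF der]) (use left right in force)
qed

text \<open>Rational intervals around a fixed one share its constant by overlap, and they exhaust
  (p, q). Only rational endpoints are asked for, so that callers have countably many exceptional
  sets.\<close>

lemma AE_const_on_Ioo: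
 fixes v :: "real => real"
 assumes pq: "p < q"
  and loc: "!!r s. r \<in> \<rat> ==> s \<in> \<rat> ==> p < r ==> r < s ==> s < q ==> \<exists>c. AE t in lborel. r < t & t < s --> v t = c"
 obtains c where "AE t in lborel. p < t & t < q --> v t = c"
proof -
 obtain r0 where r0: "r0 \<in> \<rat>" "p < r0" "r0 < q" using Rats_dense_in_real[OF pq] by blast
 obtain s0 where s0: "s0 \<in> \<rat>" "r0 < s0" "s0 < q" using Rats_dense_in_real[OF r0(3)] by blast
 obtain c where c: "AE t in lborel. r0 < t & t < s0 --> v t = c" using loc[OF r0(1) s0(1)] r0 s0 by blast
 have ext: "AE t in lborel. r < t & t < s --> v t = c" if h: "r \<in> \<rat>" "s \<in> \<rat>" "p < r" "r < r0" "s0 < s" "s < q" for r s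
 proof -
  have rs: "r < s" using that r0 s0 by linarith
  obtain c' where c': "AE t in lborel. r < t & t < s --> v t = c'" using loc[OF h(1-3) rs h(6)] by blast
  have "c' = c"
  proof (rule ccontr)
   assume "c' ~= c"
   from c c' have "AE t in lborel. t \<notin> {r0<..<s0}" by eventually_elim (use that \<open>c' ~= c\<close> in auto)
   then have "emeasure lborel {r0<..<s0} = 0" by (subst (asm) AE_iff_measurable[of "{r0<..<s0}"]) auto
   then show False using s0 by simp
  qed
  with c' show ?thesis by simp
 qed
 have "AE t in lborel. \<forall>z\<in>(\<rat> \<times> \<rat>). p < fst z & fst z < r0 & s0 < snd z & snd z < q --> fst z < t & t < snd z --> v t = c"
 proof (rule AE_ball_countable')
  show "countable ((\<rat> :: real set) \<times> (\<rat> :: real set))" by (intro countable_SIGMA countable_rat)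
  fix z :: "real \<times> real" assume "z \<in> \<rat> \<times> \<rat>"
  then show "AE t in lborel. p < fst z & fst z < r0 & s0 < snd z & snd z < q --> fst z < t & t < snd z --> v t = c"
   using ext[of "fst z" "snd z"] by (cases "p < fst z & fst z < r0 & s0 < snd z & snd z < q") auto
 qed
 then have "AE t in lborel. p < t & t < q --> v t = c"
 proof eventually_elim
  case (elim t)
  show ?case
  proof
   assume t: "p < t & t < q"
   obtain r where r: "r \<in> \<rat>" "p < r" "r < min t r0" using Rats_dense_in_real[of p "min t r0"] t r0 by auto
   obtain s where s: "s \<in> \<rat>" "max t s0 < s" "s < q" using Rats_dense_in_real[of "max t s0" q] t s0 by auto
   have "(r, s) \<in> \<rat> \<times> \<rat>" using r s by simp
   from elim[rule_format, OF this] r s show "v t = c" by auto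
  qed
 qed
 then show thesis by (rule that)
qed

lemma integral_Ioo_split:
 fixes f :: "real => real"
 assumes "integrable lborel (%t. indicator {p<..<q} t * f t)" "p < r" "r < q"
 shows "(LBINT t. indicator {p<..<q} t * f t)
  = (LBINT t. indicator {p<..<r} t * f t) + (LBINT t. indicator {r<..<q} t * f t)"
proof -
 have i: "integrable lborel (%t. indicator A t * (indicator {p<..<q} t * f t))" if "A \<in> sets borel" for A
  using integrable_real_mult_indicator[OF _ assms(1), of A] that by (simp add: mult.commute)
 have e: "(%t. indicator {p<..<r} t * f t) = (%t. indicator {..<r} t * (indicator {p<..<q} t * f t))"
  "(%t. indicator {r<..<q} t * f t) = (%t. indicator {r<..} t * (indicator {p<..<q} t * f t))" using assms by (auto simp: fun_eq_iff indicator_def)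
 have i1: "integrable lborel (%t. indicator {p<..<r} t * f t)" "integrable lborel (%t. indicator {r<..<q} t * f t)" unfolding e by (intro i; simp)+
 have "(LBINT t. indicator {p<..<q} t * f t) = (LBINT t. indicator {p<..<r} t * f t + indicator {r<..<q} t * f t)"
 proof (rule integral_cong_AE)
  show "AE t in lborel. indicator {p<..<q} t * f t = indicator {p<..<r} t * f t + indicator {r<..<q} t * f t"
   using AE_lborel_singleton[of r] by eventually_elim (use assms in \<open>auto simp: indicator_def\<close>)
 qed (use assms(1) i1 in auto)
 then show ?thesis using i1 by simp
qed

text \<open>Each jump of v has height at most 1, so the integral of v \<eta>' is bounded by the
  values of \<eta> at the jump points. Induction on the number of points of F in the interval,
  splitting at one of them.\<close>

lemma piecewise_constant_variation:
 fixes v \<eta> \<eta>' :: "real => real"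
 assumes F: "finite F" and ab: "a < b"
  and [measurable]: "v \<in> borel_measurable borel" and v01: "!!t. 0 <= v t & v t <= 1"
  and loc: "!!r s. r \<in> \<rat> ==> s \<in> \<rat> ==> a < r ==> r < s ==> s < b ==> {r..s} \<inter> F = {} ==>
    \<exists>c. AE t in lborel. r < t & t < s --> v t = c"
  and der: "!!t. (\<eta> has_real_derivative \<eta>' t) (at t)" and cont: "continuous_on UNIV \<eta>'"
  and pos: "!!t. \<eta> t \<ge> 0" and bd: "\<eta> a = 0" "\<eta> b = 0"
 shows "\<bar>LBINT t. indicator {a<..<b} t * (v t * \<eta>' t)\<bar> <= (\<Sum>t\<in>F. \<eta> t)"
proof -
 define I where "I p q = (LBINT t. indicator {p<..<q} t * (v t * \<eta>' t))" for p q
 have [measurable]: "\<eta>' \<in> borel_measurable borel" using cont by (intro continuous_borel) auto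
 have intI: "integrable lborel (%t. indicator {p<..<q} t * (v t * \<eta>' t))" for p q
 proof (rule integrable_dominated)
  show "integrable lborel (%t. indicator {p..q} t *\<^sub>R \<eta>' t)" by (rule borel_integrable_compact) (auto intro: continuous_on_subset[OF cont])
  have "\<bar>v t * \<eta>' t\<bar> <= \<bar>\<eta>' t\<bar>" for t
   using v01[of t] mult_right_mono[of "\<bar>v t\<bar>" 1 "\<bar>\<eta>' t\<bar>"] by (simp add: abs_mult)
  then show "AE t in lborel. norm (indicator {p<..<q} t * (v t * \<eta>' t)) <= norm (indicator {p..q} t *\<^sub>R \<eta>' t)"
   by (auto simp: indicator_def)
 qed simp
 \<comment> \<open>c1 and c2 play the one-sided values of v at p and q. Carrying them through the
   induction lets the two boundary terms at a splitting point combine into one jump.\<close>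
 have main: "\<exists>c1 c2. 0 <= c1 & c1 <= 1 & 0 <= c2 & c2 <= 1 &
   \<bar>I p q - (c2 * \<eta> q - c1 * \<eta> p)\<bar> <= (\<Sum>t\<in>F \<inter> {p<..<q}. \<eta> t)" if "a <= p" "p < q" "q <= b" for p q using that
 proof (induction "card (F \<inter> {p<..<q})" arbitrary: p q rule: less_induct)
  case less
  show ?case
  proof (cases "F \<inter> {p<..<q} = {}")
   case True
   obtain c where c: "AE t in lborel. p < t & t < q --> v t = c"
   proof (rule AE_const_on_Ioo[OF less(3), of v])
    fix r s assume rs: "r \<in> \<rat>" "s \<in> \<rat>" "p < r" "r < s" "s < q"
    then have "{r..s} \<inter> F = {}" using True by force
    then show "\<exists>c. AE t in lborel. r < t & t < s --> v t = c" using loc[of r s] rs less by auto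
   qed
   \<comment> \<open>Clamping keeps the constant in [0, 1] without exhibiting a point where v takes
     it.\<close>
   define c' where "c' = min 1 (max 0 c)"
   have c': "AE t in lborel. p < t & t < q --> v t = c'" using c
   proof eventually_elim
    case (elim t)
    then show ?case using v01[of t] by (auto simp: c'_def)
   qed
   have "I p q = (LBINT t. c' * (indicator {p..q} t * \<eta>' t))" unfolding I_def
   proof (rule integral_cong_AE)
    show "AE t in lborel. indicator {p<..<q} t * (v t * \<eta>' t) = c' * (indicator {p..q} t * \<eta>' t)"
     using c' AE_lborel_singleton[of p] AE_lborel_singleton[of q] by eventually_elim (auto simp: indicator_def)
   qed simp_all
   also have "... = c' * (\<eta> q - \<eta> p)" using primitive_of_deriv(1)[of p q \<eta> \<eta>'] less(3) der continuous_on_subset[OF cont] by simp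
   finally have "\<bar>I p q - (c' * \<eta> q - c' * \<eta> p)\<bar> = 0" by (simp add: algebra_simps)
   then show ?thesis using True by (intro exI[of _ c']) (simp add: c'_def)
  next
   case False
   then obtain r where r: "r \<in> F" "p < r" "r < q" by auto
   have sub: "F \<inter> {p<..<q} = insert r ((F \<inter> {p<..<r}) \<union> (F \<inter> {r<..<q}))" using r by auto
   have "card (F \<inter> {p<..<r}) < card (F \<inter> {p<..<q})" "card (F \<inter> {r<..<q}) < card (F \<inter> {p<..<q})"
    using F r by (auto intro!: psubset_card_mono)
   then obtain c1 c2 d1 d2 where c: "0 <= c1" "c1 <= 1" "0 <= c2" "c2 <= 1" "0 <= d1" "d1 <= 1" "0 <= d2" "d2 <= 1"
    and b1: "\<bar>I p r - (c2 * \<eta> r - c1 * \<eta> p)\<bar> <= (\<Sum>t\<in>F \<inter> {p<..<r}. \<eta> t)"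
    and b2: "\<bar>I r q - (d2 * \<eta> q - d1 * \<eta> r)\<bar> <= (\<Sum>t\<in>F \<inter> {r<..<q}. \<eta> t)"
    using less(1)[of p r] less(1)[of r q] less(2-4) r by force
   have "I p q = I p r + I r q" unfolding I_def by (rule integral_Ioo_split[OF intI]) (use r in auto)
   moreover have "(\<Sum>t\<in>F \<inter> {p<..<q}. \<eta> t) = \<eta> r + ((\<Sum>t\<in>F \<inter> {p<..<r}. \<eta> t) + (\<Sum>t\<in>F \<inter> {r<..<q}. \<eta> t))"
    unfolding sub using F by (subst sum.insert) (auto intro!: sum.union_disjoint)
   \<comment> \<open>The jump at r: left value c2 minus right value d1, both in [0, 1].\<close>
   moreover have "\<bar>(c2 - d1) * \<eta> r\<bar> <= \<eta> r"
   proof -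
    have "\<bar>c2 - d1\<bar> * \<bar>\<eta> r\<bar> <= 1 * \<bar>\<eta> r\<bar>" using c by (intro mult_right_mono) auto
    then show ?thesis using pos[of r] by (simp add: abs_mult)
   qed
   ultimately have "\<bar>I p q - (d2 * \<eta> q - c1 * \<eta> p)\<bar> <= (\<Sum>t\<in>F \<inter> {p<..<q}. \<eta> t)"
    using b1 b2 unfolding left_diff_distrib by linarith
   then show ?thesis using c by blast
  qed
 qed
 have "\<bar>I a b\<bar> <= (\<Sum>t\<in>F \<inter> {a<..<b}. \<eta> t)" using main[of a b] ab bd by auto
 also have "... <= (\<Sum>t\<in>F. \<eta> t)" using F pos by (intro sum_mono2) auto
 finally show ?thesis by (simp add: I_def)
qed

section \<open>Coordinates along tilted lines\<close>

text \<open>Lines of direction (s1, s2, 1), given by their foot in the plane of height 0 and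
  parametrised by height. Height rather than arc length makes the change of coordinates volume
  preserving for every tilt.\<close>

definition shear :: "real => real => (real \<times> real) \<times> real => real^3" where
 "shear s1 s2 q = vector [fst (fst q) + s1 * snd q, snd (fst q) + s2 * snd q, snd q]"

definition foot :: "real => real => real^3 => real \<times> real" where
 "foot s1 s2 p = (p $ 1 - s1 * p $ 3, p $ 2 - s2 * p $ 3)"

lemma shear_nth [simp]:
 "shear s1 s2 q $ 1 = fst (fst q) + s1 * snd q" "shear s1 s2 q $ 2 = snd (fst q) + s2 * snd q" "shear s1 s2 q $ 3 = snd q"
 by (simp_all add: shear_def)

lemma foot_shear [simp]: "foot s1 s2 (shear s1 s2 (z, t)) = z" by (simp add: foot_def)

lemma shear_foot [simp]: "shear s1 s2 (foot s1 s2 p, p $ 3) = p" by (simp add: vec_eq_iff forall_3 foot_def)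

lemma continuous_shear: "continuous_on A (shear s1 s2)"
proof -
 have "continuous_on A (%q. shear s1 s2 q $ i)" for i using exhaust_3[of i] by (elim disjE) (auto intro!: continuous_intros)
 then have "continuous_on A (%q. \<chi> i. shear s1 s2 q $ i)" by (intro continuous_on_vec_lambda)
 then show ?thesis by (simp add: vec_lambda_eta)
qed

lemma continuous_foot: "continuous_on A (foot s1 s2)" unfolding foot_def[abs_def] by (intro continuous_intros)

lemma borel_measurable_shear [measurable]: "shear s1 s2 \<in> borel_measurable borel" by (intro continuous_borel continuous_shear)

lemma borel_measurable_foot [measurable]: "foot s1 s2 \<in> borel_measurable borel" by (intro continuous_borel continuous_foot)

lemma prod_Basis_vec3: "(\<Prod>b\<in>Basis. f (b :: real^3)) = f (axis 1 1) * f (axis 2 1) * f (axis 3 1)"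
proof -
 have B: "(Basis :: (real^3) set) = {axis 1 1, axis 2 1, axis 3 1}" by (auto simp: Basis_vec_def UNIV_3)
 show ?thesis unfolding B by (simp add: axis_eq_axis mult.assoc)
qed

text \<open>Preimages of boxes have rectangles of constant size as sections at fixed height, merely
  translated by the tilt; Fubini finishes.\<close>

lemma distr_shear: "distr lborel borel (shear s1 s2) = lborel"
proof (rule lborel_eqI[symmetric])
 fix l u :: "real^3" assume lu: "!!b. b \<in> Basis ==> l \<bullet> b <= u \<bullet> b"
 have lu': "l $ i <= u $ i" for i using lu[of "axis i 1"] by (simp add: inner_axis)
 define A where "A = shear s1 s2 -` box l u"
 have A: "A \<in> sets (lborel \<Otimes>\<^sub>M lborel)"
  unfolding lborel_prod A_def using measurable_sets[OF borel_measurable_shear, of "box l u"] by simp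
 have sec: "emeasure lborel ((%x. (x, t)) -` A) = ennreal ((u $ 1 - l $ 1) * (u $ 2 - l $ 2)) * indicator {l $ 3<..<u $ 3} t" for t
 proof -
  have "(%x. (x, t)) -` A = (if t \<in> {l $ 3<..<u $ 3} then box (l $ 1 - s1 * t, l $ 2 - s2 * t) (u $ 1 - s1 * t, u $ 2 - s2 * t) else {})"
   by (auto simp: A_def mem_box_cart forall_3 box_prod algebra_simps mem_Times_iff mem_box Basis_prod_def)
  moreover have "emeasure lborel (box (l $ 1 - s1 * t, l $ 2 - s2 * t) (u $ 1 - s1 * t, u $ 2 - s2 * t)) = ennreal ((u $ 1 - l $ 1) * (u $ 2 - l $ 2))"
   by (subst emeasure_lborel_box) (use lu' in \<open>auto simp: Basis_prod_def prod.union_disjoint prod.reindex inj_on_def\<close>)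
  ultimately show ?thesis by simp
 qed
 have "emeasure (distr lborel borel (shear s1 s2)) (box l u) = emeasure lborel A" by (subst emeasure_distr) (auto simp: A_def)
 also have "... = emeasure (lborel \<Otimes>\<^sub>M lborel) A" by (simp add: lborel_prod)
 also have "... = (\<integral>\<^sup>+t. emeasure lborel ((%x. (x, t)) -` A) \<partial>lborel)" by (rule lborel_pair.emeasure_pair_measure_alt2[OF A])
 also have "... = ennreal ((u $ 1 - l $ 1) * (u $ 2 - l $ 2)) * ennreal (u $ 3 - l $ 3)" unfolding sec using lu' by (subst nn_integral_cmult) auto
 also have "... = ennreal (\<Prod>b\<in>Basis. (u - l) \<bullet> b)" using lu' by (simp add: prod_Basis_vec3 inner_axis ennreal_mult[symmetric])
 finally show "emeasure (distr lborel borel (shear s1 s2)) (box l u) = ennreal (\<Prod>b\<in>Basis. (u - l) \<bullet> b)" .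
qed simp

lemma AE_shear:
 assumes "AE p in lborel. P p"
 shows "AE z in lborel. AE t in lborel. P (shear s1 s2 (z, t))"
proof -
 have m: "shear s1 s2 \<in> lborel \<rightarrow>\<^sub>M borel" by simp
 have "AE q in lborel. P (shear s1 s2 q)" by (rule AE_distrD[OF m]) (simp only: distr_shear assms)
 then show ?thesis by (intro lborel_pair.AE_pair) (simp only: lborel_prod)
qed

lemma integrable_shear:
 fixes f :: "real^3 => real"
 assumes "integrable lborel f"
 shows "integrable lborel (%q. f (shear s1 s2 q))" "(LBINT p. f p) = (LBINT q. f (shear s1 s2 q))"
 using assms integrable_distr_eq[of "shear s1 s2" lborel borel f] integral_distr[of "shear s1 s2" lborel borel f] by (simp_all add: distr_shear)

lemma nn_integral_shear:
 assumes [measurable]: "f \<in> borel_measurable borel"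
 shows "(\<integral>\<^sup>+p. f p \<partial>lborel) = (\<integral>\<^sup>+z. \<integral>\<^sup>+t. f (shear s1 s2 (z, t)) \<partial>lborel \<partial>lborel)"
proof -
 have "(\<integral>\<^sup>+p. f p \<partial>lborel) = (\<integral>\<^sup>+q. f (shear s1 s2 q) \<partial>lborel)"
  by (subst distr_shear[symmetric]) (simp add: nn_integral_distr)
 also have "... = (\<integral>\<^sup>+z. \<integral>\<^sup>+t. f (shear s1 s2 (z, t)) \<partial>lborel \<partial>lborel)"
 proof -
  have "(%q. f (shear s1 s2 q)) \<in> borel_measurable (lborel \<Otimes>\<^sub>M lborel)" unfolding lborel_prod by simp
  from lborel.nn_integral_fst[OF this] show ?thesis by (simp add: lborel_prod)
 qed
 finally show ?thesis .
qed

text \<open>The sharp constant matters: it has no term linear in the tilt. The defect is a sum of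
  squares by Lagrange's identity for (s1, s2, 1) and p - q.\<close>

lemma dist_foot: "(dist (foot s1 s2 p) (foot s1 s2 q))\<^sup>2 <= (1 + s1\<^sup>2 + s2\<^sup>2) * (dist p q)\<^sup>2"
proof -
 define a b c where "a = p $ 1 - q $ 1" and "b = p $ 2 - q $ 2" and "c = p $ 3 - q $ 3"
 have 1: "(dist (foot s1 s2 p) (foot s1 s2 q))\<^sup>2 = (a - s1 * c)\<^sup>2 + (b - s2 * c)\<^sup>2"
  by (simp add: foot_def dist_Pair_sq a_def b_def c_def algebra_simps)
 have 2: "(dist p q)\<^sup>2 = a\<^sup>2 + b\<^sup>2 + c\<^sup>2" by (simp add: dist_norm norm_vec_def L2_set_def sum_3 a_def b_def c_def)
 have "(1 + s1\<^sup>2 + s2\<^sup>2) * (a\<^sup>2 + b\<^sup>2 + c\<^sup>2) - ((a - s1 * c)\<^sup>2 + (b - s2 * c)\<^sup>2) = (s1 * a + s2 * b + c)\<^sup>2 + (s1 * b - s2 * a)\<^sup>2"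
  by (simp add: power2_eq_square algebra_simps)
 moreover have "0 <= (s1 * a + s2 * b + c)\<^sup>2 + (s1 * b - s2 * a)\<^sup>2" by simp
 ultimately show ?thesis unfolding 1 2 by linarith
qed

section \<open>Counting cover sets met by a line\<close>

text \<open>The summand of \<open>hausdorff_pre\<close> for k = 2: area of the disc of the same
  diameter, and 0 for the empty set.\<close>

definition disc_area :: "'a::metric_space set => ennreal" where
 "disc_area C = (if C = {} then 0 else ennreal (pi * (diameter C / 2)\<^sup>2))"

text \<open>The projection has diameter at most L times that of C, and the isodiametric inequality
  turns diameter into area. The normalisation of the Hausdorff measure then gives the factor L^2
  exactly, with no dimensional loss.\<close>

lemma foot_image_area:
 assumes "bounded C"
 shows "emeasure lborel (closure (foot s1 s2 ` C)) <= ennreal (1 + s1\<^sup>2 + s2\<^sup>2) * disc_area C"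
proof (cases "C = {}")
 case False
 define L where "L = sqrt (1 + s1\<^sup>2 + s2\<^sup>2)"
 have L: "L\<^sup>2 = 1 + s1\<^sup>2 + s2\<^sup>2" "L \<ge> 0" by (simp_all add: L_def add_nonneg_nonneg)
 have Lip: "dist (foot s1 s2 p) (foot s1 s2 q) <= L * dist p q" for p q
  by (rule power2_le_imp_le) (use dist_foot[of s1 s2 p q] L in \<open>simp_all add: power_mult_distrib\<close>)
 have D: "dist p q <= L * diameter C" if pq: "p \<in> foot s1 s2 ` C" "q \<in> foot s1 s2 ` C" for p q
 proof -
  obtain x y where xy: "x \<in> C" "y \<in> C" "p = foot s1 s2 x" "q = foot s1 s2 y" using pq by auto
  have "dist x y <= diameter C" using diameter_bounded_bound[OF assms xy(1,2)] .
  then have "L * dist x y <= L * diameter C" using L by (intro mult_left_mono) auto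
  then show ?thesis using Lip[of x y] xy by simp
 qed
 have "bounded (foot s1 s2 ` C)" unfolding bounded_two_points using D by blast
 from isodiametric_plane[OF this D] have "emeasure lborel (closure (foot s1 s2 ` C)) <= ennreal (pi * (L * diameter C / 2)\<^sup>2)"
  using L diameter_ge_0[OF assms] by simp
 also have "... = ennreal (1 + s1\<^sup>2 + s2\<^sup>2) * disc_area C"
  unfolding L(1)[symmetric] using False by (simp add: disc_area_def ennreal_mult[symmetric] power_mult_distrib power_divide mult_ac)
 finally show ?thesis .
qed (simp add: disc_area_def)

text \<open>Weighted number of cover sets that the line through z may meet. The closures make it a
  Borel function of z whatever the covering sets are.\<close>

definition line_count :: "real => real => (nat => (real^3) set) => (nat => ennreal) => real \<times> real => ennreal" where
 "line_count s1 s2 C W z = (\<Sum>i. W i * indicator (closure (foot s1 s2 ` C i)) z)"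

lemma borel_measurable_line_count [measurable]: "line_count s1 s2 C W \<in> borel_measurable borel" unfolding line_count_def[abs_def] by measurable

lemma nn_integral_line_count:
 assumes "!!i. bounded (C i)"
 shows "(\<integral>\<^sup>+z. line_count s1 s2 C W z \<partial>lborel) <= (\<Sum>i. W i * (ennreal (1 + s1\<^sup>2 + s2\<^sup>2) * disc_area (C i)))"
proof -
 have "(\<integral>\<^sup>+z. line_count s1 s2 C W z \<partial>lborel) = (\<Sum>i. \<integral>\<^sup>+z. W i * indicator (closure (foot s1 s2 ` C i)) z \<partial>lborel)"
  unfolding line_count_def by (subst nn_integral_suminf) auto
 also have "... = (\<Sum>i. W i * emeasure lborel (closure (foot s1 s2 ` C i)))" by (simp add: nn_integral_cmult)
 also have "... <= (\<Sum>i. W i * (ennreal (1 + s1\<^sup>2 + s2\<^sup>2) * disc_area (C i)))"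
  by (intro suminf_le mult_left_mono foot_image_area assms) auto
 finally show ?thesis .
qed

text \<open>A sequence of nearly optimal covers of vanishing mesh. One fixed sequence serves every
  tilt and every weight, so that estimates for different directions can be added cover by
  cover.\<close>

definition fine_covers :: "(real^3) set => (nat => nat => (real^3) set) => bool" where
 "fine_covers S C \<longleftrightarrow> (\<forall>m. S \<subseteq> (\<Union>i. C m i) & (\<forall>i. bounded (C m i) & diameter (C m i) <= 1 / real (Suc m)) &
   (\<Sum>i. disc_area (C m i)) <= hausdorff 2 S + ennreal (1 / real (Suc m)))"

lemma fine_covers_exist:
 assumes fin: "hausdorff 2 (S :: (real^3) set) < \<infinity>"
 obtains C where "fine_covers S C"
proof -
 have "\<exists>C. S \<subseteq> (\<Union>i. C i) & (\<forall>i. bounded (C i) & diameter (C i) <= 1 / real (Suc m)) &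
   (\<Sum>i. disc_area (C i)) <= hausdorff 2 S + ennreal (1 / real (Suc m))" for m
 proof -
  have "hausdorff_pre 2 (1 / real (Suc m)) S <= hausdorff 2 S" unfolding hausdorff_def by (rule SUP_upper) simp
  moreover have "hausdorff 2 S < hausdorff 2 S + ennreal (1 / real (Suc m))"
   using fin by (cases "hausdorff 2 S") (auto simp: ennreal_less_iff simp flip: ennreal_plus)
  ultimately have "hausdorff_pre 2 (1 / real (Suc m)) S < hausdorff 2 S + ennreal (1 / real (Suc m))" by (rule order.strict_trans1)
  then obtain C where "S \<subseteq> (\<Union>i. C i)" "\<forall>i. bounded (C i) & diameter (C i) <= 1 / real (Suc m)"
   "(\<Sum>i. if C i = {} then 0 else ennreal (unit_ball_vol (real 2) * (diameter (C i) / 2) ^ 2)) < hausdorff 2 S + ennreal (1 / real (Suc m))"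
   unfolding hausdorff_pre_def INF_less_iff by auto
  then show ?thesis by (intro exI[of _ C]) (auto simp: disc_area_def unit_ball_vol_2 less_imp_le cong: if_cong)
 qed
 then obtain C where "\<forall>m. S \<subseteq> (\<Union>i. C m i) & (\<forall>i. bounded (C m i) & diameter (C m i) <= 1 / real (Suc m)) &
   (\<Sum>i. disc_area (C m i)) <= hausdorff 2 S + ennreal (1 / real (Suc m))" by metis
 then show thesis by (intro that[of C]) (simp add: fine_covers_def)
qed

text \<open>Once the mesh is below the least distance of the finitely many points, different points
  lie in different cover sets, and each set is counted at z with at least the weight of its
  point.\<close>

lemma line_sum_le_liminf:
 assumes C: "fine_covers S C" and F: "finite F" "F \<subseteq> S" "!!p. p \<in> F ==> foot s1 s2 p = z"
  and W: "!!m i p. p \<in> C m i ==> p \<in> S ==> \<psi> p <= W m i"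
 shows "(\<Sum>p\<in>F. \<psi> p) <= liminf (%m. line_count s1 s2 (C m) (W m) z)"
proof -
 obtain e where e: "e > 0" "!!p q. p \<in> F ==> q \<in> F ==> p ~= q ==> dist p q \<ge> e"
 proof -
  \<comment> \<open>The extra element 1 keeps the set nonempty when F has fewer than two
    points.\<close>
  define D where "D = insert 1 ((%(p, q). dist p q) ` {(p, q) \<in> F \<times> F. p ~= q})"
  have fD: "finite D" unfolding D_def using F(1) by (auto intro!: finite_imageI intro: finite_subset[of _ "F \<times> F"])
  show thesis
  proof (rule that[of "Min D"])
   show "Min D > 0" using fD by (subst Min_gr_iff) (auto simp: D_def)
   show "dist p q \<ge> Min D" if "p \<in> F" "q \<in> F" "p ~= q" for p q
    using fD that by (intro Min_le) (auto simp: D_def intro!: image_eqI[of _ _ "(p, q)"])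
  qed
 qed
 obtain M where M: "1 / real (Suc M) < e" using e(1) by (metis nat_approx_posE)
 have "(\<Sum>p\<in>F. \<psi> p) <= line_count s1 s2 (C m) (W m) z" if m: "m \<ge> M" for m
 proof -
  have "1 / real (Suc m) <= 1 / real (Suc M)" using m by (simp add: frac_le)
  then have me: "1 / real (Suc m) < e" using M by linarith
  have "\<forall>p\<in>F. \<exists>i. p \<in> C m i" using C F(2) unfolding fine_covers_def by blast
  then obtain i where i: "!!p. p \<in> F ==> p \<in> C m (i p)" by metis
  have inj: "inj_on i F"
  proof (rule inj_onI, rule ccontr)
   fix p q assume pq: "p \<in> F" "q \<in> F" "i p = i q" "p ~= q"
   have "dist p q <= diameter (C m (i p))" using C i[OF pq(1)] i[OF pq(2)] pq(3) by (intro diameter_bounded_bound) (auto simp: fine_covers_def)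
   also have "... <= 1 / real (Suc m)" using C unfolding fine_covers_def by blast
   finally show False using e(2)[OF pq(1,2,4)] me by linarith
  qed
  have "(\<Sum>p\<in>F. \<psi> p) <= (\<Sum>p\<in>F. W m (i p) * indicator (closure (foot s1 s2 ` C m (i p))) z)"
  proof (rule sum_mono)
   fix p assume p: "p \<in> F"
   have "foot s1 s2 p \<in> closure (foot s1 s2 ` C m (i p))" by (rule closure_subset[THEN subsetD]) (intro imageI i[OF p])
   then have "z \<in> closure (foot s1 s2 ` C m (i p))" unfolding F(3)[OF p] .
   then show "\<psi> p <= W m (i p) * indicator (closure (foot s1 s2 ` C m (i p))) z" using W[OF i[OF p] subsetD[OF F(2) p]] by simp
  qed
  also have "... = (\<Sum>j\<in>i ` F. W m j * indicator (closure (foot s1 s2 ` C m j)) z)" using inj by (simp add: sum.reindex)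
  also have "... <= line_count s1 s2 (C m) (W m) z" unfolding line_count_def using F(1) by (intro sum_le_suminf) auto
  finally show ?thesis .
 qed
 then show ?thesis by (intro Liminf_bounded) (auto simp: eventually_sequentially)
qed

section \<open>Product test functions along tilted lines\<close>

lemma mem_box3: "(p :: real^3) \<in> box (vector [a1, a2, a3]) (vector [b1, b2, b3]) \<longleftrightarrow>
  a1 < p $ 1 & p $ 1 < b1 & a2 < p $ 2 & p $ 2 < b2 & a3 < p $ 3 & p $ 3 < (b3 :: real)" by (auto simp: mem_box_cart forall_3)

lemma convex_combination_bounds:
 fixes a b t s x :: real
 assumes "a <= t" "t <= b"
 shows "l < x + s * a ==> l < x + s * b ==> l < x + s * t" "x + s * a < r ==> x + s * b < r ==> x + s * t < r"
proof -
 have "s * a <= s * t & s * t <= s * b \<or> s * b <= s * t & s * t <= s * a"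
  using assms by (cases "s \<ge> 0") (auto intro: mult_left_mono mult_left_mono_neg)
 then show "l < x + s * a ==> l < x + s * b ==> l < x + s * t" "x + s * a < r ==> x + s * b < r ==> x + s * t < r" by auto
qed

lemma has_derivative_nth: "((%p :: real^3. p $ i) has_derivative (%h. h $ i)) (at p)"
 by (rule bounded_linear_imp_has_derivative) (rule bounded_linear_vec_nth)

text \<open>P1 and P2 depend only on the foot and so are constant along the lines; hence the
  derivative in the direction (s1, s2, 1) falls on \<eta> alone. The third entry of g is chosen from
  this chain rule.\<close>

lemma sheared_product_derivative:
 fixes P1 P2 \<eta> :: "real => real" and s1 s2 :: real
 assumes d: "!!t. (P1 has_real_derivative P1' t) (at t)" "!!t. (P2 has_real_derivative P2' t) (at t)"
   "!!t. (\<eta> has_real_derivative \<eta>' t) (at t)"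
  and c: "continuous_on UNIV P1'" "continuous_on UNIV P2'" "continuous_on UNIV \<eta>'"
 defines "\<phi> \<equiv> %p :: real^3. P1 (p $ 1 - s1 * p $ 3) * (P2 (p $ 2 - s2 * p $ 3) * \<eta> (p $ 3))"
  and "g \<equiv> %p :: real^3. vector [P1' (p $ 1 - s1 * p $ 3) * (P2 (p $ 2 - s2 * p $ 3) * \<eta> (p $ 3)),
    P1 (p $ 1 - s1 * p $ 3) * (P2' (p $ 2 - s2 * p $ 3) * \<eta> (p $ 3)),
    - s1 * (P1' (p $ 1 - s1 * p $ 3) * (P2 (p $ 2 - s2 * p $ 3) * \<eta> (p $ 3)))
    - s2 * (P1 (p $ 1 - s1 * p $ 3) * (P2' (p $ 2 - s2 * p $ 3) * \<eta> (p $ 3)))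
    + P1 (p $ 1 - s1 * p $ 3) * (P2 (p $ 2 - s2 * p $ 3) * \<eta>' (p $ 3))] :: real^3"
 shows "(\<phi> has_derivative (%h. g p \<bullet> h)) (at p)" "continuous_on UNIV g"
  "g p $ 3 + s1 * g p $ 1 + s2 * g p $ 2 = P1 (p $ 1 - s1 * p $ 3) * (P2 (p $ 2 - s2 * p $ 3) * \<eta>' (p $ 3))"
proof -
 have f1: "((%p :: real^3. p $ 1 - s1 * p $ 3) has_derivative (%h. h $ 1 - s1 * h $ 3)) (at p)"
  by (intro has_derivative_diff has_derivative_mult_right has_derivative_nth)
 have f2: "((%p :: real^3. p $ 2 - s2 * p $ 3) has_derivative (%h. h $ 2 - s2 * h $ 3)) (at p)"
  by (intro has_derivative_diff has_derivative_mult_right has_derivative_nth)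
 note D1 = DERIV_compose_FDERIV[OF d(1) f1] and D2 = DERIV_compose_FDERIV[OF d(2) f2]
  and D3 = DERIV_compose_FDERIV[OF d(3) has_derivative_nth[of 3 p]]
 show "(\<phi> has_derivative (%h. g p \<bullet> h)) (at p)" unfolding \<phi>_def
  by (rule has_derivative_eq_rhs[OF has_derivative_mult[OF D1 has_derivative_mult[OF D2 D3]]])
   (simp add: fun_eq_iff g_def inner_vec_def sum_3 algebra_simps)
 have cc: "continuous_on UNIV P1" "continuous_on UNIV P2" "continuous_on UNIV \<eta>"
  using d by (auto intro!: continuous_at_imp_continuous_on DERIV_isCont)
 have comp: "continuous_on UNIV (%p :: real^3. f (h p))" if "continuous_on UNIV f" "continuous_on UNIV h" for f :: "real => real" and h
  by (rule continuous_on_compose2[OF that(1,2)]) simp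
 have hc: "continuous_on UNIV (%p :: real^3. p $ 1 - s1 * p $ 3)" "continuous_on UNIV (%p :: real^3. p $ 2 - s2 * p $ 3)"
  "continuous_on UNIV (%p :: real^3. p $ 3)" by (intro continuous_intros)+
 have "continuous_on UNIV (%p. g p $ i)" for i using exhaust_3[of i]
  by (elim disjE; simp add: g_def; intro continuous_intros comp[OF _ hc(1)] comp[OF _ hc(2)] comp[OF _ hc(3)] c cc)
 then have "continuous_on UNIV (%p. \<chi> i. g p $ i)" by (intro continuous_on_vec_lambda)
 then show "continuous_on UNIV g" by (simp add: vec_lambda_eta)
 show "g p $ 3 + s1 * g p $ 1 + s2 * g p $ 2 = P1 (p $ 1 - s1 * p $ 3) * (P2 (p $ 2 - s2 * p $ 3) * \<eta>' (p $ 3))" by (simp add: g_def)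
qed

text \<open>Intervals with rational endpoints suffice by approximation from inside, which lets a
  single null set of lines serve all intervals.\<close>

lemma AE_0_if_integral_rational_0:
 fixes g :: "real => real"
 assumes g: "integrable lborel g" and out: "!!t. g t ~= 0 ==> a < t & t < b"
  and zero: "!!c c'. c \<in> \<rat> ==> c' \<in> \<rat> ==> a < c ==> c < c' ==> c' < b ==> (LBINT t. indicator {c<..<c'} t * g t) = 0"
 shows "AE t in lborel. g t = 0"
proof (rule AE_0_if_integral_box_0[OF g])
 fix p q :: real
 define c c' where "c = max a p" and "c' = min b q"
 have [measurable]: "g \<in> borel_measurable borel" using g by auto
 have e: "(LBINT t. indicator (box p q) t * g t) = (LBINT t. indicator {c<..<c'} t * g t)"
  by (intro lint_cong refl) (use out in \<open>auto simp: indicator_def c_def c'_def\<close>)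
 show "(LBINT t. indicator (box p q) t * g t) = 0"
 proof (cases "c < c'")
  case False
  then show ?thesis unfolding e by simp
 next
  case True
  \<comment> \<open>The divisor 2 (n + 1) keeps the left endpoints below the right ones from n = 0
    on.\<close>
  have "\<exists>r\<in>\<rat>. c < r & r < c + (c' - c) / (2 * real (Suc n))" for n
   using Rats_dense_in_real[of c "c + (c' - c) / (2 * real (Suc n))"] True by auto
  then obtain r where r: "!!n. r n \<in> \<rat>" "!!n. c < r n" "!!n. r n < c + (c' - c) / (2 * real (Suc n))" by metis
  have "\<exists>r\<in>\<rat>. c' - (c' - c) / (2 * real (Suc n)) < r & r < c'" for n
   using Rats_dense_in_real[of "c' - (c' - c) / (2 * real (Suc n))" c'] True by auto
  then obtain s where s: "!!n. s n \<in> \<rat>" "!!n. c' - (c' - c) / (2 * real (Suc n)) < s n" "!!n. s n < c'" by metis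
  have half: "(c' - c) / (2 * real (Suc n)) <= (c' - c) / 2" for n using True by (intro divide_left_mono) auto
  have aux: "x < y" if "x < c + e" "c' - e < y" "e <= (c' - c) / 2" for e x y
  proof -
   have "2 * e <= c' - c" using that(3) by simp
   then show ?thesis using that(1,2) by linarith
  qed
  have rs: "r n < s n" for n by (rule aux[OF r(3)[of n] s(2)[of n] half[of n]])
  have z: "(LBINT t. indicator {r n<..<s n} t * g t) = 0" for n by (rule zero) (use r s rs in \<open>auto simp: c_def c'_def\<close>)
  have small: "(%n. (c' - c) / (2 * real (Suc n))) \<longlonglongrightarrow> 0"
  proof -
   have "(%n. (c' - c) / 2 * inverse (real (Suc n))) \<longlonglongrightarrow> (c' - c) / 2 * 0" by (intro tendsto_intros LIMSEQ_inverse_real_of_nat)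
   then show ?thesis by (simp add: field_simps)
  qed
  have "(%n. LBINT t. indicator {r n<..<s n} t * g t) \<longlonglongrightarrow> (LBINT t. indicator {c<..<c'} t * g t)"
  proof (rule integral_dominated_convergence[where w="%t. norm (g t)"])
   show "AE t in lborel. (%n. indicator {r n<..<s n} t * g t) \<longlonglongrightarrow> indicator {c<..<c'} t * g t"
   proof (intro AE_I2 tendsto_eventually)
    fix t
    show "\<forall>\<^sub>F n in sequentially. indicator {r n<..<s n} t * g t = indicator {c<..<c'} t * g t"
    proof (cases "c < t & t < c'")
     case True
     then have "\<forall>\<^sub>F n in sequentially. (c' - c) / (2 * real (Suc n)) < min (t - c) (c' - t)" by (intro order_tendstoD(2)[OF small]) auto
     then show ?thesis
     proof eventually_elim
      case (elim n)
      then show ?case using r(3)[of n] s(2)[of n] True by (auto simp: indicator_def)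
     qed
    next
     case False
     then show ?thesis using r(2) s(3) by (auto simp: indicator_def intro!: always_eventually intro: less_trans)
    qed
   qed
  qed (use g in \<open>auto simp: indicator_def\<close>)
  then show ?thesis unfolding e z by (simp add: LIMSEQ_const_iff)
 qed
qed

lemma test_function_facts:
 fixes \<phi> :: "real ^ 'n => real"
 assumes "test_function \<Omega> \<phi> g"
 shows "\<exists>C M. compact C & C \<subseteq> \<Omega> & (\<forall>x. x \<notin> C --> \<phi> x = 0) & (\<forall>x. x \<notin> C --> g x = 0) &
  M \<ge> 0 & (\<forall>x. \<bar>\<phi> x\<bar> <= M) & (\<forall>x. norm (g x) <= M) & continuous_on UNIV \<phi> & continuous_on UNIV g"
proof -
 define C where "C = closure {x. \<phi> x ~= 0}"
 have C: "compact C" "C \<subseteq> \<Omega>" and cg: "continuous_on UNIV g" and der: "!!x. (\<phi> has_derivative (%h. g x \<bullet> h)) (at x)"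
  using assms by (auto simp: test_function_def C_def)
 have c\<phi>: "continuous_on UNIV \<phi>" by (intro continuous_at_imp_continuous_on ballI has_derivative_continuous[OF der])
 have \<phi>0: "\<phi> x = 0" if "x \<notin> C" for x using that closure_subset[of "{x. \<phi> x ~= 0}"] by (auto simp: C_def)
 have g0: "g x = 0" if "x \<notin> C" for x
 proof -
  have "open (- C)" using C compact_imp_closed by blast
  then have "((%_. 0) has_derivative (%h. g x \<bullet> h)) (at x)" by (rule has_derivative_transform_within_open[OF der]) (use that \<phi>0 in auto)
  moreover have "((%_ :: real ^ 'n. 0 :: real) has_derivative (%h. 0)) (at x)" by simp
  ultimately have "(%h. g x \<bullet> h) = (%h. 0)" by (rule has_derivative_unique)
  then have "g x \<bullet> g x = 0" by metis
  then show ?thesis by simp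
 qed
 have "bounded (\<phi> ` C)" "bounded (g ` C)"
  using C c\<phi> cg by (auto intro!: compact_imp_bounded compact_continuous_image intro: continuous_on_subset)
 then obtain B1 B2 where "\<forall>x\<in>C. \<bar>\<phi> x\<bar> <= B1" "\<forall>x\<in>C. norm (g x) <= B2" by (auto simp: bounded_iff)
 then have "\<bar>\<phi> x\<bar> <= max 0 (max B1 B2)" "norm (g x) <= max 0 (max B1 B2)" for x
  using \<phi>0[of x] g0[of x] by (cases "x \<in> C"; force)+
 then show ?thesis using C \<phi>0 g0 c\<phi> cg by (intro exI[of _ C] exI[of _ "max 0 (max B1 B2)"]) auto
qed

lemma integrable_continuous_compact_support:
 fixes f :: "'a::euclidean_space => real"
 assumes "compact C" "continuous_on UNIV f" "!!x. x \<notin> C ==> f x = 0"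
 shows "integrable lborel f"
proof -
 have "integrable lborel (%x. indicator C x *\<^sub>R f x)"
  by (rule borel_integrable_compact[OF assms(1)]) (rule continuous_on_subset[OF assms(2)], simp)
 moreover have "(%x. indicator C x *\<^sub>R f x) = f" using assms(3) by (auto simp: fun_eq_iff indicator_def)
 ultimately show ?thesis by simp
qed

lemma integrable_times_test_gradient:
 fixes w \<phi> :: "real ^ 'n => real"
 assumes t: "test_function \<Omega> \<phi> g" and w: "w \<in> borel_measurable borel" "!!p. \<bar>w p\<bar> <= B"
 shows "integrable lborel (%p. w p * g p $ j)"
proof -
 obtain C where C: "compact C" "!!x. x \<notin> C ==> g x = 0" "continuous_on UNIV g" using test_function_facts[OF t] by blast
 have "integrable lborel (%p. B * g p $ j)" by (rule integrable_continuous_compact_support[OF C(1)]) (auto intro!: continuous_intros C(3) simp: C(2))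
 then show ?thesis
 proof (rule integrable_dominated)
  have "(%p. g p $ j) \<in> borel_measurable borel" by (intro continuous_borel continuous_intros C(3))
  then show "(%p. w p * g p $ j) \<in> borel_measurable lborel" using w(1) by simp
  show "AE p in lborel. norm (w p * g p $ j) <= norm (B * g p $ j)"
   unfolding real_norm_def abs_mult by (intro AE_I2 mult_right_mono order_trans[OF w(2) abs_ge_self]) auto
 qed
qed

lemma integral_shear_iterated:
 fixes f :: "real^3 => real"
 assumes f: "integrable lborel f"
 shows "integrable lborel (%z. LBINT t. f (shear s1 s2 (z, t)))"
  "(LBINT p. f p) = (LBINT z. LBINT t. f (shear s1 s2 (z, t)))"
proof -
 have i: "integrable (lborel \<Otimes>\<^sub>M lborel) (%q. f (shear s1 s2 q))" unfolding lborel_prod by (rule integrable_shear(1)[OF f])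
 show "integrable lborel (%z. LBINT t. f (shear s1 s2 (z, t)))" by (rule lborel_pair.integrable_fst'[OF i])
 show "(LBINT p. f p) = (LBINT z. LBINT t. f (shear s1 s2 (z, t)))"
  using integrable_shear(2)[OF f, of s1 s2] lborel_pair.integral_fst'[OF i] by (simp add: lborel_prod)
qed

section \<open>Slicing a map whose singular derivative is carried by a sigma-compact set\<close>

text \<open>u is a bounded Borel representative, H the density of the absolutely continuous part of
  its derivative, and \<sigma> \<mu> the remaining part, carried by the union of the compact sets K
  n. Compactness is what keeps projections of this set Borel. The bounds hold everywhere, not only
  almost everywhere, so that they survive restriction to lines.\<close>

locale slicing =
 fixes L1 L2 z0 z1 :: real and u :: "real^3 => real^3" and H :: "real^3 => real^3 ^ 3"
  and \<mu> :: "(real^3) measure" and \<sigma> :: "real^3 => real^3 ^ 3" and K :: "nat => (real^3) set"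
 assumes u_borel [measurable]: "u \<in> borel_measurable borel" and u_le_1: "!!x. norm (u x) <= 1"
  and H_integrable: "!!i j. integrable lborel (%x. H x $ i $ j)"
  and sets_\<mu> [measurable_cong]: "sets \<mu> = sets borel" and finite_\<mu>: "finite_measure \<mu>"
  and \<sigma>_borel [measurable]: "\<sigma> \<in> borel_measurable borel" and \<sigma>_le_1: "!!i j x. \<bar>\<sigma> x $ i $ j\<bar> <= 1"
  and K_compact: "!!n. compact (K n)" and null_S: "- (\<Union>n. K n) \<in> null_sets \<mu>"
  and parts: "!!\<phi> g i j. test_function (box (vector [- L1, - L2, z0]) (vector [L1, L2, z1])) \<phi> g ==>
   (LBINT x. u x $ i * g x $ j) = - (LBINT x. \<phi> x * H x $ i $ j) - (LINT x|\<mu>. \<phi> x * \<sigma> x $ i $ j)"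
begin

abbreviation U :: "(real^3) set" where "U \<equiv> box (vector [- L1, - L2, z0]) (vector [L1, L2, z1])"

abbreviation S :: "(real^3) set" where "S \<equiv> (\<Union>n. K n)"

text \<open>\<open>HE\<close> and \<open>SE\<close> are the two densities, with respect to volume
  and to \<mu>, of the derivative of component i in the direction (s1, s2, 1).\<close>

definition HE :: "real => real => 3 => real^3 => real" where
 "HE s1 s2 i p = H p $ i $ 3 + s1 * H p $ i $ 1 + s2 * H p $ i $ 2"

definition SE :: "real => real => 3 => real^3 => real" where
 "SE s1 s2 i p = \<sigma> p $ i $ 3 + s1 * \<sigma> p $ i $ 1 + s2 * \<sigma> p $ i $ 2"

lemma HE_integrable: "integrable lborel (HE s1 s2 i)"
 unfolding HE_def[abs_def] using H_integrable by (intro Bochner_Integration.integrable_add integrable_mult_right) auto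

lemma vec3_nth_borel [measurable]: "(%x :: real^3. x $ i) \<in> borel_measurable borel" by (intro continuous_borel continuous_intros)

lemma mat3_nth_borel [measurable]: "(%x :: real^3 ^ 3. x $ i) \<in> borel_measurable borel" by (intro continuous_borel continuous_intros)

lemma HE_borel [measurable]: "HE s1 s2 i \<in> borel_measurable borel" using HE_integrable borel_measurable_integrable by fastforce

lemma SE_borel [measurable]: "SE s1 s2 i \<in> borel_measurable borel" unfolding SE_def[abs_def] by measurable

lemma SE_le: "\<bar>SE s1 s2 i p\<bar> <= 1 + \<bar>s1\<bar> + \<bar>s2\<bar>"
proof -
 have "\<bar>s1 * \<sigma> p $ i $ 1\<bar> <= \<bar>s1\<bar>" "\<bar>s2 * \<sigma> p $ i $ 2\<bar> <= \<bar>s2\<bar>"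
  using \<sigma>_le_1[of p i 1] \<sigma>_le_1[of p i 2] by (auto simp: abs_mult intro!: mult_left_le)
 then show ?thesis using \<sigma>_le_1[of p i 3] unfolding SE_def by linarith
qed

lemma u_nth_le: "\<bar>u p $ i\<bar> <= 1" using component_le_norm_cart[of "u p" i] u_le_1[of p] by linarith

lemma test_function_integrable:
 assumes "test_function U \<phi> g"
 shows "integrable lborel (%x. u x $ i * g x $ j)" "integrable lborel (%x. \<phi> x * H x $ i $ j)"
  "integrable \<mu> (%x. \<phi> x * \<sigma> x $ i $ j)"
proof -
 interpret \<mu>: finite_measure \<mu> by (rule finite_\<mu>)
 obtain B where B: "B \<ge> 0" "!!x. \<bar>\<phi> x\<bar> <= B" "continuous_on UNIV \<phi>" using test_function_facts[OF assms] by blast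
 have [measurable]: "\<phi> \<in> borel_measurable borel" using B(3) by (rule continuous_borel)
 show "integrable lborel (%x. u x $ i * g x $ j)" by (rule integrable_times_test_gradient[OF assms _ u_nth_le]) measurable
 show "integrable lborel (%x. \<phi> x * H x $ i $ j)"
 proof (rule integrable_dominated)
  show "integrable lborel (%x. B * H x $ i $ j)" using H_integrable by simp
  show "AE x in lborel. norm (\<phi> x * H x $ i $ j) <= norm (B * H x $ i $ j)" using B by (auto simp: abs_mult intro!: mult_right_mono)
  show "(%x. \<phi> x * H x $ i $ j) \<in> borel_measurable lborel" using borel_measurable_integrable[OF H_integrable[of i j]] by simp
 qed
 show "integrable \<mu> (%x. \<phi> x * \<sigma> x $ i $ j)"
 proof (rule \<mu>.integrable_const_bound[where B="B * 1"])
  have "\<bar>\<phi> x * \<sigma> x $ i $ j\<bar> <= B * 1" for x unfolding abs_mult by (intro mult_mono B \<sigma>_le_1) (auto simp: B)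
  then show "AE x in \<mu>. norm (\<phi> x * \<sigma> x $ i $ j) <= B * 1" by simp
 qed simp
qed

lemma parts_directional:
 assumes t: "test_function U \<phi> g"
 shows "(LBINT x. u x $ i * (g x $ 3 + s1 * g x $ 1 + s2 * g x $ 2))
  = - (LBINT x. \<phi> x * HE s1 s2 i x) - (LINT x|\<mu>. \<phi> x * SE s1 s2 i x)"
proof -
 note I = test_function_integrable[OF t]
 have 1: "(LBINT x. u x $ i * (g x $ 3 + s1 * g x $ 1 + s2 * g x $ 2))
  = (LBINT x. u x $ i * g x $ 3) + s1 * (LBINT x. u x $ i * g x $ 1) + s2 * (LBINT x. u x $ i * g x $ 2)"
 proof -
  have "(%x. u x $ i * (g x $ 3 + s1 * g x $ 1 + s2 * g x $ 2))
   = (%x. u x $ i * g x $ 3 + s1 * (u x $ i * g x $ 1) + s2 * (u x $ i * g x $ 2))" by (simp add: fun_eq_iff algebra_simps)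
  then show ?thesis using I(1) by simp
 qed
 have 2: "(LBINT x. \<phi> x * HE s1 s2 i x)
  = (LBINT x. \<phi> x * H x $ i $ 3) + s1 * (LBINT x. \<phi> x * H x $ i $ 1) + s2 * (LBINT x. \<phi> x * H x $ i $ 2)"
 proof -
  have "(%x. \<phi> x * HE s1 s2 i x)
   = (%x. \<phi> x * H x $ i $ 3 + s1 * (\<phi> x * H x $ i $ 1) + s2 * (\<phi> x * H x $ i $ 2))" by (simp add: fun_eq_iff HE_def algebra_simps)
  then show ?thesis using I(2) by simp
 qed
 have 3: "(LINT x|\<mu>. \<phi> x * SE s1 s2 i x)
  = (LINT x|\<mu>. \<phi> x * \<sigma> x $ i $ 3) + s1 * (LINT x|\<mu>. \<phi> x * \<sigma> x $ i $ 1) + s2 * (LINT x|\<mu>. \<phi> x * \<sigma> x $ i $ 2)"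
 proof -
  have "(%x. \<phi> x * SE s1 s2 i x)
   = (%x. \<phi> x * \<sigma> x $ i $ 3 + s1 * (\<phi> x * \<sigma> x $ i $ 1) + s2 * (\<phi> x * \<sigma> x $ i $ 2))"
   by (simp add: fun_eq_iff SE_def algebra_simps)
  then show ?thesis using I(3) by simp
 qed
 show ?thesis unfolding 1 2 3 parts[OF t] by (simp add: algebra_simps)
qed

lemma directional_integrable:
 assumes t: "test_function U \<phi> g"
 shows "integrable lborel (%x. u x $ i * (g x $ 3 + s1 * g x $ 1 + s2 * g x $ 2))"
  "integrable lborel (%x. \<phi> x * HE s1 s2 i x)"
proof -
 note I = test_function_integrable[OF t]
 have "(%x. u x $ i * (g x $ 3 + s1 * g x $ 1 + s2 * g x $ 2))
   = (%x. u x $ i * g x $ 3 + s1 * (u x $ i * g x $ 1) + s2 * (u x $ i * g x $ 2))" by (simp add: fun_eq_iff algebra_simps)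
 then show "integrable lborel (%x. u x $ i * (g x $ 3 + s1 * g x $ 1 + s2 * g x $ 2))" using I(1) by simp
 have "(%x. \<phi> x * HE s1 s2 i x)
   = (%x. \<phi> x * H x $ i $ 3 + s1 * (\<phi> x * H x $ i $ 1) + s2 * (\<phi> x * H x $ i $ 2))" by (simp add: fun_eq_iff HE_def algebra_simps)
 then show "integrable lborel (%x. \<phi> x * HE s1 s2 i x)" using I(2) by simp
qed

text \<open>Feet of the lines whose piece between heights a and b lies in the box; by convexity its
  two endpoints decide.\<close>

definition feet :: "real => real => real => real => (real \<times> real) set" where
 "feet s1 s2 a b = {z. shear s1 s2 (z, a) \<in> U & shear s1 s2 (z, b) \<in> U}"

lemma feet_shear: "z \<in> feet s1 s2 a b ==> a <= t ==> t <= b ==> shear s1 s2 (z, t) \<in> U" unfolding feet_def mem_box3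
 by (auto intro: convex_combination_bounds[of a t b])

lemma feet_eq:
 assumes "z0 < a" "a <= b" "b < z1"
 shows "feet s1 s2 a b = {z. max (- L1 - s1 * a) (- L1 - s1 * b) < fst z & fst z < min (L1 - s1 * a) (L1 - s1 * b)
  & max (- L2 - s2 * a) (- L2 - s2 * b) < snd z & snd z < min (L2 - s2 * a) (L2 - s2 * b)}"
 using assms unfolding feet_def mem_box3 by (auto simp: algebra_simps)

lemma feet_borel [measurable]: "feet s1 s2 a b \<in> sets borel"
proof -
 have "feet s1 s2 a b = (%z. shear s1 s2 (z, a)) -` U \<inter> (%z. shear s1 s2 (z, b)) -` U" by (auto simp: feet_def)
 moreover have "continuous_on UNIV (%z. shear s1 s2 (z, t))" for t
  by (rule continuous_on_compose2[OF continuous_shear[of UNIV]]) (auto intro!: continuous_intros)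
 ultimately have "open (feet s1 s2 a b)" by (auto intro!: open_Int open_vimage open_box)
 then show ?thesis by simp
qed

text \<open>Density of the absolutely continuous part of the derivative of \<eta> u along the line;
  its integral is balanced by the \<mu>-integral of \<eta> times \<open>SE\<close>.\<close>

definition flux :: "real => real => 3 => (real => real) => (real => real) => real^3 => real" where
 "flux s1 s2 i \<eta> \<eta>' p = \<eta>' (p $ 3) * u p $ i + \<eta> (p $ 3) * HE s1 s2 i p"

definition clear_feet :: "real => real => real => real => (real \<times> real) set" where
 "clear_feet s1 s2 a b = feet s1 s2 a b - foot s1 s2 ` (S \<inter> {p. a <= p $ 3 & p $ 3 <= b})"

text \<open>The part of K n between two heights is compact, hence so is its projection. Projections
  of general Borel sets would not be available here.\<close>

lemma clear_feet_borel [measurable]: "clear_feet s1 s2 a b \<in> sets borel"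
proof -
 have "compact (foot s1 s2 ` (K n \<inter> {p. a <= p $ 3 & p $ 3 <= b}))" for n
  by (intro compact_continuous_image continuous_foot compact_Int_closed K_compact closed_Collect_conj closed_Collect_le)
   (auto intro!: continuous_intros)
 then have "(\<Union>n. foot s1 s2 ` (K n \<inter> {p. a <= p $ 3 & p $ 3 <= b})) \<in> sets borel"
  by (intro sets.countable_UN) (auto intro: borel_compact)
 also have "(\<Union>n. foot s1 s2 ` (K n \<inter> {p. a <= p $ 3 & p $ 3 <= b})) = foot s1 s2 ` (S \<inter> {p. a <= p $ 3 & p $ 3 <= b})" by blast
 finally show ?thesis unfolding clear_feet_def by simp
qed

context
 fixes s1 s2 a b c c' :: real and \<eta> \<eta>' :: "real => real" and i :: 3
 assumes ab: "z0 < a" "a < c" "c <= c'" "c' < b" "b < z1"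
  and der: "!!t. (\<eta> has_real_derivative \<eta>' t) (at t)" and cont: "continuous_on UNIV \<eta>'"
  and supp: "!!t. \<eta> t ~= 0 ==> c <= t & t <= c'" "!!t. \<eta>' t ~= 0 ==> c <= t & t <= c'"
begin

lemma \<eta>_continuous: "continuous_on A \<eta>" using der by (auto intro!: continuous_at_imp_continuous_on DERIV_isCont)

lemma \<eta>_borel [measurable]: "\<eta> \<in> borel_measurable borel" "\<eta>' \<in> borel_measurable borel"
 using cont \<eta>_continuous by (auto intro: continuous_borel)

lemma flux_borel [measurable]: "flux s1 s2 i \<eta> \<eta>' \<in> borel_measurable borel" unfolding flux_def[abs_def] by measurable

lemma \<eta>_bounded: obtains B where "B \<ge> 0" "!!t. \<bar>\<eta> t\<bar> <= B" "!!t. \<bar>\<eta>' t\<bar> <= B"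
proof -
 have "bounded (\<eta> ` {c..c'})" "bounded (\<eta>' ` {c..c'})"
  using \<eta>_continuous cont by (auto intro!: compact_imp_bounded compact_continuous_image intro: continuous_on_subset)
 then obtain B1 B2 where "\<forall>t\<in>{c..c'}. \<bar>\<eta> t\<bar> <= B1" "\<forall>t\<in>{c..c'}. \<bar>\<eta>' t\<bar> <= B2"
  by (auto simp: bounded_iff)
 then have B: "!!t. c <= t ==> t <= c' ==> \<bar>\<eta> t\<bar> <= B1" "!!t. c <= t ==> t <= c' ==> \<bar>\<eta>' t\<bar> <= B2" by auto
 show thesis
 proof (rule that[of "max 0 (max B1 B2)"])
  show "\<bar>\<eta> t\<bar> <= max 0 (max B1 B2)" for t using supp(1)[of t] B(1)[of t] by (cases "\<eta> t = 0") auto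
  show "\<bar>\<eta>' t\<bar> <= max 0 (max B1 B2)" for t using supp(2)[of t] B(2)[of t] by (cases "\<eta>' t = 0") auto
 qed simp
qed

lemma feet_flux_integrable:
 "integrable lborel (%p. indicator (feet s1 s2 a b) (foot s1 s2 p) * flux s1 s2 i \<eta> \<eta>' p)"
 "integrable \<mu> (%p. indicator (feet s1 s2 a b) (foot s1 s2 p) * (\<eta> (p $ 3) * SE s1 s2 i p))"
proof -
 interpret \<mu>: finite_measure \<mu> by (rule finite_\<mu>)
 obtain B where B: "B \<ge> 0" "!!t. \<bar>\<eta> t\<bar> <= B" "!!t. \<bar>\<eta>' t\<bar> <= B" by (rule \<eta>_bounded) blast
 have 1: "integrable lborel (%p. indicator (feet s1 s2 a b) (foot s1 s2 p) * (\<eta>' (p $ 3) * u p $ i))"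
 proof (rule integrable_dominated)
  have "emeasure lborel U < \<infinity>" by (simp add: emeasure_lborel_box_eq)
  then show "integrable lborel (%p. B * indicator U p)" by auto
  show "AE p in lborel. norm (indicator (feet s1 s2 a b) (foot s1 s2 p) * (\<eta>' (p $ 3) * u p $ i)) <= norm (B * indicator U p)"
  proof (rule AE_I2)
   fix p
   show "norm (indicator (feet s1 s2 a b) (foot s1 s2 p) * (\<eta>' (p $ 3) * u p $ i)) <= norm (B * indicator U p)"
   proof (cases "foot s1 s2 p \<in> feet s1 s2 a b & \<eta>' (p $ 3) ~= 0")
    case True
    then have "p \<in> U" using feet_shear[of "foot s1 s2 p" s1 s2 a b "p $ 3"] supp(2)[of "p $ 3"] ab by auto
    moreover have "\<bar>\<eta>' (p $ 3) * u p $ i\<bar> <= B * 1" unfolding abs_mult using B u_nth_le by (intro mult_mono) auto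
    ultimately show ?thesis using True B(1) by simp
   qed auto
  qed
 qed simp
 have 2: "integrable lborel (%p. indicator (feet s1 s2 a b) (foot s1 s2 p) * (\<eta> (p $ 3) * HE s1 s2 i p))"
 proof (rule integrable_dominated)
  show "integrable lborel (%p. B * HE s1 s2 i p)" using HE_integrable by simp
  show "AE p in lborel. norm (indicator (feet s1 s2 a b) (foot s1 s2 p) * (\<eta> (p $ 3) * HE s1 s2 i p)) <= norm (B * HE s1 s2 i p)"
   using B by (intro AE_I2) (auto simp: indicator_def abs_mult intro!: mult_right_mono)
 qed simp
 show "integrable lborel (%p. indicator (feet s1 s2 a b) (foot s1 s2 p) * flux s1 s2 i \<eta> \<eta>' p)"
  unfolding flux_def distrib_left using 1 2 by simp
 show "integrable \<mu> (%p. indicator (feet s1 s2 a b) (foot s1 s2 p) * (\<eta> (p $ 3) * SE s1 s2 i p))"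
 proof (rule \<mu>.integrable_const_bound[where B="B * (1 + \<bar>s1\<bar> + \<bar>s2\<bar>)"])
  have "\<bar>\<eta> (p $ 3) * SE s1 s2 i p\<bar> <= B * (1 + \<bar>s1\<bar> + \<bar>s2\<bar>)" for p
   unfolding abs_mult using B SE_le by (intro mult_mono) auto
  moreover have "0 <= B * (1 + \<bar>s1\<bar> + \<bar>s2\<bar>)" using B by simp
  ultimately show "AE p in \<mu>. norm (indicator (feet s1 s2 a b) (foot s1 s2 p) * (\<eta> (p $ 3) * SE s1 s2 i p)) <= B * (1 + \<bar>s1\<bar> + \<bar>s2\<bar>)"
   by (intro AE_I2) (auto simp: indicator_def)
 qed simp
qed

text \<open>A cutoff in the foot times \<eta> of the height is a test function supported in the box,
  since the feet of the cutoff lie in \<open>feet\<close>. Its derivative along the lines leaves the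
  cutoff untouched.\<close>

lemma plateau_flux:
 assumes m: "m > 0" and sub: "{z. lx < fst z & fst z < ux & ly < snd z & snd z < uy} \<subseteq> feet s1 s2 a b"
 defines "\<theta> \<equiv> %z. plateau m lx ux (fst z) * plateau m ly uy (snd z)"
 shows "(LBINT p. \<theta> (foot s1 s2 p) * flux s1 s2 i \<eta> \<eta>' p) + (LINT p|\<mu>. \<theta> (foot s1 s2 p) * (\<eta> (p $ 3) * SE s1 s2 i p)) = 0"
proof -
 note D = sheared_product_derivative[OF plateau_deriv[of m lx ux] plateau_deriv[of m ly uy] der
  plateau'_continuous plateau'_continuous cont, where ?s1.0=s1 and ?s2.0=s2]
 define \<phi> where "\<phi> p = \<theta> (foot s1 s2 p) * \<eta> (p $ 3)" for p
 have \<phi>: "\<phi> = (%p. plateau m lx ux (p $ 1 - s1 * p $ 3) * (plateau m ly uy (p $ 2 - s2 * p $ 3) * \<eta> (p $ 3)))"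
  by (simp add: fun_eq_iff \<phi>_def \<theta>_def foot_def)
 have "\<exists>g :: real^3 => real^3. (\<forall>p. (\<phi> has_derivative (%h. g p \<bullet> h)) (at p)) & continuous_on UNIV g &
  (\<forall>p. g p $ 3 + s1 * g p $ 1 + s2 * g p $ 2
   = plateau m lx ux (p $ 1 - s1 * p $ 3) * (plateau m ly uy (p $ 2 - s2 * p $ 3) * \<eta>' (p $ 3)))"
  unfolding \<phi> by (intro exI conjI allI, rule D(1), rule D(2), rule D(3))
 then obtain g :: "real^3 => real^3" where g12: "!!p. (\<phi> has_derivative (%h. g p \<bullet> h)) (at p)" "continuous_on UNIV g"
  and g': "!!p. g p $ 3 + s1 * g p $ 1 + s2 * g p $ 2
   = plateau m lx ux (p $ 1 - s1 * p $ 3) * (plateau m ly uy (p $ 2 - s2 * p $ 3) * \<eta>' (p $ 3))" by blast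
 have g3: "g p $ 3 + s1 * g p $ 1 + s2 * g p $ 2 = \<theta> (foot s1 s2 p) * \<eta>' (p $ 3)" for p unfolding g' by (simp add: \<theta>_def foot_def)
 define C where "C = shear s1 s2 ` (({lx + 1 / m..ux - 1 / m} \<times> {ly + 1 / m..uy - 1 / m}) \<times> {c..c'})"
 have C: "compact C" unfolding C_def by (intro compact_continuous_image continuous_shear compact_Times compact_Icc)
 have "1 / m > 0" using m by simp
 have CU: "C \<subseteq> U"
 proof
  fix p assume "p \<in> C"
  then obtain z t where p: "p = shear s1 s2 (z, t)" "lx + 1 / m <= fst z" "fst z <= ux - 1 / m"
   "ly + 1 / m <= snd z" "snd z <= uy - 1 / m" "c <= t" "t <= c'" unfolding C_def by fastforce
  have "z \<in> {z. lx < fst z & fst z < ux & ly < snd z & snd z < uy}"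
   unfolding mem_Collect_eq using p \<open>1 / m > 0\<close> by (intro conjI) linarith+
  then have "z \<in> feet s1 s2 a b" by (rule subsetD[OF sub])
  then show "p \<in> U" unfolding p(1) by (rule feet_shear) (use p ab in auto)
 qed
 have supC: "{p. \<phi> p ~= 0} \<subseteq> C"
 proof
  fix p assume "p \<in> {p. \<phi> p ~= 0}"
  then have "plateau m lx ux (fst (foot s1 s2 p)) ~= 0" "plateau m ly uy (snd (foot s1 s2 p)) ~= 0" "\<eta> (p $ 3) ~= 0"
   by (auto simp: \<phi>_def \<theta>_def)
  then have "(foot s1 s2 p, p $ 3) \<in> ({lx + 1 / m..ux - 1 / m} \<times> {ly + 1 / m..uy - 1 / m}) \<times> {c..c'}"
   using plateau_support[OF m, of lx ux "fst (foot s1 s2 p)"] plateau_support[OF m, of ly uy "snd (foot s1 s2 p)"] supp(1)[of "p $ 3"]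
   by (simp add: mem_Times_iff)
  then show "p \<in> C" unfolding C_def by (rule image_eqI[rotated]) simp
 qed
 have "closure {p. \<phi> p ~= 0} \<subseteq> C" using supC C by (intro closure_minimal compact_imp_closed)
 moreover have "compact (closure {p. \<phi> p ~= 0})" using bounded_subset[OF compact_imp_bounded[OF C] supC] by (simp add: compact_closure)
 ultimately have T: "test_function U \<phi> g" unfolding test_function_def using g12 CU by auto
 have "(LBINT p. \<theta> (foot s1 s2 p) * flux s1 s2 i \<eta> \<eta>' p)
  = (LBINT p. u p $ i * (\<theta> (foot s1 s2 p) * \<eta>' (p $ 3))) + (LBINT p. \<phi> p * HE s1 s2 i p)"
  by (subst Bochner_Integration.integral_add[OF directional_integrable[OF T, where i=i and ?s1.0=s1 and ?s2.0=s2, unfolded g3], symmetric])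
   (auto intro!: lint_cong simp: flux_def \<phi>_def algebra_simps)
 then show ?thesis using parts_directional[OF T, where i=i and ?s1.0=s1 and ?s2.0=s2, unfolded g3] by (simp add: \<phi>_def mult.assoc)
qed

text \<open>Limit of \<open>plateau_flux\<close> as the plateaus sharpen to the indicator of a
  rectangle. The set of admissible feet is itself a rectangle, so its intersection with a box is one
  too.\<close>

lemma feet_flux_box:
 "(LBINT p. indicator (box z z') (foot s1 s2 p) * (indicator (feet s1 s2 a b) (foot s1 s2 p) * flux s1 s2 i \<eta> \<eta>' p))
  + (LINT p|\<mu>. indicator (box z z') (foot s1 s2 p) * (indicator (feet s1 s2 a b) (foot s1 s2 p) * (\<eta> (p $ 3) * SE s1 s2 i p))) = 0"
proof -
 define lx where "lx = max (fst z) (max (- L1 - s1 * a) (- L1 - s1 * b))"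
 define ux where "ux = min (fst z') (min (L1 - s1 * a) (L1 - s1 * b))"
 define ly where "ly = max (snd z) (max (- L2 - s2 * a) (- L2 - s2 * b))"
 define uy where "uy = min (snd z') (min (L2 - s2 * a) (L2 - s2 * b))"
 have ab': "a <= b" using ab by simp
 have bx: "y \<in> box z z' \<longleftrightarrow> fst z < fst y & fst y < fst z' & snd z < snd y & snd y < snd z'" for y :: "real \<times> real"
  by (auto simp: mem_box Basis_prod_def inner_prod_def)
 have eqI: "{y. lx < fst y & fst y < ux & ly < snd y & snd y < uy} = box z z' \<inter> feet s1 s2 a b"
  unfolding feet_eq[OF ab(1) ab' ab(5)] by (auto simp: bx lx_def ux_def ly_def uy_def)
 define \<theta> where "\<theta> n y = plateau (real (Suc n)) lx ux (fst y) * plateau (real (Suc n)) ly uy (snd y)" for n and y :: "real \<times> real"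
 have [measurable]: "\<theta> n \<in> borel_measurable borel" for n unfolding \<theta>_def[abs_def]
  by (intro continuous_borel continuous_intros continuous_on_compose2[OF plateau_continuous[of UNIV]]) auto
 have \<theta>lim: "(%n. \<theta> n y) \<longlonglongrightarrow> indicator (box z z') y * indicator (feet s1 s2 a b) y" for y
 proof -
  have "(%n. \<theta> n y) \<longlonglongrightarrow> indicator {lx<..<ux} (fst y) * indicator {ly<..<uy} (snd y)"
   unfolding \<theta>_def by (intro tendsto_mult plateau_tendsto)
  also have "indicator {lx<..<ux} (fst y) * indicator {ly<..<uy} (snd y) = (indicator (box z z' \<inter> feet s1 s2 a b) y :: real)"
   unfolding eqI[symmetric] by (auto simp: indicator_def)
  finally show ?thesis by (simp add: indicator_inter_arith)
 qed
 \<comment> \<open>The plateaus vanish outside \<open>feet\<close>, where the integrand has no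
   integrable bound; this makes the restricted integrand a dominating function.\<close>
 have \<theta>feet: "\<theta> n y = \<theta> n y * indicator (feet s1 s2 a b) y" for n y
 proof (cases "\<theta> n y = 0")
  case False
  have "1 / real (Suc n) > 0" by simp
  moreover have "lx + 1 / real (Suc n) <= fst y & fst y <= ux - 1 / real (Suc n)" "ly + 1 / real (Suc n) <= snd y & snd y <= uy - 1 / real (Suc n)"
   using False by (auto intro!: plateau_support simp: \<theta>_def simp del: of_nat_Suc)
  ultimately have "y \<in> {y. lx < fst y & fst y < ux & ly < snd y & snd y < uy}" unfolding mem_Collect_eq by (intro conjI) linarith+
  then show ?thesis unfolding eqI by simp
 qed simp
 have \<theta>1: "\<bar>\<theta> n y\<bar> <= 1" for n y unfolding \<theta>_def abs_mult using plateau_range by (intro mult_le_one) auto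
 have lim: "(%n. LINT p|M. \<theta> n (foot s1 s2 p) * f p) \<longlonglongrightarrow> (LINT p|M. indicator (box z z') (foot s1 s2 p) * (indicator (feet s1 s2 a b) (foot s1 s2 p) * f p))"
  if int: "integrable M (%p. indicator (feet s1 s2 a b) (foot s1 s2 p) * f p)" and M[measurable_cong]: "sets M = sets borel"
   and [measurable]: "f \<in> borel_measurable borel" for M f
 proof (rule integral_dominated_convergence[where w="%p. norm (indicator (feet s1 s2 a b) (foot s1 s2 p) * f p)"])
  show "AE p in M. (%n. \<theta> n (foot s1 s2 p) * f p) \<longlonglongrightarrow> indicator (box z z') (foot s1 s2 p) * (indicator (feet s1 s2 a b) (foot s1 s2 p) * f p)"
   using tendsto_mult[OF \<theta>lim tendsto_const] by (simp add: mult.assoc)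
  show "AE p in M. norm (\<theta> n (foot s1 s2 p) * f p) <= norm (indicator (feet s1 s2 a b) (foot s1 s2 p) * f p)" for n
  proof (rule AE_I2)
   fix p
   have "norm (\<theta> n (foot s1 s2 p) * f p) = \<bar>\<theta> n (foot s1 s2 p)\<bar> * norm (indicator (feet s1 s2 a b) (foot s1 s2 p) * f p)"
    using \<theta>feet[of n "foot s1 s2 p"] by (metis abs_mult mult.assoc real_norm_def)
   also have "... <= 1 * norm (indicator (feet s1 s2 a b) (foot s1 s2 p) * f p)" by (intro mult_right_mono \<theta>1) simp
   finally show "norm (\<theta> n (foot s1 s2 p) * f p) <= norm (indicator (feet s1 s2 a b) (foot s1 s2 p) * f p)" by simp
  qed
 qed (use int in simp_all)
 have "(%n. (LBINT p. \<theta> n (foot s1 s2 p) * flux s1 s2 i \<eta> \<eta>' p) + (LINT p|\<mu>. \<theta> n (foot s1 s2 p) * (\<eta> (p $ 3) * SE s1 s2 i p)))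
  \<longlonglongrightarrow> (LBINT p. indicator (box z z') (foot s1 s2 p) * (indicator (feet s1 s2 a b) (foot s1 s2 p) * flux s1 s2 i \<eta> \<eta>' p))
  + (LINT p|\<mu>. indicator (box z z') (foot s1 s2 p) * (indicator (feet s1 s2 a b) (foot s1 s2 p) * (\<eta> (p $ 3) * SE s1 s2 i p)))"
  by (intro tendsto_add lim feet_flux_integrable sets_\<mu>) simp_all
 moreover have "(LBINT p. \<theta> n (foot s1 s2 p) * flux s1 s2 i \<eta> \<eta>' p) + (LINT p|\<mu>. \<theta> n (foot s1 s2 p) * (\<eta> (p $ 3) * SE s1 s2 i p)) = 0" for n
  unfolding \<theta>_def by (rule plateau_flux) (use eqI in auto)
 ultimately show ?thesis by (simp add: LIMSEQ_const_iff)
qed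

text \<open>The balance extends from boxes of feet to all Borel sets of feet. Over clear feet the
  singular term drops out, and Fubini in sheared coordinates leaves an identity on almost every
  single line.\<close>

lemma clear_flux_AE:
 "AE z in lborel. z \<in> (clear_feet s1 s2 a b) -->
   (LBINT t. \<eta>' t * u (shear s1 s2 (z, t)) $ i + \<eta> t * HE s1 s2 i (shear s1 s2 (z, t))) = 0"
proof -
 define f where "f p = indicator (clear_feet s1 s2 a b) (foot s1 s2 p) * flux s1 s2 i \<eta> \<eta>' p" for p
 have [measurable]: "f \<in> borel_measurable borel" unfolding f_def[abs_def] by measurable
 have f: "integrable lborel f"
 proof (rule integrable_dominated[OF feet_flux_integrable(1)])
  show "AE p in lborel. norm (f p) <= norm (indicator (feet s1 s2 a b) (foot s1 s2 p) * flux s1 s2 i \<eta> \<eta>' p)"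
   by (auto simp: f_def clear_feet_def indicator_def)
 qed simp
 have zero: "(LBINT p. indicator A (foot s1 s2 p) * f p) = 0" if A[measurable]: "A \<in> sets borel" for A
 proof -
  have "(LBINT p. indicator (A \<inter> (clear_feet s1 s2 a b)) (foot s1 s2 p) * (indicator (feet s1 s2 a b) (foot s1 s2 p) * flux s1 s2 i \<eta> \<eta>' p))
   + (LINT p|\<mu>. indicator (A \<inter> (clear_feet s1 s2 a b)) (foot s1 s2 p) * (indicator (feet s1 s2 a b) (foot s1 s2 p) * (\<eta> (p $ 3) * SE s1 s2 i p))) = 0"
   by (rule integral_indicator_eq_0_borel[OF _ _ feet_flux_integrable feet_flux_box]) auto
  \<comment> \<open>\<mu>-almost every p lies in S. If \<eta> does not vanish at its height, that
    height is between a and b, and the foot of p is not clear.\<close>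
  moreover have "(LINT p|\<mu>. indicator (A \<inter> (clear_feet s1 s2 a b)) (foot s1 s2 p) * (indicator (feet s1 s2 a b) (foot s1 s2 p) * (\<eta> (p $ 3) * SE s1 s2 i p))) = 0"
  proof (rule integral_eq_zero_AE)
   show "AE p in \<mu>. indicator (A \<inter> (clear_feet s1 s2 a b)) (foot s1 s2 p) * (indicator (feet s1 s2 a b) (foot s1 s2 p) * (\<eta> (p $ 3) * SE s1 s2 i p)) = 0"
    using AE_not_in[OF null_S]
   proof eventually_elim
    case (elim p)
    show ?case
    proof (cases "\<eta> (p $ 3) = 0")
     case False
     then have "a <= p $ 3 & p $ 3 <= b" using supp(1)[of "p $ 3"] ab by auto
     then have "foot s1 s2 p \<notin> (clear_feet s1 s2 a b)" using elim unfolding clear_feet_def by blast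
     then show ?thesis by simp
    qed simp
   qed
  qed
  moreover have "indicator (A \<inter> (clear_feet s1 s2 a b)) y * (indicator (feet s1 s2 a b) y * x) = indicator A y * (indicator (clear_feet s1 s2 a b) y * (x :: real))" for x y
   by (auto simp: indicator_def clear_feet_def)
  ultimately show ?thesis by (simp add: f_def)
 qed
 define \<Phi> where "\<Phi> z = (LBINT t. f (shear s1 s2 (z, t)))" for z
 have fs: "integrable (lborel \<Otimes>\<^sub>M lborel) (%q. f (shear s1 s2 q))" unfolding lborel_prod by (rule integrable_shear(1)[OF f])
 have "AE z in lborel. \<Phi> z = 0"
 proof (rule AE_0_if_integral_box_0)
  show "integrable lborel \<Phi>" unfolding \<Phi>_def[abs_def] using lborel_pair.integrable_fst'[OF fs] by simp
  fix y y' :: "real \<times> real"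
  have i: "integrable lborel (%p. indicator (box y y') (foot s1 s2 p) * f p)" by (rule integrable_dominated[OF f]) (auto simp: indicator_def)
  have fs': "integrable (lborel \<Otimes>\<^sub>M lborel) (%q. indicator (box y y') (foot s1 s2 (shear s1 s2 q)) * f (shear s1 s2 q))"
   unfolding lborel_prod by (rule integrable_shear(1)[OF i])
  have "0 = (LINT q|(lborel \<Otimes>\<^sub>M lborel). indicator (box y y') (foot s1 s2 (shear s1 s2 q)) * f (shear s1 s2 q))"
   unfolding lborel_prod using integrable_shear(2)[OF i, of s1 s2] zero[of "box y y'"] by simp
  also have "... = (LBINT z. LBINT t. indicator (box y y') (foot s1 s2 (shear s1 s2 (z, t))) * f (shear s1 s2 (z, t)))"
   using lborel_pair.integral_fst'[OF fs'] by simp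
  also have "... = (LBINT z. indicator (box y y') z * \<Phi> z)" by (simp add: \<Phi>_def)
  finally show "(LBINT z. indicator (box y y') z * \<Phi> z) = 0" by simp
 qed
 then show ?thesis
 proof eventually_elim
  case (elim z)
  show ?case
  proof
   assume z: "z \<in> (clear_feet s1 s2 a b)"
   have "\<Phi> z = (LBINT t. \<eta>' t * u (shear s1 s2 (z, t)) $ i + \<eta> t * HE s1 s2 i (shear s1 s2 (z, t)))"
    unfolding \<Phi>_def f_def flux_def using z by simp
   with elim show "(LBINT t. \<eta>' t * u (shear s1 s2 (z, t)) $ i + \<eta> t * HE s1 s2 i (shear s1 s2 (z, t))) = 0" by simp
  qed
 qed
qed

end

declare \<eta>_borel [measurable del] flux_borel [measurable del]

definition primitive :: "real => real => real => 3 => real \<times> real => real => real" where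
 "primitive s1 s2 a i z t = (LBINT \<tau>. indicator {a..t} \<tau> * HE s1 s2 i (shear s1 s2 (z, \<tau>)))"

lemma HE_slice_integrable: "AE z in lborel. integrable lborel (%t. HE s1 s2 i (shear s1 s2 (z, t)))"
proof -
 have "integrable (lborel \<Otimes>\<^sub>M lborel) (%q. HE s1 s2 i (shear s1 s2 q))"
  unfolding lborel_prod by (rule integrable_shear(1)[OF HE_integrable])
 from lborel_pair.AE_integrable_fst'[OF this] show ?thesis .
qed

text \<open>\<open>clear_flux_AE\<close> for the compactly supported antiderivative of \<rho>.
  Integration by parts moves the derivative from \<eta> to the primitive of \<open>HE\<close>, so u
  minus this primitive is orthogonal to \<rho>.\<close>

lemma clear_primitive_AE:
 assumes ab: "z0 < a" "a < c" "c <= c'" "c' < b" "b < z1"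
  and \<rho>: "continuous_on UNIV \<rho>" "!!t. \<rho> t ~= 0 ==> c <= t & t <= c'" "(LBINT t. \<rho> t) = 0"
 shows "AE z in lborel. z \<in> clear_feet s1 s2 a b -->
  (LBINT t. \<rho> t * (indicator {a<..<b} t * (u (shear s1 s2 (z, t)) $ i - primitive s1 s2 a i z t))) = 0"
proof -
 have "\<exists>\<eta>. (\<forall>t. (\<eta> has_real_derivative \<rho> t) (at t)) & (\<forall>t. \<eta> t ~= 0 --> c <= t & t <= c')"
 proof (rule antiderivative_compact_support[OF \<rho> ab(3)])
  fix \<eta> assume "!!t. (\<eta> has_real_derivative \<rho> t) (at t)" "!!t. \<eta> t ~= 0 ==> c <= t & t <= c'"
  then show ?thesis by (intro exI[of _ \<eta>]) simp
 qed
 then obtain \<eta> where \<eta>: "!!t. (\<eta> has_real_derivative \<rho> t) (at t)" "!!t. \<eta> t ~= 0 ==> c <= t & t <= c'" by blast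
 have c\<eta>: "continuous_on UNIV \<eta>" using \<eta>(1) by (auto intro!: continuous_at_imp_continuous_on DERIV_isCont)
 have [measurable]: "\<rho> \<in> borel_measurable borel" "\<eta> \<in> borel_measurable borel"
  using \<rho>(1) c\<eta> by (auto intro: continuous_borel)
 have "AE z in lborel. z \<in> clear_feet s1 s2 a b -->
   (LBINT t. \<rho> t * u (shear s1 s2 (z, t)) $ i + \<eta> t * HE s1 s2 i (shear s1 s2 (z, t))) = 0"
  by (rule clear_flux_AE[OF ab]) (use \<eta> \<rho> in auto)
 then show ?thesis using HE_slice_integrable[of s1 s2 i]
 proof eventually_elim
  case (elim z)
  define h where "h t = HE s1 s2 i (shear s1 s2 (z, t))" for t
  define v where "v t = u (shear s1 s2 (z, t)) $ i" for t
  define w where "w t = primitive s1 s2 a i z t" for t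
  have [measurable]: "(%t. shear s1 s2 (z, t)) \<in> borel_measurable borel" by (rule measurable_compose[OF _ borel_measurable_shear]) simp
  have [measurable]: "v \<in> borel_measurable borel" unfolding v_def[abs_def] by measurable
  have h: "integrable lborel h" using elim(2) by (simp add: h_def[abs_def])
  have [measurable]: "h \<in> borel_measurable borel" using h by auto
  show ?case
  proof
   assume z: "z \<in> clear_feet s1 s2 a b"
   have 0: "(LBINT t. \<rho> t * v t + \<eta> t * h t) = 0" using elim(1) z by (simp add: v_def h_def)
   have i\<rho>: "integrable lborel \<rho>"
   proof (rule integrable_dominated)
    show "integrable lborel (%t. indicator {c..c'} t *\<^sub>R \<rho> t)"
     by (rule borel_integrable_compact) (auto intro: continuous_on_subset[OF \<rho>(1)])
    show "AE t in lborel. norm (\<rho> t) <= norm (indicator {c..c'} t *\<^sub>R \<rho> t)"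
     using \<rho>(2) by (intro AE_I2) (auto simp: indicator_def)
   qed simp
   have i1: "integrable lborel (%t. \<rho> t * v t)"
   proof (rule integrable_dominated[OF i\<rho>])
    show "AE t in lborel. norm (\<rho> t * v t) <= norm (\<rho> t)"
     using u_nth_le by (intro AE_I2) (auto simp: v_def abs_mult intro!: mult_right_le_one_le)
   qed simp
   have hab: "integrable lborel (%t. indicator {a..b} t * h t)" by (rule integrable_dominated[OF h]) (auto simp: indicator_def)
   have \<rho>ab: "integrable lborel (%t. indicator {a..b} t * \<rho> t)" by (rule integrable_dominated[OF i\<rho>]) (auto simp: indicator_def)
   have \<eta>0: "\<eta> a = 0" "\<eta> b = 0" using \<eta>(2)[of a] \<eta>(2)[of b] ab by auto
   have W: "w t = 0 + (LBINT s. indicator {a..t} s * h s)" for t by (simp add: w_def primitive_def h_def)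
   have E: "\<eta> t = 0 + (LBINT s. indicator {a..t} s * \<rho> s)" if "a <= t" "t <= b" for t
    using primitive_of_deriv(1)[of a t \<eta> \<rho>] that \<eta> \<eta>0 continuous_on_subset[OF \<rho>(1)] by simp
   have ab': "a <= b" using ab by simp
   note P = integral_by_parts_primitive[OF ab' hab \<rho>ab W E]
   have e1: "indicator {a..b} t * (w t * \<rho> t) = \<rho> t * (indicator {a<..<b} t * w t)" for t
    using \<rho>(2)[of t] ab by (cases "\<rho> t = 0") (auto simp: indicator_def)
   have e2: "indicator {a..b} t * (h t * \<eta> t) = \<eta> t * h t" for t
    using \<eta>(2)[of t] ab by (cases "\<eta> t = 0") (auto simp: indicator_def)
   have e3: "\<rho> t * v t = \<rho> t * (indicator {a<..<b} t * v t)" for t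
    using \<rho>(2)[of t] ab by (cases "\<rho> t = 0") (auto simp: indicator_def)
   have i2: "integrable lborel (%t. \<rho> t * (indicator {a<..<b} t * w t))" using P(3) unfolding e1 .
   have i3: "integrable lborel (%t. \<eta> t * h t)" using P(4) unfolding e2 .
   have "(LBINT t. \<rho> t * (indicator {a<..<b} t * w t)) + (LBINT t. \<eta> t * h t) = 0"
    using P(2) \<eta>0 i2 i3 unfolding distrib_left e1 e2 by simp
   moreover have "(LBINT t. \<rho> t * v t) + (LBINT t. \<eta> t * h t) = 0" using 0 i1 i3 by simp
   moreover have "(LBINT t. \<rho> t * (indicator {a<..<b} t * (v t - w t)))
    = (LBINT t. \<rho> t * v t) - (LBINT t. \<rho> t * (indicator {a<..<b} t * w t))" using i1 i2 unfolding right_diff_distrib e3 by simp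
   ultimately show "(LBINT t. \<rho> t * (indicator {a<..<b} t * (u (shear s1 s2 (z, t)) $ i - primitive s1 s2 a i z t))) = 0"
    by (simp add: v_def w_def)
  qed
 qed
qed

text \<open>The du Bois-Reymond lemma on lines: orthogonality to all mean-zero weights makes u minus
  the primitive constant. The weights are reduced to countably many before the line is fixed, so the
  exceptional set of lines is null.\<close>

theorem clear_slice_AE:
 assumes ab: "z0 < a" "a < b" "b < z1"
 shows "AE z in lborel. z \<in> clear_feet s1 s2 a b -->
  (\<exists>k. AE t in lborel. a < t & t < b --> u (shear s1 s2 (z, t)) $ i = k + primitive s1 s2 a i z t)"
proof -
 \<comment> \<open>With this m the reference plateau equals 1 on the middle half of (a, b), so its
   integral N is positive.\<close>
 define m where "m = 8 / (b - a)"
 have m: "m > 0" "1 / m = (b - a) / 8" "2 / m = (b - a) / 4" using ab by (simp_all add: m_def)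
 define N where "N = (LBINT t. plateau m a b t)"
 have plint: "integrable lborel (plateau n c c')" if "n > 0" for n c c'
 proof (rule integrable_dominated)
  show "integrable lborel (%t. indicator {c..c'} t *\<^sub>R plateau n c c' t)" by (rule borel_integrable_compact[OF compact_Icc plateau_continuous])
  have pos: "1 / n > 0" using that by simp
  have "plateau n c c' t = 0" if "t \<notin> {c..c'}" for t
  proof (rule ccontr)
   assume "plateau n c c' t ~= 0"
   from plateau_support[OF \<open>n > 0\<close> this] pos have "c <= t" "t <= c'" by linarith+
   then show False using that by simp
  qed
  then show "AE t in lborel. norm (plateau n c c' t) <= norm (indicator {c..c'} t *\<^sub>R plateau n c c' t)"
   by (intro AE_I2) (auto simp: indicator_def)
  show "plateau n c c' \<in> borel_measurable lborel" using plateau_continuous by (auto intro: continuous_borel)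
 qed
 have N: "N > 0"
 proof -
  have "(LBINT t. indicator {a + 2 / m..b - 2 / m} t) <= N" unfolding N_def
  proof (rule integral_mono)
   show "indicator {a + 2 / m..b - 2 / m} t <= plateau m a b t" for t
    using plateau_eq_1[OF m(1), of a t b] plateau_range(1)[of m a b t] by (auto simp: indicator_def)
   show "integrable lborel (indicat_real {a + 2 / m..b - 2 / m})" by (rule integrable_real_indicator) (simp_all add: emeasure_lborel_Icc_eq)
  qed (rule plint[OF m(1)])
  moreover have "(LBINT t. indicator {a + 2 / m..b - 2 / m} t) = (b - 2 / m) - (a + 2 / m)" using ab m(3) by simp
  moreover have "(b - 2 / m) - (a + 2 / m) > 0" unfolding m(3) using ab by simp
  ultimately show ?thesis by linarith
 qed
 define \<kappa> where "\<kappa> n c c' = (LBINT t. plateau n c c' t)" for n c c'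
 define good where "good z n c c' \<longleftrightarrow> (LBINT t. (plateau n c c' t - \<kappa> n c c' / N * plateau m a b t)
   * (indicator {a<..<b} t * (u (shear s1 s2 (z, t)) $ i - primitive s1 s2 a i z t))) = 0" for z n c c'
 \<comment> \<open>Subtracting the right multiple of the reference plateau makes the weight mean
   zero.\<close>
 have each: "AE z in lborel. z \<in> clear_feet s1 s2 a b --> good z n c c'" if n: "n > 0" "a < c" "c < c'" "c' < b" for n c c' unfolding good_def
 proof (rule clear_primitive_AE[where c="min c (a + 1 / m)" and c'="max c' (b - 1 / m)"])
  show "z0 < a" "b < z1" using ab by auto
  have "1 / m > 0" using m by simp
  then show "a < min c (a + 1 / m)" "max c' (b - 1 / m) < b" "min c (a + 1 / m) <= max c' (b - 1 / m)" using n by auto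
  show "continuous_on UNIV (%t. plateau n c c' t - \<kappa> n c c' / N * plateau m a b t)" by (intro continuous_intros plateau_continuous)
  show "(LBINT t. plateau n c c' t - \<kappa> n c c' / N * plateau m a b t) = 0"
   using plint[OF n(1), of c c'] plint[OF m(1), of a b] N by (simp add: \<kappa>_def N_def[symmetric])
  fix t assume "plateau n c c' t - \<kappa> n c c' / N * plateau m a b t ~= 0"
  then consider "plateau n c c' t ~= 0" | "plateau m a b t ~= 0" by force
  then show "min c (a + 1 / m) <= t & t <= max c' (b - 1 / m)"
  proof cases
   case 1
   have "1 / n > 0" using n by simp
   with plateau_support[OF n(1) 1] show ?thesis by linarith
  next
   case 2
   with plateau_support[OF m(1) 2] show ?thesis by linarith
  qed
 qed
 have "AE z in lborel. \<forall>x\<in>UNIV \<times> (\<rat> \<times> \<rat>). a < fst (snd x) & fst (snd x) < snd (snd x) & snd (snd x) < b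
   --> z \<in> clear_feet s1 s2 a b --> good z (real (Suc (fst x))) (fst (snd x)) (snd (snd x))"
 proof (rule AE_ball_countable')
  show "countable ((UNIV :: nat set) \<times> ((\<rat> :: real set) \<times> (\<rat> :: real set)))" by (intro countable_SIGMA countable_rat) auto
  fix x :: "nat \<times> real \<times> real"
  show "AE z in lborel. a < fst (snd x) & fst (snd x) < snd (snd x) & snd (snd x) < b
   --> z \<in> clear_feet s1 s2 a b --> good z (real (Suc (fst x))) (fst (snd x)) (snd (snd x))"
  proof (cases "a < fst (snd x) & fst (snd x) < snd (snd x) & snd (snd x) < b")
   case True
   have "AE z in lborel. z \<in> clear_feet s1 s2 a b --> good z (real (Suc (fst x))) (fst (snd x)) (snd (snd x))" by (rule each) (use True in auto)
   then show ?thesis by eventually_elim blast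
  next
   case False
   then show ?thesis by (intro AE_I2) blast
  qed
 qed
 then show ?thesis using HE_slice_integrable[of s1 s2 i]
 proof eventually_elim
  case (elim z)
  show ?case
  proof
   assume z: "z \<in> clear_feet s1 s2 a b"
   define h where "h t = HE s1 s2 i (shear s1 s2 (z, t))" for t
   have h: "integrable lborel h" using elim(2) by (simp add: h_def[abs_def])
   have [measurable]: "h \<in> borel_measurable borel" using h by auto
   define D where "D t = indicator {a<..<b} t * (u (shear s1 s2 (z, t)) $ i - primitive s1 s2 a i z t)" for t
   have [measurable]: "(%t. shear s1 s2 (z, t)) \<in> borel_measurable borel" by (rule measurable_compose[OF _ borel_measurable_shear]) simp
   have prim: "primitive s1 s2 a i z = (%t. LBINT \<tau>. (if a <= \<tau> & \<tau> <= t then h \<tau> else 0))"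
    unfolding primitive_def h_def by (intro ext lint_cong) (auto simp: indicator_def)
   have [measurable]: "primitive s1 s2 a i z \<in> borel_measurable borel" unfolding prim by measurable
   have pb: "\<bar>primitive s1 s2 a i z t\<bar> <= (LBINT \<tau>. \<bar>h \<tau>\<bar>)" for t
   proof -
    have "\<bar>primitive s1 s2 a i z t\<bar> <= (LBINT \<tau>. \<bar>if a <= \<tau> & \<tau> <= t then h \<tau> else 0\<bar>)"
     unfolding prim by (rule integral_abs_bound)
    also have "... <= (LBINT \<tau>. \<bar>h \<tau>\<bar>)"
    proof (rule integral_mono)
     show "integrable lborel (%\<tau>. \<bar>if a <= \<tau> & \<tau> <= t then h \<tau> else 0\<bar>)" by (rule integrable_dominated[OF h]) auto
    qed (use h in auto)
    finally show ?thesis .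
   qed
   have Db: "\<bar>D t\<bar> <= (1 + (LBINT \<tau>. \<bar>h \<tau>\<bar>)) * indicator {a<..<b} t" for t
    using u_nth_le[of "shear s1 s2 (z, t)" i] pb[of t] by (auto simp: D_def indicator_def)
   have [measurable]: "D \<in> borel_measurable borel" unfolding D_def[abs_def] by measurable
   have D: "integrable lborel D"
   proof (rule integrable_dominated)
    show "integrable lborel (%t. (1 + (LBINT \<tau>. \<bar>h \<tau>\<bar>)) * indicator {a<..<b} t)"
     using ab by (intro integrable_mult_right integrable_real_indicator) simp_all
    show "AE t in lborel. norm (D t) <= norm ((1 + (LBINT \<tau>. \<bar>h \<tau>\<bar>)) * indicator {a<..<b} t)"
    proof (rule AE_I2)
     fix t show "norm (D t) <= norm ((1 + (LBINT \<tau>. \<bar>h \<tau>\<bar>)) * indicator {a<..<b} t)"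
      using order_trans[OF Db[of t] abs_ge_self] by (simp only: real_norm_def)
    qed
   qed simp
   have pD: "integrable lborel (%t. plateau n c c' t * D t)" for n c c'
   proof (rule integrable_dominated[OF D])
    show "(%t. plateau n c c' t * D t) \<in> borel_measurable lborel" using continuous_borel[OF plateau_continuous, of n c c'] by simp
    show "AE t in lborel. norm (plateau n c c' t * D t) <= norm (D t)"
     using plateau_range[of n c c'] by (intro AE_I2) (auto simp: abs_mult intro!: mult_left_le_one_le)
   qed
   \<comment> \<open>The constant can only be the average of D against the reference
     plateau.\<close>
   define k where "k = (LBINT t. plateau m a b t * D t) / N"
   have main: "(LBINT t. plateau (real (Suc n)) c c' t * (D t - k)) = 0"
    if "c \<in> \<rat>" "c' \<in> \<rat>" "a < c" "c < c'" "c' < b" for n c c'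
   proof -
    have "good z (real (Suc n)) c c'" using elim(1)[rule_format, of "(n, c, c')"] that z by simp
    then have "(LBINT t. plateau (real (Suc n)) c c' t * D t - \<kappa> (real (Suc n)) c c' / N * (plateau m a b t * D t)) = 0"
     unfolding good_def D_def[symmetric] left_diff_distrib mult.assoc .
    then have "(LBINT t. plateau (real (Suc n)) c c' t * D t) = \<kappa> (real (Suc n)) c c' * k" using pD by (simp add: k_def)
    moreover have "(LBINT t. plateau (real (Suc n)) c c' t * (D t - k))
      = (LBINT t. plateau (real (Suc n)) c c' t * D t) - \<kappa> (real (Suc n)) c c' * k"
     unfolding right_diff_distrib \<kappa>_def using pD plint[of "real (Suc n)" c c'] by simp
    ultimately show ?thesis by simp
   qed
   have "AE t in lborel. indicator {a<..<b} t * (D t - k) = 0"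
   proof (rule AE_0_if_integral_rational_0[of _ a b])
    have i: "integrable lborel (%t. indicator {a<..<b} t * k :: real)" using ab by (intro integrable_mult_left integrable_real_indicator) simp_all
    have "(%t. indicator {a<..<b} t * (D t - k)) = (%t. D t - indicator {a<..<b} t * k)" by (auto simp: fun_eq_iff D_def indicator_def)
    then show "integrable lborel (%t. indicator {a<..<b} t * (D t - k))" using D i by simp
    fix c c' assume c: "c \<in> \<rat>" "c' \<in> \<rat>" "a < c" "c < c'" "c' < b"
    have "(%n. LBINT t. plateau (real (Suc n)) c c' t * (D t - k)) \<longlonglongrightarrow> (LBINT t. indicator {c<..<c'} t * (D t - k))"
    proof (rule integral_dominated_convergence[where w="%t. \<bar>D t\<bar> + \<bar>k\<bar> * indicator {c..c'} t"])
     show "integrable lborel (%t. \<bar>D t\<bar> + \<bar>k\<bar> * indicator {c..c'} t)"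
      by (intro Bochner_Integration.integrable_add integrable_abs D integrable_mult_right integrable_real_indicator)
       (simp_all add: emeasure_lborel_Icc_eq)
     show "AE t in lborel. (%n. plateau (real (Suc n)) c c' t * (D t - k)) \<longlonglongrightarrow> indicator {c<..<c'} t * (D t - k)"
      by (intro AE_I2 tendsto_mult plateau_tendsto tendsto_const)
     show "AE t in lborel. norm (plateau (real (Suc n)) c c' t * (D t - k)) <= \<bar>D t\<bar> + \<bar>k\<bar> * indicator {c..c'} t" for n
     proof (rule AE_I2)
      fix t
      show "norm (plateau (real (Suc n)) c c' t * (D t - k)) <= \<bar>D t\<bar> + \<bar>k\<bar> * indicator {c..c'} t"
      proof (cases "plateau (real (Suc n)) c c' t = 0")
       case False
       have pos: "1 / real (Suc n) > 0" by simp
       have "real (Suc n) > 0" by simp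
       from plateau_support[OF this False] pos have "c <= t" "t <= c'" by linarith+
       then have "t \<in> {c..c'}" by simp
       moreover have "norm (plateau (real (Suc n)) c c' t * (D t - k)) <= 1 * \<bar>D t - k\<bar>"
        unfolding real_norm_def abs_mult using plateau_range[of "real (Suc n)" c c' t] by (intro mult_right_mono) auto
       ultimately show ?thesis using abs_triangle_ineq4[of "D t" k] by simp
      qed simp
     qed
     show "(%t. plateau (real (Suc n)) c c' t * (D t - k)) \<in> borel_measurable lborel" for n
      using continuous_borel[OF plateau_continuous, of "real (Suc n)" c c'] by simp
    qed simp
    then have "(LBINT t. indicator {c<..<c'} t * (D t - k)) = 0" unfolding main[OF c] by (simp add: LIMSEQ_const_iff)
    moreover have "indicator {c<..<c'} t * (indicator {a<..<b} t * (D t - k)) = indicator {c<..<c'} t * (D t - k)" for t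
     using c by (auto simp: indicator_def)
    ultimately show "(LBINT t. indicator {c<..<c'} t * (indicator {a<..<b} t * (D t - k))) = 0" by (simp only:)
   qed (auto simp: indicator_def split: if_splits)
   then have "AE t in lborel. a < t & t < b --> u (shear s1 s2 (z, t)) $ i = k + primitive s1 s2 a i z t" by eventually_elim (auto simp: D_def)
   then show "\<exists>k. AE t in lborel. a < t & t < b --> u (shear s1 s2 (z, t)) $ i = k + primitive s1 s2 a i z t" by blast
  qed
 qed
qed

end

section \<open>Lebesgue points and the identification of the approximate gradient\<close>

text \<open>For rational q the measure |f - q| restricted to the points where |f - q| > 1 / (n + 1)
  does not charge the remaining points, so it has density zero at almost all of them. At x take q
  close to f x: what is left of |f - f x| is at most 2 / (n + 1).\<close>

lemma lebesgue_point_AE: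
 fixes f :: "'a::euclidean_space => real"
 assumes f: "integrable lborel f" and V: "open V" "bounded V"
 shows "AE x in lborel. x \<in> V -->
  ((%r. (LBINT y. indicator (ball x r) y * \<bar>f y - f x\<bar>) / r ^ DIM('a)) \<longlongrightarrow> 0) (at_right 0)"
proof -
 have [measurable]: "f \<in> borel_measurable borel" using f by auto
 have Vb[measurable]: "V \<in> sets borel" using V by simp
 have Vfin: "emeasure lborel V < \<infinity>" using V(2) by (rule emeasure_bounded_finite)
 define \<nu> where "\<nu> q n = density lborel (%y. ennreal (indicator (V \<inter> {y. \<bar>f y - q\<bar> > 1 / real (Suc n)}) y * \<bar>f y - q\<bar>))" for q n
 have intq: "integrable lborel (%y. indicator V y * \<bar>f y - q\<bar>)" for q
 proof (rule integrable_dominated)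
  have "integrable lborel (indicat_real V)" using Vfin by (intro integrable_real_indicator) auto
  then show "integrable lborel (%y. \<bar>f y\<bar> + \<bar>q\<bar> * indicat_real V y)" using f by simp
  show "AE y in lborel. norm (indicator V y * \<bar>f y - q\<bar>) <= norm (\<bar>f y\<bar> + \<bar>q\<bar> * indicat_real V y)"
   by (intro AE_I2) (auto simp: indicator_def)
 qed simp
 have int\<nu>: "integrable lborel (%y. indicator (V \<inter> {y. \<bar>f y - q\<bar> > 1 / real (Suc n)}) y * \<bar>f y - q\<bar>)" for q n
  by (rule integrable_dominated[OF intq[of q]]) (auto simp: indicator_def)
 have fin\<nu>: "finite_measure (\<nu> q n)" for q n
 proof (rule finite_measureI)
  have "emeasure (\<nu> q n) (space (\<nu> q n)) = (\<integral>\<^sup>+y. ennreal (indicator (V \<inter> {y. \<bar>f y - q\<bar> > 1 / real (Suc n)}) y * \<bar>f y - q\<bar>) \<partial>lborel)"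
   by (simp add: \<nu>_def emeasure_density)
  also have "... < \<infinity>" using int\<nu>[where q=q and n=n] by (subst nn_integral_eq_integral) auto
  finally show "emeasure (\<nu> q n) (space (\<nu> q n)) ~= \<infinity>" by simp
 qed
 have AE1: "AE x in lborel. x \<in> {y. \<bar>f y - q\<bar> <= 1 / real (Suc n)} -->
   ((%r. measure (\<nu> q n) (ball x r) / r ^ DIM('a)) \<longlongrightarrow> 0) (at_right 0)" for q n
 proof (rule measure_ball_density_zero[OF _ fin\<nu>])
  show "sets (\<nu> q n) = sets borel" by (simp add: \<nu>_def)
  show "{y. \<bar>f y - q\<bar> <= 1 / real (Suc n)} \<in> sets borel" by measurable
  have "emeasure (\<nu> q n) {y. \<bar>f y - q\<bar> <= 1 / real (Suc n)}
   = (\<integral>\<^sup>+y. ennreal (indicator (V \<inter> {y. \<bar>f y - q\<bar> > 1 / real (Suc n)}) y * \<bar>f y - q\<bar>) * indicator {y. \<bar>f y - q\<bar> <= 1 / real (Suc n)} y \<partial>lborel)"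
   unfolding \<nu>_def by (rule emeasure_density) measurable
  also have "... = (\<integral>\<^sup>+y. 0 \<partial>(lborel :: 'a measure))"
  proof (rule nn_integral_cong)
   fix y
   show "ennreal (indicator (V \<inter> {y. \<bar>f y - q\<bar> > 1 / real (Suc n)}) y * \<bar>f y - q\<bar>) * indicator {y. \<bar>f y - q\<bar> <= 1 / real (Suc n)} y = 0"
    by (cases "\<bar>f y - q\<bar> <= 1 / real (Suc n)") (simp_all add: indicator_def)
  qed
  finally show "emeasure (\<nu> q n) {y. \<bar>f y - q\<bar> <= 1 / real (Suc n)} = 0" by simp
 qed
 have "AE x in lborel. \<forall>z\<in>\<rat> \<times> UNIV. x \<in> {y. \<bar>f y - fst z\<bar> <= 1 / real (Suc (snd z))} -->
   ((%r. measure (\<nu> (fst z) (snd z)) (ball x r) / r ^ DIM('a)) \<longlongrightarrow> 0) (at_right 0)"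
  by (intro AE_ball_countable' AE1 countable_SIGMA countable_rat) auto
 then show ?thesis
 proof eventually_elim
  case (elim x)
  show ?case
  proof (intro impI tendstoI)
   fix e :: real assume x: "x \<in> V" and e: "e > 0"
   define c where "c = unit_ball_vol (real DIM('a))"
   have c: "c > 0" by (simp add: c_def)
   have "e / (4 * c) > 0" using e c by simp
   then obtain n where n: "1 / real (Suc n) < e / (4 * c)" by (metis nat_approx_posE)
   have "f x - 1 / real (Suc n) < f x" by simp
   \<comment> \<open>Within 1 / (n + 1) of f x, so x belongs to the set on which the measure for (q,
     n) has density zero.\<close>
   then obtain q where q: "q \<in> \<rat>" "f x - 1 / real (Suc n) < q" "q < f x" using Rats_dense_in_real by blast
   have qx: "\<bar>f x - q\<bar> <= 1 / real (Suc n)" using q by linarith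
   have lim: "((%r. measure (\<nu> q n) (ball x r) / r ^ DIM('a)) \<longlongrightarrow> 0) (at_right 0)"
    using elim[rule_format, of "(q, n)"] q(1) qx by simp
   obtain d where d: "d > 0" "ball x d \<subseteq> V" using V(1) x open_contains_ball by blast
   have ev1: "\<forall>\<^sub>F r in at_right 0. measure (\<nu> q n) (ball x r) / r ^ DIM('a) < e / 2"
    using order_tendstoD(2)[OF lim, of "e / 2"] e by simp
   have ev2: "\<forall>\<^sub>F r in at_right (0::real). 0 < r & r < d" using d by (auto simp: eventually_at_right intro!: exI[of _ d])
   show "\<forall>\<^sub>F r in at_right 0. dist ((LBINT y. indicator (ball x r) y * \<bar>f y - f x\<bar>) / r ^ DIM('a)) 0 < e" using ev1 ev2
   proof eventually_elim
    case (elim r)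
    then have r: "0 < r" "ball x r \<subseteq> V" using d(2) by (auto simp: subset_iff)
    have [measurable]: "ball x r \<in> sets borel" by simp
    have [measurable]: "(%y. \<bar>f y - f x\<bar>) \<in> borel_measurable borel" by simp
    have iball: "integrable lborel (indicat_real (ball x r))"
     using emeasure_bounded_finite[OF bounded_ball, of x r] by (intro integrable_real_indicator) auto
    have i2: "integrable lborel (%y. indicator (ball x r) y * (indicator (V \<inter> {y. \<bar>f y - q\<bar> > 1 / real (Suc n)}) y * \<bar>f y - q\<bar>))"
     by (rule integrable_dominated[OF int\<nu>[where q=q and n=n]]) (auto simp: indicator_def)
    have "(LBINT y. indicator (ball x r) y * \<bar>f y - f x\<bar>)
     <= (LBINT y. indicator (ball x r) y * (indicator (V \<inter> {y. \<bar>f y - q\<bar> > 1 / real (Suc n)}) y * \<bar>f y - q\<bar>)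
       + 2 / real (Suc n) * indicator (ball x r) y)"
    proof (rule integral_mono)
     show "integrable lborel (%y. indicator (ball x r) y * \<bar>f y - f x\<bar>)"
     proof (rule integrable_dominated[OF intq[of "f x"]])
      show "AE y in lborel. norm (indicator (ball x r) y * \<bar>f y - f x\<bar>) <= norm (indicator V y * \<bar>f y - f x\<bar>)"
       using r(2) by (intro AE_I2) (auto simp: indicator_def subset_iff)
      show "(%y. indicator (ball x r) y * \<bar>f y - f x\<bar>) \<in> borel_measurable lborel" by measurable
     qed
     show "integrable lborel (%y. indicator (ball x r) y * (indicator (V \<inter> {y. \<bar>f y - q\<bar> > 1 / real (Suc n)}) y * \<bar>f y - q\<bar>)
       + 2 / real (Suc n) * indicator (ball x r) y)" using i2 iball by simp
     fix y :: 'a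
     show "indicator (ball x r) y * \<bar>f y - f x\<bar>
      <= indicator (ball x r) y * (indicator (V \<inter> {y. \<bar>f y - q\<bar> > 1 / real (Suc n)}) y * \<bar>f y - q\<bar>)
       + 2 / real (Suc n) * indicator (ball x r) y"
     proof (cases "y \<in> ball x r")
      case True
      then have yV: "y \<in> V" using r by auto
      have t: "\<bar>f y - f x\<bar> <= \<bar>f y - q\<bar> + 1 / real (Suc n)" using qx by linarith
      have t2: "2 / real (Suc n) = 1 / real (Suc n) + 1 / real (Suc n)" by simp
      have t0: "0 <= 1 / real (Suc n)" by simp
      show ?thesis
      proof (cases "\<bar>f y - q\<bar> > 1 / real (Suc n)")
       case T: True
       have "\<bar>f y - f x\<bar> <= \<bar>f y - q\<bar> + 2 / real (Suc n)" using t t2 t0 by linarith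
       then show ?thesis using T True yV by (simp del: of_nat_Suc)
      next
       case F: False
       have "\<bar>f y - f x\<bar> <= 2 / real (Suc n)" using t F t2 by linarith
       then show ?thesis using F True yV by (simp del: of_nat_Suc)
      qed
     qed simp
    qed
    also have "... = (LBINT y. indicator (ball x r) y * (indicator (V \<inter> {y. \<bar>f y - q\<bar> > 1 / real (Suc n)}) y * \<bar>f y - q\<bar>))
       + 2 / real (Suc n) * measure lborel (ball x r)" using i2 iball by simp
    also have "(LBINT y. indicator (ball x r) y * (indicator (V \<inter> {y. \<bar>f y - q\<bar> > 1 / real (Suc n)}) y * \<bar>f y - q\<bar>))
     = measure (\<nu> q n) (ball x r)"
    proof -
     have "emeasure (\<nu> q n) (ball x r) = (\<integral>\<^sup>+y. ennreal (indicator (V \<inter> {y. \<bar>f y - q\<bar> > 1 / real (Suc n)}) y * \<bar>f y - q\<bar>) * indicator (ball x r) y \<partial>lborel)"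
      unfolding \<nu>_def by (rule emeasure_density) measurable
     also have "... = (\<integral>\<^sup>+y. ennreal (indicator (ball x r) y * (indicator (V \<inter> {y. \<bar>f y - q\<bar> > 1 / real (Suc n)}) y * \<bar>f y - q\<bar>)) \<partial>lborel)"
     proof (rule nn_integral_cong)
      fix y
      show "ennreal (indicator (V \<inter> {y. \<bar>f y - q\<bar> > 1 / real (Suc n)}) y * \<bar>f y - q\<bar>) * indicator (ball x r) y
       = ennreal (indicator (ball x r) y * (indicator (V \<inter> {y. \<bar>f y - q\<bar> > 1 / real (Suc n)}) y * \<bar>f y - q\<bar>))"
       by (cases "y \<in> ball x r") simp_all
     qed
     also have "... = ennreal (LBINT y. indicator (ball x r) y * (indicator (V \<inter> {y. \<bar>f y - q\<bar> > 1 / real (Suc n)}) y * \<bar>f y - q\<bar>))"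
      using i2 by (intro nn_integral_eq_integral) auto
     finally show ?thesis unfolding measure_def by (simp add: integral_nonneg_AE)
    qed
    also have "measure lborel (ball x r) = c * r ^ DIM('a)" using r by (simp add: c_def content_ball)
    finally have "(LBINT y. indicator (ball x r) y * \<bar>f y - f x\<bar>) / r ^ DIM('a)
     <= (measure (\<nu> q n) (ball x r) + 2 / real (Suc n) * (c * r ^ DIM('a))) / r ^ DIM('a)" using r by (intro divide_right_mono) auto
    also have "... = measure (\<nu> q n) (ball x r) / r ^ DIM('a) + 2 * c * (1 / real (Suc n))" using r by (simp add: add_divide_distrib)
    also have "... < e / 2 + 2 * c * (e / (4 * c))" using elim(1) n c by (intro add_strict_mono mult_strict_left_mono) auto
    also have "... = e" using c by simp
    finally have "(LBINT y. indicator (ball x r) y * \<bar>f y - f x\<bar>) / r ^ DIM('a) < e" .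
    moreover have "0 <= (LBINT y. indicator (ball x r) y * \<bar>f y - f x\<bar>) / r ^ DIM('a)"
     using r by (intro divide_nonneg_nonneg integral_nonneg_AE) auto
    ultimately show ?case by simp
   qed
  qed
 qed
qed

text \<open>The integral of \<open>w (\<phi> (y + h e) - \<phi> y) / h\<close> vanishes by translation invariance; let \<open>h\<close> tend to \<open>0\<close>.\<close>

lemma integral_directional_derivative_0:
 fixes \<phi> :: "real ^ 'n => real" and w :: "real ^ 'n => real"
 assumes t: "test_function \<Omega> \<phi> g" and [measurable]: "w \<in> borel_measurable borel"
  and wb: "!!x. \<bar>w x\<bar> <= B" and inv: "!!x t. w (x + t *\<^sub>R e) = w x"
 shows "(LBINT x. w x * (g x \<bullet> e)) = 0"
proof -
 obtain C M where C: "compact C" "C \<subseteq> \<Omega>" "!!x. x \<notin> C ==> \<phi> x = 0" "!!x. x \<notin> C ==> g x = 0"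
  "M \<ge> 0" "!!x. \<bar>\<phi> x\<bar> <= M" "!!x. norm (g x) <= M" "continuous_on UNIV \<phi>" "continuous_on UNIV g"
  using test_function_facts[OF t] by blast
 have der: "(\<phi> has_derivative (%h. g x \<bullet> h)) (at x)" for x using t by (auto simp: test_function_def)
 have [measurable]: "\<phi> \<in> borel_measurable borel" "g \<in> borel_measurable borel" using C by (auto intro: continuous_borel)
 have B0: "B \<ge> 0" using wb[of 0] by linarith
 obtain R where R: "R > 0" "!!x. x \<in> C ==> norm x <= R" using compact_imp_bounded[OF C(1)] by (auto simp: bounded_pos)
 define D where "D = cball (0 :: real ^ 'n) (R + norm e)"
 define h where "h n = 1 / real (Suc n)" for n
 have h: "0 < h n" "h n <= 1" for n by (simp_all add: h_def)
 have iD: "integrable lborel (indicat_real D)" using emeasure_bounded_finite[of D] by (intro integrable_real_indicator) (auto simp: D_def)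
 have i\<phi>: "integrable lborel (%x. w x * \<phi> (x + s *\<^sub>R e))" if "\<bar>s\<bar> <= 1" for s
 proof (rule integrable_dominated)
  show "integrable lborel (%x. B * M * indicat_real D x)" using iD by simp
  show "AE x in lborel. norm (w x * \<phi> (x + s *\<^sub>R e)) <= norm (B * M * indicat_real D x)"
  proof (rule AE_I2)
   fix x
   show "norm (w x * \<phi> (x + s *\<^sub>R e)) <= norm (B * M * indicat_real D x)"
   proof (cases "x + s *\<^sub>R e \<in> C")
    case True
    have "norm x <= norm (x + s *\<^sub>R e) + norm (s *\<^sub>R e)" using norm_triangle_ineq4[of "x + s *\<^sub>R e" "s *\<^sub>R e"] by simp
    also have "... <= R + norm e" using R(2)[OF True] mult_right_mono[OF that, of "norm e"] by simp
    finally have "x \<in> D" by (simp add: D_def)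
    moreover have "\<bar>w x * \<phi> (x + s *\<^sub>R e)\<bar> <= B * M" unfolding abs_mult using wb C(6) B0 by (intro mult_mono) auto
    ultimately show ?thesis using B0 C(5) by simp
   qed (use C(3) in simp)
  qed
 qed simp
 have zero: "(LBINT x. w x * ((\<phi> (x + h n *\<^sub>R e) - \<phi> x) / h n)) = 0" for n
 proof -
  have "(LBINT x. w x * \<phi> (x + h n *\<^sub>R e)) = (LBINT x. w (x + h n *\<^sub>R e) * \<phi> (x + h n *\<^sub>R e))" by (simp add: inv)
  also have "... = (LINT x|distr lborel borel ((+) (h n *\<^sub>R e)). w x * \<phi> x)" by (subst integral_distr) (auto simp: add.commute)
  also have "... = (LBINT x. w x * \<phi> x)" by (simp only: lborel_distr_plus)
  finally have e: "(LBINT x. w x * \<phi> (x + h n *\<^sub>R e)) - (LBINT x. w x * \<phi> x) = 0" by simp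
  have "(LBINT x. w x * ((\<phi> (x + h n *\<^sub>R e) - \<phi> x) / h n))
   = (LBINT x. (w x * \<phi> (x + h n *\<^sub>R e) - w x * \<phi> x) / h n)" by (simp add: right_diff_distrib diff_divide_distrib)
  also have "... = ((LBINT x. w x * \<phi> (x + h n *\<^sub>R e)) - (LBINT x. w x * \<phi> x)) / h n"
   using i\<phi>[of "h n"] i\<phi>[of 0] h[of n] by simp
  finally show ?thesis using e by simp
 qed
 have "(%n. LBINT x. w x * ((\<phi> (x + h n *\<^sub>R e) - \<phi> x) / h n)) \<longlonglongrightarrow> (LBINT x. w x * (g x \<bullet> e))"
 proof (rule integral_dominated_convergence[where w="%x. B * (M * norm e) * indicat_real D x"])
  show "integrable lborel (%x. B * (M * norm e) * indicat_real D x)" using iD by simp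
  show "AE x in lborel. (%n. w x * ((\<phi> (x + h n *\<^sub>R e) - \<phi> x) / h n)) \<longlonglongrightarrow> w x * (g x \<bullet> e)"
  proof (intro AE_I2 tendsto_mult tendsto_const)
   fix x
   have "((%s. \<phi> (x + s *\<^sub>R e)) has_derivative (%s. g x \<bullet> (s *\<^sub>R e))) (at 0)"
   proof -
    have "((%s. x + s *\<^sub>R e) has_derivative (%s. s *\<^sub>R e)) (at 0)" by (auto intro!: derivative_eq_intros)
    from has_derivative_compose[OF this, of \<phi> "%h. g x \<bullet> h"] der show ?thesis by simp
   qed
   then have "((%s. \<phi> (x + s *\<^sub>R e)) has_real_derivative (g x \<bullet> e)) (at 0)"
    by (simp add: has_field_derivative_def mult.commute[of _ "g x \<bullet> e"] fun_eq_iff)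
   then have "((%s. (\<phi> (x + s *\<^sub>R e) - \<phi> x) / s) \<longlongrightarrow> g x \<bullet> e) (at 0)" by (simp add: DERIV_def)
   moreover have "filterlim h (at 0) sequentially" unfolding filterlim_at using h(1) LIMSEQ_inverse_real_of_nat
    by (auto simp: h_def[abs_def] inverse_eq_divide less_imp_neq[symmetric] intro!: always_eventually)
   ultimately show "(%n. (\<phi> (x + h n *\<^sub>R e) - \<phi> x) / h n) \<longlonglongrightarrow> g x \<bullet> e" by (rule filterlim_compose)
  qed
  show "AE x in lborel. norm (w x * ((\<phi> (x + h n *\<^sub>R e) - \<phi> x) / h n)) <= B * (M * norm e) * indicat_real D x" for n
  proof (rule AE_I2)
   fix x
   show "norm (w x * ((\<phi> (x + h n *\<^sub>R e) - \<phi> x) / h n)) <= B * (M * norm e) * indicat_real D x"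
   proof (cases "x \<in> D")
    case True
    have "norm (\<phi> (x + h n *\<^sub>R e) - \<phi> x) <= M * norm ((x + h n *\<^sub>R e) - x)"
    proof (rule differentiable_bound[of UNIV])
     show "(\<phi> has_derivative (%h. g y \<bullet> h)) (at y within UNIV)" for y using der by simp
     show "onorm (%h. g y \<bullet> h) <= M" for y
     proof (rule onorm_le)
      fix k show "norm (g y \<bullet> k) <= M * norm k" using Cauchy_Schwarz_ineq2[of "g y" k] mult_right_mono[OF C(7)[of y], of "norm k"] by simp
     qed
    qed auto
    moreover have "norm ((x + h n *\<^sub>R e) - x) = h n * norm e" using h(1)[of n] by simp
    ultimately have "\<bar>\<phi> (x + h n *\<^sub>R e) - \<phi> x\<bar> <= M * (h n * norm e)" by (simp only: real_norm_def)
    then have "\<bar>(\<phi> (x + h n *\<^sub>R e) - \<phi> x) / h n\<bar> <= M * norm e"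
     unfolding abs_divide abs_of_pos[OF h(1)] pos_divide_le_eq[OF h(1)] by (simp only: mult.assoc mult.commute[of "h n"])
    then have "\<bar>w x * ((\<phi> (x + h n *\<^sub>R e) - \<phi> x) / h n)\<bar> <= B * (M * norm e)"
     unfolding abs_mult using wb B0 by (intro mult_mono) auto
    then show ?thesis using True by simp
   next
    case False
    have "x \<notin> C"
    proof
     assume "x \<in> C"
     from R(2)[OF this] norm_ge_zero[of e] have "norm x <= R + norm e" by linarith
     then show False using False by (simp add: D_def)
    qed
    moreover have "x + h n *\<^sub>R e \<notin> C"
    proof
     assume a: "x + h n *\<^sub>R e \<in> C"
     have "norm x <= norm (x + h n *\<^sub>R e) + norm (h n *\<^sub>R e)" using norm_triangle_ineq4[of "x + h n *\<^sub>R e" "h n *\<^sub>R e"] by simp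
     also have "... <= R + norm e" using R(2)[OF a] mult_right_mono[of "\<bar>h n\<bar>" 1 "norm e"] h[of n] by simp
     finally show False using False by (simp add: D_def)
    qed
    ultimately show ?thesis using C(3) B0 C(5) by simp
   qed
  qed
 qed simp_all
 then show ?thesis unfolding zero by (simp add: LIMSEQ_const_iff)
qed

text \<open>The square of the positive part of 1 - |y - x|^2 / r^2. It is continuously
  differentiable because squaring removes the kink, and at half the radius its value is still
  (3/4)^2 = 9/16, above 1/2.\<close>

lemma quadratic_bump:
 fixes x :: "real ^ 'n"
 assumes r: "r > 0" and sub: "cball x r \<subseteq> \<Omega>"
 defines "\<phi> \<equiv> %y. (max 0 (1 - ((y - x) \<bullet> (y - x)) / r\<^sup>2))\<^sup>2"
  and "g \<equiv> %y. (- (4 / r\<^sup>2) * max 0 (1 - ((y - x) \<bullet> (y - x)) / r\<^sup>2)) *\<^sub>R (y - x)"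
 shows "test_function \<Omega> \<phi> g" "!!y. y \<notin> ball x r ==> \<phi> y = 0" "!!y. y \<notin> ball x r ==> g y = 0"
  "!!y. 0 <= \<phi> y & \<phi> y <= 1" "!!y. norm (g y) <= 4 / r" "!!y. y \<in> ball x (r / 2) ==> 1 / 2 <= \<phi> y"
proof -
 define m where "m y = max 0 (1 - ((y - x) \<bullet> (y - x)) / r\<^sup>2)" for y
 have d: "(y - x) \<bullet> (y - x) = (dist x y)\<^sup>2" for y by (simp only: dist_norm norm_minus_commute[of x y] power2_norm_eq_inner)
 have m0: "m y = 0" if "y \<notin> ball x r" for y
 proof -
  have "r\<^sup>2 <= (dist x y)\<^sup>2" using that r by (intro power_mono) auto
  then show ?thesis using r by (simp add: m_def d max_def)
 qed
 have m1: "0 <= m y & m y <= 1" for y by (simp add: m_def)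
 have \<phi>m: "\<phi> y = (m y)\<^sup>2" "g y = (- (4 / r\<^sup>2) * m y) *\<^sub>R (y - x)" for y by (simp_all add: \<phi>_def g_def m_def)
 show p0: "\<phi> y = 0" if "y \<notin> ball x r" for y using m0[OF that] by (simp add: \<phi>m)
 show g0: "g y = 0" if "y \<notin> ball x r" for y using m0[OF that] by (simp add: \<phi>m)
 show "0 <= \<phi> y & \<phi> y <= 1" for y using m1[of y] by (simp add: \<phi>m power_le_one)
 show "norm (g y) <= 4 / r" for y
 proof (cases "y \<in> ball x r")
  case True
  have "norm (g y) = (4 / r\<^sup>2 * m y) * dist x y" using m1[of y] r by (simp add: \<phi>m dist_norm norm_minus_commute abs_mult)
  also have "... <= (4 / r\<^sup>2 * 1) * r" using m1[of y] r True by (intro mult_mono) auto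
  also have "... = 4 / r" using r by (simp add: power2_eq_square)
  finally show ?thesis .
 qed (use g0 r in simp)
 show "1 / 2 <= \<phi> y" if "y \<in> ball x (r / 2)" for y
 proof -
  have "(dist x y)\<^sup>2 <= (r / 2)\<^sup>2" using that by (intro power_mono) auto
  then have "(dist x y)\<^sup>2 / r\<^sup>2 <= (r / 2)\<^sup>2 / r\<^sup>2" by (intro divide_right_mono) auto
  also have "(r / 2)\<^sup>2 / r\<^sup>2 = 1 / 4" using r by (simp add: power_divide)
  finally have "3 / 4 <= 1 - (dist x y)\<^sup>2 / r\<^sup>2" by linarith
  then have "3 / 4 <= m y" unfolding m_def d by (rule max.coboundedI2)
  then have "(3 / 4)\<^sup>2 <= (m y)\<^sup>2" by (intro power_mono) auto
  then show ?thesis by (simp add: \<phi>m power2_eq_square)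
 qed
 have cg: "continuous_on UNIV g" unfolding g_def by (intro continuous_intros) (use r in simp)
 have der: "(\<phi> has_derivative (%h. g y \<bullet> h)) (at y)" for y
 proof -
  have inner: "((%y. 1 - ((y - x) \<bullet> (y - x)) / r\<^sup>2) has_derivative (%h. - ((2 * ((y - x) \<bullet> h)) / r\<^sup>2))) (at y)"
  proof -
   have sq: "((%y. (y - x) \<bullet> (y - x)) has_derivative (%h. 2 * ((y - x) \<bullet> h))) (at y)"
    by (auto intro!: derivative_eq_intros simp: inner_commute fun_eq_iff)
   show ?thesis unfolding divide_inverse
    by (rule has_derivative_eq_rhs[OF has_derivative_diff[OF has_derivative_const has_derivative_mult_left[OF sq]]])
     (simp add: fun_eq_iff)
  qed
  show ?thesis unfolding \<phi>_def by (rule has_derivative_eq_rhs[OF DERIV_compose_FDERIV[OF max0_square_deriv inner]])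
    (simp add: fun_eq_iff g_def)
 qed
 have "{y. \<phi> y ~= 0} \<subseteq> ball x r" using p0 by blast
 then have cl: "closure {y. \<phi> y ~= 0} \<subseteq> cball x r" by (intro closure_minimal closed_cball order_trans[OF _ ball_subset_cball])
 then have "compact (closure {y. \<phi> y ~= 0})" by (metis bounded_cball bounded_subset closed_closure compact_eq_bounded_closed)
 then show "test_function \<Omega> \<phi> g" unfolding test_function_def using der cg cl sub by auto
qed

lemma quadratic_bump_exists:
 fixes x :: "real ^ 'n"
 assumes "r > 0" "cball x r \<subseteq> \<Omega>"
 shows "\<exists>\<phi> g. test_function \<Omega> \<phi> g & (\<forall>y. y \<notin> ball x r --> \<phi> y = 0) & (\<forall>y. y \<notin> ball x r --> g y = 0) &
  (\<forall>y. 0 <= \<phi> y & \<phi> y <= 1) & (\<forall>y. norm (g y) <= 4 / r) & (\<forall>y. y \<in> ball x (r / 2) --> 1 / 2 <= \<phi> y)"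
 using quadratic_bump(1-3,5,6)[OF assms] quadratic_bump(4)[OF assms, THEN conjunct1] quadratic_bump(4)[OF assms, THEN conjunct2]
 by (intro exI conjI allI impI)

text \<open>Gives the moments of the gradient: integrating the derivative of (y_k - x_k) \<phi>
  shows that (y_k - x_k) times the j-th derivative of \<phi> has integral minus the integral of
  \<phi> for k = j, and 0 otherwise.\<close>

lemma test_function_mult_affine:
 fixes \<phi> :: "real ^ 'n => real"
 assumes t: "test_function \<Omega> \<phi> g"
 shows "test_function \<Omega> (%y. (y $ k - a) * \<phi> y) (%y. (y $ k - a) *\<^sub>R g y + \<phi> y *\<^sub>R axis k 1)"
proof -
 have der: "!!x. (\<phi> has_derivative (%h. g x \<bullet> h)) (at x)" and cg: "continuous_on UNIV g"
  and C: "compact (closure {x. \<phi> x ~= 0})" "closure {x. \<phi> x ~= 0} \<subseteq> \<Omega>" using t by (auto simp: test_function_def)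
 have c\<phi>: "continuous_on UNIV \<phi>" by (intro continuous_at_imp_continuous_on ballI has_derivative_continuous[OF der])
 have 1: "((%y :: real ^ 'n. y $ k - a) has_derivative (%h. h $ k)) (at y)" for y
  by (intro has_derivative_eq_rhs[OF has_derivative_diff[OF bounded_linear_imp_has_derivative[OF bounded_linear_vec_nth] has_derivative_const]]) simp
 have "((%y. (y $ k - a) * \<phi> y) has_derivative (%h. ((y $ k - a) *\<^sub>R g y + \<phi> y *\<^sub>R axis k 1) \<bullet> h)) (at y)" for y
  by (rule has_derivative_eq_rhs[OF has_derivative_mult[OF 1 der]])
   (simp add: fun_eq_iff inner_add_left inner_axis' mult_ac)
 moreover have "continuous_on UNIV (%y. (y $ k - a) *\<^sub>R g y + \<phi> y *\<^sub>R axis k 1)" by (intro continuous_intros cg c\<phi>)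
 moreover have sub: "closure {x. (x $ k - a) * \<phi> x ~= 0} \<subseteq> closure {x. \<phi> x ~= 0}" by (intro closure_mono) auto
 moreover from sub have "compact (closure {x. (x $ k - a) * \<phi> x ~= 0})"
  using bounded_subset[OF compact_imp_bounded[OF C(1)] order_trans[OF closure_subset sub]] by (simp add: compact_closure)
 ultimately show ?thesis using C(2) unfolding test_function_def by blast
qed

lemma set_lebesgue_integral_borel:
 fixes f :: "'a::euclidean_space => real"
 assumes [measurable]: "A \<in> sets borel" "f \<in> borel_measurable borel"
 shows "(LINT y : A | lebesgue. f y) = (LBINT y. indicator A y * f y)"
proof -
 have "(%y. indicator A y * f y) \<in> borel_measurable lborel" by measurable
 from integral_completion[OF this] show ?thesis by (simp add: set_lebesgue_integral_def)
qed

context slicing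
begin

text \<open>Test with the bump on the ball of radius r. The affine map z + G (y - x) contributes
  exactly G times the integral of \<phi>, and u itself contributes H and \<mu>. What remains is the
  approximation error against a gradient of size 4 / r, the oscillation of H, and the \<mu>-mass of
  the ball.\<close>

lemma blow_up_bound:
 assumes r: "r > 0" and sub: "cball x r \<subseteq> U"
 shows "\<bar>G $ i $ j - H x $ i $ j\<bar> * (unit_ball_vol 3 / 16 * r ^ 3)
  <= 4 * (LINT y : ball x r | lebesgue. norm (u y - z - G *v (y - x)) / r)
   + (LBINT y. indicator (ball x r) y * \<bar>H y $ i $ j - H x $ i $ j\<bar>) + measure \<mu> (ball x r)"
proof -
 interpret \<mu>: finite_measure \<mu> by (rule finite_\<mu>)
 obtain \<phi> :: "real^3 => real" and g where T: "test_function U \<phi> g" and p0: "!!y. y \<notin> ball x r ==> \<phi> y = 0"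
  and g0: "!!y. y \<notin> ball x r ==> g y = 0" and p1: "!!y. 0 <= \<phi> y & \<phi> y <= 1" and gn: "!!y. norm (g y) <= 4 / r"
  and ph: "!!y. y \<in> ball x (r / 2) ==> 1 / 2 <= \<phi> y" using quadratic_bump_exists[OF r sub] by blast
 have cg: "continuous_on UNIV g" and der: "!!x. (\<phi> has_derivative (%h. g x \<bullet> h)) (at x)" using T by (auto simp: test_function_def)
 have c\<phi>: "continuous_on UNIV \<phi>" by (intro continuous_at_imp_continuous_on ballI has_derivative_continuous[OF der])
 have [measurable]: "\<phi> \<in> borel_measurable borel" "g \<in> borel_measurable borel" using c\<phi> cg by (auto intro: continuous_borel)
 have ballb[measurable]: "ball x \<rho> \<in> sets borel" for \<rho> by simp
 have out: "y \<notin> cball x r ==> y \<notin> ball x r" for y by auto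
 have i\<phi>: "integrable lborel \<phi>" by (rule integrable_continuous_compact_support[OF compact_cball c\<phi>]) (use p0 out in blast)
 have ig: "integrable lborel (%y. g y $ j)"
  by (rule integrable_continuous_compact_support[OF compact_cball, of _ x r]) (use g0 out cg in \<open>auto intro!: continuous_intros\<close>)
 have igk: "integrable lborel (%y. (y $ k - x $ k) * g y $ j)" for k
  by (rule integrable_continuous_compact_support[OF compact_cball, of _ x r]) (use g0 out cg in \<open>auto intro!: continuous_intros\<close>)
 have zero1: "(LBINT y. g y $ j) = 0" using integral_directional_derivative_0[OF T, of "%_. 1" 1 "axis j 1"] by (simp add: inner_axis)
 \<comment> \<open>The moments of the gradient of \<phi>, from
   \<open>test_function_mult_affine\<close>.\<close>
 have zero2: "(LBINT y. (y $ k - x $ k) * g y $ j) = - (if k = j then 1 else 0) * (LBINT y. \<phi> y)" for k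
 proof -
  have ax: "axis k (1 :: real) $ j = (if k = j then 1 else 0)" by (simp add: axis_def)
  have "(LBINT y. 1 * (((y $ k - x $ k) *\<^sub>R g y + \<phi> y *\<^sub>R axis k 1) \<bullet> axis j 1)) = 0"
   by (rule integral_directional_derivative_0[OF test_function_mult_affine[OF T], where B=1]) simp_all
  then have "(LBINT y. (y $ k - x $ k) * g y $ j + (if k = j then 1 else 0) * \<phi> y) = 0"
   by (simp only: mult_1_left inner_axis inner_real_def mult_1_right vector_add_component vector_scaleR_component
     ax real_scaleR_def mult.commute[of "\<phi> _"])
  then show ?thesis using igk[of k] i\<phi> by (cases "k = j") simp_all
 qed
 define err where "err y = u y - z - G *v (y - x)" for y
 have [measurable]: "err \<in> borel_measurable borel"
 proof -
  have "continuous_on UNIV (%y. z + G *v (y - x))" by (intro continuous_intros linear_continuous_on_compose[of _ _ "(*v) G"] matrix_vector_mul_linear)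
  then have [measurable]: "(%y. z + G *v (y - x)) \<in> borel_measurable borel" by (rule continuous_borel)
  have "err = (%y. u y - (z + G *v (y - x)))" by (simp add: err_def fun_eq_iff)
  then show ?thesis by simp
 qed
 have erri: "err y $ i = u y $ i - z $ i - (G $ i $ 1 * (y $ 1 - x $ 1) + G $ i $ 2 * (y $ 2 - x $ 2) + G $ i $ 3 * (y $ 3 - x $ 3))" for y
  by (simp add: err_def matrix_vector_mult_def sum_3)
 have e: "(%y. err y $ i * g y $ j) = (%y. u y $ i * g y $ j - (z $ i * g y $ j + (G $ i $ 1 * ((y $ 1 - x $ 1) * g y $ j)
   + G $ i $ 2 * ((y $ 2 - x $ 2) * g y $ j) + G $ i $ 3 * ((y $ 3 - x $ 3) * g y $ j))))" by (simp add: fun_eq_iff erri algebra_simps)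
 note I = test_function_integrable[OF T]
 have ierr: "integrable lborel (%y. err y $ i * g y $ j)"
  unfolding e using I(1) ig igk by (intro Bochner_Integration.integrable_diff Bochner_Integration.integrable_add integrable_mult_right)
 have "(LBINT y. err y $ i * g y $ j) = (LBINT y. u y $ i * g y $ j)
  - (z $ i * (LBINT y. g y $ j) + (G $ i $ 1 * (LBINT y. (y $ 1 - x $ 1) * g y $ j)
   + G $ i $ 2 * (LBINT y. (y $ 2 - x $ 2) * g y $ j) + G $ i $ 3 * (LBINT y. (y $ 3 - x $ 3) * g y $ j)))" unfolding e using I(1) ig igk by simp
 also have "... = (LBINT y. u y $ i * g y $ j) + G $ i $ j * (LBINT y. \<phi> y)" unfolding zero1 zero2 using exhaust_3[of j] by auto
 finally have E1: "(LBINT y. err y $ i * g y $ j) = - (LBINT y. \<phi> y * H y $ i $ j) - (LINT y|\<mu>. \<phi> y * \<sigma> y $ i $ j) + G $ i $ j * (LBINT y. \<phi> y)"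
  unfolding parts[OF T] .
 have E2: "(LBINT y. \<phi> y * (H y $ i $ j - H x $ i $ j)) = (LBINT y. \<phi> y * H y $ i $ j) - H x $ i $ j * (LBINT y. \<phi> y)"
  unfolding right_diff_distrib using I(2)[of i j] i\<phi> by simp
 have main: "(G $ i $ j - H x $ i $ j) * (LBINT y. \<phi> y)
  = (LBINT y. err y $ i * g y $ j) + (LBINT y. \<phi> y * (H y $ i $ j - H x $ i $ j)) + (LINT y|\<mu>. \<phi> y * \<sigma> y $ i $ j)"
  unfolding E1 E2 by (simp add: left_diff_distrib)
 have b1: "\<bar>LBINT y. err y $ i * g y $ j\<bar> <= 4 * (LBINT y. indicator (ball x r) y * (norm (err y) / r))"
 proof -
  have ie: "integrable lborel (%y. indicator (ball x r) y * (norm (err y) / r))"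
  proof (rule integrable_dominated)
   have "continuous_on UNIV (%y. 1 + norm (z + G *v (y - x)))"
    by (intro continuous_intros linear_continuous_on_compose[of _ _ "(*v) G"] matrix_vector_mul_linear)
   then have "integrable lborel (%y. indicator (cball x r) y *\<^sub>R (1 + norm (z + G *v (y - x))))"
    by (intro borel_integrable_compact compact_cball) (auto intro: continuous_on_subset)
   then show "integrable lborel (%y. (indicator (cball x r) y *\<^sub>R (1 + norm (z + G *v (y - x)))) / r)" by simp
   show "AE y in lborel. norm (indicator (ball x r) y * (norm (err y) / r))
    <= norm ((indicator (cball x r) y *\<^sub>R (1 + norm (z + G *v (y - x)))) / r)"
   proof (rule AE_I2)
    fix y
    have "err y = u y - (z + G *v (y - x))" by (simp add: err_def)
    then have "norm (err y) <= 1 + norm (z + G *v (y - x))" using norm_triangle_ineq4[of "u y" "z + G *v (y - x)"] u_le_1[of y] by simp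
    then show "norm (indicator (ball x r) y * (norm (err y) / r))
    <= norm ((indicator (cball x r) y *\<^sub>R (1 + norm (z + G *v (y - x)))) / r)" using r by (auto simp: indicator_def divide_right_mono)
   qed
  qed simp
  have "\<bar>LBINT y. err y $ i * g y $ j\<bar> <= (LBINT y. \<bar>err y $ i * g y $ j\<bar>)" by (rule integral_abs_bound)
  also have "... <= (LBINT y. 4 * (indicator (ball x r) y * (norm (err y) / r)))"
  proof (rule integral_mono)
   show "integrable lborel (%y. \<bar>err y $ i * g y $ j\<bar>)" using ierr by simp
   show "integrable lborel (%y. 4 * (indicator (ball x r) y * (norm (err y) / r)))" by (rule integrable_mult_right[OF ie])
   fix y
   show "\<bar>err y $ i * g y $ j\<bar> <= 4 * (indicator (ball x r) y * (norm (err y) / r))"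
   proof (cases "y \<in> ball x r")
    case True
    have "\<bar>g y $ j\<bar> <= 4 / r" using component_le_norm_cart[of "g y" j] gn[of y] by linarith
    then have "\<bar>err y $ i\<bar> * \<bar>g y $ j\<bar> <= norm (err y) * (4 / r)" by (intro mult_mono component_le_norm_cart) auto
    then show ?thesis using True by (simp add: abs_mult mult_ac)
   qed (use g0 in simp)
  qed
  finally show ?thesis by simp
 qed
 have b2: "\<bar>LBINT y. \<phi> y * (H y $ i $ j - H x $ i $ j)\<bar> <= (LBINT y. indicator (ball x r) y * \<bar>H y $ i $ j - H x $ i $ j\<bar>)"
 proof -
  have i1: "integrable lborel (%y. \<phi> y * (H y $ i $ j - H x $ i $ j))" unfolding right_diff_distrib using I(2)[of i j] i\<phi> by simp
  have [measurable]: "(%y. H y $ i $ j) \<in> borel_measurable borel" using H_integrable[of i j] by auto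
  have iball: "integrable lborel (indicat_real (ball x r))"
   using emeasure_bounded_finite[OF bounded_ball, of x r] by (intro integrable_real_indicator) auto
  have i2: "integrable lborel (%y. indicator (ball x r) y * \<bar>H y $ i $ j - H x $ i $ j\<bar>)"
  proof (rule integrable_dominated)
   show "integrable lborel (%y. \<bar>H y $ i $ j\<bar> + \<bar>H x $ i $ j\<bar> * indicat_real (ball x r) y)" using H_integrable[of i j] iball by simp
   show "AE y in lborel. norm (indicator (ball x r) y * \<bar>H y $ i $ j - H x $ i $ j\<bar>) <= norm (\<bar>H y $ i $ j\<bar> + \<bar>H x $ i $ j\<bar> * indicat_real (ball x r) y)"
    by (intro AE_I2) (auto simp: indicator_def)
  qed simp
  have "\<bar>LBINT y. \<phi> y * (H y $ i $ j - H x $ i $ j)\<bar> <= (LBINT y. \<bar>\<phi> y * (H y $ i $ j - H x $ i $ j)\<bar>)" by (rule integral_abs_bound)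
  also have "... <= (LBINT y. indicator (ball x r) y * \<bar>H y $ i $ j - H x $ i $ j\<bar>)"
  proof (rule integral_mono)
   show "integrable lborel (%y. \<bar>\<phi> y * (H y $ i $ j - H x $ i $ j)\<bar>)" using i1 by simp
   fix y
   show "\<bar>\<phi> y * (H y $ i $ j - H x $ i $ j)\<bar> <= indicator (ball x r) y * \<bar>H y $ i $ j - H x $ i $ j\<bar>"
    using p1[of y] p0[of y] by (cases "y \<in> ball x r") (auto simp: abs_mult intro!: mult_left_le_one_le)
  qed (rule i2)
  finally show ?thesis .
 qed
 have b3: "\<bar>LINT y|\<mu>. \<phi> y * \<sigma> y $ i $ j\<bar> <= measure \<mu> (ball x r)"
 proof -
  have "\<bar>LINT y|\<mu>. \<phi> y * \<sigma> y $ i $ j\<bar> <= (LINT y|\<mu>. \<bar>\<phi> y * \<sigma> y $ i $ j\<bar>)" by (rule integral_abs_bound)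
  also have "... <= (LINT y|\<mu>. indicator (ball x r) y)"
  proof (rule integral_mono)
   show "integrable \<mu> (%y. \<bar>\<phi> y * \<sigma> y $ i $ j\<bar>)" using I(3)[of i j] by simp
   show "integrable \<mu> (indicat_real (ball x r))" by (rule \<mu>.integrable_const_bound[where B=1]) auto
   fix y
   have "\<bar>\<phi> y\<bar> * \<bar>\<sigma> y $ i $ j\<bar> <= 1 * 1" using p1[of y] \<sigma>_le_1 by (intro mult_mono) auto
   then show "\<bar>\<phi> y * \<sigma> y $ i $ j\<bar> <= indicator (ball x r) y" using p0[of y] by (cases "y \<in> ball x r") (auto simp: abs_mult)
  qed
  also have "... = measure \<mu> (ball x r)" using sets_\<mu> by (simp add: sets_eq_imp_space_eq)
  finally show ?thesis .
 qed
 \<comment> \<open>\<phi> is at least 1/2 on the ball of half the radius, whose volume is 1/8 of the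
   whole.\<close>
 have low: "unit_ball_vol 3 / 16 * r ^ 3 <= (LBINT y. \<phi> y)"
 proof -
  have ib: "integrable lborel (indicat_real (ball x (r / 2)))"
   using emeasure_bounded_finite[OF bounded_ball, of x "r / 2"] by (intro integrable_real_indicator) auto
  have "unit_ball_vol 3 / 16 * r ^ 3 = 1 / 2 * measure lborel (ball x (r / 2))" using r by (simp add: content_ball power_divide)
  also have "... = (LBINT y. 1 / 2 * indicator (ball x (r / 2)) y)" by simp
  also have "... <= (LBINT y. \<phi> y)"
  proof (rule integral_mono)
   show "integrable lborel (%y. 1 / 2 * indicat_real (ball x (r / 2)) y)" using ib by simp
   show "1 / 2 * indicat_real (ball x (r / 2)) y <= \<phi> y" for y using ph[of y] p1[of y] by (cases "y \<in> ball x (r / 2)") auto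
  qed (rule i\<phi>)
  finally show ?thesis .
 qed
 have "\<bar>G $ i $ j - H x $ i $ j\<bar> * (unit_ball_vol 3 / 16 * r ^ 3) <= \<bar>G $ i $ j - H x $ i $ j\<bar> * (LBINT y. \<phi> y)"
  by (rule mult_left_mono[OF low]) simp
 also have "... = \<bar>(G $ i $ j - H x $ i $ j) * (LBINT y. \<phi> y)\<bar>"
 proof -
  have "0 <= (LBINT y. \<phi> y)" by (rule Bochner_Integration.integral_nonneg) (use p1 in auto)
  then show ?thesis by (simp add: abs_mult)
 qed
 also have "... <= 4 * (LBINT y. indicator (ball x r) y * (norm (err y) / r))
   + (LBINT y. indicator (ball x r) y * \<bar>H y $ i $ j - H x $ i $ j\<bar>) + measure \<mu> (ball x r)" unfolding main using b1 b2 b3 by linarith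
 also have "(LBINT y. indicator (ball x r) y * (norm (err y) / r)) = (LINT y : ball x r | lebesgue. norm (u y - z - G *v (y - x)) / r)"
  by (subst set_lebesgue_integral_borel) (simp_all add: err_def[symmetric])
 finally show ?thesis .
qed

text \<open>In \<open>blow_up_bound\<close> divided by r^3 all three terms vanish in the limit: the
  first by definition of the approximate gradient, the second at Lebesgue points of H, the third
  because \<mu> is singular and so has density zero almost everywhere. The statement covers every G,
  hence also gives uniqueness.\<close>

lemma approx_gradient_AE:
 assumes N: "N \<in> null_sets lborel" "- N \<in> null_sets \<mu>"
 shows "AE x in lborel. x \<in> U --> (\<forall>G. has_approx_gradient u x G --> G = H x)"
proof -
 have bU: "bounded U" "open U" by (simp_all add: bounded_box open_box)
 have Nb: "- N \<in> sets borel" using N(1) by auto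
 have A1: "AE x in lborel. x \<in> - N --> ((%r. measure \<mu> (ball x r) / r ^ 3) \<longlongrightarrow> 0) (at_right 0)"
  using measure_ball_density_zero[OF sets_\<mu> finite_\<mu> Nb] N(2) by (simp add: null_setsD1)
 have A2: "AE x in lborel. \<forall>i\<in>UNIV. \<forall>j\<in>UNIV. x \<in> U -->
  ((%r. (LBINT y. indicator (ball x r) y * \<bar>H y $ i $ j - H x $ i $ j\<bar>) / r ^ 3) \<longlongrightarrow> 0) (at_right 0)"
  by (intro AE_finite_allI finite) (use lebesgue_point_AE[OF H_integrable bU(2,1)] in simp)
 show ?thesis using A1 A2 AE_not_in[OF N(1)]
 proof eventually_elim
  case (elim x)
  show ?case
  proof (intro impI allI)
   fix G assume x: "x \<in> U" and "has_approx_gradient u x G"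
   then obtain z where z: "((%r. (LINT y : ball x r | lebesgue. norm (u y - z - G *v (y - x)) / r)
        / measure lebesgue (ball x r)) \<longlongrightarrow> 0) (at_right 0)" by (auto simp: has_approx_gradient_def)
   define c where "c = unit_ball_vol (3 :: real)"
   have c: "c > 0" by (simp add: c_def)
   obtain d where d: "d > 0" "cball x d \<subseteq> U" using bU(2) x open_contains_cball by blast
   have ev: "\<forall>\<^sub>F r in at_right (0::real). 0 < r & r < d" using d by (auto simp: eventually_at_right intro!: exI[of _ d])
   have "G $ i $ j = H x $ i $ j" for i j
   proof -
    let ?A = "%r. LINT y : ball x r | lebesgue. norm (u y - z - G *v (y - x)) / r"
    let ?B = "%r. LBINT y. indicator (ball x r) y * \<bar>H y $ i $ j - H x $ i $ j\<bar>"
    have lim: "((%r. (16 / c) * (4 * c * (?A r / measure lebesgue (ball x r)) + ?B r / r ^ 3 + measure \<mu> (ball x r) / r ^ 3)) \<longlongrightarrow> (16 / c) * (4 * c * 0 + 0 + 0)) (at_right 0)"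
     by (intro tendsto_intros z) (use elim x in auto)
    have "\<forall>\<^sub>F r in at_right 0. \<bar>G $ i $ j - H x $ i $ j\<bar> <= (16 / c) * (4 * c * (?A r / measure lebesgue (ball x r)) + ?B r / r ^ 3 + measure \<mu> (ball x r) / r ^ 3)"
     using ev
    proof eventually_elim
     case (elim r)
     then have r: "r > 0" "cball x r \<subseteq> U" using d(2) by (auto simp: subset_iff)
     have m: "measure lebesgue (ball x r) = c * r ^ 3" using r by (simp add: content_ball c_def)
     have "\<bar>G $ i $ j - H x $ i $ j\<bar> * (c / 16 * r ^ 3) <= 4 * ?A r + ?B r + measure \<mu> (ball x r)"
      unfolding c_def by (rule blow_up_bound[OF r])
     then have "\<bar>G $ i $ j - H x $ i $ j\<bar> <= (4 * ?A r + ?B r + measure \<mu> (ball x r)) / (c / 16 * r ^ 3)"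
      using c r by (subst pos_le_divide_eq) auto
     also have "... = (16 / c) * (4 * c * (?A r / measure lebesgue (ball x r)) + ?B r / r ^ 3 + measure \<mu> (ball x r) / r ^ 3)"
      unfolding m using c r by (simp add: field_simps)
     finally show ?case .
    qed
    then have "\<bar>G $ i $ j - H x $ i $ j\<bar> <= (16 / c) * (4 * c * 0 + 0 + 0)" by (intro tendsto_lowerbound[OF lim]) auto
    then show ?thesis by simp
   qed
   then show "G = H x" by (simp add: vec_eq_iff)
  qed
 qed
qed

end

section \<open>Independence of the representative, and decomposition of a special BV map\<close>

lemma nth_measurable_iff:
 "(f :: 'a => real ^ 'n) \<in> borel_measurable M \<longleftrightarrow> (\<forall>i. (%x. f x $ i) \<in> borel_measurable M)"
proof
 assume "f \<in> borel_measurable M"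
 then show "\<forall>i. (%x. f x $ i) \<in> borel_measurable M"
  by (auto intro!: measurable_compose[of f M borel "%x. x $ i" for i] continuous_borel continuous_intros)
next
 assume *: "\<forall>i. (%x. f x $ i) \<in> borel_measurable M"
 have "(%x. f x \<bullet> b) \<in> borel_measurable M" if "b \<in> Basis" for b using that * by (auto simp: Basis_vec_def inner_axis)
 then show "f \<in> borel_measurable M" by (subst borel_measurable_euclidean_space) auto
qed

lemma mat_nth_borel: "(%x :: real ^ 'n ^ 'm. x $ i $ j) \<in> borel_measurable borel" by (intro continuous_borel continuous_intros)

lemma set_borel_measurable_nth:
 assumes "(%y. indicat_real \<Omega> y *\<^sub>R (u y :: real ^ 'm)) \<in> borel_measurable M"
 shows "(%y. indicat_real \<Omega> y * u y $ i) \<in> borel_measurable M" using assms unfolding nth_measurable_iff by simp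

lemma average_cong_AE:
 fixes u v :: "real ^ 'n => real ^ 'm"
 assumes ae: "AE y in lebesgue. y \<in> \<Omega> --> u y = v y"
  and mu: "(%y. indicat_real \<Omega> y *\<^sub>R u y) \<in> borel_measurable lebesgue"
  and mv: "(%y. indicat_real \<Omega> y *\<^sub>R v y) \<in> borel_measurable lebesgue"
  and c: "continuous_on UNIV c" and B: "ball x r \<subseteq> \<Omega>"
 shows "(LINT y : ball x r | lebesgue. norm (u y - c y) / k) = (LINT y : ball x r | lebesgue. norm (v y - c y) / k)"
 unfolding set_lebesgue_integral_def
proof (rule integral_cong_AE)
 have [measurable]: "c \<in> borel_measurable lebesgue" by (rule measurable_completion) (use c in \<open>simp add: continuous_borel\<close>)
 have [measurable]: "ball x r \<in> sets lebesgue" by simp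
 have e: "indicat_real (ball x r) y *\<^sub>R (norm (w y - c y) / k) = indicat_real (ball x r) y *\<^sub>R (norm (indicat_real \<Omega> y *\<^sub>R w y - c y) / k)" for w y
  using B by (auto simp: indicator_def)
 show "(%y. indicat_real (ball x r) y *\<^sub>R (norm (u y - c y) / k)) \<in> borel_measurable lebesgue" unfolding e[of _ u] using mu by measurable
 show "(%y. indicat_real (ball x r) y *\<^sub>R (norm (v y - c y) / k)) \<in> borel_measurable lebesgue" unfolding e[of _ v] using mv by measurable
 show "AE y in lebesgue. indicat_real (ball x r) y *\<^sub>R (norm (u y - c y) / k) = indicat_real (ball x r) y *\<^sub>R (norm (v y - c y) / k)"
  using ae by eventually_elim (use B in \<open>auto simp: indicator_def\<close>)
qed

text \<open>Approximate limits and gradients are limits of averages over small balls, and a ball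
  inside \<Omega> does not see a null set. Measurability of both maps enters because the integrals
  would otherwise take default values.\<close>

lemma approx_cong_AE:
 fixes u v :: "real ^ 'n => real ^ 'm"
 assumes op: "open \<Omega>" and x: "x \<in> \<Omega>" and ae: "AE y in lebesgue. y \<in> \<Omega> --> u y = v y"
  and mu: "(%y. indicat_real \<Omega> y *\<^sub>R u y) \<in> borel_measurable lebesgue"
  and mv: "(%y. indicat_real \<Omega> y *\<^sub>R v y) \<in> borel_measurable lebesgue"
 shows "has_approx_limit u x z \<longleftrightarrow> has_approx_limit v x z" "has_approx_gradient u x G \<longleftrightarrow> has_approx_gradient v x G"
proof -
 obtain d where d: "d > 0" "ball x d \<subseteq> \<Omega>" using op x open_contains_ball by blast
 have ev: "\<forall>\<^sub>F r in at_right (0::real). 0 < r & r < d" using d by (auto simp: eventually_at_right intro!: exI[of _ d])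
 have eq: "(LINT y : ball x r | lebesgue. norm (u y - c y) / k) = (LINT y : ball x r | lebesgue. norm (v y - c y) / k)"
  if "r < d" "continuous_on UNIV c" for r c k
  by (rule average_cong_AE[OF ae mu mv that(2)]) (use d(2) that(1) in \<open>auto simp: subset_iff\<close>)
 have 1: "has_approx_limit u x z \<longleftrightarrow> has_approx_limit v x z" for z unfolding has_approx_limit_def
 proof (rule tendsto_cong, use ev in eventually_elim)
  case (elim r)
  then show ?case using eq[of r "%_. z" 1] by simp
 qed
 show "has_approx_limit u x z \<longleftrightarrow> has_approx_limit v x z" by (rule 1)
 have 2: "((%r. (LINT y : ball x r | lebesgue. norm (u y - z - G *v (y - x)) / r) / measure lebesgue (ball x r)) \<longlongrightarrow> 0) (at_right 0)
  \<longleftrightarrow> ((%r. (LINT y : ball x r | lebesgue. norm (v y - z - G *v (y - x)) / r) / measure lebesgue (ball x r)) \<longlongrightarrow> 0) (at_right 0)" for z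
 proof (rule tendsto_cong, use ev in eventually_elim)
  case (elim r)
  have c: "continuous_on UNIV (%y. z + G *v (y - x))"
   by (intro continuous_intros linear_continuous_on_compose[of _ _ "(*v) G"] matrix_vector_mul_linear)
  show ?case using eq[OF _ c, of r r] elim by (simp add: diff_diff_eq)
 qed
 show "has_approx_gradient u x G \<longleftrightarrow> has_approx_gradient v x G" unfolding has_approx_gradient_def 1 2 ..
qed

lemma AE_lebesgue_on_iff:
 assumes "open (\<Omega> :: 'a::euclidean_space set)"
 shows "(AE x in lebesgue_on \<Omega>. P x) \<longleftrightarrow> (AE x in lborel. x \<in> \<Omega> --> P x)"
 using assms by (subst AE_restrict_space_iff) (auto simp: AE_completion_iff)

lemma approx_gradient_cong_AE:
 fixes u v :: "real ^ 'n => real ^ 'm"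
 assumes op: "open \<Omega>" and ae: "AE y in lebesgue. y \<in> \<Omega> --> u y = v y"
  and mu: "(%y. indicat_real \<Omega> y *\<^sub>R u y) \<in> borel_measurable lebesgue"
  and mv: "(%y. indicat_real \<Omega> y *\<^sub>R v y) \<in> borel_measurable lebesgue"
 shows "x \<in> \<Omega> ==> approx_gradient u x = approx_gradient v x"
  "approx_discontinuity_set \<Omega> u = approx_discontinuity_set \<Omega> v"
proof -
 note C = approx_cong_AE[OF op _ ae mu mv]
 have "has_approx_gradient u x = has_approx_gradient v x" if "x \<in> \<Omega>" by (intro ext C(2) that)
 then show "x \<in> \<Omega> ==> approx_gradient u x = approx_gradient v x" by (simp add: approx_gradient_def)
 show "approx_discontinuity_set \<Omega> u = approx_discontinuity_set \<Omega> v" using C(1) unfolding approx_discontinuity_set_def by blast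
qed

lemma SBV2_measurable:
 assumes "u \<in> SBV2 \<Omega> T" shows "(%y. indicat_real \<Omega> y *\<^sub>R u y) \<in> borel_measurable lebesgue"
 using assms by (auto simp: SBV2_def SBV_def BV_def set_integrable_def)

lemma measurable_cong_AE_on:
 fixes u v :: "real ^ 'n => real ^ 'm"
 assumes mu: "(%y. indicat_real \<Omega> y *\<^sub>R u y) \<in> borel_measurable lebesgue" and ae: "AE y in lebesgue. y \<in> \<Omega> --> u y = v y"
 shows "(%y. indicat_real \<Omega> y *\<^sub>R v y) \<in> borel_measurable lebesgue"
 by (rule borel_measurable_AE[OF mu]) (use ae in eventually_elim, auto simp: indicator_def)

lemma SBV2_cong_AE:
 fixes u v :: "real ^ 'n => real ^ 'm"
 assumes op: "open \<Omega>" and u: "u \<in> SBV2 \<Omega> T" and ae: "AE y in lebesgue. y \<in> \<Omega> --> u y = v y"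
 shows "v \<in> SBV2 \<Omega> T"
proof -
 have mu: "(%y. indicat_real \<Omega> y *\<^sub>R u y) \<in> borel_measurable lebesgue" by (rule SBV2_measurable[OF u])
 have mv: "(%y. indicat_real \<Omega> y *\<^sub>R v y) \<in> borel_measurable lebesgue" by (rule measurable_cong_AE_on[OF mu ae])
 note C = approx_cong_AE[OF op _ ae mu mv] approx_gradient_cong_AE[OF op ae mu mv]
 have der: "has_measure_derivative \<Omega> v \<mu> \<sigma>" if "has_measure_derivative \<Omega> u \<mu> \<sigma>" for \<mu> \<sigma>
 proof -
  have eq: "(LINT x : \<Omega> | lebesgue. u x $ i * g x $ j) = (LINT x : \<Omega> | lebesgue. v x $ i * g x $ j)"
   if "test_function \<Omega> \<phi> g" for \<phi> g i j unfolding set_lebesgue_integral_def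
  proof (rule integral_cong_AE)
   have "continuous_on UNIV (%x. g x $ j)" using that by (auto simp: test_function_def intro!: continuous_intros)
   then have [measurable]: "(%x. g x $ j) \<in> borel_measurable lebesgue" by (intro measurable_completion) (simp add: continuous_borel)
   have "(%x. (indicat_real \<Omega> x * w x $ i) * g x $ j) \<in> borel_measurable lebesgue"
    if "(%y. indicat_real \<Omega> y *\<^sub>R w y) \<in> borel_measurable lebesgue" for w :: "real ^ 'n => real ^ 'm"
    using set_borel_measurable_nth[OF that] by measurable
   then show "(%x. indicat_real \<Omega> x *\<^sub>R (u x $ i * g x $ j)) \<in> borel_measurable lebesgue"
     "(%x. indicat_real \<Omega> x *\<^sub>R (v x $ i * g x $ j)) \<in> borel_measurable lebesgue" using mu mv by (simp_all add: mult.assoc)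
   show "AE x in lebesgue. indicat_real \<Omega> x *\<^sub>R (u x $ i * g x $ j) = indicat_real \<Omega> x *\<^sub>R (v x $ i * g x $ j)"
    using ae by eventually_elim (auto simp: indicator_def)
  qed
  have "(LINT x : \<Omega> | lebesgue. v x $ i * g x $ j) = - (LINT x | \<mu>. \<phi> x * \<sigma> x $ i $ j)"
   if t: "test_function \<Omega> \<phi> g" for \<phi> g i j
   using \<open>has_measure_derivative \<Omega> u \<mu> \<sigma>\<close> t eq[OF t, of i j] by (simp add: has_measure_derivative_def)
  then show ?thesis using that unfolding has_measure_derivative_def by blast
 qed
 have "set_integrable lebesgue \<Omega> v" unfolding set_integrable_def
 proof (rule integrable_cong_AE_imp)
  show "integrable lebesgue (%x. indicat_real \<Omega> x *\<^sub>R u x)" using u by (auto simp: SBV2_def SBV_def BV_def set_integrable_def)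
  show "AE x in lebesgue. indicat_real \<Omega> x *\<^sub>R u x = indicat_real \<Omega> x *\<^sub>R v x"
   using ae by eventually_elim (auto simp: indicator_def)
 qed (rule mv)
 moreover obtain \<mu> \<sigma> \<mu>a \<mu>s where "has_measure_derivative \<Omega> u \<mu> \<sigma>" "lebesgue_decomposition \<mu> \<mu>a \<mu>s"
  "\<Omega> - approx_discontinuity_set \<Omega> u \<in> null_sets \<mu>s" using u by (auto simp: SBV2_def SBV_def)
 ultimately have vSBV: "v \<in> SBV \<Omega>" unfolding SBV_def BV_def mem_Collect_eq C(4)[symmetric] using der by blast
 have "AE x in lebesgue_on \<Omega>. v x \<in> T"
 proof -
  have "AE x in lebesgue_on \<Omega>. u x \<in> T" using u by (auto simp: SBV2_def)
  moreover have "AE x in lebesgue_on \<Omega>. u x = v x" unfolding AE_lebesgue_on_iff[OF op] using ae by (simp add: AE_completion_iff)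
  ultimately show ?thesis by eventually_elim simp
 qed
 moreover have "AE x in lebesgue_on \<Omega>. \<exists>G. has_approx_gradient v x G"
 proof -
  have "AE x in lebesgue_on \<Omega>. \<exists>G. has_approx_gradient u x G" using u by (auto simp: SBV2_def)
  then show ?thesis unfolding AE_lebesgue_on_iff[OF op] by eventually_elim (use C(2) in blast)
 qed
 moreover have "set_integrable lebesgue \<Omega> (%x. (norm (approx_gradient v x))\<^sup>2)"
 proof -
  have "(%x. indicat_real \<Omega> x *\<^sub>R (norm (approx_gradient v x))\<^sup>2) = (%x. indicat_real \<Omega> x *\<^sub>R (norm (approx_gradient u x))\<^sup>2)"
   using C(3) by (auto simp: fun_eq_iff indicator_def)
  then show ?thesis using u by (auto simp: SBV2_def set_integrable_def)
 qed
 moreover have "hausdorff (CARD('n) - 1) (approx_discontinuity_set \<Omega> v) < \<infinity>"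
  using u unfolding C(4)[symmetric] by (simp add: SBV2_def)
 ultimately show ?thesis using vSBV unfolding SBV2_def by blast
qed

text \<open>Inner regularity exhausts S up to measure 1 / (n + 1) by compact sets.\<close>

lemma sigma_compact_concentration:
 fixes \<nu> :: "'a::euclidean_space measure"
 assumes sets: "sets \<nu> = sets borel" and fin: "finite_measure \<nu>" and S: "S \<in> sets borel" "- S \<in> null_sets \<nu>"
 obtains K where "!!n. compact (K n)" "(\<Union>n. K n) \<subseteq> S" "- (\<Union>n::nat. K n) \<in> null_sets \<nu>"
proof -
 interpret finite_measure \<nu> by (rule fin)
 note [simp] = sets
 have "\<exists>K. K \<subseteq> S & compact K & emeasure \<nu> S < emeasure \<nu> K + ennreal (1 / real (Suc n))" for n
 proof (cases "emeasure \<nu> S = 0")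
  \<comment> \<open>Separate because for mass 0 truncated subtraction of 1 / (n + 1) does not give
    anything strictly smaller.\<close>
  case True then show ?thesis by (intro exI[of _ "{}"]) simp
 next
  case False
  have "emeasure \<nu> S - ennreal (1 / real (Suc n)) < emeasure \<nu> S"
   using False by (intro ennreal_between) (simp_all add: emeasure_eq_measure zero_less_iff_neq_zero)
  also have "emeasure \<nu> S = (SUP K \<in> {K. K \<subseteq> S & compact K}. emeasure \<nu> K)" by (rule inner_regular[OF sets _ S(1)]) simp
  finally obtain K where K: "K \<subseteq> S" "compact K" "emeasure \<nu> S - ennreal (1 / real (Suc n)) < emeasure \<nu> K"
   unfolding less_SUP_iff by auto
  have "emeasure \<nu> S < emeasure \<nu> K + ennreal (1 / real (Suc n))"
  proof -
   have "ennreal (measure \<nu> S - 1 / real (Suc n)) < ennreal (measure \<nu> K)"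
    using K(3) by (simp add: emeasure_eq_measure ennreal_minus del: of_nat_Suc)
   then have "measure \<nu> S - 1 / real (Suc n) < measure \<nu> K" by (rule contrapos_pp) (simp add: not_less ennreal_leI del: of_nat_Suc)
   then have "measure \<nu> S < measure \<nu> K + 1 / real (Suc n)" by linarith
   then show ?thesis by (simp add: emeasure_eq_measure ennreal_less_iff ennreal_plus[symmetric] del: ennreal_plus of_nat_Suc)
  qed
  then show ?thesis using K by blast
 qed
 then obtain K where K: "!!n. K n \<subseteq> S" "!!n. compact (K n)" "!!n. emeasure \<nu> S < emeasure \<nu> (K n) + ennreal (1 / real (Suc n))"
  by metis
 have Kb: "K n \<in> sets borel" for n using K(2) by (rule borel_compact)
 have le: "measure \<nu> (S - (\<Union>n. K n)) <= 1 / real (Suc n)" for n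
 proof -
  have "measure \<nu> (S - (\<Union>n. K n)) <= measure \<nu> (S - K n)" using S Kb by (intro finite_measure_mono) auto
  also have "... = measure \<nu> S - measure \<nu> (K n)" using S Kb K(1) by (intro finite_measure_Diff) auto
  also have "... <= 1 / real (Suc n)"
   using K(3)[of n] by (simp add: emeasure_eq_measure ennreal_less_iff ennreal_plus[symmetric] del: ennreal_plus of_nat_Suc)
  finally show ?thesis .
 qed
 have "measure \<nu> (S - (\<Union>n. K n)) <= 0"
 proof (rule field_le_epsilon)
  fix e :: real assume "e > 0"
  then obtain n where "1 / real (Suc n) < e" by (metis nat_approx_posE)
  then show "measure \<nu> (S - (\<Union>n. K n)) <= 0 + e" using le[of n] by linarith
 qed
 then have "measure \<nu> (S - (\<Union>n. K n)) = 0" using measure_nonneg[of \<nu> "S - (\<Union>n. K n)"] by linarith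
 then have "S - (\<Union>n. K n) \<in> null_sets \<nu>" using S Kb by (intro null_setsI) (auto simp: emeasure_eq_measure)
 then have "(S - (\<Union>n. K n)) \<union> - S \<in> null_sets \<nu>" using S(2) by (rule null_sets.Un)
 moreover have "(S - (\<Union>n. K n)) \<union> - S = - (\<Union>n. K n)" using K(1) by blast
 ultimately show thesis using K by (intro that[of K]) auto
qed

text \<open>Splits |Du| along the Lebesgue null set N that carries its singular part: off N it has a
  density h, which times \<sigma> gives H, and on N it lives on the discontinuity set, where a
  sigma-compact core is selected. The approximate gradient of u is then identified with H.\<close>

lemma SBV2_slicing:
 assumes u: "u \<in> SBV2 (box (vector [- L1, - L2, z0]) (vector [L1, L2, z1])) T" (is "u \<in> SBV2 ?U T")
  and T: "closed T" "T \<subseteq> cball 0 1" "0 \<in> T"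
 shows "\<exists>w H \<mu> \<sigma> K. slicing L1 L2 z0 z1 w H \<mu> \<sigma> K & (\<forall>x. w x \<in> T) & (AE x in lborel. x \<in> ?U --> u x = w x)
  & (\<Union>n. K n) \<subseteq> approx_discontinuity_set ?U u & (AE x in lborel. x \<in> ?U --> approx_gradient u x = H x)
  & (AE x in lborel. x \<in> ?U --> (\<forall>G. has_approx_gradient u x G --> G = H x))"
proof -
 have op: "open ?U" by (rule open_box)
 have mu: "(%y. indicat_real ?U y *\<^sub>R u y) \<in> borel_measurable lebesgue" by (rule SBV2_measurable[OF u])
 have "\<exists>g\<in>borel_measurable lborel. AE x in lborel. indicat_real ?U x * u x $ i = g x" for i
  by (rule completion_ex_borel_measurable_real) (rule set_borel_measurable_nth[OF mu])
 then have "\<exists>f. \<forall>i. f i \<in> borel_measurable lborel & (AE x in lborel. indicat_real ?U x * u x $ i = f i x)"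
  by (intro choice allI) blast
 then obtain f where f': "\<forall>i. f i \<in> borel_measurable lborel & (AE x in lborel. indicat_real ?U x * u x $ i = f i x)" ..
 then have f: "!!i. f i \<in> borel_measurable lborel" "!!i. AE x in lborel. indicat_real ?U x * u x $ i = f i x" by auto
 define w0 where "w0 x = (\<chi> i. f i x)" for x
 \<comment> \<open>The value 0, an element of T, is substituted on a null set so that the constraint
   holds at every point and therefore on every line.\<close>
 define w where "w x = (if w0 x \<in> T then w0 x else 0)" for x
 have [measurable]: "w0 \<in> borel_measurable borel" unfolding nth_measurable_iff w0_def using f(1) by simp
 have [measurable]: "T \<in> sets borel" using T by simp
 have wb[measurable]: "w \<in> borel_measurable borel" unfolding w_def[abs_def] by measurable
 have wT: "w x \<in> T" for x using T by (simp add: w_def)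
 have aef: "AE x in lborel. \<forall>i\<in>UNIV. indicat_real ?U x * u x $ i = f i x" by (intro AE_finite_allI finite f(2))
 have "AE x in lborel. x \<in> ?U --> u x \<in> T" using u by (simp add: SBV2_def AE_lebesgue_on_iff[OF op])
 with aef have aew: "AE x in lborel. x \<in> ?U --> u x = w x"
 proof eventually_elim
  case (elim x)
  show ?case
  proof
   assume "x \<in> ?U"
   then have "w0 x = u x" using elim(1) by (simp add: w0_def vec_eq_iff)
   then show "u x = w x" using elim(2) \<open>x \<in> ?U\<close> by (simp add: w_def)
  qed
 qed
 have aew': "AE x in lebesgue. x \<in> ?U --> u x = w x" using aew by (simp add: AE_completion_iff)
 have mw: "(%y. indicat_real ?U y *\<^sub>R w y) \<in> borel_measurable lebesgue" by (rule measurable_cong_AE_on[OF mu aew'])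
 obtain \<mu> \<sigma>0 \<mu>a \<mu>s where D: "has_measure_derivative ?U u \<mu> \<sigma>0" and L: "lebesgue_decomposition \<mu> \<mu>a \<mu>s"
  and Sn: "?U - approx_discontinuity_set ?U u \<in> null_sets \<mu>s" using u by (auto simp: SBV2_def SBV_def)
 have s\<mu>: "sets \<mu> = sets borel" "sets \<mu>a = sets borel" "sets \<mu>s = sets borel"
  using D L by (auto simp: has_measure_derivative_def lebesgue_decomposition_def)
 note [measurable_cong] = s\<mu>
 have sp: "space \<mu> = UNIV" "space \<mu>a = UNIV" "space \<mu>s = UNIV" using s\<mu> by (auto dest: sets_eq_imp_space_eq)
 interpret \<mu>: finite_measure \<mu> using D by (simp add: has_measure_derivative_def)
 have add: "emeasure \<mu> A = emeasure \<mu>a A + emeasure \<mu>s A" if "A \<in> sets borel" for A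
  using L that by (auto simp: lebesgue_decomposition_def)
 have fin: "finite_measure \<mu>a" "finite_measure \<mu>s"
  using add[of UNIV] \<mu>.emeasure_finite[of UNIV] sp by (auto intro!: finite_measureI simp: top_unique)
 interpret \<mu>a: finite_measure \<mu>a by (rule fin)
 interpret \<mu>s: finite_measure \<mu>s by (rule fin)
 obtain N where N: "N \<in> null_sets lborel" "- N \<in> null_sets \<mu>s" using L by (auto simp: lebesgue_decomposition_def)
 have Nb[measurable]: "N \<in> sets borel" using N(1) by auto
 have aN: "emeasure \<mu>a N = 0" using L N(1) by (auto simp: lebesgue_decomposition_def absolutely_continuous_def)
 \<comment> \<open>Both parts of |Du| become restrictions of the one measure \<mu>, so integrals
   against \<mu> can be split by the indicator of N.\<close>
 have es: "\<mu>s = density \<mu> (indicator N)"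
 proof (rule measure_eqI)
  fix A assume "A \<in> sets \<mu>s"
  then have A[measurable]: "A \<in> sets borel" using s\<mu> by simp
  have "emeasure (density \<mu> (indicator N)) A = emeasure \<mu> (N \<inter> A)"
   by (subst emeasure_density) (auto simp: s\<mu> simp flip: indicator_inter_arith)
  also have "... = emeasure \<mu>s (N \<inter> A)" using add[of "N \<inter> A"] aN emeasure_mono[of "N \<inter> A" N \<mu>a] by (simp add: s\<mu>)
  also have "... = emeasure \<mu>s A"
  proof (rule emeasure_eq_AE)
   show "AE x in \<mu>s. x \<in> N \<inter> A \<longleftrightarrow> x \<in> A" using AE_not_in[OF N(2)] by eventually_elim auto
  qed (auto simp: s\<mu>)
  finally show "emeasure \<mu>s A = emeasure (density \<mu> (indicator N)) A" by simp
 qed (simp add: s\<mu>)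
 have ea: "\<mu>a = density \<mu> (indicator (- N))"
 proof (rule measure_eqI)
  fix A assume "A \<in> sets \<mu>a"
  then have A[measurable]: "A \<in> sets borel" using s\<mu> by simp
  have "emeasure (density \<mu> (indicator (- N))) A = emeasure \<mu> (- N \<inter> A)"
   by (subst emeasure_density) (auto simp: s\<mu> simp flip: indicator_inter_arith)
  also have "... = emeasure \<mu>a (- N \<inter> A)"
   using add[of "- N \<inter> A"] N(2) emeasure_mono[of "- N \<inter> A" "- N" \<mu>s] by (auto simp: s\<mu> dest: null_setsD1)
  also have "... = emeasure \<mu>a A"
  proof (rule emeasure_eq_AE)
   have "N \<in> null_sets \<mu>a" using aN by (simp add: null_sets_def s\<mu>)
   from AE_not_in[OF this] show "AE x in \<mu>a. x \<in> - N \<inter> A \<longleftrightarrow> x \<in> A" by eventually_elim auto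
  qed (auto simp: s\<mu>)
  finally show "emeasure \<mu>a A = emeasure (density \<mu> (indicator (- N))) A" by simp
 qed (simp add: s\<mu>)
 obtain h0 where h0[measurable]: "h0 \<in> borel_measurable lborel" "density lborel h0 = \<mu>a"
  using sigma_finite_measure.Radon_Nikodym[OF sigma_finite_lborel, of \<mu>a] L by (auto simp: lebesgue_decomposition_def)
 define h where "h x = enn2real (h0 x)" for x
 have hb[measurable]: "h \<in> borel_measurable borel" unfolding h_def[abs_def] using h0(1) by simp
 have h0fin: "(\<integral>\<^sup>+x. h0 x \<partial>lborel) < \<infinity>"
 proof -
  have "(\<integral>\<^sup>+x. h0 x \<partial>lborel) = emeasure (density lborel h0) UNIV" by (simp add: emeasure_density)
  then have "(\<integral>\<^sup>+x. h0 x \<partial>lborel) = emeasure \<mu>a UNIV" unfolding h0(2) .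
  then show ?thesis by (simp add: \<mu>a.emeasure_eq_measure)
 qed
 have "AE x in lborel. h0 x ~= \<infinity>" using h0fin by (intro nn_integral_PInf_AE) auto
 then have hh0: "AE x in lborel. h0 x = ennreal (h x)" by eventually_elim (auto simp: h_def less_top)
 have \<mu>ah: "\<mu>a = density lborel (%x. ennreal (h x))" unfolding h0(2)[symmetric] by (rule density_cong) (use hh0 in auto)
 have hint: "integrable lborel h"
 proof (rule integrableI_bounded)
  have "(\<integral>\<^sup>+x. ennreal (norm (h x)) \<partial>lborel) = (\<integral>\<^sup>+x. h0 x \<partial>lborel)"
   by (rule nn_integral_cong_AE) (use hh0 in eventually_elim, simp add: h_def)
  then show "(\<integral>\<^sup>+x. ennreal (norm (h x)) \<partial>lborel) < \<infinity>" using h0fin by simp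
 qed simp
 have \<sigma>0b[measurable]: "\<sigma>0 \<in> borel_measurable borel" using D by (simp add: has_measure_derivative_def)
 \<comment> \<open>Norm 1 is known only \<mu>-almost everywhere; the default 0 makes the entries
   bounded by 1 everywhere.\<close>
 define \<sigma> where "\<sigma> x = (if norm (\<sigma>0 x) = 1 then \<sigma>0 x else 0)" for x
 have \<sigma>b[measurable]: "\<sigma> \<in> borel_measurable borel" unfolding \<sigma>_def[abs_def] by measurable
 have nth_b: "(%x. \<sigma> x $ i $ j) \<in> borel_measurable borel" for i j by (rule measurable_compose[OF \<sigma>b mat_nth_borel])
 have [measurable]: "(%x. \<sigma> x $ i $ j) \<in> borel_measurable borel" for i j by (rule nth_b)
 have \<sigma>1: "\<bar>\<sigma> x $ i $ j\<bar> <= 1" for x i j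
 proof -
  have "\<bar>\<sigma> x $ i $ j\<bar> <= norm (\<sigma> x $ i)" by (rule component_le_norm_cart)
  also have "... <= norm (\<sigma> x)" by (rule Finite_Cartesian_Product.norm_nth_le)
  also have "... <= 1" by (simp add: \<sigma>_def)
  finally show ?thesis .
 qed
 have ae\<sigma>: "AE x in \<mu>. \<sigma>0 x = \<sigma> x"
 proof -
  have "AE x in \<mu>. norm (\<sigma>0 x) = 1" using D by (simp add: has_measure_derivative_def)
  then show ?thesis by eventually_elim (simp add: \<sigma>_def)
 qed
 define H where "H x = h x *\<^sub>R \<sigma> x" for x
 define S where "S = approx_discontinuity_set ?U u"
 have SU: "S \<subseteq> ?U" by (auto simp: S_def approx_discontinuity_set_def)
 have Un: "- ?U \<in> null_sets \<mu>s"
 proof -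
  have "- ?U \<in> null_sets \<mu>" using D by (simp add: has_measure_derivative_def)
  then have "emeasure \<mu> (- ?U) = 0" by auto
  then have "emeasure \<mu>s (- ?U) = 0" using add[of "- ?U"] by simp
  then show ?thesis by (simp add: null_sets_def s\<mu>)
 qed
 have Sc: "- S \<in> null_sets \<mu>s"
 proof -
  have "(?U - S) \<union> - ?U \<in> null_sets \<mu>s" using Sn Un unfolding S_def by (rule null_sets.Un)
  moreover have "(?U - S) \<union> - ?U = - S" using SU by blast
  ultimately show ?thesis by simp
 qed
 \<comment> \<open>Measurability of the discontinuity set is read off from membership of its
   complement in \<open>null_sets\<close>.\<close>
 have Sb: "S \<in> sets borel"
 proof -
  have "- S \<in> sets borel" using Sc s\<mu> by auto
  then show ?thesis using borel_comp[of "- S"] by simp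
 qed
 obtain K where K: "!!n. compact (K n)" "(\<Union>n. K n) \<subseteq> S" "- (\<Union>n::nat. K n) \<in> null_sets \<mu>s"
  using sigma_compact_concentration[OF s\<mu>(3) fin(2) Sb Sc] by blast
 have Hint: "integrable lborel (%x. H x $ i $ j)" for i j
 proof (rule integrable_dominated[OF hint])
  show "AE x in lborel. norm (H x $ i $ j) <= norm (h x)" using \<sigma>1 by (auto simp: H_def abs_mult intro!: mult_right_le_one_le)
  show "(%x. H x $ i $ j) \<in> borel_measurable lborel" by (simp add: H_def)
 qed
 have parts: "(LBINT x. w x $ i * g x $ j) = - (LBINT x. \<phi> x * H x $ i $ j) - (LINT x|\<mu>s. \<phi> x * \<sigma> x $ i $ j)"
  if t: "test_function ?U \<phi> g" for \<phi> g i j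
 proof -
  obtain C M where C: "compact C" "C \<subseteq> ?U" "!!x. x \<notin> C ==> \<phi> x = 0" "!!x. x \<notin> C ==> g x = 0"
   "M \<ge> 0" "!!x. \<bar>\<phi> x\<bar> <= M" "!!x. norm (g x) <= M" "continuous_on UNIV \<phi>" "continuous_on UNIV g"
   using test_function_facts[OF t] by blast
  have [measurable]: "\<phi> \<in> borel_measurable borel" "(%x. g x $ j) \<in> borel_measurable borel"
   using C by (auto intro!: continuous_borel continuous_intros)
  have [measurable]: "(%x. w x $ i) \<in> borel_measurable borel" using wb unfolding nth_measurable_iff by blast
  have "(LINT x : ?U | lebesgue. u x $ i * g x $ j) = (LINT x|lebesgue. w x $ i * g x $ j)" unfolding set_lebesgue_integral_def
  proof (rule integral_cong_AE)
   have [measurable]: "(%x. g x $ j) \<in> borel_measurable lebesgue" by (rule measurable_completion) simp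
   have "(%x. (indicat_real ?U x * u x $ i) * g x $ j) \<in> borel_measurable lebesgue" using set_borel_measurable_nth[OF mu] by measurable
   then show "(%x. indicat_real ?U x *\<^sub>R (u x $ i * g x $ j)) \<in> borel_measurable lebesgue" by (simp add: mult.assoc)
   show "(%x. w x $ i * g x $ j) \<in> borel_measurable lebesgue" by (rule measurable_completion) simp
   show "AE x in lebesgue. indicat_real ?U x *\<^sub>R (u x $ i * g x $ j) = w x $ i * g x $ j" using aew'
   proof eventually_elim
    case (elim x)
    show ?case
    proof (cases "x \<in> ?U")
     case False
     then have "g x = 0" using C(2,4) by blast
     then show ?thesis by simp
    qed (use elim in simp)
   qed
  qed
  also have "... = (LBINT x. w x $ i * g x $ j)" by (rule integral_completion) simp
  finally have 1: "(LBINT x. w x $ i * g x $ j) = - (LINT x|\<mu>. \<phi> x * \<sigma>0 x $ i $ j)"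
   using D t by (simp add: has_measure_derivative_def)
  have 2: "(LINT x|\<mu>. \<phi> x * \<sigma>0 x $ i $ j) = (LINT x|\<mu>. \<phi> x * \<sigma> x $ i $ j)"
  proof (rule integral_cong_AE)
   show "AE x in \<mu>. \<phi> x * \<sigma>0 x $ i $ j = \<phi> x * \<sigma> x $ i $ j" using ae\<sigma> by eventually_elim simp
   have [measurable]: "(%x. \<sigma>0 x $ i $ j) \<in> borel_measurable borel" by (rule measurable_compose[OF \<sigma>0b mat_nth_borel])
   show "(%x. \<phi> x * \<sigma>0 x $ i $ j) \<in> borel_measurable \<mu>" by measurable
  qed measurable
  have bd: "\<bar>\<phi> x * \<sigma> x $ i $ j\<bar> <= M * 1" for x unfolding abs_mult using C(5,6) \<sigma>1 by (intro mult_mono) auto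
  have i\<mu>: "integrable \<mu> (%x. \<phi> x * \<sigma> x $ i $ j)" by (rule \<mu>.integrable_const_bound[where B="M * 1"]) (use bd in auto)
  have iA: "integrable \<mu> (%x. indicator A x * (\<phi> x * \<sigma> x $ i $ j))" if [measurable]: "A \<in> sets borel" for A
   by (rule integrable_dominated[OF i\<mu>]) (auto simp: indicator_def)
  have "(LINT x|\<mu>. \<phi> x * \<sigma> x $ i $ j) = (LINT x|\<mu>. indicator N x * (\<phi> x * \<sigma> x $ i $ j) + indicator (- N) x * (\<phi> x * \<sigma> x $ i $ j))"
   by (intro lint_cong) (auto simp: indicator_def)
  also have "... = (LINT x|\<mu>. indicator N x * (\<phi> x * \<sigma> x $ i $ j)) + (LINT x|\<mu>. indicator (- N) x * (\<phi> x * \<sigma> x $ i $ j))"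
   using iA[of N] iA[of "- N"] by simp
  also have "(LINT x|\<mu>. indicator N x * (\<phi> x * \<sigma> x $ i $ j)) = (LINT x|\<mu>s. \<phi> x * \<sigma> x $ i $ j)"
  proof -
   have "\<mu>s = density \<mu> (%x. ennreal (indicator N x))" unfolding es by (simp add: ennreal_indicator)
   then show ?thesis by (simp add: integral_density)
  qed
  also have "(LINT x|\<mu>. indicator (- N) x * (\<phi> x * \<sigma> x $ i $ j)) = (LINT x|\<mu>a. \<phi> x * \<sigma> x $ i $ j)"
  proof -
   have "\<mu>a = density \<mu> (%x. ennreal (indicator (- N) x))" unfolding ea by (simp add: ennreal_indicator)
   then show ?thesis by (simp add: integral_density)
  qed
  also have "(LINT x|\<mu>a. \<phi> x * \<sigma> x $ i $ j) = (LBINT x. \<phi> x * H x $ i $ j)"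
   unfolding \<mu>ah by (subst integral_density) (auto simp: H_def h_def intro!: lint_cong)
  finally show ?thesis unfolding 1 2 by simp
 qed
 have sl: "slicing L1 L2 z0 z1 w H \<mu>s \<sigma> K"
 proof
  show "norm (w x) <= 1" for x using wT[of x] T(2) by auto
 qed (use Hint s\<mu> fin \<sigma>1 K parts in auto)
 interpret slicing L1 L2 z0 z1 w H \<mu>s \<sigma> K by (rule sl)
 have all: "AE x in lborel. x \<in> ?U --> (\<forall>G. has_approx_gradient u x G --> G = H x)" using approx_gradient_AE[OF N]
 proof eventually_elim
  case (elim x)
  show ?case
  proof (intro impI allI)
   fix G assume x: "x \<in> ?U" and "has_approx_gradient u x G"
   then have "has_approx_gradient w x G" using approx_cong_AE(2)[OF op x aew' mu mw] by simp
   then show "G = H x" using elim x by blast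
  qed
 qed
 have "AE x in lborel. x \<in> ?U --> (\<exists>G. has_approx_gradient u x G)" using u by (simp add: SBV2_def AE_lebesgue_on_iff[OF op])
 with all have ag: "AE x in lborel. x \<in> ?U --> approx_gradient u x = H x"
 proof eventually_elim
  case (elim x)
  show ?case unfolding approx_gradient_def using elim by (intro impI the_equality) auto
 qed
 have "slicing L1 L2 z0 z1 w H \<mu>s \<sigma> K & (\<forall>x. w x \<in> T) & (AE x in lborel. x \<in> ?U --> u x = w x)
  & (\<Union>n. K n) \<subseteq> approx_discontinuity_set ?U u & (AE x in lborel. x \<in> ?U --> approx_gradient u x = H x)
  & (AE x in lborel. x \<in> ?U --> (\<forall>G. has_approx_gradient u x G --> G = H x))" using sl wT aew K(2) all ag unfolding S_def by simp
 then show ?thesis by (intro exI)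
qed

section \<open>Continuous curves with values in the sphere or 0\<close>

lemma primitive_continuous:
 fixes f :: "real => real"
 assumes f: "integrable lborel f"
 shows "continuous_on A (%t. LBINT s. indicator {a..t} s * f s)"
proof -
 have [measurable]: "f \<in> borel_measurable borel" using f by auto
 have "isCont (%t. LBINT s. indicator {a..t} s * f s) t" for t unfolding continuous_at_sequentially o_def
 proof (intro allI impI)
  fix x assume x: "x \<longlonglongrightarrow> t"
  show "(%n. LBINT s. indicator {a..x n} s * f s) \<longlonglongrightarrow> (LBINT s. indicator {a..t} s * f s)"
  proof (rule integral_dominated_convergence[where w="%s. norm (f s)"])
   show "AE s in lborel. (%n. indicator {a..x n} s * f s) \<longlonglongrightarrow> indicator {a..t} s * f s" using AE_lborel_singleton[of t]
   proof eventually_elim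
    case (elim s)
    have "\<forall>\<^sub>F n in sequentially. s <= x n \<longleftrightarrow> s <= t"
    proof (cases "s < t")
     case True
     show ?thesis using order_tendstoD(1)[OF x True] by eventually_elim (use True in auto)
    next
     case False
     then have "t < s" using elim by simp
     show ?thesis using order_tendstoD(2)[OF x \<open>t < s\<close>] by eventually_elim (use \<open>t < s\<close> in auto)
    qed
    then show ?case by (rule tendsto_eventually[OF eventually_mono]) (auto simp: indicator_def)
   qed
  qed (use f in \<open>auto simp: indicator_def\<close>)
 qed
 then show ?thesis by (auto intro: continuous_at_imp_continuous_on)
qed

text \<open>The exceptional points form an open set, and a nonempty open set is not negligible.
  Closedness of X carries the conclusion to the end points.\<close>

lemma AE_imp_everywhere_continuous:
 fixes v :: "real => 'a::topological_space"
 assumes cont: "continuous_on UNIV v" and X: "closed X" and ae: "AE t in lborel. p < t & t < q --> v t \<in> X"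
  and t: "p <= t" "t <= q" and pq: "p < q"
 shows "v t \<in> X"
proof -
 define O' where "O' = {p<..<q} \<inter> v -` (- X)"
 have op: "open O'" unfolding O'_def using X cont by (intro open_Int open_vimage) auto
 have "AE t in lborel. t \<notin> O'" using ae by eventually_elim (auto simp: O'_def)
 then have "O' \<in> null_sets lborel" using op by (subst (asm) AE_iff_null) (auto simp: Collect_mem_eq)
 then have "negligible O'" by (simp add: negligible_iff_null_sets null_sets_completionI)
 then have "O' = {}" using op open_not_negligible by blast
 then have "{p<..<q} \<subseteq> v -` X" by (auto simp: O'_def)
 moreover have "closed (v -` X)" using X cont by (rule closed_vimage)
 ultimately have "closure {p<..<q} \<subseteq> v -` X" by (rule closure_minimal)
 then show ?thesis using t pq by auto
qed

text \<open>A continuous norm with values 0 and 1 cannot pass through 1/2. This excludes the target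
  value 0 on lines without a jump.\<close>

lemma sphere_or_0_continuous:
 fixes v :: "real => 'a::real_normed_vector"
 assumes cont: "continuous_on UNIV v" and v: "!!t. p <= t ==> t <= q ==> v t = 0 \<or> norm (v t) = 1"
  and p: "norm (v p) = 1" and t: "p <= t" "t <= q"
 shows "norm (v t) = 1"
proof (rule ccontr)
 assume "norm (v t) ~= 1"
 then have "norm (v t) = 0" using v t by auto
 moreover have "continuous_on {p..t} (%t. norm (v t))" by (intro continuous_intros continuous_on_subset[OF cont]) simp
 ultimately obtain s where "p <= s" "s <= t" "norm (v s) = 1 / 2" using IVT2'[of "%t. norm (v t)" t "1/2" p] p t by auto
 then show False using v[of s] t by auto
qed

text \<open>The continuous representative V is pinned to e1 at height 0 and to e3 at height d by its
  constant values in the two layers. Starting the primitive at 0 instead of a therefore gives the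
  same curve on [0, d].\<close>

lemma arc_of_AE_primitive:
 fixes y h :: "real => real^3" and k :: "real^3"
 assumes a: "a < 0" and d: "0 < d" "d < b" and h: "!!i. integrable lborel (%t. h t $ i)"
  and y: "!!i. AE t in lborel. a < t & t < b --> y t $ i = k $ i + (LBINT s. indicator {a..t} s * h s $ i)"
  and T: "!!t. y t = 0 \<or> norm (y t) = 1"
  and below: "AE t in lborel. a < t & t < 0 --> y t = axis 1 1"
  and above: "AE t in lborel. d < t & t < b --> y t = axis 3 1"
 defines "v \<equiv> %t. \<chi> i. axis 1 1 $ i + (LBINT s. indicator {0..t} s * h s $ i)"
 shows "!!t. 0 <= t ==> t <= d ==> norm (v t) = 1" "v d = axis 3 1"
  "AE t in lborel. 0 < t & t < d --> y t = v t"
proof -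
 define V where "V t = (\<chi> i. k $ i + (LBINT s. indicator {a..t} s * h s $ i))" for t
 have cV: "continuous_on UNIV V" unfolding V_def by (intro continuous_on_vec_lambda continuous_intros primitive_continuous h)
 have "AE t in lborel. \<forall>i\<in>UNIV. a < t & t < b --> y t $ i = k $ i + (LBINT s. indicator {a..t} s * h s $ i)"
  by (intro AE_finite_allI y) auto
 then have yV: "AE t in lborel. a < t & t < b --> y t = V t" by eventually_elim (auto simp: V_def vec_eq_iff)
 have "AE t in lborel. a < t & t < b --> V t \<in> sphere 0 1 \<union> {0}" using yV
 proof eventually_elim
  case (elim t)
  then show ?case using T[of t] by auto
 qed
 then have VT: "V t = 0 \<or> norm (V t) = 1" if "a <= t" "t <= b" for t
  using AE_imp_everywhere_continuous[OF cV, of "sphere 0 1 \<union> {0}" a b t] that a d by auto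
 have "AE t in lborel. a < t & t < 0 --> V t \<in> {axis 1 1}" using yV below by eventually_elim (use d in auto)
 then have V0: "V 0 = axis 1 1" using AE_imp_everywhere_continuous[OF cV, of "{axis 1 1}" a 0 0] a by auto
 have "AE t in lborel. d < t & t < b --> V t \<in> {axis 3 1}" using yV above by eventually_elim (use a d in auto)
 then have Vd: "V d = axis 3 1" using AE_imp_everywhere_continuous[OF cV, of "{axis 3 1}" d b d] d by auto
 have vV: "v t = V t" if t: "0 <= t" for t
 proof -
  have "(LBINT s. indicator {a..t} s * h s $ i) = (LBINT s. indicator {a..0} s * h s $ i + indicator {0..t} s * h s $ i)" for i
  proof (rule integral_cong_AE)
   have [measurable]: "(%s. h s $ i) \<in> borel_measurable borel" using h[of i] by auto
   show "(%s. indicator {a..t} s * h s $ i) \<in> borel_measurable lborel"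
    "(%s. indicator {a..0} s * h s $ i + indicator {0..t} s * h s $ i) \<in> borel_measurable lborel" by measurable
   show "AE s in lborel. indicator {a..t} s * h s $ i = indicator {a..0} s * h s $ i + indicator {0..t} s * h s $ i"
    using AE_lborel_singleton[of 0] by eventually_elim (use a t in \<open>auto simp: indicator_def\<close>)
  qed
  moreover have ih: "integrable lborel (%s. indicator A s * h s $ i)" if "A \<in> sets borel" for A i
   using integrable_real_mult_indicator[OF _ h[of i], of A] that by (simp add: mult.commute)
  ultimately have "(LBINT s. indicator {a..t} s * h s $ i)
    = (LBINT s. indicator {a..0} s * h s $ i) + (LBINT s. indicator {0..t} s * h s $ i)" for i by simp
  then show ?thesis using V0 by (simp add: v_def V_def vec_eq_iff)
 qed
 show "norm (v t) = 1" if t: "0 <= t" "t <= d" for t unfolding vV[OF t(1)]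
 proof (rule sphere_or_0_continuous[OF cV, of 0 d])
  show "norm (V 0) = 1" by (simp add: V0)
 qed (use VT a d t in auto)
 show "v d = axis 3 1" using vV[of d] Vd d by simp
 show "AE t in lborel. 0 < t & t < d --> y t = v t" using yV by eventually_elim (use vV a d in auto)
qed

section \<open>Vertical lines: lower bound and uniqueness for large K\<close>

text \<open>The surplus of f over c has integral 0. Finiteness of the mass of Q is what allows the
  common term to be cancelled in the extended reals.\<close>

lemma nn_integral_minimal_AE:
 fixes f :: "'a => ennreal"
 assumes [measurable]: "f \<in> borel_measurable M" "Q \<in> sets M" and Q: "emeasure M Q < \<infinity>"
  and lb: "AE z in M. z \<in> Q --> ennreal c <= f z" and le: "(\<integral>\<^sup>+z. f z * indicator Q z \<partial>M) <= ennreal c * emeasure M Q"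
 shows "AE z in M. z \<in> Q --> f z = ennreal c"
proof -
 define g where "g z = (f z - ennreal c) * indicator Q z" for z
 have [measurable]: "g \<in> borel_measurable M" unfolding g_def[abs_def] by measurable
 have "(\<integral>\<^sup>+z. f z * indicator Q z \<partial>M) = (\<integral>\<^sup>+z. ennreal c * indicator Q z + g z \<partial>M)"
  by (rule nn_integral_cong_AE, use lb in eventually_elim) (auto simp: g_def indicator_def add_diff_inverse_ennreal)
 also have "... = (\<integral>\<^sup>+z. ennreal c * indicator Q z \<partial>M) + (\<integral>\<^sup>+z. g z \<partial>M)" by (rule nn_integral_add) auto
 also have "(\<integral>\<^sup>+z. ennreal c * indicator Q z \<partial>M) = ennreal c * emeasure M Q" by (rule nn_integral_cmult_indicator) simp
 finally have "ennreal c * emeasure M Q + (\<integral>\<^sup>+z. g z \<partial>M) <= ennreal c * emeasure M Q + 0" using le by simp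
 moreover have "ennreal c * emeasure M Q ~= \<infinity>" using Q by (simp add: ennreal_mult_eq_top_iff)
 ultimately have "(\<integral>\<^sup>+z. g z \<partial>M) = 0" by (simp only: ennreal_add_left_cancel_le) simp
 then have "AE z in M. g z = 0" by (simp add: nn_integral_0_iff_AE)
 with lb show ?thesis by eventually_elim (auto simp: g_def diff_eq_0_iff_ennreal indicator_def split: if_splits)
qed

lemma nn_integral_liminf_line_count:
 assumes "!!m i. bounded (C m i)"
 shows "(\<integral>\<^sup>+z. liminf (%m. line_count s1 s2 (C m) (W m) z) \<partial>lborel)
  <= liminf (%m. \<Sum>i. W m i * (ennreal (1 + s1\<^sup>2 + s2\<^sup>2) * disc_area (C m i)))"
proof -
 have "(\<integral>\<^sup>+z. liminf (%m. line_count s1 s2 (C m) (W m) z) \<partial>lborel)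
   <= liminf (%m. \<integral>\<^sup>+z. line_count s1 s2 (C m) (W m) z \<partial>lborel)" by (rule nn_integral_liminf) simp
 also have "... <= liminf (%m. \<Sum>i. W m i * (ennreal (1 + s1\<^sup>2 + s2\<^sup>2) * disc_area (C m i)))"
  by (intro Liminf_mono always_eventually allI nn_integral_line_count assms)
 finally show ?thesis .
qed

lemma AE_lborel_pair_iff:
 assumes [measurable]: "Measurable.pred borel (P :: (real \<times> real) \<times> real => bool)"
 shows "(AE q in lborel. P q) \<longleftrightarrow> (AE z in lborel. AE t in lborel. P (z, t))"
proof -
 have "{q. P q} \<in> sets (lborel \<Otimes>\<^sub>M (lborel :: real measure))" unfolding lborel_prod using assms by measurable
 then show ?thesis using lborel_pair.AE_pair_iff[of "%z t. P (z, t)"] unfolding lborel_prod by (simp add: lborel_prod[symmetric] space_pair_measure)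
qed

lemma AE_shear_iff:
 assumes [measurable]: "Measurable.pred borel P"
 shows "(AE p in lborel. P p) \<longleftrightarrow> (AE z in lborel. AE t in lborel. P (shear s1 s2 (z, t)))"
proof -
 have "(AE p in lborel. P p) \<longleftrightarrow> (AE q in lborel. P (shear s1 s2 q))"
  by (subst distr_shear[of s1 s2, symmetric], subst AE_distr_iff) auto
 also have "... \<longleftrightarrow> (AE z in lborel. AE t in lborel. P (shear s1 s2 (z, t)))" by (rule AE_lborel_pair_iff) measurable
 finally show ?thesis .
qed

text \<open>Two sets with different roles: S carries the singular derivative and decides which lines
  are clear, while D pays the surface energy. S is sigma-compact, D may be any set of finite
  Hausdorff measure containing S, and it is accessible only through the covers C.\<close>

locale director = slicing L1 L2 "- \<epsilon>" "d + \<epsilon>" u H \<mu> \<sigma> K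
 for L1 L2 d \<epsilon> :: real and u H \<mu> \<sigma> K +
 fixes D :: "(real^3) set" and C :: "nat => nat => (real^3) set"
 assumes L_pos: "L1 > 0" "L2 > 0" and d_pos: "d > 0" and \<epsilon>_pos: "\<epsilon> > 0"
  and u_T: "!!x. u x = 0 \<or> norm (u x) = 1"
  and below: "AE p in lborel. p \<in> U --> p $ 3 < 0 --> u p = axis 1 1"
  and above: "AE p in lborel. p \<in> U --> d < p $ 3 --> u p = axis 3 1"
  and S_D: "S \<subseteq> D" and D_U: "D \<subseteq> U" and D_finite: "hausdorff 2 D < \<infinity>" and C: "fine_covers D C"
begin

definition base :: "(real \<times> real) set" where
 "base = {z. - L1 < fst z & fst z < L1 & - L2 < snd z & snd z < L2}"

lemma base_box: "base = box (- L1, - L2) (L1, L2)" by (auto simp: base_def box_prod mem_Times_iff box_real)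

lemma base_borel [measurable]: "base \<in> sets borel" unfolding base_box by simp

lemma base_area: "emeasure lborel base = ennreal (4 * L1 * L2)" unfolding base_box using L_pos
 by (subst emeasure_lborel_box) (auto simp: Basis_prod_def prod.union_disjoint prod.reindex inj_on_def mult_ac)

lemma upright_U: "shear 0 0 (z, t) \<in> U \<longleftrightarrow> z \<in> base & - \<epsilon> < t & t < d + \<epsilon>"
 by (auto simp: base_def mem_box3)

lemma upright_cell: "shear 0 0 (z, t) \<in> cell L1 L2 d \<longleftrightarrow> z \<in> base & 0 < t & t < d"
 by (auto simp: base_def cell_def mem_box3)

lemma H_borel [measurable]: "H \<in> borel_measurable borel"
proof -
 have "(%x. H x $ i) \<in> borel_measurable borel" for i
  using H_integrable[of i] borel_measurable_integrable unfolding nth_measurable_iff by fastforce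
 moreover have "(%x. H x \<bullet> b) \<in> borel_measurable borel" if "b \<in> Basis" for b
 proof -
  obtain i c where "b = axis i c" using \<open>b \<in> Basis\<close> by (auto simp: Basis_vec_def)
  then have "(%x. H x \<bullet> b) = (%x. H x $ i \<bullet> c)" by (simp add: inner_axis fun_eq_iff)
  then show ?thesis using calculation[of i] by simp
 qed
 ultimately show ?thesis by (subst borel_measurable_euclidean_space) auto
qed

lemma shear_slice_borel [measurable]: "(%t. shear s1 s2 (z, t)) \<in> borel_measurable borel"
 by (rule measurable_compose[OF _ borel_measurable_shear]) simp

definition bulk :: "real \<times> real => ennreal" where
 "bulk z = (\<integral>\<^sup>+t. indicator {0..d} t * ennreal ((norm (H (shear 0 0 (z, t))))\<^sup>2) \<partial>lborel)"

definition excess :: "real \<times> real => ennreal" where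
 "excess z = (\<integral>\<^sup>+t. indicator {0..d} t * ennreal ((norm (u (shear 0 0 (z, t)) - n_star d (shear 0 0 (z, t))))\<^sup>2) \<partial>lborel)"

text \<open>A Borel substitute for the number of points of D on the vertical line: it dominates the
  number of points in every finite subset.\<close>

definition jumps :: "real \<times> real => ennreal" where
 "jumps z = liminf (%m. line_count 0 0 (C m) (%_. 1) z)"

text \<open>Half of each layer is included: the segment stays inside the box, and yet both
  prescribed values are seen on intervals of positive length.\<close>

abbreviation whole :: "(real \<times> real) set" where
 "whole \<equiv> clear_feet 0 0 (- \<epsilon> / 2) (d + \<epsilon> / 2)"

lemma slice_integral_borel:
 assumes [measurable]: "f \<in> borel_measurable borel"
 shows "(%z. \<integral>\<^sup>+t. indicator {0..d} t * f (shear 0 0 (z, t)) \<partial>lborel) \<in> borel_measurable borel"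
proof -
 have 1: "(%q. f (shear 0 0 q)) \<in> borel_measurable borel" by (rule measurable_compose[OF borel_measurable_shear assms])
 have "(%q. f (shear 0 0 q)) \<in> borel_measurable (borel \<Otimes>\<^sub>M borel)" unfolding borel_prod by (rule 1)
 then have "(%q. indicator {0..d} (snd q) * f (shear 0 0 q) :: ennreal) \<in> borel_measurable (borel \<Otimes>\<^sub>M borel)" by measurable
 then have "(%(z, t). indicator {0..d} t * f (shear 0 0 (z, t)) :: ennreal) \<in> borel_measurable (borel \<Otimes>\<^sub>M lborel)"
  by (simp add: case_prod_beta')
 from lborel.borel_measurable_nn_integral[OF this] show ?thesis .
qed

lemma n_star_borel [measurable]: "n_star d \<in> borel_measurable borel" unfolding nth_measurable_iff n_star_def[abs_def] by (simp add: forall_3)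

lemma bulk_borel [measurable]: "bulk \<in> borel_measurable borel" unfolding bulk_def[abs_def] by (rule slice_integral_borel) simp

lemma excess_borel [measurable]: "excess \<in> borel_measurable borel" unfolding excess_def[abs_def] by (rule slice_integral_borel) simp

lemma jumps_borel [measurable]: "jumps \<in> borel_measurable borel" unfolding jumps_def[abs_def] by measurable

lemma nn_integral_cell:
 assumes [measurable]: "f \<in> borel_measurable borel"
 shows "(\<integral>\<^sup>+z. (\<integral>\<^sup>+t. indicator {0..d} t * f (shear 0 0 (z, t)) \<partial>lborel) * indicator base z \<partial>lborel)
  = (\<integral>\<^sup>+p. f p * indicator (cell L1 L2 d) p \<partial>lborel)"
proof -
 have [measurable]: "cell L1 L2 d \<in> sets borel" by (simp add: cell_def)
 have "(\<integral>\<^sup>+p. f p * indicator (cell L1 L2 d) p \<partial>lborel)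
   = (\<integral>\<^sup>+z. \<integral>\<^sup>+t. f (shear 0 0 (z, t)) * indicator (cell L1 L2 d) (shear 0 0 (z, t)) \<partial>lborel \<partial>lborel)"
  by (rule nn_integral_shear) simp
 also have "... = (\<integral>\<^sup>+z. (\<integral>\<^sup>+t. indicator {0..d} t * f (shear 0 0 (z, t)) \<partial>lborel) * indicator base z \<partial>lborel)"
 proof (rule nn_integral_cong)
  fix z :: "real \<times> real"
  have "(\<integral>\<^sup>+t. f (shear 0 0 (z, t)) * indicator (cell L1 L2 d) (shear 0 0 (z, t)) \<partial>lborel)
    = (\<integral>\<^sup>+t. indicator {0..d} t * f (shear 0 0 (z, t)) * indicator base z \<partial>lborel)"
  proof (rule nn_integral_cong_AE)
   show "AE t in lborel. f (shear 0 0 (z, t)) * indicator (cell L1 L2 d) (shear 0 0 (z, t))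
     = indicator {0..d} t * f (shear 0 0 (z, t)) * indicator base z" using AE_lborel_singleton[of 0] AE_lborel_singleton[of d]
   proof eventually_elim
    case (elim t)
    then show ?case using upright_cell[of z t] by (auto simp: indicator_def)
   qed
  qed
  also have "... = (\<integral>\<^sup>+t. indicator {0..d} t * f (shear 0 0 (z, t)) \<partial>lborel) * indicator base z"
   by (rule nn_integral_multc) measurable
  finally show "(\<integral>\<^sup>+t. f (shear 0 0 (z, t)) * indicator (cell L1 L2 d) (shear 0 0 (z, t)) \<partial>lborel)
   = (\<integral>\<^sup>+t. indicator {0..d} t * f (shear 0 0 (z, t)) \<partial>lborel) * indicator base z" .
 qed
 finally show ?thesis by simp
qed

text \<open>Fatou's lemma with tilt 0, where projecting does not enlarge areas. This bounds the area
  of the shadow of D, with multiplicity, by its Hausdorff measure.\<close>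

lemma jumps_integral: "(\<integral>\<^sup>+z. jumps z \<partial>lborel) <= hausdorff 2 D"
proof -
 have C': "bounded (C m i)" "(\<Sum>i. disc_area (C m i)) <= hausdorff 2 D + ennreal (1 / real (Suc m))" for m i
  using C by (auto simp: fine_covers_def)
 have "(\<integral>\<^sup>+z. jumps z \<partial>lborel) <= liminf (%m. \<Sum>i. 1 * (ennreal (1 + 0\<^sup>2 + 0\<^sup>2) * disc_area (C m i)))"
  unfolding jumps_def by (rule nn_integral_liminf_line_count) (rule C')
 also have "... <= liminf (%m. hausdorff 2 D + ennreal (1 / real (Suc m)))" by (intro Liminf_mono always_eventually allI) (use C'(2) in simp)
 also have "(%m. hausdorff 2 D + ennreal (1 / real (Suc m))) \<longlonglongrightarrow> hausdorff 2 D + ennreal 0"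
  by (intro tendsto_add tendsto_const tendsto_ennrealI LIMSEQ_Suc[OF lim_1_over_n])
 then have "liminf (%m. hausdorff 2 D + ennreal (1 / real (Suc m))) = hausdorff 2 D" using lim_imp_Liminf[OF sequentially_bot] by simp
 finally show ?thesis .
qed

lemma jumps_ge_1:
 assumes "z \<in> base" "z \<notin> whole" shows "1 <= jumps z"
proof -
 have "z \<in> feet 0 0 (- \<epsilon> / 2) (d + \<epsilon> / 2)" using assms(1) d_pos \<epsilon>_pos by (simp add: feet_def upright_U)
 then have "z \<in> foot 0 0 ` (S \<inter> {p. - \<epsilon> / 2 <= p $ 3 & p $ 3 <= d + \<epsilon> / 2})"
  using assms(2) unfolding clear_feet_def by blast
 then obtain p where p: "p \<in> S" "z = foot 0 0 p" by (elim imageE IntE)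
 have "(\<Sum>p\<in>{p}. 1) <= liminf (%m. line_count 0 0 (C m) (%_. 1) z)" using p S_D by (intro line_sum_le_liminf[OF C]) auto
 then show ?thesis by (simp add: jumps_def)
qed

lemma below_slice: "AE z in lborel. AE t in lborel. shear s1 s2 (z, t) \<in> U --> t < 0 --> u (shear s1 s2 (z, t)) = axis 1 1"
 using AE_shear[OF below, of s1 s2] by simp

lemma above_slice: "AE z in lborel. AE t in lborel. shear s1 s2 (z, t) \<in> U --> d < t --> u (shear s1 s2 (z, t)) = axis 3 1"
 using AE_shear[OF above, of s1 s2] by simp

text \<open>On almost every clear line the map is an absolutely continuous curve; the layers fix its
  ends and continuity keeps it on the sphere, so \<open>unit_arc_energy_Icc\<close> applies. The
  excess is retained for the uniqueness proof.\<close>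

lemma whole_bulk:
 "AE z in lborel. z \<in> base --> z \<in> whole --> ennreal (pi\<^sup>2 / (4 * d)) + ennreal (5 / 4 * (pi / (2 * d))\<^sup>2) * excess z <= bulk z"
proof -
 define a b where "a = - \<epsilon> / 2" and "b = d + \<epsilon> / 2"
 have ab: "- \<epsilon> < a" "a < b" "b < d + \<epsilon>" "a < 0" "d < b" using d_pos \<epsilon>_pos by (auto simp: a_def b_def)
 have 1: "AE z in lborel. \<forall>i\<in>UNIV. z \<in> whole -->
   (\<exists>k. AE t in lborel. a < t & t < b --> u (shear 0 0 (z, t)) $ i = k + primitive 0 0 a i z t)" unfolding a_def[symmetric] b_def[symmetric]
  by (intro AE_finite_allI) (simp, rule clear_slice_AE[OF ab(1-3)])
 have 2: "AE z in lborel. \<forall>i\<in>UNIV. integrable lborel (%t. HE 0 0 i (shear 0 0 (z, t)))"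
  by (intro AE_finite_allI) (simp, rule HE_slice_integrable)
 from 1 2 below_slice[of 0 0] above_slice[of 0 0] show ?thesis
 proof eventually_elim
  case (elim z)
  show ?case
  proof (intro impI)
   assume z: "z \<in> base" "z \<in> whole"
   define y where "y t = u (shear 0 0 (z, t))" for t
   define h where "h t = (\<chi> i. HE 0 0 i (shear 0 0 (z, t)))" for t
   have hn: "h t $ i = H (shear 0 0 (z, t)) $ i $ 3" for t i by (simp add: h_def HE_def)
   have ih: "integrable lborel (%t. h t $ i)" for i using elim(2) by (simp add: h_def)
   have "\<forall>i. \<exists>k. AE t in lborel. a < t & t < b --> y t $ i = k + (LBINT s. indicator {a..t} s * h s $ i)"
    using elim(1) z by (simp add: y_def h_def primitive_def)
   then have "\<exists>k. \<forall>i. AE t in lborel. a < t & t < b --> y t $ i = k i + (LBINT s. indicator {a..t} s * h s $ i)" by (rule choice)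
   then obtain k where k: "\<forall>i. AE t in lborel. a < t & t < b --> y t $ i = k i + (LBINT s. indicator {a..t} s * h s $ i)" ..
   have y: "AE t in lborel. a < t & t < b --> y t $ i = vec_lambda k $ i + (LBINT s. indicator {a..t} s * h s $ i)" for i
    using spec[OF k, of i] by simp
   have inU: "shear 0 0 (z, t) \<in> U" if "a < t" "t < b" for t using that ab z(1) by (simp add: upright_U)
   have bel: "AE t in lborel. a < t & t < 0 --> y t = axis 1 1" using elim(3) by eventually_elim (use inU ab d_pos in \<open>auto simp: y_def\<close>)
   have abv: "AE t in lborel. d < t & t < b --> y t = axis 3 1" using elim(4) by eventually_elim (use inU ab d_pos in \<open>auto simp: y_def\<close>)
   define v :: "real => real^3" where "v t = (\<chi> i. axis 1 1 $ i + (LBINT s. indicator {0..t} s * h s $ i))" for t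
   note arc = arc_of_AE_primitive[OF ab(4) d_pos ab(5) ih y u_T[of "shear 0 0 (z, t)" for t, folded y_def] bel abv, folded v_def]
   define N where "N t = (vector [cos (pi / (2 * d) * t), 0, sin (pi / (2 * d) * t)] :: real^3)" for t
   have N: "N t = n_star d (shear 0 0 (z, t))" for t by (simp add: N_def n_star_def)
   have [measurable]: "h \<in> borel_measurable borel" unfolding nth_measurable_iff using ih by auto
   \<comment> \<open>Only the third column of H, the vertical derivative, enters the estimate; the
     horizontal columns are discarded.\<close>
   have hH: "(norm (h t))\<^sup>2 <= (norm (H (shear 0 0 (z, t))))\<^sup>2" for t
   proof -
    have "(norm (h t))\<^sup>2 = (\<Sum>i\<in>UNIV. (H (shear 0 0 (z, t)) $ i $ 3)\<^sup>2)" by (simp add: norm_vec_def L2_set_def sum_nonneg hn)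
    also have "... <= (\<Sum>i\<in>UNIV. (norm (H (shear 0 0 (z, t)) $ i))\<^sup>2)"
     by (intro sum_mono power2_le_iff_abs_le[THEN iffD2]) (auto simp: component_le_norm_cart)
    also have "... = (norm (H (shear 0 0 (z, t))))\<^sup>2" by (simp add: norm_vec_def[of "H x" for x] L2_set_def sum_nonneg)
    finally show ?thesis .
   qed
   have bh: "(\<integral>\<^sup>+t. ennreal (indicator {0..d} t * (norm (h t))\<^sup>2) \<partial>lborel) <= bulk z"
    unfolding bulk_def by (intro nn_integral_mono) (use hH in \<open>auto simp: indicator_def simp del: power2_le_iff_abs_le abs_norm_cancel power_mono_iff intro!: ennreal_leI\<close>)
   show "ennreal (pi\<^sup>2 / (4 * d)) + ennreal (5 / 4 * (pi / (2 * d))\<^sup>2) * excess z <= bulk z"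
   \<comment> \<open>Square integrability of h is available only when the bulk term is finite;
     otherwise the claim is trivial.\<close>
   proof (cases "bulk z = \<infinity>")
    case False
    have int: "integrable lborel (%t. indicator {0..d} t * (norm (h t))\<^sup>2)"
     using bh False by (intro integrableI_bounded) (auto simp: abs_mult top.not_eq_extremum)
    have h2: "Icc_integrable d (%t. (h t $ i)\<^sup>2)" for i unfolding Icc_integrable_def
    proof (rule integrable_dominated[OF int])
     have "(h t $ i)\<^sup>2 <= (norm (h t))\<^sup>2" for t using component_le_norm_cart[of "h t" i] by (simp add: abs_le_square_iff[symmetric])
     then show "AE t in lborel. norm (indicator {0..d} t * (h t $ i)\<^sup>2) <= norm (indicator {0..d} t * (norm (h t))\<^sup>2)"
      by (auto simp: indicator_def)
    qed (use ih in measurable)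
    have hb: "(%t. h t $ i) \<in> borel_measurable borel" for i using ih[of i] by auto
    have vi: "v t $ i = axis 1 1 $ i + (LBINT s. indicator {0..t} s * h s $ i)" for t i by (simp add: v_def)
    note U = unit_arc_energy_Icc[OF d_pos hb h2 vi arc(1,2), folded N_def]
    have nonneg: "Icc_int d (%t. (norm (v t - N t))\<^sup>2) \<ge> 0" by (rule Icc_int_nonneg) simp
    have "excess z = (\<integral>\<^sup>+t. ennreal (indicator {0..d} t * (norm (v t - N t))\<^sup>2) \<partial>lborel)" unfolding excess_def
    proof (rule nn_integral_cong_AE)
     show "AE t in lborel. indicator {0..d} t * ennreal ((norm (u (shear 0 0 (z, t)) - n_star d (shear 0 0 (z, t))))\<^sup>2)
       = ennreal (indicator {0..d} t * (norm (v t - N t))\<^sup>2)" using arc(3) AE_lborel_singleton[of 0] AE_lborel_singleton[of d]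
      by eventually_elim (auto simp: indicator_def N y_def)
    qed
    also have "... = ennreal (Icc_int d (%t. (norm (v t - N t))\<^sup>2))"
     unfolding Icc_int_def using U(2) by (intro nn_integral_eq_integral) (auto simp: Icc_integrable_def)
    finally have ex: "excess z = ennreal (Icc_int d (%t. (norm (v t - N t))\<^sup>2))" .
    have "(pi / (2 * d))\<^sup>2 * d = pi\<^sup>2 / (4 * d)" using d_pos by (simp add: power2_eq_square field_simps)
    moreover have "0 <= pi\<^sup>2 / (4 * d)" "0 <= 5 / 4 * (pi / (2 * d))\<^sup>2" using d_pos by auto
    ultimately have "ennreal (pi\<^sup>2 / (4 * d)) + ennreal (5 / 4 * (pi / (2 * d))\<^sup>2) * excess z
      = ennreal ((pi / (2 * d))\<^sup>2 * d + 5 / 4 * (pi / (2 * d))\<^sup>2 * Icc_int d (%t. (norm (v t - N t))\<^sup>2))"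
     unfolding ex using nonneg by (simp only: ennreal_mult ennreal_plus mult_nonneg_nonneg)
    also have "... <= ennreal (Icc_int d (%t. (norm (h t))\<^sup>2))" by (rule ennreal_leI[OF U(1)])
    also have "... = (\<integral>\<^sup>+t. ennreal (indicator {0..d} t * (norm (h t))\<^sup>2) \<partial>lborel)"
     unfolding Icc_int_def using int by (intro nn_integral_eq_integral[symmetric]) auto
    also have "... <= bulk z" by (rule bh)
    finally show ?thesis .
   qed simp
  qed
 qed
qed

definition functional :: "real => ennreal" where
 "functional k = (\<integral>\<^sup>+p. ennreal ((norm (H p))\<^sup>2) * indicator (cell L1 L2 d) p \<partial>lborel) + ennreal k * hausdorff 2 D"

lemma slice_functional:
 "(\<integral>\<^sup>+z. (bulk z + ennreal k * jumps z) * indicator base z \<partial>lborel) <= functional k"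
proof -
 have "(\<integral>\<^sup>+z. (bulk z + ennreal k * jumps z) * indicator base z \<partial>lborel)
   <= (\<integral>\<^sup>+z. bulk z * indicator base z + ennreal k * jumps z \<partial>lborel)" by (intro nn_integral_mono) (auto simp: indicator_def)
 also have "... = (\<integral>\<^sup>+z. bulk z * indicator base z \<partial>lborel) + ennreal k * (\<integral>\<^sup>+z. jumps z \<partial>lborel)"
  by (subst nn_integral_add) (auto simp: nn_integral_cmult)
 also have "... <= functional k" unfolding functional_def bulk_def using jumps_integral
  by (subst nn_integral_cell) (auto intro!: add_mono mult_left_mono)
 finally show ?thesis .
qed

lemma slice_lower_bound:
 assumes "c <= k" "c <= pi\<^sup>2 / (4 * d)"
 shows "AE z in lborel. z \<in> base --> ennreal c <= bulk z + ennreal k * jumps z" using whole_bulk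
proof eventually_elim
 case (elim z)
 show ?case
 proof
  assume z: "z \<in> base"
  show "ennreal c <= bulk z + ennreal k * jumps z"
  proof (cases "z \<in> whole")
   case True
   have "ennreal c <= ennreal (pi\<^sup>2 / (4 * d))" using assms(2) by (rule ennreal_leI)
   also have "... <= ennreal (pi\<^sup>2 / (4 * d)) + ennreal (5 / 4 * (pi / (2 * d))\<^sup>2) * excess z" by simp
   also have "... <= bulk z" using elim z True by blast
   also have "... <= bulk z + ennreal k * jumps z" by simp
   finally show ?thesis .
  next
   case False
   have "ennreal c <= ennreal k * 1" using assms(1) by (simp add: ennreal_leI)
   also have "... <= ennreal k * jumps z" by (intro mult_left_mono jumps_ge_1 z False) simp
   also have "... <= bulk z + ennreal k * jumps z" by simp
   finally show ?thesis .
  qed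
 qed
qed

lemma functional_lower_bound:
 assumes "c <= k" "c <= pi\<^sup>2 / (4 * d)"
 shows "ennreal c * ennreal (4 * L1 * L2) <= functional k"
proof -
 have "ennreal c * ennreal (4 * L1 * L2) = (\<integral>\<^sup>+z. ennreal c * indicator base z \<partial>lborel)"
  by (simp add: nn_integral_cmult_indicator base_area)
 also have "... <= (\<integral>\<^sup>+z. (bulk z + ennreal k * jumps z) * indicator base z \<partial>lborel)"
  by (rule nn_integral_mono_AE, use slice_lower_bound[OF assms] in eventually_elim) (auto simp: indicator_def)
 also have "... <= functional k" by (rule slice_functional)
 finally show ?thesis .
qed

lemma slice_equality:
 assumes "c <= k" "c <= pi\<^sup>2 / (4 * d)" "functional k <= ennreal c * ennreal (4 * L1 * L2)"
 shows "AE z in lborel. z \<in> base --> bulk z + ennreal k * jumps z = ennreal c"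
 by (rule nn_integral_minimal_AE[OF _ _ _ slice_lower_bound[OF assms(1,2)]])
  (use order_trans[OF slice_functional assms(3)] in \<open>simp_all add: base_area\<close>)

text \<open>Equality in the lower bound holds line by line. A line that is not whole would cost at
  least k, more than pi^2 / (4 d), so almost all lines are whole and their excess, a multiple of the
  squared distance to \<open>n_star\<close>, is zero.\<close>

lemma minimal_eq_n_star:
 assumes k: "pi\<^sup>2 / (4 * d) < k" and le: "functional k <= ennreal (pi\<^sup>2 / (4 * d)) * ennreal (4 * L1 * L2)"
 shows "AE p in lborel. p \<in> cell L1 L2 d --> u p = n_star d p"
proof -
 have "AE z in lborel. z \<in> base --> excess z = 0" using whole_bulk slice_equality[OF less_imp_le[OF k] order_refl le]
 proof eventually_elim
  case (elim z)
  show ?case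
  proof
   assume z: "z \<in> base"
   have eq: "bulk z + ennreal k * jumps z = ennreal (pi\<^sup>2 / (4 * d))" using elim(2) z by blast
   have "z \<in> whole"
   proof (rule ccontr)
    assume "z \<notin> whole"
    then have "ennreal k * 1 <= ennreal k * jumps z" by (intro mult_left_mono jumps_ge_1 z) auto
    also have "... <= ennreal (pi\<^sup>2 / (4 * d))" unfolding eq[symmetric] by simp
    finally have "ennreal k <= ennreal (pi\<^sup>2 / (4 * d))" by simp
    moreover have "0 < pi\<^sup>2 / (4 * d)" using d_pos by simp
    ultimately show False using k unfolding ennreal_le_iff2 by linarith
   qed
   then have "ennreal (pi\<^sup>2 / (4 * d)) + ennreal (5 / 4 * (pi / (2 * d))\<^sup>2) * excess z <= bulk z" using elim(1) z by blast
   also have "... <= ennreal (pi\<^sup>2 / (4 * d)) + 0" unfolding eq[symmetric] by simp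
   finally have "ennreal (5 / 4 * (pi / (2 * d))\<^sup>2) * excess z <= 0" by (simp only: ennreal_add_left_cancel_le) simp
   then show "excess z = 0" using d_pos by simp
  qed
 qed
 then have "(\<integral>\<^sup>+z. excess z * indicator base z \<partial>lborel) = 0"
  by (subst nn_integral_0_iff_AE) (auto elim!: eventually_mono simp: indicator_def)
 then have "(\<integral>\<^sup>+p. ennreal ((norm (u p - n_star d p))\<^sup>2) * indicator (cell L1 L2 d) p \<partial>lborel) = 0"
  unfolding excess_def by (subst (asm) nn_integral_cell) auto
 moreover have [measurable]: "cell L1 L2 d \<in> sets borel" by (simp add: cell_def)
 ultimately have "AE p in lborel. ennreal ((norm (u p - n_star d p))\<^sup>2) * indicator (cell L1 L2 d) p = 0"
  by (subst (asm) nn_integral_0_iff_AE) auto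
 then show ?thesis by eventually_elim (auto simp: indicator_def)
qed

end

section \<open>Structure of minimisers for small K\<close>

lemma liminf_add_superadditive:
 fixes f g :: "nat => ennreal"
 shows "liminf f + liminf g <= liminf (%n. f n + g n)"
proof -
 have inc: "incseq (%n. INF m\<in>{n..}. h m)" for h :: "nat => ennreal" by (intro monoI INF_superset_mono) auto
 have "liminf f + liminf g = (SUP n. (INF m\<in>{n..}. f m) + (INF m\<in>{n..}. g m))"
  unfolding liminf_SUP_INF by (rule ennreal_SUP_add[OF inc inc, symmetric])
 also have "... <= (SUP n. INF m\<in>{n..}. f m + g m)" by (intro SUP_mono' INF_greatest add_mono INF_lower) auto
 finally show ?thesis unfolding liminf_SUP_INF .
qed

lemma test_function_lipschitz:
 fixes \<phi> :: "real ^ 'n => real"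
 assumes t: "test_function \<Omega> \<phi> g"
 obtains M where "M \<ge> 0" "!!p q. \<bar>\<phi> p - \<phi> q\<bar> <= M * dist p q"
proof -
 obtain C M where M: "M \<ge> 0" "!!x. norm (g x) <= M" using test_function_facts[OF t] by blast
 have "onorm (%h. g x \<bullet> h) <= M" for x
 proof (rule onorm_le)
  fix h
  have "norm (g x \<bullet> h) <= norm (g x) * norm h" by (simp add: Cauchy_Schwarz_ineq2)
  also have "... <= M * norm h" using M by (intro mult_right_mono) auto
  finally show "norm (g x \<bullet> h) <= M * norm h" .
 qed
 then have "norm (\<phi> p - \<phi> q) <= M * norm (p - q)" for p q
  using t by (intro differentiable_bound[of UNIV \<phi> "%x h. g x \<bullet> h"]) (auto simp: test_function_def)
 with M show ?thesis by (intro that[of M]) (auto simp: dist_norm)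
qed

lemma open_interval_of_convex:
 fixes I :: "real set"
 assumes "open I" "convex I" "bounded I" "I ~= {}"
 obtains a b where "a < b" "I = {a<..<b}"
proof -
 have "connected I" using assms(2) by (rule convex_connected)
 have bd: "bdd_above I" "bdd_below I" using assms(3) bounded_imp_bdd_above bounded_imp_bdd_below by auto
 have "I = {Inf I<..<Sup I}"
 proof (intro set_eqI iffI)
  fix t assume t: "t \<in> I"
  then obtain e where e: "e > 0" "ball t e \<subseteq> I" using assms(1) open_contains_ball by blast
  have "t - e / 2 \<in> I" "t + e / 2 \<in> I" using e by (auto intro!: subsetD[OF e(2)] simp: dist_real_def)
  then have "Inf I <= t - e / 2" "t + e / 2 <= Sup I" using bd by (auto intro: cInf_lower cSup_upper)
  then show "t \<in> {Inf I<..<Sup I}" using e(1) by simp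
 next
  fix t assume t: "t \<in> {Inf I<..<Sup I}"
  obtain x y where "x \<in> I" "x < t" "y \<in> I" "t < y" using t assms(4) bd by (auto simp: cInf_less_iff less_cSup_iff)
  then show "t \<in> I" using connected_contains_Icc[OF \<open>connected I\<close>, of x y] by auto
 qed
 moreover from this assms(4) have "Inf I < Sup I" by fastforce
 ultimately show thesis by (rule that[rotated])
qed

context director
begin

text \<open>On almost every line \<open>bulk\<close> plus k times \<open>jumps\<close> equals k. A
  whole line would cost at least pi^2 / (4 d) > k, so there is a jump; one jump already uses up k
  and leaves no bulk.\<close>

lemma minimal_slices:
 assumes k: "0 < k" "k < pi\<^sup>2 / (4 * d)" and le: "functional k <= ennreal k * ennreal (4 * L1 * L2)"
 shows "AE z in lborel. z \<in> base --> z \<notin> whole & bulk z = 0 & jumps z = 1"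
 using whole_bulk slice_equality[OF order_refl less_imp_le[OF k(2)] le]
proof eventually_elim
 case (elim z)
 show ?case
 proof
  assume z: "z \<in> base"
  have eq: "bulk z + ennreal k * jumps z = ennreal k" using elim(2) z by blast
  have nw: "z \<notin> whole"
  proof
   assume "z \<in> whole"
   then have "ennreal (pi\<^sup>2 / (4 * d)) + ennreal (5 / 4 * (pi / (2 * d))\<^sup>2) * excess z <= bulk z" using elim(1) z by blast
   then have "ennreal (pi\<^sup>2 / (4 * d)) <= bulk z" using order_trans[rotated] by fastforce
   also have "... <= bulk z + ennreal k * jumps z" by simp
   finally have "ennreal (pi\<^sup>2 / (4 * d)) <= ennreal k" unfolding eq .
   then show False using k by (simp add: ennreal_le_iff)
  qed
  have "ennreal k * jumps z <= bulk z + ennreal k * jumps z" by simp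
  also have "... = ennreal k * 1" using eq by simp
  finally have "jumps z <= 1" using k by (subst (asm) ennreal_mult_le_mult_iff) auto
  with jumps_ge_1[OF z nw] have "jumps z = 1" by simp
  with eq have "ennreal k + bulk z = ennreal k + 0" by (simp add: add.commute)
  then have "bulk z = 0" unfolding ennreal_add_left_cancel by simp
  with nw \<open>jumps z = 1\<close> show "z \<notin> whole & bulk z = 0 & jumps z = 1" by blast
 qed
qed

lemma minimal_area:
 assumes k: "0 < k" and le: "functional k <= ennreal k * ennreal (4 * L1 * L2)"
 shows "hausdorff 2 D <= ennreal (4 * L1 * L2)"
proof -
 have "ennreal k * hausdorff 2 D <= functional k" by (simp add: functional_def)
 also note le
 finally show ?thesis using k by (subst (asm) ennreal_mult_le_mult_iff) auto
qed

text \<open>The slices control H inside the cell only; in the layers it vanishes by hypothesis, and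
  the two faces are null sets.\<close>

lemma minimal_gradient_0:
 assumes k: "0 < k" "k < pi\<^sup>2 / (4 * d)" and le: "functional k <= ennreal k * ennreal (4 * L1 * L2)"
  and layers: "AE p in lborel. p \<in> U --> p $ 3 < 0 \<or> d < p $ 3 --> H p = 0"
 shows "AE p in lborel. p \<in> U --> H p = 0"
proof -
 have "(\<integral>\<^sup>+z. bulk z * indicator base z \<partial>lborel) = 0"
  using minimal_slices[OF k le] by (subst nn_integral_0_iff_AE) (auto elim!: eventually_mono simp: indicator_def)
 then have "(\<integral>\<^sup>+p. ennreal ((norm (H p))\<^sup>2) * indicator (cell L1 L2 d) p \<partial>lborel) = 0"
  unfolding bulk_def by (subst (asm) nn_integral_cell) auto
 moreover have [measurable]: "cell L1 L2 d \<in> sets borel" by (simp add: cell_def)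
 ultimately have cell0: "AE p in lborel. ennreal ((norm (H p))\<^sup>2) * indicator (cell L1 L2 d) p = 0" by (subst (asm) nn_integral_0_iff_AE) auto
 have face: "AE p in lborel. (p :: real^3) $ 3 ~= c" for c
 proof -
  have m: "Measurable.pred borel (%p :: real^3. p $ 3 ~= c)" by measurable
  show ?thesis unfolding AE_shear_iff[OF m, of 0 0] by (simp add: AE_lborel_singleton)
 qed
 show ?thesis using cell0 layers face[of 0] face[of d]
 proof eventually_elim
  case (elim p)
  then show ?case by (cases "p \<in> cell L1 L2 d") (auto simp: cell_def mem_box3)
 qed
qed

text \<open>With H = 0 the primitive in \<open>clear_slice_AE\<close> vanishes. The quantifier over
  rational heights stands inside the almost-everywhere statement, so one null set of lines serves
  all segments, for a fixed tilt.\<close>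

lemma constant_slices_AE:
 assumes H0: "AE p in lborel. p \<in> U --> H p = 0"
 shows "AE z in lborel. \<forall>r\<in>\<rat>. \<forall>s\<in>\<rat>. r < s --> z \<in> clear_feet s1 s2 r s -->
  (\<forall>i. \<exists>c. AE t in lborel. r < t & t < s --> u (shear s1 s2 (z, t)) $ i = c)"
proof (intro AE_ball_countable' countable_rat)
 fix r s :: real assume rs: "r \<in> \<rat>" "s \<in> \<rat>"
 show "AE z in lborel. r < s --> z \<in> clear_feet s1 s2 r s -->
  (\<forall>i. \<exists>c. AE t in lborel. r < t & t < s --> u (shear s1 s2 (z, t)) $ i = c)"
 proof (cases "- \<epsilon> < r & r < s & s < d + \<epsilon>")
  case False
  then have "\<not> (r < s & z \<in> clear_feet s1 s2 r s)" for z by (auto simp: clear_feet_def feet_def mem_box3)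
  then show ?thesis by (intro AE_I2) blast
 next
  case True
  have "AE z in lborel. \<forall>i\<in>UNIV. z \<in> clear_feet s1 s2 r s -->
   (\<exists>k. AE t in lborel. r < t & t < s --> u (shear s1 s2 (z, t)) $ i = k + primitive s1 s2 r i z t)"
   by (intro AE_finite_allI) (simp, rule clear_slice_AE, use True in auto)
  then show ?thesis using AE_shear[OF H0, of s1 s2]
  proof eventually_elim
   case (elim z)
   show ?case
   proof (intro impI allI)
    fix i assume z: "z \<in> clear_feet s1 s2 r s"
    have prim: "primitive s1 s2 r i z t = 0" if t: "t < s" for t unfolding primitive_def
    proof (rule integral_eq_zero_AE)
     show "AE \<tau> in lborel. indicator {r..t} \<tau> * HE s1 s2 i (shear s1 s2 (z, \<tau>)) = 0" using elim(2)
     proof eventually_elim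
      case (elim \<tau>)
      show ?case
      proof (cases "\<tau> \<in> {r..t}")
       case True
       then have "shear s1 s2 (z, \<tau>) \<in> U" using z t by (intro feet_shear[of z s1 s2 r s]) (auto simp: clear_feet_def)
       then show ?thesis using elim by (simp add: HE_def)
      qed simp
     qed
    qed
    obtain k where k: "AE t in lborel. r < t & t < s --> u (shear s1 s2 (z, t)) $ i = k + primitive s1 s2 r i z t" using elim(1) z by blast
    show "\<exists>c. AE t in lborel. r < t & t < s --> u (shear s1 s2 (z, t)) $ i = c"
     by (intro exI[of _ k]) (use k in eventually_elim, simp add: prim)
   qed
  qed
 qed
qed

lemma cover_sum_le:
 assumes "!!i. W i <= ennreal B"
 shows "(\<Sum>i. W i * (c * disc_area (C m i))) <= ennreal B * c * (hausdorff 2 D + ennreal (1 / real (Suc m)))"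
proof -
 have "(\<Sum>i. W i * (c * disc_area (C m i))) <= (\<Sum>i. ennreal B * c * disc_area (C m i))"
  by (intro suminf_le) (auto simp: mult.assoc intro!: mult_right_mono assms)
 also have "... = ennreal B * c * (\<Sum>i. disc_area (C m i))" by simp
 also have "... <= ennreal B * c * (hausdorff 2 D + ennreal (1 / real (Suc m)))" using C by (intro mult_left_mono) (auto simp: fine_covers_def)
 finally show ?thesis .
qed

lemma C_bounded: "bounded (C m i)" using C by (auto simp: fine_covers_def)

text \<open>The liminf of the line counts has a finite integral and dominates the number of points
  in every finite part of D on the line; infinitely many points would make it infinite. The tilt
  only costs a constant factor.\<close>

lemma finite_line_AE: "AE z in lborel. finite {t. shear s1 s2 (z, t) \<in> D}"
proof -
 define J where "J z = liminf (%m. line_count s1 s2 (C m) (%_. 1) z)" for z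
 have [measurable]: "J \<in> borel_measurable borel" unfolding J_def[abs_def] by measurable
 obtain h where h: "hausdorff 2 D = ennreal h" "h \<ge> 0" using D_finite by (cases "hausdorff 2 D") auto
 have "(\<integral>\<^sup>+z. J z \<partial>lborel) <= liminf (%m. \<Sum>i. 1 * (ennreal (1 + s1\<^sup>2 + s2\<^sup>2) * disc_area (C m i)))"
  unfolding J_def by (rule nn_integral_liminf_line_count) (rule C_bounded)
 also have "... <= limsup (%m. \<Sum>i. 1 * (ennreal (1 + s1\<^sup>2 + s2\<^sup>2) * disc_area (C m i)))" by (rule Liminf_le_Limsup) simp
 also have "... <= ennreal (1 + s1\<^sup>2 + s2\<^sup>2) * ennreal (h + 1)"
 proof (rule Limsup_bounded, rule always_eventually, rule allI)
  fix m
  have "(\<Sum>i. 1 * (ennreal (1 + s1\<^sup>2 + s2\<^sup>2) * disc_area (C m i)))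
    <= ennreal 1 * ennreal (1 + s1\<^sup>2 + s2\<^sup>2) * (hausdorff 2 D + ennreal (1 / real (Suc m)))" by (rule cover_sum_le) simp
  also have "... <= ennreal 1 * ennreal (1 + s1\<^sup>2 + s2\<^sup>2) * (ennreal h + ennreal 1)"
   unfolding h by (intro mult_left_mono add_mono ennreal_leI) auto
  finally show "(\<Sum>i. 1 * (ennreal (1 + s1\<^sup>2 + s2\<^sup>2) * disc_area (C m i))) <= ennreal (1 + s1\<^sup>2 + s2\<^sup>2) * ennreal (h + 1)"
   using h by simp
 qed
 also have "... < \<infinity>" by (simp add: ennreal_mult_less_top)
 finally have "(\<integral>\<^sup>+z. J z \<partial>lborel) ~= \<infinity>" by simp
 then have "AE z in lborel. J z ~= \<infinity>" by (intro nn_integral_PInf_AE) auto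
 then show ?thesis
 proof eventually_elim
  case (elim z)
  show ?case
  proof (rule ccontr)
   assume inf: "infinite {t. shear s1 s2 (z, t) \<in> D}"
   have "of_nat n <= J z" for n
   proof -
    obtain T where T: "T \<subseteq> {t. shear s1 s2 (z, t) \<in> D}" "finite T" "card T = n" using infinite_arbitrarily_large[OF inf] by blast
    have inj: "inj_on (%t. shear s1 s2 (z, t)) T" by (rule inj_onI) (metis shear_nth(3) snd_conv)
    have "(\<Sum>p\<in>(%t. shear s1 s2 (z, t)) ` T. 1) <= J z" unfolding J_def using T by (intro line_sum_le_liminf[OF C]) auto
    then show ?thesis using inj T by (simp add: card_image)
   qed
   then have "J z = \<infinity>" using ennreal_Ex_less_of_nat[of "J z"] by (force simp: top.not_eq_extremum not_le[symmetric])
   then show False using elim by simp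
  qed
 qed
qed

text \<open>A scalar that is 0 at e1 and 1 at e3. The clamp limits every jump to height 1, so its
  variation along a line is controlled by the number of jump points alone.\<close>

definition f :: "real^3 => real" where
 "f p = max 0 (min 1 (u p $ 3))"

lemma f_borel [measurable]: "f \<in> borel_measurable borel" unfolding f_def[abs_def] by measurable

lemma f_range: "0 <= f p" "f p <= 1" by (auto simp: f_def)

lemma f_abs_le: "\<bar>f p\<bar> <= 1" using f_range[of p] by simp

lemma line_interval:
 assumes "shear s1 s2 (z, t0) \<in> U"
 obtains a b where "a < b" "{t. shear s1 s2 (z, t) \<in> U} = {a<..<b}"
proof -
 define I where "I = {t. shear s1 s2 (z, t) \<in> U}"
 have c: "continuous_on UNIV (%t. shear s1 s2 (z, t))" by (rule continuous_on_compose2[OF continuous_shear[of UNIV]]) (auto intro!: continuous_intros)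
 have "I = (%t. shear s1 s2 (z, t)) -` U" by (auto simp: I_def)
 then have "open I" using c by (auto intro!: open_vimage open_box)
 moreover have "convex I" unfolding is_interval_convex_1[symmetric] is_interval_1
 proof (intro ballI allI impI)
  fix a b t assume "a \<in> I" "b \<in> I" "a <= t & t <= b"
  then show "t \<in> I" using feet_shear[of z s1 s2 a b t] by (auto simp: I_def feet_def)
 qed
 moreover have "bounded I" by (rule bounded_subset[of "{- \<epsilon>..d + \<epsilon>}"]) (auto simp: I_def mem_box3)
 moreover have "I ~= {}" using assms by (auto simp: I_def)
 ultimately show thesis using open_interval_of_convex[of I] that unfolding I_def by metis
qed

end

section \<open>Flux along tilted lines of a map without bulk gradient\<close>

lemma test_function_linear_combination:
 fixes \<phi> \<theta> :: "real ^ 'n => real"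
 assumes t: "test_function \<Omega> \<phi> g" "test_function \<Omega> \<theta> k"
 shows "test_function \<Omega> (%x. a * \<phi> x + b * \<theta> x) (%x. a *\<^sub>R g x + b *\<^sub>R k x)"
proof -
 have d: "(\<phi> has_derivative (%h. g x \<bullet> h)) (at x)" "(\<theta> has_derivative (%h. k x \<bullet> h)) (at x)" for x
  using t by (auto simp: test_function_def)
 have "((%x. a * \<phi> x + b * \<theta> x) has_derivative (%h. (a *\<^sub>R g x + b *\<^sub>R k x) \<bullet> h)) (at x)" for x
  by (rule has_derivative_eq_rhs[OF has_derivative_add[OF has_derivative_mult_right[OF d(1)] has_derivative_mult_right[OF d(2)]]])
   (simp add: fun_eq_iff inner_add_left)
 moreover have "continuous_on UNIV (%x. a *\<^sub>R g x + b *\<^sub>R k x)" using t by (intro continuous_intros) (auto simp: test_function_def)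
 moreover have sub: "closure {x. a * \<phi> x + b * \<theta> x ~= 0} \<subseteq> closure {x. \<phi> x ~= 0} \<union> closure {x. \<theta> x ~= 0}"
  unfolding closure_Un[symmetric] by (intro closure_mono) auto
 moreover have "compact (closure {x. \<phi> x ~= 0} \<union> closure {x. \<theta> x ~= 0})"
  using t by (intro compact_Un) (auto simp: test_function_def)
 then have "compact (closure {x. a * \<phi> x + b * \<theta> x ~= 0})"
  using bounded_subset[OF compact_imp_bounded order_trans[OF closure_subset sub]] by (simp add: compact_closure)
 moreover have "closure {x. \<phi> x ~= 0} \<union> closure {x. \<theta> x ~= 0} \<subseteq> \<Omega>" using t by (auto simp: test_function_def)
 ultimately show ?thesis unfolding test_function_def by blast
qed

lemma derivative_along_shear:
 assumes "!!x. (\<psi> has_derivative (%h. g x \<bullet> h)) (at x)"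
 shows "((%t. \<psi> (shear s1 s2 (z, t))) has_real_derivative
  g (shear s1 s2 (z, t)) $ 3 + s1 * g (shear s1 s2 (z, t)) $ 1 + s2 * g (shear s1 s2 (z, t)) $ 2) (at t)"
proof -
 define e where "e = (vector [s1, s2, 1] :: real^3)"
 have sh: "shear s1 s2 (z, t) = shear s1 s2 (z, 0) + t *\<^sub>R e" for t by (simp add: vec_eq_iff forall_3 e_def)
 have 1: "((%t. shear s1 s2 (z, 0) + t *\<^sub>R e) has_derivative (%h. h *\<^sub>R e)) (at t)" by (auto intro!: derivative_eq_intros)
 have "((%t. \<psi> (shear s1 s2 (z, 0) + t *\<^sub>R e)) has_derivative (%h. g (shear s1 s2 (z, 0) + t *\<^sub>R e) \<bullet> (h *\<^sub>R e))) (at t)"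
  by (rule has_derivative_compose[OF 1 assms])
 then show ?thesis unfolding has_field_derivative_def sh[symmetric]
  by (rule has_derivative_eq_rhs) (simp add: fun_eq_iff e_def inner_vec_def sum_3 algebra_simps)
qed

context director
begin

text \<open>An upper bound of the Lipschitz function \<psi> on the cover set, taken from its value
  at one chosen point. Unlike suprema, these values are additive: the weights of two functions add
  up to a weight of their sum, because both use the same point.\<close>

definition weight :: "(real^3 => real) => real => nat => nat => real" where
 "weight \<psi> M m i = (if C m i = {} then 0 else \<psi> (SOME p. p \<in> C m i) + M / real (Suc m))"

lemma le_weight:
 assumes lip: "!!p q. \<bar>\<psi> p - \<psi> q\<bar> <= M * dist p q" and M: "M \<ge> 0" and p: "p \<in> C m i"
 shows "\<psi> p <= weight \<psi> M m i"
proof -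
 define q where "q = (SOME p. p \<in> C m i)"
 have q: "q \<in> C m i" unfolding q_def by (rule someI[of _ p]) (rule p)
 have "dist p q <= diameter (C m i)" by (rule diameter_bounded_bound[OF C_bounded p q])
 also have "... <= 1 / real (Suc m)" using C unfolding fine_covers_def by blast
 finally have "M * dist p q <= M * (1 / real (Suc m))" using M by (rule mult_left_mono)
 then have "\<psi> p <= \<psi> q + M / real (Suc m)" using lip[of p q] by simp
 then show ?thesis using p by (auto simp: weight_def q_def)
qed

context
 fixes s1 s2 M :: real and \<psi> g
 assumes H0: "AE p in lborel. p \<in> U --> H p = 0"
  and test: "test_function U \<psi> g" and nonneg: "!!p. \<psi> p \<ge> 0"
  and lip: "!!p q. \<bar>\<psi> p - \<psi> q\<bar> <= M * dist p q" and M: "M \<ge> 0"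
begin

text \<open>Almost every line carries finitely many points of S and constant values in between, so
  the integral of f against the derivative of \<psi> is at most the sum of \<psi> over these points.
  That sum is then bounded by the weighted line counts.\<close>

lemma line_variation_AE:
 "AE z in lborel. ennreal \<bar>LBINT t. f (shear s1 s2 (z, t)) *
   (g (shear s1 s2 (z, t)) $ 3 + s1 * g (shear s1 s2 (z, t)) $ 1 + s2 * g (shear s1 s2 (z, t)) $ 2)\<bar>
  <= liminf (%m. line_count s1 s2 (C m) (%i. ennreal (weight \<psi> M m i)) z)" using constant_slices_AE[OF H0, of s1 s2] finite_line_AE[of s1 s2]
proof eventually_elim
 case (elim z)
 obtain Cs where Cs: "Cs \<subseteq> U" "!!x. x \<notin> Cs ==> \<psi> x = 0" "!!x. x \<notin> Cs ==> g x = 0"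
  using test_function_facts[OF test] by blast
 have out: "\<psi> x = 0" "g x = 0" if "x \<notin> U" for x using Cs that by blast+
 have cg: "continuous_on UNIV g" and der: "!!x. (\<psi> has_derivative (%h. g x \<bullet> h)) (at x)" using test by (auto simp: test_function_def)
 define \<eta> where "\<eta> t = \<psi> (shear s1 s2 (z, t))" for t
 define \<eta>' where "\<eta>' t = g (shear s1 s2 (z, t)) $ 3 + s1 * g (shear s1 s2 (z, t)) $ 1 + s2 * g (shear s1 s2 (z, t)) $ 2" for t
 define v where "v t = f (shear s1 s2 (z, t))" for t
 have [measurable]: "v \<in> borel_measurable borel" unfolding v_def[abs_def] by (rule measurable_compose[OF shear_slice_borel f_borel])
 have "ennreal \<bar>LBINT t. v t * \<eta>' t\<bar> <= liminf (%m. line_count s1 s2 (C m) (%i. ennreal (weight \<psi> M m i)) z)"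
 proof (cases "\<exists>t. shear s1 s2 (z, t) \<in> U")
  case False
  then have "\<eta>' t = 0" for t using out(2) by (simp add: \<eta>'_def)
  then show ?thesis by simp
 next
  case True
  then obtain t0 where "shear s1 s2 (z, t0) \<in> U" ..
  then obtain a b where ab: "a < b" and I: "{t. shear s1 s2 (z, t) \<in> U} = {a<..<b}" by (rule line_interval)
  have inU: "shear s1 s2 (z, t) \<in> U \<longleftrightarrow> a < t & t < b" for t using I by auto
  define F where "F = {t. shear s1 s2 (z, t) \<in> S}"
  have F: "finite F" unfolding F_def by (rule finite_subset[OF _ elim(2)]) (use S_D in auto)
  have c\<eta>': "continuous_on UNIV \<eta>'" unfolding \<eta>'_def[abs_def]
   by (intro continuous_intros continuous_on_compose2[OF cg] continuous_on_compose2[OF continuous_shear[of UNIV]]) auto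
  have "\<bar>LBINT t. indicator {a<..<b} t * (v t * \<eta>' t)\<bar> <= (\<Sum>t\<in>F. \<eta> t)"
  proof (rule piecewise_constant_variation[OF F ab])
   show "0 <= v t & v t <= 1" for t using f_range by (simp add: v_def)
   show "\<exists>c. AE t in lborel. r < t & t < s --> v t = c"
    if rs: "r \<in> \<rat>" "s \<in> \<rat>" "a < r" "r < s" "s < b" "{r..s} \<inter> F = {}" for r s
   proof -
    have "z \<in> clear_feet s1 s2 r s"
    proof -
     have "z \<in> feet s1 s2 r s" using rs by (simp add: feet_def inU)
     moreover have "z ~= foot s1 s2 p" if p: "p \<in> S" "r <= p $ 3" "p $ 3 <= s" for p
     proof
      assume "z = foot s1 s2 p"
      then have "shear s1 s2 (z, p $ 3) = p" by simp
      then have "p $ 3 \<in> F" using p(1) by (simp add: F_def)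
      then show False using rs(6) p by auto
     qed
     ultimately show ?thesis unfolding clear_feet_def by blast
    qed
    then obtain c where "AE t in lborel. r < t & t < s --> u (shear s1 s2 (z, t)) $ 3 = c" using elim(1) rs by blast
    then have "AE t in lborel. r < t & t < s --> v t = max 0 (min 1 c)" by eventually_elim (simp add: v_def f_def)
    then show ?thesis by blast
   qed
   show "(\<eta> has_real_derivative \<eta>' t) (at t)" for t unfolding \<eta>_def[abs_def] \<eta>'_def by (rule derivative_along_shear[OF der])
   show "\<eta> a = 0" "\<eta> b = 0" using out(1) inU[of a] inU[of b] by (auto simp: \<eta>_def)
  qed (auto simp: c\<eta>' \<eta>_def nonneg)
  moreover have "(%t. indicator {a<..<b} t * (v t * \<eta>' t)) = (%t. v t * \<eta>' t)"
  proof
   fix t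
   have "\<eta>' t = 0" if "t \<notin> {a<..<b}" using that inU[of t] out(2) by (auto simp: \<eta>'_def)
   then show "indicator {a<..<b} t * (v t * \<eta>' t) = v t * \<eta>' t" by (auto simp: indicator_def)
  qed
  ultimately have "\<bar>LBINT t. v t * \<eta>' t\<bar> <= (\<Sum>t\<in>F. \<eta> t)" by simp
  then have "ennreal \<bar>LBINT t. v t * \<eta>' t\<bar> <= ennreal (\<Sum>t\<in>F. \<eta> t)" by (rule ennreal_leI)
  also have "... = (\<Sum>t\<in>F. ennreal (\<eta> t))" by (simp add: \<eta>_def nonneg)
  also have "... = (\<Sum>p\<in>(%t. shear s1 s2 (z, t)) ` F. ennreal (\<psi> p))"
  proof -
   have "inj_on (%t. shear s1 s2 (z, t)) F" by (rule inj_onI) (metis shear_nth(3) snd_conv)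
   then show ?thesis by (simp add: sum.reindex \<eta>_def)
  qed
  also have "... <= liminf (%m. line_count s1 s2 (C m) (%i. ennreal (weight \<psi> M m i)) z)"
   using F S_D by (intro line_sum_le_liminf[OF C] ennreal_leI le_weight[OF lip M]) (auto simp: F_def)
  finally show ?thesis .
 qed
 then show ?case by (simp add: v_def \<eta>'_def)
qed

text \<open>Integrates the bound for single lines over the feet. The tilt is paid with the factor 1
  + s1^2 + s2^2 of the projected areas.\<close>

lemma flux_le_liminf:
 "ennreal \<bar>LBINT p. f p * (g p $ 3 + s1 * g p $ 1 + s2 * g p $ 2)\<bar>
  <= liminf (%m. \<Sum>i. ennreal (weight \<psi> M m i) * (ennreal (1 + s1\<^sup>2 + s2\<^sup>2) * disc_area (C m i)))"
proof -
 define F where "F p = f p * (g p $ 3 + s1 * g p $ 1 + s2 * g p $ 2)" for p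
 have "integrable lborel (%p. f p * g p $ j)" for j by (rule integrable_times_test_gradient[OF test f_borel f_abs_le])
 moreover have "F = (%p. f p * g p $ 3 + s1 * (f p * g p $ 1) + s2 * (f p * g p $ 2))" by (simp add: fun_eq_iff F_def algebra_simps)
 ultimately have iF: "integrable lborel F" by simp
 have "(LBINT p. F p) = (LBINT z. LBINT t. F (shear s1 s2 (z, t)))" by (rule integral_shear_iterated(2)[OF iF])
 then have "ennreal \<bar>LBINT p. F p\<bar> = ennreal (norm (LBINT z. LBINT t. F (shear s1 s2 (z, t))))" by simp
 also have "... <= (\<integral>\<^sup>+z. norm (LBINT t. F (shear s1 s2 (z, t))) \<partial>lborel)"
  by (rule integral_norm_bound_ennreal) (rule integral_shear_iterated(1)[OF iF])
 also have "... <= (\<integral>\<^sup>+z. liminf (%m. line_count s1 s2 (C m) (%i. ennreal (weight \<psi> M m i)) z) \<partial>lborel)"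
  by (rule nn_integral_mono_AE) (use line_variation_AE in \<open>simp add: F_def\<close>)
 also have "... <= liminf (%m. \<Sum>i. ennreal (weight \<psi> M m i) * (ennreal (1 + s1\<^sup>2 + s2\<^sup>2) * disc_area (C m i)))"
  by (rule nn_integral_liminf_line_count) (rule C_bounded)
 finally show ?thesis by (simp add: F_def)
qed

end

text \<open>Split \<theta> into (\<theta> + \<phi>) / 2 and (\<theta> - \<phi>) / 2, nonnegative
  because |\<phi>| <= \<theta>, and use the tilts s and - s for them. In the sum of the two fluxes
  the horizontal derivatives of \<theta> cancel and those of \<phi> add up, while the two weights
  together do not exceed that of \<theta> <= 1. Both tilts have the same quadratic cost.\<close>

lemma tilted_flux_bound:
 assumes H0: "AE p in lborel. p \<in> U --> H p = 0"
  and \<theta>: "test_function U \<theta> g" "!!p. \<theta> p <= 1" and \<phi>: "test_function U \<phi> k" "!!p. \<bar>\<phi> p\<bar> <= \<theta> p"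
 shows "\<bar>LBINT p. f p * (g p $ 3 + s1 * k p $ 1 + s2 * k p $ 2)\<bar> <= (1 + s1\<^sup>2 + s2\<^sup>2) * enn2real (hausdorff 2 D)"
proof -
 define h where "h = enn2real (hausdorff 2 D)"
 have h: "hausdorff 2 D = ennreal h" "h \<ge> 0" using D_finite by (auto simp: h_def)
 define c where "c = 1 + s1\<^sup>2 + s2\<^sup>2"
 have c: "c \<ge> 0" by (simp add: c_def)
 define \<psi>1 where "\<psi>1 p = 1 / 2 * \<theta> p + 1 / 2 * \<phi> p" for p
 define \<psi>2 where "\<psi>2 p = 1 / 2 * \<theta> p + (- 1 / 2) * \<phi> p" for p
 define g1 where "g1 p = (1 / 2) *\<^sub>R g p + (1 / 2) *\<^sub>R k p" for p
 define g2 where "g2 p = (1 / 2) *\<^sub>R g p + (- 1 / 2) *\<^sub>R k p" for p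
 have t: "test_function U \<psi>1 g1" "test_function U \<psi>2 g2" unfolding \<psi>1_def[abs_def] \<psi>2_def[abs_def] g1_def[abs_def] g2_def[abs_def]
  by (rule test_function_linear_combination[OF \<theta>(1) \<phi>(1)])+
 have n: "\<psi>1 p \<ge> 0" "\<psi>2 p \<ge> 0" for p using \<phi>(2)[of p] by (auto simp: \<psi>1_def \<psi>2_def)
 obtain M1 where M1: "M1 \<ge> 0" "!!p q. \<bar>\<psi>1 p - \<psi>1 q\<bar> <= M1 * dist p q" using test_function_lipschitz[OF t(1)] by blast
 obtain M2 where M2: "M2 \<ge> 0" "!!p q. \<bar>\<psi>2 p - \<psi>2 q\<bar> <= M2 * dist p q" using test_function_lipschitz[OF t(2)] by blast
 define A where "A = (LBINT p. f p * (g1 p $ 3 + s1 * g1 p $ 1 + s2 * g1 p $ 2))"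
 define B where "B = (LBINT p. f p * (g2 p $ 3 + (- s1) * g2 p $ 1 + (- s2) * g2 p $ 2))"
 define X where "X m = (\<Sum>i. ennreal (weight \<psi>1 M1 m i) * (ennreal c * disc_area (C m i)))" for m
 define Y where "Y m = (\<Sum>i. ennreal (weight \<psi>2 M2 m i) * (ennreal c * disc_area (C m i)))" for m
 have AX: "ennreal \<bar>A\<bar> <= liminf X" using flux_le_liminf[OF H0 t(1) n(1) M1(2,1), of s1 s2] by (simp add: A_def X_def[abs_def] c_def)
 have BY: "ennreal \<bar>B\<bar> <= liminf Y"
  using flux_le_liminf[OF H0 t(2) n(2) M2(2,1), of "- s1" "- s2"] by (simp add: B_def Y_def[abs_def] c_def)
 have w0: "weight \<psi>1 M1 m i \<ge> 0" "weight \<psi>2 M2 m i \<ge> 0" for m i using n M1 M2 by (auto simp: weight_def)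
 \<comment> \<open>The two sums run over the same cover, so they are added set by set before any
   limit; \<open>cover_sum_le\<close> then needs only the sum of the weights.\<close>
 have XY: "X m + Y m <= ennreal ((1 + (M1 + M2) / real (Suc m)) * c * (h + 1 / real (Suc m)))" for m
 proof -
  have "X m + Y m = (\<Sum>i. ennreal (weight \<psi>1 M1 m i) * (ennreal c * disc_area (C m i)) + ennreal (weight \<psi>2 M2 m i) * (ennreal c * disc_area (C m i)))"
   unfolding X_def Y_def by (rule suminf_add) auto
  also have "... = (\<Sum>i. (ennreal (weight \<psi>1 M1 m i + weight \<psi>2 M2 m i)) * (ennreal c * disc_area (C m i)))"
   using w0 by (simp add: distrib_right)
  also have "... <= ennreal (1 + (M1 + M2) / real (Suc m)) * ennreal c * (hausdorff 2 D + ennreal (1 / real (Suc m)))"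
  proof (rule cover_sum_le, rule ennreal_leI)
   fix i
   show "weight \<psi>1 M1 m i + weight \<psi>2 M2 m i <= 1 + (M1 + M2) / real (Suc m)" using \<theta>(2)[of "SOME p. p \<in> C m i"] M1(1) M2(1)
    by (auto simp: weight_def \<psi>1_def \<psi>2_def add_divide_distrib)
  qed
  also have "... = ennreal ((1 + (M1 + M2) / real (Suc m)) * c * (h + 1 / real (Suc m)))" unfolding h(1) using h(2) c M1(1) M2(1)
   by (simp add: ennreal_plus[symmetric] ennreal_mult[symmetric] del: ennreal_plus)
  finally show ?thesis .
 qed
 have lim0: "(%m. K' / real (Suc m)) \<longlonglongrightarrow> 0" for K' using LIMSEQ_Suc[OF lim_const_over_n[of K']] by simp
 have "(%m. (1 + (M1 + M2) / real (Suc m)) * c * (h + 1 / real (Suc m))) \<longlonglongrightarrow> (1 + 0) * c * (h + 0)"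
  by (intro tendsto_intros lim0)
 then have "(%m. ennreal ((1 + (M1 + M2) / real (Suc m)) * c * (h + 1 / real (Suc m)))) \<longlonglongrightarrow> ennreal (c * h)"
  by (intro tendsto_ennrealI) simp
 then have L: "liminf (%m. ennreal ((1 + (M1 + M2) / real (Suc m)) * c * (h + 1 / real (Suc m)))) = ennreal (c * h)" by (intro lim_imp_Liminf) auto
 have "ennreal (\<bar>A\<bar> + \<bar>B\<bar>) = ennreal \<bar>A\<bar> + ennreal \<bar>B\<bar>" by simp
 also have "... <= liminf X + liminf Y" by (intro add_mono AX BY)
 also have "... <= liminf (%m. X m + Y m)" by (rule liminf_add_superadditive)
 also have "... <= ennreal (c * h)" unfolding L[symmetric] by (intro Liminf_mono always_eventually allI XY)
 finally have le: "\<bar>A\<bar> + \<bar>B\<bar> <= c * h" using c h(2) by (subst (asm) ennreal_le_iff) auto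
 note int = integrable_times_test_gradient[OF _ f_borel f_abs_le]
 have "A + B = (LBINT p. f p * (g p $ 3 + s1 * k p $ 1 + s2 * k p $ 2))"
 proof -
  have e: "f p * (g' p $ 3 + a * g' p $ 1 + b * g' p $ 2) = f p * g' p $ 3 + a * (f p * g' p $ 1) + b * (f p * g' p $ 2)"
   for p a b and g' :: "real^3 => real^3" by (simp add: algebra_simps)
  have "A + B = (LBINT p. f p * (g1 p $ 3 + s1 * g1 p $ 1 + s2 * g1 p $ 2)
    + f p * (g2 p $ 3 + (- s1) * g2 p $ 1 + (- s2) * g2 p $ 2))" unfolding A_def B_def using int[OF t(1)] int[OF t(2)] unfolding e by simp
  also have "... = (LBINT p. f p * (g p $ 3 + s1 * k p $ 1 + s2 * k p $ 2))" by (intro lint_cong) (auto simp: g1_def g2_def algebra_simps)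
  finally show ?thesis .
 qed
 then show ?thesis using le unfolding c_def h_def by linarith
qed

end

section \<open>Vanishing horizontal flux and functions with weak gradient zero\<close>

lemma plateau'_eq_0:
 assumes m: "m > 0" and t: "t < l + 1 / m \<or> u - 1 / m < t \<or> l + 2 / m < t & t < u - 2 / m"
 shows "plateau' m l u t = 0"
proof -
 obtain c T where T: "open T" "t \<in> T" "!!x. x \<in> T ==> plateau m l u x = c"
 proof (cases "l + 2 / m < t & t < u - 2 / m")
  case True
  then show ?thesis using that[of "{l + 2 / m<..<u - 2 / m}" 1] plateau_eq_1[OF m] by auto
 next
  case False
  have z: "plateau m l u x = 0" if "x < l + 1 / m \<or> u - 1 / m < x" for x using plateau_support[OF m, of l u x] that by (meson leD)
  show ?thesis
  proof (rule that[of "{..<l + 1 / m} \<union> {u - 1 / m<..}" 0])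
   show "t \<in> {..<l + 1 / m} \<union> {u - 1 / m<..}" using False t by auto
  qed (use z in auto)
 qed
 have "((%_. c) has_real_derivative plateau' m l u t) (at t)"
  by (rule has_field_derivative_transform_within_open[OF plateau_deriv T(1,2)]) (use T(3) in auto)
 moreover have "((%_. c) has_real_derivative 0) (at t)" by simp
 ultimately show ?thesis by (rule DERIV_unique)
qed

lemma integrable_indicator_Ioo: "integrable lborel (indicat_real {l<..<u :: real})"
 by (intro integrable_real_indicator emeasure_bounded_finite bounded_subset[of "{l..u}" "{l<..<u}"]) auto

lemma plateau_le_indicator: "m > 0 ==> \<bar>plateau m l u t\<bar> <= indicator {l<..<u} t"
proof -
 assume m: "m > 0"
 then have "1 / m > 0" by simp
 have "plateau m l u t = 0" if "t \<notin> {l<..<u}"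
 proof (rule ccontr)
  assume "plateau m l u t ~= 0"
  from plateau_support[OF m this] \<open>1 / m > 0\<close> have "l < t" "t < u" by linarith+
  then show False using that by simp
 qed
 then show ?thesis using plateau_range[of m l u t] by (auto simp: indicator_def)
qed

lemma plateau_integrable: "m > 0 ==> integrable lborel (plateau m l u)"
proof -
 assume m: "m > 0"
 show ?thesis
 proof (rule integrable_dominated)
  show "integrable lborel (indicat_real {l<..<u})" by (rule integrable_indicator_Ioo)
  show "AE t in lborel. norm (plateau m l u t) <= norm (indicat_real {l<..<u} t)" using plateau_le_indicator[OF m] by auto
  show "plateau m l u \<in> borel_measurable lborel" using plateau_continuous by (auto intro: continuous_borel)
 qed
qed

lemma integral_plateau_tendsto:
 assumes "l <= u"
 shows "(%n. LBINT t. plateau (real (Suc n)) l u t) \<longlonglongrightarrow> u - l"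
proof -
 have "(%n. LBINT t. plateau (real (Suc n)) l u t) \<longlonglongrightarrow> (LBINT t. indicator {l<..<u} t)"
 proof (rule integral_dominated_convergence[where w="indicator {l<..<u}"])
  show "plateau (real (Suc n)) l u \<in> borel_measurable lborel" for n using plateau_continuous by (auto intro: continuous_borel)
  show "AE t in lborel. (%n. plateau (real (Suc n)) l u t) \<longlonglongrightarrow> indicator {l<..<u} t" by (intro AE_I2 plateau_tendsto)
  show "AE t in lborel. norm (plateau (real (Suc n)) l u t) <= indicator {l<..<u} t" for n
   using plateau_le_indicator[of "real (Suc n)" l u] by (intro AE_I2) (simp del: of_nat_Suc)
 qed (auto simp: integrable_indicator_Ioo)
 then show ?thesis using assms by simp
qed

lemma integral_product:
 fixes f g :: "real => real"
 assumes f: "integrable lborel f" and g: "integrable lborel g"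
 shows "integrable lborel (%z. f (fst z) * g (snd z))"
  "(LBINT z. f (fst z) * g (snd z)) = (LBINT t. f t) * (LBINT t. g t)"
proof -
 have i: "integrable (lborel \<Otimes>\<^sub>M lborel) (%z. f (fst z) * g (snd z))"
  using lborel_product_integrable[OF f g] by (simp add: case_prod_beta')
 then show "integrable lborel (%z. f (fst z) * g (snd z))" by (simp add: lborel_prod)
 show "(LBINT z. f (fst z) * g (snd z)) = (LBINT t. f t) * (LBINT t. g t)" using lborel_pair.integral_fst'[OF i] by (simp add: lborel_prod)
qed

lemma product_test_function:
 fixes P1 P2 P3 :: "real => real"
 assumes d: "!!t. (P1 has_real_derivative P1' t) (at t)" "!!t. (P2 has_real_derivative P2' t) (at t)"
   "!!t. (P3 has_real_derivative P3' t) (at t)"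
  and c: "continuous_on UNIV P1'" "continuous_on UNIV P2'" "continuous_on UNIV P3'" and e: "e > 0"
  and supp: "!!t. P1 t ~= 0 ==> l1 + e <= t & t <= u1 - e" "!!t. P2 t ~= 0 ==> l2 + e <= t & t <= u2 - e"
   "!!t. P3 t ~= 0 ==> l3 + e <= t & t <= u3 - e"
 shows "test_function (box (vector [l1, l2, l3]) (vector [u1, u2, u3]) :: (real^3) set) (%p. P1 (p $ 1) * (P2 (p $ 2) * P3 (p $ 3)))
  (%p. vector [P1' (p $ 1) * (P2 (p $ 2) * P3 (p $ 3)), P1 (p $ 1) * (P2' (p $ 2) * P3 (p $ 3)),
   P1 (p $ 1) * (P2 (p $ 2) * P3' (p $ 3))])"
proof -
 define Q where "Q = (cbox (vector [l1 + e, l2 + e, l3 + e]) (vector [u1 - e, u2 - e, u3 - e]) :: (real^3) set)"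
 have Q: "compact Q" "Q \<subseteq> box (vector [l1, l2, l3]) (vector [u1, u2, u3])"
  using e by (auto simp: Q_def mem_box3 mem_box_cart forall_3 intro: compact_cbox)
 have sub: "closure {p. P1 (p $ 1) * (P2 (p $ 2) * P3 (p $ 3)) ~= 0} \<subseteq> Q"
  using Q(1) supp by (intro closure_minimal) (auto simp: Q_def mem_box_cart forall_3 compact_imp_closed)
 then have "compact (closure {p :: real^3. P1 (p $ 1) * (P2 (p $ 2) * P3 (p $ 3)) ~= 0})"
  using bounded_subset[OF compact_imp_bounded[OF Q(1)] order_trans[OF closure_subset sub]] by (simp add: compact_closure)
 with sub Q(2) sheared_product_derivative(1,2)[OF d c, of 0 0] show ?thesis
  unfolding test_function_def by (simp only: diff_zero mult_zero_left minus_zero add_0_left diff_self) blast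
qed

text \<open>A linear function of s below a multiple of s^2 has slope 0; s = B / (2 A) makes the
  contradiction explicit.\<close>

lemma zero_if_quadratic_bound:
 fixes A B :: real
 assumes "A > 0" "!!s. s * B <= s\<^sup>2 * A"
 shows "B = 0"
proof (rule ccontr)
 assume "B ~= 0"
 have "B / (2 * A) * B <= (B / (2 * A))\<^sup>2 * A" by (rule assms)
 then have "B\<^sup>2 * (1 / (2 * A)) <= B\<^sup>2 * (1 / (4 * A))" using assms(1) by (simp add: power2_eq_square field_simps)
 then have "1 / (2 * A) <= 1 / (4 * A)" using \<open>B ~= 0\<close> by (subst (asm) mult_le_cancel_left_pos) auto
 then show False using assms(1) by (simp add: field_simps)
qed

text \<open>The du Bois-Reymond lemma in a rectangle, one variable at a time: a factor of a product
  weight may be replaced by a multiple of a fixed bump with the same mean, since the difference is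
  the derivative of a compactly supported function. Thus G acts on every product of plateaus as a
  constant c does.\<close>

lemma const_if_weak_gradient_0:
 fixes G :: "real \<times> real => real"
 assumes L: "L1 > 0" "L2 > 0" and [measurable]: "G \<in> borel_measurable borel" and bd: "!!z. \<bar>G z\<bar> <= B"
  and w: "!!P P' R R' e. e > 0 ==> (!!t. (P has_real_derivative P' t) (at t)) ==> (!!t. (R has_real_derivative R' t) (at t)) ==>
    continuous_on UNIV P' ==> continuous_on UNIV R' ==>
    (!!t. P t ~= 0 ==> - L1 + e <= t & t <= L1 - e) ==> (!!t. R t ~= 0 ==> - L2 + e <= t & t <= L2 - e) ==>
    (LBINT z. G z * (P' (fst z) * R (snd z))) = 0 & (LBINT z. G z * (P (fst z) * R' (snd z))) = 0"
 shows "\<exists>c. AE z in lborel. - L1 < fst z & fst z < L1 & - L2 < snd z & snd z < L2 --> G z = c"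
proof -
 define I where "I P R = (LBINT z. G z * (P (fst z) * R (snd z)))" for P R :: "real => real"
 have int: "integrable lborel (%z. G z * (P (fst z) * R (snd z)))" if "integrable lborel P" "integrable lborel R" for P R
 proof (rule integrable_dominated)
  show "integrable lborel (%z. B * (P (fst z) * R (snd z)))" using integral_product(1)[OF that] by simp
  have [measurable]: "(%z. P (fst z) * R (snd z)) \<in> borel_measurable borel" using integral_product(1)[OF that] by auto
  show "(%z. G z * (P (fst z) * R (snd z))) \<in> borel_measurable lborel" by measurable
  show "AE z in lborel. norm (G z * (P (fst z) * R (snd z))) <= norm (B * (P (fst z) * R (snd z)))"
   using bd by (intro AE_I2) (auto simp: abs_mult intro!: mult_right_mono order_trans[OF bd abs_ge_self])
 qed
 \<comment> \<open>Then 2 / n is at most a quarter of L1 and of L2, and the reference bumps equal 1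
   at least on the middle halves.\<close>
 define n where "n = max (8 / L1) (8 / L2)"
 have n: "n > 0" "2 / n <= L1 / 4" "2 / n <= L2 / 4" using L by (auto simp: n_def field_simps max_def)
 have pos: "(LBINT t. plateau n (- l) l t) > 0" if l: "l > 0" "2 / n <= l / 4" for l
 proof -
  have "l <= (LBINT t. indicator {- l / 2..l / 2} t)" using l by simp
  also have "... <= (LBINT t. plateau n (- l) l t)"
  proof (rule integral_mono)
   show "indicator {- l / 2..l / 2} t <= plateau n (- l) l t" for t
    using plateau_range(1)[of n "- l" l t] plateau_eq_1[OF n(1), of "- l" t l] l by (auto simp: indicator_def)
   show "integrable lborel (indicat_real {- l / 2..l / 2})" by (intro integrable_real_indicator emeasure_bounded_finite) auto
  qed (rule plateau_integrable[OF n(1)])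
  finally show ?thesis using l by simp
 qed
 define b1 where "b1 = plateau n (- L1) L1"
 define b2 where "b2 = plateau n (- L2) L2"
 define c where "c = I b1 b2 / ((LBINT t. b1 t) * (LBINT t. b2 t))"
 have b: "(LBINT t. b1 t) > 0" "(LBINT t. b2 t) > 0" using pos L n by (auto simp: b1_def b2_def)
 \<comment> \<open>Compactly supported antiderivative of the mean-zero combination; its distance
   from the boundary is that of the two plateaus.\<close>
 have reduce: "\<exists>P. (\<forall>t. (P has_real_derivative plateau m l u t - (LBINT t. plateau m l u t) / (LBINT t. plateau n (- L) L t) * plateau n (- L) L t) (at t))
   & (\<forall>t. P t ~= 0 --> - L + min (1 / m) (1 / n) <= t & t <= L - min (1 / m) (1 / n))"
  if m: "m > 0" and lu: "- L <= l" "u <= L" and L: "L > 0" "2 / n <= L / 4" for m l u L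
 proof -
  define q where "q = (LBINT t. plateau m l u t) / (LBINT t. plateau n (- L) L t)"
  have z: "(LBINT t. plateau m l u t - q * plateau n (- L) L t) = 0"
   using plateau_integrable[OF m] plateau_integrable[OF n(1)] pos[OF L] by (simp add: q_def)
  have cont: "continuous_on UNIV (%t. plateau m l u t - q * plateau n (- L) L t)" by (intro continuous_intros plateau_continuous)
  have s: "- L + min (1 / m) (1 / n) <= t & t <= L - min (1 / m) (1 / n)" if "plateau m l u t - q * plateau n (- L) L t ~= 0" for t
  proof -
   have "plateau m l u t ~= 0 \<or> plateau n (- L) L t ~= 0" using that by auto
   then show ?thesis using plateau_support[OF m, of l u t] plateau_support[OF n(1), of "- L" L t] lu by linarith
  qed
  have "min (1 / m) (1 / n) <= L" using n(1) L by (simp add: min_le_iff_disj field_simps)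
  then have "- L + min (1 / m) (1 / n) <= L - min (1 / m) (1 / n)" using L n by (simp add: field_simps min_def split: if_splits)
  from antiderivative_compact_support[OF cont s z this] show ?thesis unfolding q_def by metis
 qed
 \<comment> \<open>The replacement is made in the first factor with \<rho>2 fixed, then in the
   second factor with the bump b1 in the first.\<close>
 have prod: "I (plateau m l1 u1) (plateau m l2 u2) = c * ((LBINT t. plateau m l1 u1 t) * (LBINT t. plateau m l2 u2 t))"
  if m: "m > 0" and lu: "- L1 <= l1" "u1 <= L1" "- L2 <= l2" "u2 <= L2" for m l1 u1 l2 u2
 proof -
  define e where "e = min (1 / m) (1 / n)"
  have e: "e > 0" using m n by (simp add: e_def)
  define \<rho>1 where "\<rho>1 = plateau m l1 u1"
  define \<rho>2 where "\<rho>2 = plateau m l2 u2"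
  define q1 where "q1 = (LBINT t. \<rho>1 t) / (LBINT t. b1 t)"
  define q2 where "q2 = (LBINT t. \<rho>2 t) / (LBINT t. b2 t)"
  have i: "integrable lborel \<rho>1" "integrable lborel \<rho>2" "integrable lborel b1" "integrable lborel b2"
   using plateau_integrable m n by (auto simp: \<rho>1_def \<rho>2_def b1_def b2_def)
  have ct: "continuous_on UNIV \<rho>1" "continuous_on UNIV \<rho>2" "continuous_on UNIV b1" "continuous_on UNIV b2"
   by (auto simp: \<rho>1_def \<rho>2_def b1_def b2_def intro: plateau_continuous)
  have supp: "\<rho>2 t ~= 0 ==> - L2 + e <= t & t <= L2 - e" "b1 t ~= 0 ==> - L1 + e <= t & t <= L1 - e" for t
   using plateau_support[OF m, of l2 u2 t] plateau_support[OF n(1), of "- L1" L1 t] lu unfolding \<rho>2_def b1_def e_def by linarith+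
  obtain P1 where P1: "!!t. (P1 has_real_derivative \<rho>1 t - q1 * b1 t) (at t)" "!!t. P1 t ~= 0 ==> - L1 + e <= t & t <= L1 - e"
   using reduce[OF m lu(1,2) L(1) n(2)] unfolding q1_def b1_def \<rho>1_def e_def by blast
  obtain P2 where P2: "!!t. (P2 has_real_derivative \<rho>2 t - q2 * b2 t) (at t)" "!!t. P2 t ~= 0 ==> - L2 + e <= t & t <= L2 - e"
   using reduce[OF m lu(3,4) L(2) n(3)] unfolding q2_def b2_def \<rho>2_def e_def by blast
  have d\<rho>2: "!!t. (\<rho>2 has_real_derivative plateau' m l2 u2 t) (at t)" unfolding \<rho>2_def by (rule plateau_deriv)
  have db1: "!!t. (b1 has_real_derivative plateau' n (- L1) L1 t) (at t)" unfolding b1_def by (rule plateau_deriv)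
  have c1: "continuous_on UNIV (%t. \<rho>1 t - q1 * b1 t)" "continuous_on UNIV (%t. \<rho>2 t - q2 * b2 t)" by (intro continuous_intros ct)+
  have "(LBINT z. G z * ((\<rho>1 (fst z) - q1 * b1 (fst z)) * \<rho>2 (snd z))) = 0"
   using w[OF e P1(1) d\<rho>2 c1(1) plateau'_continuous P1(2) supp(1)] by blast
  then have s1: "I \<rho>1 \<rho>2 = q1 * I b1 \<rho>2" unfolding I_def using int[OF i(1,2)] int[OF i(3,2)] by (simp add: algebra_simps)
  have "(LBINT z. G z * (b1 (fst z) * (\<rho>2 (snd z) - q2 * b2 (snd z)))) = 0"
   using w[OF e db1 P2(1) plateau'_continuous c1(2) supp(2) P2(2)] by blast
  then have s2: "I b1 \<rho>2 = q2 * I b1 b2" unfolding I_def using int[OF i(3,2)] int[OF i(3,4)] by (simp add: algebra_simps)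
  show ?thesis using s1 s2 b unfolding c_def q1_def q2_def \<rho>1_def \<rho>2_def by simp
 qed
 define Q where "Q = {- L1<..<L1} \<times> {- L2<..<L2}"
 have Qbox: "Q = box (- L1, - L2) (L1, L2)" by (auto simp: Q_def box_prod box_real)
 have [measurable]: "Q \<in> sets borel" unfolding Qbox by simp
 define F where "F z = indicator Q z * (G z - c)" for z
 have iQ: "integrable lborel (%z. (B + \<bar>c\<bar>) * indicator Q z)"
 proof -
  have "emeasure lborel Q < \<infinity>" unfolding Qbox by (rule emeasure_bounded_finite) (rule bounded_box)
  then show ?thesis by simp
 qed
 have Fb: "\<bar>G z - c\<bar> <= B + \<bar>c\<bar>" for z using bd[of z] by linarith
 have [measurable]: "F \<in> borel_measurable borel" unfolding F_def[abs_def] by measurable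
 have F: "integrable lborel F" by (rule integrable_dominated[OF iQ])
   (use Fb in \<open>auto simp: F_def indicator_def intro!: AE_I2 order_trans[OF Fb abs_ge_self]\<close>)
 have "AE z in lborel. F z = 0"
 proof (rule AE_0_if_integral_box_0[OF F])
  fix a b' :: "real \<times> real"
  define l1 l2 u1 u2 where "l1 = max (- L1) (fst a)" and "l2 = max (- L2) (snd a)"
   and "u1 = min L1 (fst b')" and "u2 = min L2 (snd b')"
  define \<rho> where "\<rho> k z = plateau (real (Suc k)) l1 u1 (fst z) * plateau (real (Suc k)) l2 u2 (snd z)" for k :: nat and z
  have lu: "- L1 <= l1" "u1 <= L1" "- L2 <= l2" "u2 <= L2" by (auto simp: l1_def l2_def u1_def u2_def)
  have z0: "(LBINT z. \<rho> k z * (G z - c)) = 0" for k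
  proof -
   have m: "real (Suc k) > 0" by simp
   note p = plateau_integrable[OF m, of l1 u1] plateau_integrable[OF m, of l2 u2]
   have "(LBINT z. \<rho> k z * (G z - c)) = I (plateau (real (Suc k)) l1 u1) (plateau (real (Suc k)) l2 u2) - c * (LBINT z. \<rho> k z)"
    unfolding I_def \<rho>_def using int[OF p] integral_product(1)[OF p] by (simp add: algebra_simps del: of_nat_Suc)
   then show ?thesis unfolding prod[OF m lu] \<rho>_def integral_product(2)[OF p] by simp
  qed
  have "(%k. LBINT z. \<rho> k z * (G z - c)) \<longlonglongrightarrow> (LBINT z. indicator (box a b') z * F z)"
  proof (rule integral_dominated_convergence[OF _ _ iQ])
   show "(%z. indicator (box a b') z * F z) \<in> borel_measurable lborel" using F by measurable
   have [measurable]: "\<rho> k \<in> borel_measurable borel" for k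
   proof -
    have m: "real (Suc k) > 0" by simp
    have "integrable lborel (\<rho> k)" unfolding \<rho>_def[abs_def] by (intro integral_product(1) plateau_integrable m)
    then show ?thesis by auto
   qed
   show "(%z. \<rho> k z * (G z - c)) \<in> borel_measurable lborel" for k by measurable
   show "AE z in lborel. (%k. \<rho> k z * (G z - c)) \<longlonglongrightarrow> indicator (box a b') z * F z"
   proof (rule AE_I2)
    fix z :: "real \<times> real"
    have "(%k. \<rho> k z * (G z - c)) \<longlonglongrightarrow> indicator {l1<..<u1} (fst z) * indicator {l2<..<u2} (snd z) * (G z - c)"
     unfolding \<rho>_def by (intro tendsto_intros plateau_tendsto)
    moreover have "indicator {l1<..<u1} (fst z) * indicator {l2<..<u2} (snd z) * (G z - c) = indicator (box a b') z * F z"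
     by (cases z; cases a; cases b')
      (auto simp: F_def Q_def l1_def l2_def u1_def u2_def indicator_def box_prod box_real)
    ultimately show "(%k. \<rho> k z * (G z - c)) \<longlonglongrightarrow> indicator (box a b') z * F z" by simp
   qed
   show "AE z in lborel. norm (\<rho> k z * (G z - c)) <= (B + \<bar>c\<bar>) * indicator Q z" for k
   proof (rule AE_I2)
    fix z :: "real \<times> real"
    have m: "real (Suc k) > 0" by simp
    have "\<bar>\<rho> k z\<bar> <= indicator {l1<..<u1} (fst z) * indicator {l2<..<u2} (snd z)"
     unfolding \<rho>_def abs_mult by (intro mult_mono plateau_le_indicator m) auto
    also have "... <= indicator Q z" using lu by (cases z) (auto simp: Q_def indicator_def)
    finally have "\<bar>\<rho> k z\<bar> * \<bar>G z - c\<bar> <= indicator Q z * (B + \<bar>c\<bar>)" using Fb[of z] by (intro mult_mono) auto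
    then show "norm (\<rho> k z * (G z - c)) <= (B + \<bar>c\<bar>) * indicator Q z" by (simp add: abs_mult mult.commute)
   qed
  qed
  then show "(LBINT z. indicator (box a b') z * F z) = 0" unfolding z0 using LIMSEQ_unique[OF tendsto_const] by metis
 qed
 then have "AE z in lborel. - L1 < fst z & fst z < L1 & - L2 < snd z & snd z < L2 --> G z = c"
  by eventually_elim (auto simp: F_def Q_def indicator_def mem_Times_iff split: if_splits)
 then show ?thesis by blast
qed

lemma AE_Ioo_witness:
 fixes a b :: real
 assumes "AE t in lborel. P t" "a < b"
 obtains t where "a < t" "t < b" "P t"
proof -
 obtain N where N: "{t. \<not> P t} \<subseteq> N" "N \<in> null_sets lborel" using assms(1) by (auto simp: eventually_ae_filter)
 have "\<not> {a<..<b} \<subseteq> N"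
 proof
  assume "{a<..<b} \<subseteq> N"
  then have "emeasure lborel {a<..<b} <= emeasure lborel N" using N(2) by (intro emeasure_mono) auto
  then show False using N(2) assms(2) by (auto dest: null_setsD1)
 qed
 then obtain t where "a < t" "t < b" "t \<notin> N" by (meson subsetI greaterThanLessThan_iff)
 then show ?thesis using that[of t] N(1) by blast
qed

context director
begin

text \<open>As 2 / m < \<epsilon>, the vertical cutoff varies only in the two layers, where f is
  known: 0 below and 1 above. Its descent from 1 to 0 in the upper layer gives the factor - 1,
  independently of what happens in the cell.\<close>

lemma plateau_flux_f:
 assumes m: "m > 0" "2 / m < \<epsilon>"
 shows "(LBINT p. f p * (plateau m (- L1) L1 (p $ 1) * (plateau m (- L2) L2 (p $ 2) * plateau' m (- \<epsilon>) (d + \<epsilon>) (p $ 3))))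
  = - ((LBINT t. plateau m (- L1) L1 t) * (LBINT t. plateau m (- L2) L2 t))"
proof -
 define P where "P z = plateau m (- L1) L1 (fst z) * plateau m (- L2) L2 (snd z)" for z
 define \<eta>' where "\<eta>' = plateau' m (- \<epsilon>) (d + \<epsilon>)"
 have m': "1 / m > 0" "2 / m > 0" using m by auto
 have zero: "\<eta>' t = 0" if "t <= - \<epsilon> \<or> 0 <= t & t <= d \<or> d + \<epsilon> <= t" for t
  unfolding \<eta>'_def by (rule plateau'_eq_0[OF m(1)]) (use that m m' in linarith)
 have total: "(LBINT t. indicator {d..d + \<epsilon>} t * \<eta>' t) = - 1"
 proof -
  have "plateau m (- \<epsilon>) (d + \<epsilon>) (d + \<epsilon>) = plateau m (- \<epsilon>) (d + \<epsilon>) d + (LBINT t. indicator {d..d + \<epsilon>} t * \<eta>' t)"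
   unfolding \<eta>'_def using \<epsilon>_pos by (intro primitive_of_deriv) (auto intro: plateau_deriv plateau'_continuous)
  moreover have "plateau m (- \<epsilon>) (d + \<epsilon>) d = 1" using m d_pos by (intro plateau_eq_1) auto
  moreover have "plateau m (- \<epsilon>) (d + \<epsilon>) (d + \<epsilon>) = 0" using plateau_le_indicator[OF m(1), of "- \<epsilon>" "d + \<epsilon>" "d + \<epsilon>"] by simp
  ultimately show ?thesis by simp
 qed
 define F where "F p = f p * (plateau m (- L1) L1 (p $ 1) * (plateau m (- L2) L2 (p $ 2) * \<eta>' (p $ 3)))" for p
 have pb [measurable]: "plateau m l r \<in> borel_measurable borel" for l r using plateau_continuous by (auto intro: continuous_borel)
 have eb [measurable]: "\<eta>' \<in> borel_measurable borel" unfolding \<eta>'_def using plateau'_continuous by (auto intro: continuous_borel)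
 have iF: "integrable lborel F"
 proof (rule integrable_dominated)
  show "integrable lborel (%p :: real^3. plateau m (- L1) L1 (p $ 1) * (plateau m (- L2) L2 (p $ 2) * \<eta>' (p $ 3)))"
  proof (rule integrable_continuous_compact_support)
   show "compact (cbox (vector [- L1, - L2, - \<epsilon>]) (vector [L1, L2, d + \<epsilon>]) :: (real^3) set)" by (rule compact_cbox)
   show "continuous_on UNIV (%p :: real^3. plateau m (- L1) L1 (p $ 1) * (plateau m (- L2) L2 (p $ 2) * \<eta>' (p $ 3)))" unfolding \<eta>'_def
    by (intro continuous_intros continuous_on_compose2[OF plateau_continuous[of UNIV]] continuous_on_compose2[OF plateau'_continuous[of UNIV]]) auto
   fix p :: "real^3" assume p: "p \<notin> cbox (vector [- L1, - L2, - \<epsilon>]) (vector [L1, L2, d + \<epsilon>])"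
   have "plateau m (- L1) L1 (p $ 1) = 0 \<or> plateau m (- L2) L2 (p $ 2) = 0 \<or> \<eta>' (p $ 3) = 0"
    using p plateau_le_indicator[OF m(1), of "- L1" L1 "p $ 1"] plateau_le_indicator[OF m(1), of "- L2" L2 "p $ 2"] zero[of "p $ 3"]
    by (auto simp: mem_box_cart forall_3 indicator_def split: if_splits)
   then show "plateau m (- L1) L1 (p $ 1) * (plateau m (- L2) L2 (p $ 2) * \<eta>' (p $ 3)) = 0" by auto
  qed
  show "F \<in> borel_measurable lborel" unfolding F_def[abs_def] by measurable
  show "AE p in lborel. norm (F p) <= norm (plateau m (- L1) L1 (p $ 1) * (plateau m (- L2) L2 (p $ 2) * \<eta>' (p $ 3)))"
   unfolding F_def norm_mult using f_range by (intro AE_I2 mult_left_le_one_le) (auto intro!: mult_nonneg_nonneg)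
 qed
 have Fm: "F \<in> borel_measurable borel" using iF by auto
 have "(LBINT p. F p) = (LBINT z. LBINT t. F (shear 0 0 (z, t)))" by (rule integral_shear_iterated(2)[OF iF])
 also have "... = (LBINT z. - P z)"
 proof (rule integral_cong_AE)
  show "(%z. LBINT t. F (shear 0 0 (z, t))) \<in> borel_measurable lborel" using integral_shear_iterated(1)[OF iF] by auto
  have "integrable lborel P" unfolding P_def by (intro integral_product plateau_integrable m)
  then show "(%z. - P z) \<in> borel_measurable lborel" by auto
  show "AE z in lborel. (LBINT t. F (shear 0 0 (z, t))) = - P z" using below_slice[of 0 0] above_slice[of 0 0]
  proof eventually_elim
   case (elim z)
   have "(LBINT t. F (shear 0 0 (z, t))) = (LBINT t. P z * (indicator {d..d + \<epsilon>} t * \<eta>' t))"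
   proof (rule integral_cong_AE)
    show "(%t. F (shear 0 0 (z, t))) \<in> borel_measurable lborel" using measurable_compose[OF shear_slice_borel Fm] by simp
    show "(%t. P z * (indicator {d..d + \<epsilon>} t * \<eta>' t)) \<in> borel_measurable lborel" by measurable
    show "AE t in lborel. F (shear 0 0 (z, t)) = P z * (indicator {d..d + \<epsilon>} t * \<eta>' t)" using elim AE_lborel_singleton[of d]
    proof eventually_elim
     case (elim t)
     show ?case
     proof (cases "shear 0 0 (z, t) \<in> U & \<eta>' t ~= 0")
      case True
      then have "\<not> (t <= - \<epsilon> \<or> 0 <= t & t <= d \<or> d + \<epsilon> <= t)" using zero[of t] by blast
      then have "t < 0 \<or> d < t" "t < d + \<epsilon>" by linarith+
      then show ?thesis using elim True d_pos by (auto simp: F_def P_def f_def indicator_def axis_def)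
     next
      case False
      then have "P z = 0 \<or> \<eta>' t = 0"
       using plateau_le_indicator[OF m(1), of "- L1" L1 "fst z"] plateau_le_indicator[OF m(1), of "- L2" L2 "snd z"] zero[of t]
       by (auto simp: upright_U base_def P_def indicator_def split: if_splits)
      then show ?thesis by (auto simp: F_def P_def)
     qed
    qed
   qed
   also have "... = - P z" using total by simp
   finally show ?case .
  qed
 qed
 also have "... = - ((LBINT t. plateau m (- L1) L1 t) * (LBINT t. plateau m (- L2) L2 t))"
  using integral_product(2)[OF plateau_integrable[OF m(1)] plateau_integrable[OF m(1)]] by (simp add: P_def)
 finally show ?thesis by (simp add: F_def \<eta>'_def)
qed

text \<open>In \<open>tilted_flux_bound\<close> let \<theta> exhaust the box. Its vertical flux
  tends to minus the area 4 L1 L2, which is also the bound on the measure of D; these terms cancel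
  and only the quadratic cost of the tilt remains on the right.\<close>

lemma horizontal_flux_bound:
 assumes H0: "AE p in lborel. p \<in> U --> H p = 0" and area: "hausdorff 2 D <= ennreal (4 * L1 * L2)"
  and \<phi>: "test_function U \<phi> k" "!!p. \<bar>\<phi> p\<bar> <= 1"
 shows "- (LBINT p. f p * (s1 * k p $ 1 + s2 * k p $ 2)) <= (s1\<^sup>2 + s2\<^sup>2) * (4 * L1 * L2)"
proof -
 obtain Cs where Cs: "compact Cs" "Cs \<subseteq> U" "!!x. x \<notin> Cs ==> \<phi> x = 0" "!!x. x \<notin> Cs ==> k x = 0" "continuous_on UNIV k"
  using test_function_facts[OF \<phi>(1)] by blast
 obtain e where e: "e > 0" "(\<Union>x\<in>Cs. ball x e) \<subseteq> U"
  using compact_subset_open_imp_ball_epsilon_subset[OF Cs(1) open_box Cs(2)] by blast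
 \<comment> \<open>The support of \<phi> keeps distance e from the boundary, so moving by e / 2
   along each axis stays in the box.\<close>
 have inner: "- L1 + e / 2 <= p $ 1 & p $ 1 <= L1 - e / 2 & - L2 + e / 2 <= p $ 2 & p $ 2 <= L2 - e / 2
   & - \<epsilon> + e / 2 <= p $ 3 & p $ 3 <= d + \<epsilon> - e / 2" if p: "p \<in> Cs" for p
 proof -
  have "p + r *\<^sub>R axis i 1 \<in> U" if "\<bar>r\<bar> < e" for r i
   using e(2) p that by (auto simp: dist_norm intro!: subsetD[OF e(2)] bexI[of _ p])
  from this[of "e / 2" 1] this[of "- (e / 2)" 1] this[of "e / 2" 2] this[of "- (e / 2)" 2] this[of "e / 2" 3] this[of "- (e / 2)" 3]
  show ?thesis using e(1) by (auto simp: mem_box3)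
 qed
 define A where "A = 4 * L1 * L2"
 have A: "A > 0" using L_pos by (simp add: A_def)
 have hA: "enn2real (hausdorff 2 D) <= A" using area D_finite A by (cases "hausdorff 2 D") (auto simp: A_def)
 define T where "T n = (LBINT t. plateau (real (Suc n)) (- L1) L1 t) * (LBINT t. plateau (real (Suc n)) (- L2) L2 t)" for n
 define B where "B = (LBINT p. f p * (s1 * k p $ 1 + s2 * k p $ 2))"
 have "T \<longlonglongrightarrow> (L1 - - L1) * (L2 - - L2)" unfolding T_def using L_pos by (intro tendsto_mult integral_plateau_tendsto) auto
 then have T: "T \<longlonglongrightarrow> A" by (simp add: A_def algebra_simps)
 have "\<forall>\<^sub>F n in sequentially. T n - B <= (1 + s1\<^sup>2 + s2\<^sup>2) * A"
 proof -
  have "(%n. 2 / real (Suc n)) \<longlonglongrightarrow> 0" using LIMSEQ_Suc[OF lim_const_over_n[of 2]] by simp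
  then have "\<forall>\<^sub>F n in sequentially. 2 / real (Suc n) < min \<epsilon> (e / 2)" by (rule order_tendstoD) (use \<epsilon>_pos e in auto)
  then show ?thesis
  proof eventually_elim
   case (elim n)
   define m where "m = real (Suc n)"
   have m: "m > 0" "2 / m < \<epsilon>" "2 / m < e / 2" using elim by (auto simp: m_def)
   have m': "1 / m > 0" using m by simp
   define \<theta> where "\<theta> p = plateau m (- L1) L1 (p $ 1) * (plateau m (- L2) L2 (p $ 2) * plateau m (- \<epsilon>) (d + \<epsilon>) (p $ 3))" for p :: "real^3"
   define g where "g p = (vector [plateau' m (- L1) L1 (p $ 1) * (plateau m (- L2) L2 (p $ 2) * plateau m (- \<epsilon>) (d + \<epsilon>) (p $ 3)),
     plateau m (- L1) L1 (p $ 1) * (plateau' m (- L2) L2 (p $ 2) * plateau m (- \<epsilon>) (d + \<epsilon>) (p $ 3)),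
     plateau m (- L1) L1 (p $ 1) * (plateau m (- L2) L2 (p $ 2) * plateau' m (- \<epsilon>) (d + \<epsilon>) (p $ 3))] :: real^3)" for p :: "real^3"
   have \<theta>: "test_function U \<theta> g" unfolding \<theta>_def[abs_def] g_def[abs_def]
    by (rule product_test_function[OF plateau_deriv plateau_deriv plateau_deriv plateau'_continuous plateau'_continuous plateau'_continuous m'
       plateau_support[OF m(1)] plateau_support[OF m(1)] plateau_support[OF m(1)]])
   have \<theta>r: "0 <= \<theta> p" "\<theta> p <= 1" for p
    unfolding \<theta>_def using plateau_range by (auto intro!: mult_nonneg_nonneg mult_le_one)
   \<comment> \<open>2 / m < e / 2 makes \<theta> equal to 1 on the support of \<phi>.\<close>
   have dom: "\<bar>\<phi> p\<bar> <= \<theta> p" for p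
   proof (cases "p \<in> Cs")
    case True
    have "\<theta> p = 1" unfolding \<theta>_def using inner[OF True] m by (simp add: plateau_eq_1)
    then show ?thesis using \<phi>(2) by simp
   qed (simp add: Cs(3) \<theta>r)
   have "\<bar>LBINT p. f p * (g p $ 3 + s1 * k p $ 1 + s2 * k p $ 2)\<bar> <= (1 + s1\<^sup>2 + s2\<^sup>2) * enn2real (hausdorff 2 D)"
    by (rule tilted_flux_bound[OF H0 \<theta> \<theta>r(2) \<phi>(1) dom])
   also have "... <= (1 + s1\<^sup>2 + s2\<^sup>2) * A" by (intro mult_left_mono hA) auto
   also have "(LBINT p. f p * (g p $ 3 + s1 * k p $ 1 + s2 * k p $ 2)) = (LBINT p. f p * g p $ 3) + B"
   proof -
    note int = integrable_times_test_gradient[OF _ f_borel f_abs_le]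
    have "(%p. f p * (s1 * k p $ 1 + s2 * k p $ 2)) = (%p. s1 * (f p * k p $ 1) + s2 * (f p * k p $ 2))" by (simp add: fun_eq_iff algebra_simps)
    then have "integrable lborel (%p. f p * (s1 * k p $ 1 + s2 * k p $ 2))" using int[OF \<phi>(1)] by simp
    moreover have "integrable lborel (%p. f p * g p $ 3)" by (rule int[OF \<theta>])
    ultimately show ?thesis unfolding B_def by (subst Bochner_Integration.integral_add[symmetric]) (auto simp: distrib_left add.assoc)
   qed
   also have "(LBINT p. f p * g p $ 3) = - T n" using plateau_flux_f[OF m(1,2)] by (simp add: g_def T_def m_def)
   finally show ?case by linarith
  qed
 qed
 then have "A - B <= (1 + s1\<^sup>2 + s2\<^sup>2) * A" by (intro tendsto_upperbound[OF tendsto_diff[OF T tendsto_const]]) auto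
 then show ?thesis unfolding A_def[symmetric] B_def[symmetric] by (simp add: algebra_simps)
qed

text \<open>Each flux is linear in its tilt and bounded by a multiple of the squared tilt. Scaling
  by c only serves to meet the bound |\<phi>| <= 1.\<close>

lemma horizontal_flux_0:
 assumes H0: "AE p in lborel. p \<in> U --> H p = 0" and area: "hausdorff 2 D <= ennreal (4 * L1 * L2)"
  and \<phi>: "test_function U \<phi> k"
 shows "(LBINT p. f p * k p $ 1) = 0" "(LBINT p. f p * k p $ 2) = 0"
proof -
 obtain M where M: "M \<ge> 0" "!!p. \<bar>\<phi> p\<bar> <= M" using test_function_facts[OF \<phi>] by blast
 define c where "c = 1 / (1 + M)"
 have c: "c > 0" using M by (simp add: c_def)
 have t: "test_function U (%x. c * \<phi> x + 0 * \<phi> x) (%x. c *\<^sub>R k x + 0 *\<^sub>R k x)"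
  by (rule test_function_linear_combination[OF \<phi> \<phi>])
 have b: "\<bar>c * \<phi> p + 0 * \<phi> p\<bar> <= 1" for p using M(1) M(2)[of p] by (simp add: c_def abs_mult divide_le_eq)
 have A: "4 * L1 * L2 > 0" using L_pos by simp
 note Q = horizontal_flux_bound[OF H0 area t b]
 have e: "(LBINT p. f p * (s * (c *\<^sub>R k p + 0 *\<^sub>R k p) $ j)) = s * (c * (LBINT p. f p * k p $ j))" for s j
 proof -
  have "(%p. f p * (s * (c *\<^sub>R k p + 0 *\<^sub>R k p) $ j)) = (%p. (s * c) * (f p * k p $ j))" by (simp add: fun_eq_iff)
  then show ?thesis by (simp only: integral_mult_right_zero mult.assoc)
 qed
 have "c * (LBINT p. f p * k p $ 1) = 0"
 proof (rule zero_if_quadratic_bound[OF A])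
  fix s :: real
  show "s * (c * (LBINT p. f p * k p $ 1)) <= s\<^sup>2 * (4 * L1 * L2)" using Q[of "- s" 0] e[of "- s" 1] by simp
 qed
 moreover have "c * (LBINT p. f p * k p $ 2) = 0"
 proof (rule zero_if_quadratic_bound[OF A])
  fix s :: real
  show "s * (c * (LBINT p. f p * k p $ 2)) <= s\<^sup>2 * (4 * L1 * L2)" using Q[of 0 "- s"] e[of "- s" 2] by simp
 qed
 ultimately show "(LBINT p. f p * k p $ 1) = 0" "(LBINT p. f p * k p $ 2) = 0" using c by auto
qed

end

section \<open>Minimisers for small K jump once, at constant height\<close>

lemma n_jump_borel [measurable]: "n_jump \<alpha> \<in> borel_measurable borel"
proof -
 have [measurable]: "(%p :: real^3. p $ 3) \<in> borel_measurable borel" by (intro continuous_borel continuous_intros)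
 show ?thesis unfolding n_jump_def[abs_def] by measurable
qed

context director
begin

text \<open>\<open>jumps\<close> = 1 leaves exactly one point of S on the line, at height \<tau>, so
  the map is constant below and above it. The layers identify the two constants and force \<tau>
  into [0, d]; the end values 0 and d remain possible.\<close>

lemma single_jump_AE:
 assumes k: "0 < k" "k < pi\<^sup>2 / (4 * d)" and le: "functional k <= ennreal k * ennreal (4 * L1 * L2)"
  and H0: "AE p in lborel. p \<in> U --> H p = 0"
 shows "AE z in lborel. z \<in> base --> (\<exists>\<tau>. 0 <= \<tau> & \<tau> <= d &
  (AE t in lborel. - \<epsilon> < t & t < d + \<epsilon> --> u (shear 0 0 (z, t)) = n_jump \<tau> (shear 0 0 (z, t))))"
 using minimal_slices[OF k le] constant_slices_AE[OF H0, of 0 0] below_slice[of 0 0] above_slice[of 0 0]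
proof eventually_elim
 case (elim z)
 show ?case
 proof
  assume z: "z \<in> base"
  have nw: "z \<notin> whole" and j1: "jumps z = 1" using elim(1) z by blast+
  have "z \<in> feet 0 0 (- \<epsilon> / 2) (d + \<epsilon> / 2)" using z d_pos \<epsilon>_pos by (simp add: feet_def upright_U)
  then obtain p where p: "p \<in> S" "z = foot 0 0 p" using nw unfolding clear_feet_def by blast
  define \<tau> where "\<tau> = p $ 3"
  have pz: "shear 0 0 (z, \<tau>) = p" by (simp add: p(2) \<tau>_def)
  have "p \<in> U" using p(1) S_D D_U by blast
  then have \<tau>: "- \<epsilon> < \<tau>" "\<tau> < d + \<epsilon>" by (auto simp: \<tau>_def mem_box3)
  \<comment> \<open>Two points on the line would make \<open>jumps\<close> at least 2.\<close>
  have uniq: "q = p" if q: "q \<in> S" "z = foot 0 0 q" for q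
  proof (rule ccontr)
   assume "q ~= p"
   have "(\<Sum>p\<in>{p, q}. 1) <= liminf (%m. line_count 0 0 (C m) (%_. 1) z)" using p q S_D by (intro line_sum_le_liminf[OF C]) auto
   then have "(2 :: ennreal) <= 1" using \<open>q ~= p\<close> j1 by (simp add: jumps_def)
   then show False by simp
  qed
  have clear: "z \<in> clear_feet 0 0 r s" if rs: "- \<epsilon> < r" "r < s" "s < d + \<epsilon>" "\<tau> < r \<or> s < \<tau>" for r s
  proof -
   have "z \<in> feet 0 0 r s" using z rs by (simp add: feet_def upright_U)
   moreover have "z ~= foot 0 0 q" if "q \<in> S" "r <= q $ 3" "q $ 3 <= s" for q using uniq[OF that(1)] that rs(4) by (auto simp: \<tau>_def)
   ultimately show ?thesis unfolding clear_feet_def by blast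
  qed
  have const: "\<exists>c. AE t in lborel. a < t & t < b --> u (shear 0 0 (z, t)) = c"
   if ab: "a < b" "- \<epsilon> <= a" "b <= d + \<epsilon>" "b <= \<tau> \<or> \<tau> <= a" for a b
  proof -
   have "\<exists>c. AE t in lborel. a < t & t < b --> u (shear 0 0 (z, t)) $ i = c" for i
   proof -
    have "\<exists>c. AE t in lborel. r < t & t < s --> u (shear 0 0 (z, t)) $ i = c"
     if rs: "r \<in> \<rat>" "s \<in> \<rat>" "a < r" "r < s" "s < b" for r s
    proof -
     have "z \<in> clear_feet 0 0 r s" by (rule clear) (use rs ab in auto)
     then show ?thesis by (rule elim(2)[rule_format, OF rs(1,2,4), of i])
    qed
    then show ?thesis using AE_const_on_Ioo[OF ab(1), of "%t. u (shear 0 0 (z, t)) $ i"] by blast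
   qed
   then have "\<forall>i. \<exists>c. AE t in lborel. a < t & t < b --> u (shear 0 0 (z, t)) $ i = c" by blast
   then have "\<exists>c. \<forall>i. AE t in lborel. a < t & t < b --> u (shear 0 0 (z, t)) $ i = c i" by (rule choice)
   then obtain c where c: "\<forall>i. AE t in lborel. a < t & t < b --> u (shear 0 0 (z, t)) $ i = c i" ..
   have "AE t in lborel. \<forall>i\<in>UNIV. a < t & t < b --> u (shear 0 0 (z, t)) $ i = c i" by (intro AE_finite_allI) (use c in auto)
   then have "AE t in lborel. a < t & t < b --> u (shear 0 0 (z, t)) = (\<chi> i. c i)" by eventually_elim (auto simp: vec_eq_iff)
   then show ?thesis by blast
  qed
  have inU: "shear 0 0 (z, t) \<in> U" if "- \<epsilon> < t" "t < d + \<epsilon>" for t using z that by (simp add: upright_U)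
  obtain lo where lo: "AE t in lborel. - \<epsilon> < t & t < \<tau> --> u (shear 0 0 (z, t)) = lo"
   using const[of "- \<epsilon>" \<tau>] \<tau> by auto
  obtain hi where hi: "AE t in lborel. \<tau> < t & t < d + \<epsilon> --> u (shear 0 0 (z, t)) = hi"
   using const[of \<tau> "d + \<epsilon>"] \<tau> by auto
  note all = elim(3,4) lo hi
  have ne: "(axis 1 1 :: real^3) ~= axis 3 1" by (simp add: axis_eq_axis)
  have all': "AE t in lborel. (t < 0 --> - \<epsilon> < t --> u (shear 0 0 (z, t)) = axis 1 1) &
    (d < t --> t < d + \<epsilon> --> u (shear 0 0 (z, t)) = axis 3 1) &
    (- \<epsilon> < t --> t < \<tau> --> u (shear 0 0 (z, t)) = lo) & (\<tau> < t --> t < d + \<epsilon> --> u (shear 0 0 (z, t)) = hi)"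
   using all by eventually_elim (use inU d_pos \<epsilon>_pos in auto)
  define W where "W t \<longleftrightarrow> (t < 0 --> - \<epsilon> < t --> u (shear 0 0 (z, t)) = axis 1 1) &
    (d < t --> t < d + \<epsilon> --> u (shear 0 0 (z, t)) = axis 3 1) &
    (- \<epsilon> < t --> t < \<tau> --> u (shear 0 0 (z, t)) = lo) & (\<tau> < t --> t < d + \<epsilon> --> u (shear 0 0 (z, t)) = hi)" for t
  \<comment> \<open>A point in a given interval where all almost-everywhere statements hold at once;
    comparing two of them there identifies the constants.\<close>
  have wit: "\<exists>t. a < t & t < b & W t" if "a < b" for a b unfolding W_def by (rule AE_Ioo_witness[OF all' that]) blast
  have W: "u (shear 0 0 (z, t)) = axis 1 1" if "W t" "- \<epsilon> < t" "t < 0" for t using that unfolding W_def by blast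
  have W': "u (shear 0 0 (z, t)) = axis 3 1" if "W t" "d < t" "t < d + \<epsilon>" for t using that unfolding W_def by blast
  have Wlo: "u (shear 0 0 (z, t)) = lo" if "W t" "- \<epsilon> < t" "t < \<tau>" for t using that unfolding W_def by blast
  have Whi: "u (shear 0 0 (z, t)) = hi" if "W t" "\<tau> < t" "t < d + \<epsilon>" for t using that unfolding W_def by blast
  have hi3: "hi = axis 3 1" if "\<tau> <= d"
  proof -
   obtain t where t: "d < t" "t < d + \<epsilon>" "W t" using wit[of d "d + \<epsilon>"] \<epsilon>_pos by auto
   then show ?thesis using W'[of t] Whi[of t] that by simp
  qed
  have lo1: "lo = axis 1 1" if "0 <= \<tau>"
  proof -
   obtain t where t: "- \<epsilon> < t" "t < 0" "W t" using wit[of "- \<epsilon>" 0] \<epsilon>_pos by auto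
   then show ?thesis using W[of t] Wlo[of t] that by simp
  qed
  \<comment> \<open>For a jump below height 0 the upper constant would be e1 from the lower layer
    and e3 from the upper one.\<close>
  have \<tau>0: "0 <= \<tau>"
  proof (rule ccontr)
   assume n: "\<not> 0 <= \<tau>"
   then obtain t where t: "\<tau> < t" "t < 0" "W t" using wit[of \<tau> 0] by auto
   then have "- \<epsilon> < t" "t < d + \<epsilon>" using \<tau> d_pos \<epsilon>_pos by linarith+
   then have "hi = axis 1 1" using t W[of t] Whi[of t] by simp
   moreover have "hi = axis 3 1" using hi3 n d_pos by simp
   ultimately show False using ne by simp
  qed
  have \<tau>d: "\<tau> <= d"
  proof (rule ccontr)
   assume n: "\<not> \<tau> <= d"
   then obtain t where t: "d < t" "t < \<tau>" "W t" using wit[of d \<tau>] by auto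
   then have "- \<epsilon> < t" "t < d + \<epsilon>" using \<tau> d_pos \<epsilon>_pos by linarith+
   then have "lo = axis 3 1" using t W'[of t] Wlo[of t] by simp
   then show False using ne lo1[OF \<tau>0] by simp
  qed
  have "AE t in lborel. - \<epsilon> < t & t < d + \<epsilon> --> u (shear 0 0 (z, t)) = n_jump \<tau> (shear 0 0 (z, t))"
   using all' AE_lborel_singleton[of \<tau>] unfolding W_def[symmetric]
  proof eventually_elim
   case (elim t)
   show ?case
   proof
    assume t: "- \<epsilon> < t & t < d + \<epsilon>"
    have "t < \<tau> \<or> \<tau> < t" using elim(2) by linarith
    then show "u (shear 0 0 (z, t)) = n_jump \<tau> (shear 0 0 (z, t))"
     using t Wlo[OF elim(1)] Whi[OF elim(1)] lo1[OF \<tau>0] hi3[OF \<tau>d] by (elim disjE) (simp_all add: n_jump_def)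
   qed
  qed
  then show "\<exists>\<tau>. 0 <= \<tau> & \<tau> <= d &
   (AE t in lborel. - \<epsilon> < t & t < d + \<epsilon> --> u (shear 0 0 (z, t)) = n_jump \<tau> (shear 0 0 (z, t)))" using \<tau>0 \<tau>d by blast
 qed
qed

text \<open>The vertical integral G of f, cut off by \<eta>, has zero weak gradient by
  \<open>horizontal_flux_0\<close> and so is constant. On a line with a single jump G is d - \<tau>
  plus a constant, hence the jump height does not depend on the line.\<close>

lemma minimal_eq_n_jump:
 assumes k: "0 < k" "k < pi\<^sup>2 / (4 * d)" and le: "functional k <= ennreal k * ennreal (4 * L1 * L2)"
  and layers: "AE p in lborel. p \<in> U --> p $ 3 < 0 \<or> d < p $ 3 --> H p = 0"
 shows "\<exists>\<alpha>. 0 <= \<alpha> & \<alpha> <= d & (AE p in lborel. p \<in> U --> u p = n_jump \<alpha> p)"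
proof -
 note H0 = minimal_gradient_0[OF k le layers]
 note area = minimal_area[OF k(1) le]
 \<comment> \<open>2 / m = 2 \<epsilon> / 3 < \<epsilon>, so \<eta> equals 1 on the whole of
   [0, d].\<close>
 define m where "m = 3 / \<epsilon>"
 have m: "m > 0" "2 / m < \<epsilon>" "1 / m > 0" using \<epsilon>_pos by (auto simp: m_def)
 define \<eta> where "\<eta> = plateau m (- \<epsilon>) (d + \<epsilon>)"
 have \<eta>i: "integrable lborel \<eta>" unfolding \<eta>_def by (rule plateau_integrable[OF m(1)])
 have [measurable]: "\<eta> \<in> borel_measurable borel" using \<eta>i by auto
 have \<eta>0: "\<eta> t \<ge> 0" for t unfolding \<eta>_def by (rule plateau_range)
 have \<eta>1: "\<eta> t = 1" if "0 <= t" "t <= d" for t unfolding \<eta>_def using that m by (intro plateau_eq_1) auto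
 have \<eta>out: "\<eta> t = 0" if "t <= - \<epsilon> \<or> d + \<epsilon> <= t" for t
  using plateau_le_indicator[OF m(1), of "- \<epsilon>" "d + \<epsilon>" t] that by (auto simp: \<eta>_def indicator_def split: if_splits)
 define G where "G z = (LBINT t. \<eta> t * f (shear 0 0 (z, t)))" for z
 have sf [measurable]: "(%t. f (shear 0 0 (z, t))) \<in> borel_measurable borel" for z by (rule measurable_compose[OF shear_slice_borel f_borel])
 have Gb [measurable]: "G \<in> borel_measurable borel"
 proof -
  have 1: "(%q. f (shear 0 0 q)) \<in> borel_measurable borel" by (rule measurable_compose[OF borel_measurable_shear f_borel])
  have "(%q. f (shear 0 0 q)) \<in> borel_measurable (borel \<Otimes>\<^sub>M borel)" unfolding borel_prod by (rule 1)
  then have "(%q. \<eta> (snd q) * f (shear 0 0 q)) \<in> borel_measurable (borel \<Otimes>\<^sub>M borel)" by measurable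
  then have "(%(z, t). \<eta> t * f (shear 0 0 (z, t))) \<in> borel_measurable (borel \<Otimes>\<^sub>M lborel)" by (simp add: case_prod_beta')
  from lborel.borel_measurable_lebesgue_integral[OF this] show ?thesis by (simp add: G_def[abs_def])
 qed
 have fi: "integrable lborel (%t. \<eta> t * f (shear 0 0 (z, t)))" for z by (rule integrable_dominated[OF \<eta>i])
   (use f_range \<eta>0 in \<open>auto simp: abs_mult intro!: AE_I2 mult_right_le_one_le\<close>)
 have Gbd: "\<bar>G z\<bar> <= (LBINT t. \<eta> t)" for z
 proof -
  have "0 <= G z" unfolding G_def using f_range \<eta>0 by (intro Bochner_Integration.integral_nonneg) auto
  moreover have "G z <= (LBINT t. \<eta> t)" unfolding G_def
   by (intro integral_mono fi \<eta>i) (use f_range \<eta>0 in \<open>auto intro!: mult_right_le_one_le\<close>)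
  ultimately show ?thesis by simp
 qed
 have "\<exists>c. AE z in lborel. - L1 < fst z & fst z < L1 & - L2 < snd z & snd z < L2 --> G z = c"
 proof (rule const_if_weak_gradient_0[OF L_pos Gb Gbd])
  fix P P' R R' :: "real => real" and e :: real
  assume e: "e > 0" and d: "!!t. (P has_real_derivative P' t) (at t)" "!!t. (R has_real_derivative R' t) (at t)"
   and c: "continuous_on UNIV P'" "continuous_on UNIV R'"
   and s: "!!t. P t ~= 0 ==> - L1 + e <= t & t <= L1 - e" "!!t. R t ~= 0 ==> - L2 + e <= t & t <= L2 - e"
  define e' where "e' = min e (1 / m)"
  have e': "e' > 0" using e m by (simp add: e'_def)
  have s': "P t ~= 0 ==> - L1 + e' <= t & t <= L1 - e'" "R t ~= 0 ==> - L2 + e' <= t & t <= L2 - e'"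
    "\<eta> t ~= 0 ==> - \<epsilon> + e' <= t & t <= d + \<epsilon> - e'" for t
   using s[of t] plateau_support[OF m(1), of "- \<epsilon>" "d + \<epsilon>" t] unfolding e'_def \<eta>_def by linarith+
  define g where "g p = (vector [P' (p $ 1) * (R (p $ 2) * \<eta> (p $ 3)), P (p $ 1) * (R' (p $ 2) * \<eta> (p $ 3)),
    P (p $ 1) * (R (p $ 2) * plateau' m (- \<epsilon>) (d + \<epsilon>) (p $ 3))] :: real^3)" for p :: "real^3"
  have d\<eta>: "!!t. (\<eta> has_real_derivative plateau' m (- \<epsilon>) (d + \<epsilon>) t) (at t)" unfolding \<eta>_def by (rule plateau_deriv)
  have t: "test_function U (%p. P (p $ 1) * (R (p $ 2) * \<eta> (p $ 3))) g"
   unfolding g_def[abs_def] by (rule product_test_function[OF d d\<eta> c plateau'_continuous e' s'])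
  have fub: "(LBINT z. G z * h z) = (LBINT p. f p * g p $ j)"
   if h: "!!z t. g (shear 0 0 (z, t)) $ j = h z * \<eta> t" for h j
  proof -
   have i: "integrable lborel (%p. f p * g p $ j)" by (rule integrable_times_test_gradient[OF t f_borel f_abs_le])
   have "(LBINT p. f p * g p $ j) = (LBINT z. LBINT t. f (shear 0 0 (z, t)) * g (shear 0 0 (z, t)) $ j)" by (rule integral_shear_iterated(2)[OF i])
   also have "... = (LBINT z. G z * h z)"
   proof (rule lint_cong[OF refl])
    fix z
    have "(LBINT t. f (shear 0 0 (z, t)) * g (shear 0 0 (z, t)) $ j) = (LBINT t. h z * (\<eta> t * f (shear 0 0 (z, t))))"
     by (intro lint_cong refl) (simp add: h mult_ac)
    also have "... = G z * h z" by (simp add: G_def mult.commute)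
    finally show "(LBINT t. f (shear 0 0 (z, t)) * g (shear 0 0 (z, t)) $ j) = G z * h z" .
   qed
   finally show ?thesis by simp
  qed
  have "(LBINT z. G z * (P' (fst z) * R (snd z))) = (LBINT p. f p * g p $ 1)" by (rule fub) (simp add: g_def)
  moreover have "(LBINT z. G z * (P (fst z) * R' (snd z))) = (LBINT p. f p * g p $ 2)" by (rule fub) (simp add: g_def)
  ultimately show "(LBINT z. G z * (P' (fst z) * R (snd z))) = 0 & (LBINT z. G z * (P (fst z) * R' (snd z))) = 0"
   using horizontal_flux_0[OF H0 area t] by simp
 qed
 then obtain c where c: "AE z in lborel. z \<in> base --> G z = c" unfolding base_def by auto
 \<comment> \<open>Obtained by solving c = (d - \<tau>) + integral of \<eta> above d for
   \<tau>.\<close>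
 define \<alpha> where "\<alpha> = d + (LBINT t. indicator {d<..} t * \<eta> t) - c"
 have good: "AE z in lborel. z \<in> base --> 0 <= \<alpha> & \<alpha> <= d &
  (AE t in lborel. - \<epsilon> < t & t < d + \<epsilon> --> u (shear 0 0 (z, t)) = n_jump \<alpha> (shear 0 0 (z, t)))"
  using c single_jump_AE[OF k le H0]
 proof eventually_elim
  case (elim z)
  show ?case
  proof
   assume z: "z \<in> base"
   then obtain \<tau> where \<tau>: "0 <= \<tau>" "\<tau> <= d"
    "AE t in lborel. - \<epsilon> < t & t < d + \<epsilon> --> u (shear 0 0 (z, t)) = n_jump \<tau> (shear 0 0 (z, t))" using elim(2) by blast
   have "G z = (LBINT t. indicator {\<tau>..d} t + indicator {d<..} t * \<eta> t)" unfolding G_def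
   proof (rule integral_cong_AE)
    show "AE t in lborel. \<eta> t * f (shear 0 0 (z, t)) = indicator {\<tau>..d} t + indicator {d<..} t * \<eta> t" using \<tau>(3)
    proof eventually_elim
     case (elim t)
     show ?case
     proof (cases "- \<epsilon> < t & t < d + \<epsilon>")
      case True
      then have "f (shear 0 0 (z, t)) = (if t < \<tau> then 0 else 1)" using elim by (auto simp: f_def n_jump_def axis_def)
      then show ?thesis using \<eta>1[of t] \<tau> by (auto simp: indicator_def)
     next
      case False
      then have "\<eta> t = 0" "t \<notin> {\<tau>..d}" using \<eta>out[of t] \<tau> \<epsilon>_pos by auto
      then show ?thesis by simp
     qed
    qed
   qed measurable
   also have "... = (d - \<tau>) + (LBINT t. indicator {d<..} t * \<eta> t)"
   proof (subst Bochner_Integration.integral_add)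
    show "integrable lborel (indicat_real {\<tau>..d})" by (intro integrable_real_indicator emeasure_bounded_finite) auto
    show "integrable lborel (%t. indicator {d<..} t * \<eta> t)"
     using integrable_real_mult_indicator[OF _ \<eta>i, of "{d<..}"] by (simp add: mult.commute)
   qed (use \<tau> in simp)
   finally have "\<tau> = \<alpha>" using elim(1) z by (simp add: \<alpha>_def)
   then show "0 <= \<alpha> & \<alpha> <= d &
    (AE t in lborel. - \<epsilon> < t & t < d + \<epsilon> --> u (shear 0 0 (z, t)) = n_jump \<alpha> (shear 0 0 (z, t)))" using \<tau> by simp
  qed
 qed
 \<comment> \<open>The bounds are known only for the lines of a full-measure set; the base has
   positive area, so such a line exists.\<close>
 have "0 <= \<alpha> & \<alpha> <= d"
 proof (rule ccontr)
  assume n: "\<not> (0 <= \<alpha> & \<alpha> <= d)"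
  have "AE z in lborel. z \<notin> base" using good by eventually_elim (use n in auto)
  then have "emeasure lborel base = 0" by (subst (asm) AE_iff_null) (auto simp: null_sets_def)
  then show False using L_pos by (simp add: base_area)
 qed
 moreover have "AE p in lborel. p \<in> U --> u p = n_jump \<alpha> p"
 proof -
  have m: "Measurable.pred borel (%p. p \<in> U --> u p = n_jump \<alpha> p)" by measurable
  show ?thesis unfolding AE_shear_iff[OF m, of 0 0] using good
  proof eventually_elim
   case (elim z)
   show ?case
   proof (cases "z \<in> base")
    case True
    with elim have "AE t in lborel. - \<epsilon> < t & t < d + \<epsilon> --> u (shear 0 0 (z, t)) = n_jump \<alpha> (shear 0 0 (z, t))" by blast
    then show ?thesis by eventually_elim (auto simp: upright_U)
   qed (simp add: upright_U)
  qed
 qed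
 ultimately show ?thesis by blast
qed

end

section \<open>Hausdorff measure of a horizontal piece\<close>

lemma hausdorff_pre_2_le:
 fixes A :: "'a::metric_space set"
 assumes I: "countable I" and F: "A \<subseteq> (\<Union>i\<in>I. F i)" "!!i. i \<in> I ==> bounded (F i) & diameter (F i) <= \<delta>" and \<delta>: "\<delta> > 0"
 shows "hausdorff_pre 2 \<delta> A <= (\<integral>\<^sup>+i. disc_area (F i) \<partial>count_space I)"
proof -
 define g where "g = to_nat_on I"
 define C where "C n = (if n \<in> g ` I then F (from_nat_into I n) else {})" for n
 have bij: "bij_betw g I (g ` I)" unfolding g_def by (intro inj_on_imp_bij_betw inj_on_to_nat_on I)
 have Cg: "C (g i) = F i" if "i \<in> I" for i using that I by (auto simp: C_def g_def)
 have "A \<subseteq> (\<Union>n. C n)" using F(1) Cg by blast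
 moreover have "bounded (C n) & diameter (C n) <= \<delta>" for n
 proof (cases "n \<in> g ` I")
  case True
  then obtain i where "i \<in> I" "n = g i" by blast
  then show ?thesis using F(2) Cg by simp
 qed (use \<delta> in \<open>simp add: C_def\<close>)
 ultimately have "C \<in> {C :: nat => 'a set. A \<subseteq> (\<Union>i. C i) & (\<forall>i. bounded (C i) & diameter (C i) <= \<delta>)}" by blast
 then have "hausdorff_pre 2 \<delta> A <= (\<Sum>i. if C i = {} then 0 else ennreal (unit_ball_vol (real 2) * (diameter (C i) / 2) ^ 2))"
  unfolding hausdorff_pre_def by (rule INF_lower)
 also have "... = (\<Sum>i. disc_area (C i))" by (intro suminf_cong) (simp add: disc_area_def unit_ball_vol_2)
 also have "... = (\<integral>\<^sup>+n. disc_area (C n) \<partial>count_space UNIV)" by (rule nn_integral_count_space_nat[symmetric])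
 also have "... = (\<integral>\<^sup>+n. disc_area (C n) * indicator (g ` I) n \<partial>count_space UNIV)"
  by (intro nn_integral_cong) (auto simp: C_def disc_area_def indicator_def)
 also have "... = (\<integral>\<^sup>+n. disc_area (C n) \<partial>count_space (g ` I))"
  by (simp add: nn_integral_restrict_space[symmetric] restrict_count_space)
 also have "... = (\<integral>\<^sup>+i. disc_area (C (g i)) \<partial>count_space I)" by (rule nn_integral_bij_count_space[OF bij, symmetric])
 also have "... = (\<integral>\<^sup>+i. disc_area (F i) \<partial>count_space I)" by (intro nn_integral_cong) (simp add: Cg)
 finally show ?thesis .
qed

lemma dist_horizontal: "dist (shear 0 0 (z, \<alpha>)) (shear 0 0 (w, \<alpha>)) = dist z w"
 by (cases z; cases w) (simp add: dist_norm norm_vec_def L2_set_def sum_3 norm_prod_def)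

lemma disc_area_horizontal:
 assumes r: "r > 0" and A: "A \<subseteq> cball x r"
 shows "bounded ((%z. shear 0 0 (z, \<alpha>)) ` A)" "diameter ((%z. shear 0 0 (z, \<alpha>)) ` A) <= 2 * r"
  "disc_area ((%z. shear 0 0 (z, \<alpha>)) ` A) <= ennreal (pi * r\<^sup>2)"
proof -
 have d: "dist p q <= 2 * r" if pq: "p \<in> (%z. shear 0 0 (z, \<alpha>)) ` A" "q \<in> (%z. shear 0 0 (z, \<alpha>)) ` A" for p q
 proof -
  obtain z w where zw: "z \<in> A" "w \<in> A" "p = shear 0 0 (z, \<alpha>)" "q = shear 0 0 (w, \<alpha>)" using pq by blast
  have "dist x z <= r" "dist x w <= r" using A zw by auto
  then have "dist z w <= 2 * r" using dist_triangle3[of z w x] by linarith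
  then show ?thesis unfolding zw(3,4) dist_horizontal .
 qed
 show bd: "bounded ((%z. shear 0 0 (z, \<alpha>)) ` A)" unfolding bounded_two_points using d by blast
 show di: "diameter ((%z. shear 0 0 (z, \<alpha>)) ` A) <= 2 * r" by (rule diameter_le) (use r d in \<open>auto simp: dist_norm\<close>)
 have "(diameter ((%z. shear 0 0 (z, \<alpha>)) ` A) / 2)\<^sup>2 <= r\<^sup>2" using di diameter_ge_0[OF bd] by (intro power_mono) auto
 then show "disc_area ((%z. shear 0 0 (z, \<alpha>)) ` A) <= ennreal (pi * r\<^sup>2)"
  by (auto simp: disc_area_def intro!: ennreal_leI mult_left_mono)
qed

lemma plane_ball_area: "r > 0 ==> emeasure lborel (ball (x :: real \<times> real) r) = ennreal (pi * r\<^sup>2)"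
 by (simp add: emeasure_ball unit_ball_vol_2 power2_eq_square)

text \<open>Vitali's theorem fills V up to a null set with disjoint small discs, whose areas sum to
  at most that of V. The null set lies in an open W of tiny area and is covered by fivefold
  enlargements of disjoint discs in W.\<close>

lemma hausdorff_horizontal_le:
 assumes V: "open V" "bounded (V :: (real \<times> real) set)"
 shows "hausdorff 2 ((%z. shear 0 0 (z, \<alpha>)) ` V) <= emeasure lborel V" unfolding hausdorff_def
proof (rule SUP_least)
 fix \<delta> :: real assume "\<delta> \<in> {0<..}"
 then have \<delta>: "\<delta> > 0" by simp
 let ?h = "%z. shear 0 0 (z, \<alpha>)"
 show "hausdorff_pre 2 \<delta> (?h ` V) <= emeasure lborel V"
 proof (rule ennreal_le_epsilon)
  fix e :: real assume e: "e > 0"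
  define K1 where "K1 = {i. 0 < snd i & 2 * snd i <= \<delta> & ball (fst i) (snd i) \<subseteq> V}"
  have S1: "\<exists>i. i \<in> K1 & x \<in> ball (fst i) (snd i) & snd i < \<rho>" if x: "x \<in> V" "0 < \<rho>" for x \<rho>
  proof -
   obtain s where s: "s > 0" "ball x s \<subseteq> V" using V(1) x(1) open_contains_ball by blast
   define r where "r = min (\<rho> / 2) (min (\<delta> / 2) s)"
   have "r > 0" "r < \<rho>" "2 * r <= \<delta>" "ball x r \<subseteq> V" using s x \<delta> by (auto simp: r_def)
   then show ?thesis by (intro exI[of _ "(x, r)"]) (auto simp: K1_def)
  qed
  obtain C1 where C1: "countable C1" "C1 \<subseteq> K1"
   "pairwise (%i j. disjnt (ball (fst i) (snd i)) (ball (fst j) (snd j))) C1"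
   "negligible (V - (\<Union>i\<in>C1. ball (fst i) (snd i)))" by (rule Vitali_covering_theorem_balls[of V K1 fst snd, OF S1])
  define N where "N = V - (\<Union>i\<in>C1. ball (fst i) (snd i))"
  have "N \<in> sets lebesgue" "emeasure lebesgue N = 0" using C1(4) by (auto simp: N_def negligible_iff_null_sets)
  \<comment> \<open>Fivefold enlargement multiplies areas by 25.\<close>
  have "0 < e / 25" using e by simp
  from sets_lebesgue_outer_open[OF \<open>N \<in> sets lebesgue\<close> this]
  obtain W where W: "open W" "N \<subseteq> W" "emeasure lebesgue (W - N) < ennreal (e / 25)" by blast
  have "emeasure lebesgue W <= emeasure lebesgue (W - N) + emeasure lebesgue N"
  proof -
   have "emeasure lebesgue W <= emeasure lebesgue ((W - N) \<union> N)" using W(1) \<open>N \<in> sets lebesgue\<close> by (intro emeasure_mono) auto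
   also have "... <= emeasure lebesgue (W - N) + emeasure lebesgue N"
    using W(1) \<open>N \<in> sets lebesgue\<close> by (intro emeasure_subadditive) auto
   finally show ?thesis .
  qed
  then have eW: "emeasure lborel W <= ennreal (e / 25)" using W(1,3) \<open>emeasure lebesgue N = 0\<close> by (simp add: emeasure_completion)
  \<comment> \<open>Radius at most \<delta> / 10, so the enlarged disc has diameter at most
    \<delta>.\<close>
  define K2 where "K2 = {i. 0 < snd i & snd i <= \<delta> / 10 & ball (fst i) (snd i) \<subseteq> W}"
  have cov: "N \<subseteq> (\<Union>i\<in>K2. ball (fst i) (snd i))"
  proof
   fix x assume "x \<in> N"
   then obtain s where s: "s > 0" "ball x s \<subseteq> W" using W open_contains_ball by blast
   define r where "r = min (\<delta> / 10) s"
   have "r > 0" "r <= \<delta> / 10" "ball x r \<subseteq> W" using s \<delta> by (auto simp: r_def)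
   then show "x \<in> (\<Union>i\<in>K2. ball (fst i) (snd i))" by (intro UN_I[of "(x, r)"]) (auto simp: K2_def)
  qed
  obtain C2 where C2: "countable C2" "C2 \<subseteq> K2"
   "pairwise (%i j. disjnt (ball (fst i) (snd i)) (ball (fst j) (snd j))) C2"
   "N \<subseteq> (\<Union>i\<in>C2. ball (fst i) (5 * snd i))" by (rule Vitali_covering_lemma_balls[OF cov, of "\<delta> / 10"]) (auto simp: K2_def)
  define I where "I = Inl ` C1 \<union> Inr ` C2"
  define F where "F = case_sum (%i. ?h ` ball (fst i) (snd i)) (%i. ?h ` ball (fst i) (5 * snd i))"
  have r1: "snd i > 0" "2 * snd i <= \<delta>" "ball (fst i) (snd i) \<subseteq> V" if "i \<in> C1" for i using that C1(2) by (auto simp: K1_def)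
  have r2: "snd i > 0" "2 * (5 * snd i) <= \<delta>" "ball (fst i) (snd i) \<subseteq> W" if "i \<in> C2" for i using that C2(2) by (auto simp: K2_def)
  have db: "bounded (?h ` ball x r)" "diameter (?h ` ball x r) <= 2 * r" "disc_area (?h ` ball x r) <= ennreal (pi * r\<^sup>2)"
   if "r > 0" for x r by (rule disc_area_horizontal[OF that ball_subset_cball])+
  have "V \<subseteq> (\<Union>i\<in>C1. ball (fst i) (snd i)) \<union> (\<Union>i\<in>C2. ball (fst i) (5 * snd i))" using C2(4) by (auto simp: N_def)
  then have "?h ` V \<subseteq> (\<Union>i\<in>I. F i)" by (fastforce simp: I_def F_def)
  moreover have "bounded (F i) & diameter (F i) <= \<delta>" if i: "i \<in> I" for i
  proof -
   consider j where "j \<in> C1" "i = Inl j" | j where "j \<in> C2" "i = Inr j" using i by (auto simp: I_def)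
   then show ?thesis
   proof cases
    case 1
    then show ?thesis using db(1,2)[of "snd j" "fst j"] r1(1,2)[of j] by (simp add: F_def)
   next
    case 2
    then show ?thesis using db(1,2)[of "5 * snd j" "fst j"] r2(1,2)[of j] by (simp add: F_def)
   qed
  qed
  moreover have "countable I" using C1(1) C2(1) by (simp add: I_def)
  ultimately have "hausdorff_pre 2 \<delta> (?h ` V) <= (\<integral>\<^sup>+i. disc_area (F i) \<partial>count_space I)"
   by (intro hausdorff_pre_2_le \<delta>)
  also have "... = (\<integral>\<^sup>+i. disc_area (F i) * indicator I i \<partial>count_space UNIV)"
   by (simp add: nn_integral_restrict_space[symmetric] restrict_count_space)
  also have "... <= (\<integral>\<^sup>+i. disc_area (F i) * indicator (Inl ` C1) i + disc_area (F i) * indicator (Inr ` C2) i \<partial>count_space UNIV)"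
   by (intro nn_integral_mono) (auto simp: I_def indicator_def)
  also have "... = (\<integral>\<^sup>+i. disc_area (F i) * indicator (Inl ` C1) i \<partial>count_space UNIV) + (\<integral>\<^sup>+i. disc_area (F i) * indicator (Inr ` C2) i \<partial>count_space UNIV)"
   by (rule nn_integral_add) auto
  also have "... = (\<integral>\<^sup>+i. disc_area (F i) \<partial>count_space (Inl ` C1)) + (\<integral>\<^sup>+i. disc_area (F i) \<partial>count_space (Inr ` C2))"
   by (simp add: nn_integral_restrict_space[symmetric] restrict_count_space)
  also have "(\<integral>\<^sup>+i. disc_area (F i) \<partial>count_space (Inl ` C1)) = (\<integral>\<^sup>+i. disc_area (F (Inl i)) \<partial>count_space C1)"
   by (rule nn_integral_bij_count_space[symmetric]) (auto intro: inj_on_imp_bij_betw)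
  also have "... <= (\<integral>\<^sup>+i. emeasure lborel (ball (fst i) (snd i)) \<partial>count_space C1)"
   by (intro nn_integral_mono) (use r1 db(3) in \<open>simp add: F_def plane_ball_area\<close>)
  also have "... = emeasure lborel (\<Union>i\<in>C1. ball (fst i) (snd i))"
   using C1(1,3) by (intro emeasure_UN_countable[symmetric]) (auto simp: disjoint_family_on_def pairwise_def disjnt_def)
  also have "... <= emeasure lborel V" using r1(3) V(1) by (intro emeasure_mono) auto
  also have "(\<integral>\<^sup>+i. disc_area (F i) \<partial>count_space (Inr ` C2)) = (\<integral>\<^sup>+i. disc_area (F (Inr i)) \<partial>count_space C2)"
   by (rule nn_integral_bij_count_space[symmetric]) (auto intro: inj_on_imp_bij_betw)
  also have "... <= (\<integral>\<^sup>+i. 25 * emeasure lborel (ball (fst i) (snd i)) \<partial>count_space C2)"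
  proof (intro nn_integral_mono)
   fix i assume "i \<in> space (count_space C2)"
   then have i: "snd i > 0" using r2 by simp
   have "disc_area (F (Inr i)) <= ennreal (pi * (5 * snd i)\<^sup>2)" using db(3)[of "5 * snd i" "fst i"] i by (simp add: F_def)
   also have "... = ennreal (25 * (pi * (snd i)\<^sup>2))" by (simp add: power_mult_distrib)
   also have "... = 25 * emeasure lborel (ball (fst i) (snd i))" using i by (subst ennreal_mult) (simp_all add: plane_ball_area)
   finally show "disc_area (F (Inr i)) <= 25 * emeasure lborel (ball (fst i) (snd i))" .
  qed
  also have "... = 25 * emeasure lborel (\<Union>i\<in>C2. ball (fst i) (snd i))"
   using C2(1,3) by (subst emeasure_UN_countable) (auto simp: nn_integral_cmult disjoint_family_on_def pairwise_def disjnt_def)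
  also have "... <= 25 * ennreal (e / 25)" using r2(3) W(1) by (intro mult_left_mono order_trans[OF emeasure_mono eW]) auto
  also have "25 * ennreal (e / 25) = ennreal e" using e by (simp add: ennreal_mult'[symmetric] flip: ennreal_numeral)
  finally show "hausdorff_pre 2 \<delta> (?h ` V) <= emeasure lborel V + ennreal e" by (simp add: add_mono)
 qed
qed

section \<open>Approximate limits and gradients of explicit maps\<close>

lemma average_bounds:
 fixes f :: "real ^ 'n => real"
 assumes r: "r > 0" and f: "!!y. y \<in> ball x r ==> 0 <= f y & f y <= e"
 shows "0 <= (LINT y : ball x r | lebesgue. f y) / measure lebesgue (ball x r)"
  "(LINT y : ball x r | lebesgue. f y) / measure lebesgue (ball x r) <= e"
proof -
 have m: "measure lebesgue (ball x r) > 0" using r by (simp add: content_ball_pos)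
 show "0 <= (LINT y : ball x r | lebesgue. f y) / measure lebesgue (ball x r)" unfolding set_lebesgue_integral_def using f m
  by (intro divide_nonneg_pos Bochner_Integration.integral_nonneg) (auto simp: indicator_def)
 have e: "e \<ge> 0" using f[of x] r by (meson centre_in_ball order_trans)
 have "(LINT y : ball x r | lebesgue. f y) <= e * measure lebesgue (ball x r)"
 proof (cases "set_integrable lebesgue (ball x r) f")
  case True
  have "(LINT y : ball x r | lebesgue. f y) <= (LINT y|lebesgue. e * indicator (ball x r) y)" unfolding set_lebesgue_integral_def
  proof (rule integral_mono)
   show "integrable lebesgue (%y. indicat_real (ball x r) y *\<^sub>R f y)" using True by (simp add: set_integrable_def)
   show "integrable lebesgue (%y. e * indicat_real (ball x r) y)" using emeasure_bounded_finite[of "ball x r"]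
    by (intro integrable_mult_right integrable_real_indicator) (auto simp: emeasure_completion)
  qed (use f in \<open>auto simp: indicator_def\<close>)
  then show ?thesis by simp
 next
  \<comment> \<open>The integral of a non-integrable function is 0, so the bounds hold without any
    measurability assumption.\<close>
  case False
  then have "(LINT y : ball x r | lebesgue. f y) = 0" by (simp add: set_lebesgue_integral_def set_integrable_def not_integrable_integral_eq)
  then show ?thesis using e by simp
 qed
 then show "(LINT y : ball x r | lebesgue. f y) / measure lebesgue (ball x r) <= e" using m by (simp add: divide_le_eq)
qed

lemma average_tendsto_0:
 fixes f :: "real => real ^ 'n => real"
 assumes "!!e. e > 0 ==> \<exists>d>0. \<forall>r y. 0 < r --> r < d --> y \<in> ball x r --> 0 <= f r y & f r y <= e"
 shows "((%r. (LINT y : ball x r | lebesgue. f r y) / measure lebesgue (ball x r)) \<longlongrightarrow> 0) (at_right 0)"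
proof (rule tendstoI)
 fix e :: real assume "e > 0"
 then obtain d where d: "d > 0" "!!r y. 0 < r ==> r < d ==> y \<in> ball x r ==> 0 <= f r y & f r y <= e / 2" using assms[of "e / 2"] by auto
 have "\<forall>\<^sub>F r in at_right (0::real). 0 < r & r < d" using d(1) by (auto simp: eventually_at_right intro!: exI[of _ d])
 then show "\<forall>\<^sub>F r in at_right 0. dist ((LINT y : ball x r | lebesgue. f r y) / measure lebesgue (ball x r)) 0 < e"
 proof eventually_elim
  case (elim r)
  define A where "A = (LINT y : ball x r | lebesgue. f r y) / measure lebesgue (ball x r)"
  have "0 <= A" "A <= e / 2" unfolding A_def by (rule average_bounds; use d(2) elim in blast)+
  then show ?case using \<open>e > 0\<close> unfolding A_def[symmetric] by (simp add: dist_real_def)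
 qed
qed

lemma has_approx_limit_of_isCont:
 fixes u :: "real ^ 'n => real ^ 'm"
 assumes "isCont u x" shows "has_approx_limit u x (u x)" unfolding has_approx_limit_def
proof (rule average_tendsto_0)
 fix e :: real assume "e > 0"
 then obtain d where "d > 0" "!!y. dist y x < d ==> dist (u y) (u x) < e" using assms unfolding continuous_at_eps_delta by blast
 then show "\<exists>d>0. \<forall>r y. 0 < r --> r < d --> y \<in> ball x r --> 0 <= norm (u y - u x) & norm (u y - u x) <= e"
  by (intro exI[of _ d]) (auto simp: dist_norm norm_minus_commute intro: less_imp_le)
qed

lemma has_approx_gradient_of_derivative:
 fixes u :: "real ^ 'n => real ^ 'm"
 assumes der: "(u has_derivative (%h. G *v h)) (at x)" shows "has_approx_gradient u x G" unfolding has_approx_gradient_def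
proof (intro exI conjI)
 show "has_approx_limit u x (u x)" by (rule has_approx_limit_of_isCont[OF has_derivative_continuous[OF der]])
 show "((%r. (LINT y : ball x r | lebesgue. norm (u y - u x - G *v (y - x)) / r) / measure lebesgue (ball x r)) \<longlongrightarrow> 0) (at_right 0)"
 proof (rule average_tendsto_0)
  fix e :: real assume "e > 0"
  then obtain d where d: "d > 0" "!!y. norm (y - x) < d ==> norm (u y - u x - G *v (y - x)) <= e * norm (y - x)"
   using der unfolding has_derivative_at_alt by blast
  show "\<exists>d>0. \<forall>r y. 0 < r --> r < d --> y \<in> ball x r -->
    0 <= norm (u y - u x - G *v (y - x)) / r & norm (u y - u x - G *v (y - x)) / r <= e"
  proof (intro exI[of _ d] conjI allI impI)
   fix r y assume r: "0 < r" "r < d" "y \<in> ball x r"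
   have "norm (y - x) < r" using r(3) by (simp add: dist_norm norm_minus_commute)
   then have "norm (u y - u x - G *v (y - x)) <= e * norm (y - x)" using d r by simp
   also have "... <= e * r" using \<open>norm (y - x) < r\<close> \<open>e > 0\<close> by (intro mult_left_mono) auto
   finally show "norm (u y - u x - G *v (y - x)) / r <= e" using r by (simp add: divide_le_eq)
  qed (use d in auto)
 qed
qed

lemma average_ge_subball:
 fixes f :: "real ^ 'n => real"
 assumes r: "r > 0" "\<delta> > 0" and int: "integrable lebesgue (%y. indicator (ball x r) y * f y)"
  and pos: "!!y. y \<in> ball x r ==> 0 <= f y" and sub: "ball c (\<delta> * r) \<subseteq> ball x r"
  and k: "!!y. y \<in> ball c (\<delta> * r) ==> k <= f y"
 shows "k * \<delta> ^ CARD('n) <= (LINT y : ball x r | lebesgue. f y) / measure lebesgue (ball x r)"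
proof -
 have m: "measure lebesgue (ball x r) > 0" using r by (simp add: content_ball_pos)
 have "measure lebesgue (ball c (\<delta> * r)) = \<delta> ^ CARD('n) * measure lebesgue (ball x r)"
  using r by (simp add: content_ball power_mult_distrib)
 then have "k * \<delta> ^ CARD('n) * measure lebesgue (ball x r) = (LINT y|lebesgue. k * indicator (ball c (\<delta> * r)) y)" by simp
 also have "... <= (LINT y|lebesgue. indicator (ball x r) y * f y)"
 proof (rule integral_mono[OF _ int])
  show "integrable lebesgue (%y. k * indicat_real (ball c (\<delta> * r)) y)" using emeasure_bounded_finite[of "ball c (\<delta> * r)"]
   by (intro integrable_mult_right integrable_real_indicator) (auto simp: emeasure_completion)
  show "k * indicat_real (ball c (\<delta> * r)) y <= indicat_real (ball x r) y * f y" for y using pos[of y] sub k[of y] by (auto simp: indicator_def)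
 qed
 finally show ?thesis using m by (simp add: le_divide_eq set_lebesgue_integral_def)
qed

text \<open>If u equals a on a fixed proportion of all small balls, a limit z different from a would
  leave averages of |u - z| bounded away from 0.\<close>

lemma approx_limit_eq_on_subballs:
 fixes u :: "real ^ 'n => real ^ 'm"
 assumes L: "has_approx_limit u x z" and [measurable]: "u \<in> borel_measurable borel" and B: "!!y. norm (u y) <= B"
  and \<delta>: "\<delta> > 0" and d: "d > 0"
  and sub: "!!r. 0 < r ==> r < d ==> \<exists>c. ball c (\<delta> * r) \<subseteq> ball x r & (\<forall>y\<in>ball c (\<delta> * r). u y = a)"
 shows "z = a"
proof (rule ccontr)
 assume "z ~= a"
 then have k: "norm (a - z) > 0" by simp
 have "norm (a - z) * \<delta> ^ CARD('n) <= 0"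
 proof (rule tendsto_lowerbound[OF L[unfolded has_approx_limit_def]])
  have "\<forall>\<^sub>F r in at_right (0::real). 0 < r & r < d" using d by (auto simp: eventually_at_right intro!: exI[of _ d])
  then show "\<forall>\<^sub>F r in at_right 0. norm (a - z) * \<delta> ^ CARD('n) <= (LINT y : ball x r | lebesgue. norm (u y - z)) / measure lebesgue (ball x r)"
  proof eventually_elim
   case (elim r)
   then obtain c where c: "ball c (\<delta> * r) \<subseteq> ball x r" "!!y. y \<in> ball c (\<delta> * r) ==> u y = a" using sub by blast
   show ?case
   proof (rule average_ge_subball[OF _ \<delta> _ _ c(1)])
    have "integrable lborel (%y. indicator (ball x r) y * norm (u y - z))"
    proof (rule integrable_dominated)
     show "integrable lborel (%y. (B + norm z) * indicator (ball x r) y)" using emeasure_bounded_finite[of "ball x r"] by simp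
     have "norm (u y - z) <= B + norm z" for y using norm_triangle_ineq4[of "u y" z] B[of y] by linarith
     then show "AE y in lborel. norm (indicator (ball x r) y * norm (u y - z)) <= norm ((B + norm z) * indicat_real (ball x r) y)"
      by (auto simp: indicator_def intro!: AE_I2 order_trans[OF _ abs_ge_self])
     have "ball x r \<in> sets borel" "(%y. norm (u y - z)) \<in> borel_measurable borel" by (simp, measurable)
     then show "(%y. indicator (ball x r) y * norm (u y - z)) \<in> borel_measurable lborel"
      by (intro borel_measurable_times borel_measurable_indicator) simp_all
    qed
    then show "integrable lebesgue (%y. indicator (ball x r) y * norm (u y - z))" by (simp add: integrable_completion)
    show "!!y. y \<in> ball c (\<delta> * r) ==> norm (a - z) <= norm (u y - z)" using c(2) by simp
   qed (use elim in auto)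
  qed
 qed simp
 moreover have "0 < norm (a - z) * \<delta> ^ CARD('n)" using k \<delta> by (intro mult_pos_pos) auto
 ultimately show False by linarith
qed

section \<open>Membership of the competitors in the special BV class\<close>

context slicing
begin

text \<open>A pointwise computed gradient shows that H is an approximate gradient almost everywhere;
  \<open>approx_gradient_AE\<close> adds uniqueness, so the definite description in
  \<open>approx_gradient\<close> evaluates to H.\<close>

lemma SBV2I:
 assumes T: "!!x. u x \<in> T" and grad: "AE x in lborel. x \<in> U --> has_approx_gradient u x (H x)"
  and N: "N \<in> null_sets lborel" "- N \<in> null_sets \<mu>"
  and H2: "integrable lborel (%x. indicator U x * (norm (H x))\<^sup>2)"
  and D: "has_measure_derivative U u \<mu>' \<sigma>'" and dec: "lebesgue_decomposition \<mu>' \<mu>a \<mu>s"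
  and sing: "U - approx_discontinuity_set U u \<in> null_sets \<mu>s"
  and fin: "hausdorff 2 (approx_discontinuity_set U u) < \<infinity>"
 shows "u \<in> SBV2 U T" "AE x in lborel. x \<in> U --> approx_gradient u x = H x"
proof -
 show ag: "AE x in lborel. x \<in> U --> approx_gradient u x = H x" using approx_gradient_AE[OF N] grad
 proof eventually_elim
  case (elim x)
  show ?case unfolding approx_gradient_def by (intro impI the_equality) (use elim in blast)+
 qed
 have bU: "bounded U" "open U" by (simp_all add: bounded_box open_box)
 have "integrable lborel (%x. indicator U x *\<^sub>R u x)"
 proof (rule integrable_dominated)
  show "integrable lborel (indicat_real U)" using emeasure_bounded_finite[OF bU(1)] by (intro integrable_real_indicator) auto
  show "AE x in lborel. norm (indicat_real U x *\<^sub>R u x) <= norm (indicat_real U x)" using u_le_1 by (auto simp: indicator_def)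
 qed simp
 then have "u \<in> BV U" using D by (auto simp: BV_def set_integrable_def integrable_completion)
 moreover have "set_integrable lebesgue U (%x. (norm (approx_gradient u x))\<^sup>2)" unfolding set_integrable_def
 proof (rule integrable_cong_AE[THEN iffD1])
  show i: "integrable lebesgue (%x. indicator U x * (norm (H x))\<^sup>2)" using H2 by (simp add: integrable_completion)
  show eq: "AE x in lebesgue. indicator U x * (norm (H x))\<^sup>2 = indicat_real U x *\<^sub>R (norm (approx_gradient u x))\<^sup>2"
   using ag by (auto simp: AE_completion_iff elim!: eventually_mono simp: indicator_def)
  show "(%x. indicator U x * (norm (H x))\<^sup>2) \<in> borel_measurable lebesgue" using i by auto
  then show "(%x. indicat_real U x *\<^sub>R (norm (approx_gradient u x))\<^sup>2) \<in> borel_measurable lebesgue"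
   using eq by (rule borel_measurable_AE)
 qed
 moreover have "AE x in lebesgue_on U. \<exists>G. has_approx_gradient u x G"
  unfolding AE_lebesgue_on_iff[OF bU(2)] using grad by eventually_elim blast
 moreover have "AE x in lebesgue_on U. u x \<in> T" using T by simp
 ultimately show "u \<in> SBV2 U T" using D dec sing fin unfolding SBV2_def SBV_def by auto
qed

end

text \<open>A function of the height alone is invariant under horizontal translations, so its
  horizontal derivatives vanish; the vertical one reduces to lines by Fubini.\<close>

lemma vertical_flux:
 fixes a :: "real => real"
 assumes t: "test_function (box (vector [- L1, - L2, z0]) (vector [L1, L2, z1])) \<phi> g"
  and [measurable]: "a \<in> borel_measurable borel" and B: "!!t. \<bar>a t\<bar> <= B"
 shows "j ~= 3 ==> (LBINT p. a (p $ 3) * g p $ j) = 0"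
  "(LBINT p. a (p $ 3) * g p $ 3) = (LBINT z. LBINT t. a t * g (shear 0 0 (z, t)) $ 3)"
proof -
 have [measurable]: "(%p :: real^3. p $ 3) \<in> borel_measurable borel" by (intro continuous_borel continuous_intros)
 have [measurable]: "(%p :: real^3. a (p $ 3)) \<in> borel_measurable borel" by measurable
 show "(LBINT p. a (p $ 3) * g p $ j) = 0" if "j ~= 3"
 proof -
  have "(x + t *\<^sub>R axis j 1) $ 3 = x $ 3" for x :: "real^3" and t using that by (simp add: axis_def)
  then have "(LBINT x. a (x $ 3) * (g x \<bullet> axis j 1)) = 0"
   using B by (intro integral_directional_derivative_0[OF t, where B=B]) (simp_all del: vector_add_component)
  then show ?thesis by (simp add: inner_axis)
 qed
 have i: "integrable lborel (%p. a (p $ 3) * g p $ 3)" by (rule integrable_times_test_gradient[OF t _ B]) measurable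
 show "(LBINT p. a (p $ 3) * g p $ 3) = (LBINT z. LBINT t. a t * g (shear 0 0 (z, t)) $ 3)" using integral_shear_iterated(2)[OF i, of 0 0] by simp
qed

lemma set_integral_test_gradient:
 fixes u :: "real ^ 'n => real ^ 'm"
 assumes t: "test_function \<Omega> \<phi> g" and \<Omega>: "open \<Omega>" and u: "u \<in> borel_measurable borel"
 shows "(LINT x : \<Omega> | lebesgue. u x $ i * g x $ j) = (LBINT x. u x $ i * g x $ j)"
proof -
 obtain C where C: "C \<subseteq> \<Omega>" "!!x. x \<notin> C ==> g x = 0" "continuous_on UNIV g" using test_function_facts[OF t] by blast
 have g0: "g x = 0" if "x \<notin> \<Omega>" for x using C that by blast
 have [measurable]: "(%x. g x $ j) \<in> borel_measurable borel" by (intro continuous_borel continuous_intros C(3))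
 have [measurable]: "(%x. u x $ i) \<in> borel_measurable borel" "\<Omega> \<in> sets borel" using u \<Omega> unfolding nth_measurable_iff by auto
 have "(LINT x : \<Omega> | lebesgue. u x $ i * g x $ j) = (LBINT x. indicator \<Omega> x * (u x $ i * g x $ j))"
  by (rule set_lebesgue_integral_borel) measurable
 also have "... = (LBINT x. u x $ i * g x $ j)" using g0 by (intro lint_cong) (auto simp: indicator_def)
 finally show ?thesis .
qed

lemma AE_component_neq: "AE p in lborel. (p :: real^3) $ 3 ~= c"
proof -
 have [measurable]: "(%p :: real^3. p $ 3) \<in> borel_measurable borel" by (intro continuous_borel continuous_intros)
 have m: "Measurable.pred borel (%p :: real^3. p $ 3 ~= c)" by measurable
 show ?thesis unfolding AE_shear_iff[OF m, of 0 0] by (simp add: AE_lborel_singleton)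
qed

lemma slice_test_function:
 assumes t: "test_function (box (vector [- L1, - L2, z0]) (vector [L1, L2, z1])) \<phi> g"
 shows "((%t. \<phi> (shear 0 0 (z, t))) has_real_derivative g (shear 0 0 (z, t)) $ 3) (at t)"
  "continuous_on UNIV (%t. g (shear 0 0 (z, t)) $ 3)"
  "\<not> (z0 < t & t < z1) ==> \<phi> (shear 0 0 (z, t)) = 0" "\<not> (z0 < t & t < z1) ==> g (shear 0 0 (z, t)) = 0"
proof -
 obtain Cg where Cg: "Cg \<subseteq> box (vector [- L1, - L2, z0]) (vector [L1, L2, z1])" "!!x. x \<notin> Cg ==> \<phi> x = 0"
  "!!x. x \<notin> Cg ==> g x = 0" "continuous_on UNIV g" using test_function_facts[OF t] by blast
 have "(\<phi> has_derivative (%h. g x \<bullet> h)) (at x)" for x using t by (simp add: test_function_def)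
 from derivative_along_shear[of \<phi> g 0 0 z t, OF this]
 show "((%t. \<phi> (shear 0 0 (z, t))) has_real_derivative g (shear 0 0 (z, t)) $ 3) (at t)" by simp
 show "continuous_on UNIV (%t. g (shear 0 0 (z, t)) $ 3)"
  by (intro continuous_intros continuous_on_compose2[OF Cg(4)] continuous_on_compose2[OF continuous_shear[of UNIV]]) auto
 have "shear 0 0 (z, t) \<notin> Cg" if "\<not> (z0 < t & t < z1)" using that Cg(1) by (auto simp: mem_box3)
 then show "\<not> (z0 < t & t < z1) ==> \<phi> (shear 0 0 (z, t)) = 0" "\<not> (z0 < t & t < z1) ==> g (shear 0 0 (z, t)) = 0" using Cg(2,3) by auto
qed

definition vertical_gradient :: "(real => real^3) => real^3 => real^3 ^ 3" where
 "vertical_gradient h p = (\<chi> i j. if j = 3 then h (p $ 3) $ i else 0)"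

lemma norm_vertical_gradient: "norm (vertical_gradient h p) = norm (h (p $ 3))" by (simp add: vertical_gradient_def norm_vec_def L2_set_def sum_3)

lemma hausdorff_empty: "hausdorff 2 ({} :: (real^3) set) = 0" using hausdorff_horizontal_le[of "{}"] by simp

text \<open>For a map of the height only, integration by parts on vertical lines gives the
  derivative: the absolutely continuous matrix field H with h in its third column. Finitely many
  exceptional heights form a null set in space.\<close>

lemma vertical_SBV2:
 fixes v h :: "real => real^3" and L1 L2 z0 z1 :: real
 defines "\<Omega> \<equiv> box (vector [- L1, - L2, z0]) (vector [L1, L2, z1]) :: (real^3) set"
 assumes z: "z0 < z1" and v1: "!!t. norm (v t) = 1" and cont: "continuous_on UNIV v"
  and hb [measurable]: "h \<in> borel_measurable borel" and hM: "!!t. norm (h t) <= M"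
  and prim: "!!t i. z0 <= t ==> v t $ i = v z0 $ i + (LBINT s. indicator {z0..t} s * h s $ i)"
  and E: "finite E" "!!t. t \<notin> E ==> (v has_vector_derivative h t) (at t)"
 shows "(%p. v (p $ 3)) \<in> SBV2 \<Omega> (sphere 0 1 \<union> {0})"
  "AE p in lborel. p \<in> \<Omega> --> norm (approx_gradient (%p. v (p $ 3)) p) = norm (h (p $ 3))"
  "approx_discontinuity_set \<Omega> (%p. v (p $ 3)) = {}"
proof -
 define u where "u p = v (p $ 3)" for p :: "real^3"
 define H where "H p = indicator \<Omega> p *\<^sub>R vertical_gradient h p" for p
 have n3 [measurable]: "(%p :: real^3. p $ 3) \<in> borel_measurable borel" by (intro continuous_borel continuous_intros)
 have vb [measurable]: "v \<in> borel_measurable borel" using cont by (rule continuous_borel)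
 have [measurable]: "u \<in> borel_measurable borel" unfolding u_def[abs_def] by measurable
 have hib [measurable]: "(%t. h t $ i) \<in> borel_measurable borel" for i using hb unfolding nth_measurable_iff by blast
 have vib [measurable]: "(%t. v t $ i) \<in> borel_measurable borel" for i using vb unfolding nth_measurable_iff by blast
 have \<Omega>: "\<Omega> \<in> sets borel" "open \<Omega>" "bounded \<Omega>" by (auto simp: \<Omega>_def bounded_box open_box)
 note [measurable] = \<Omega>(1)
 have iM: "integrable lborel (%p. c * indicat_real \<Omega> p)" for c using emeasure_bounded_finite[OF \<Omega>(3)] by simp
 have Hij: "H p $ i $ j = indicator \<Omega> p * (if j = 3 then h (p $ 3) $ i else 0)" for p i j by (simp add: H_def vertical_gradient_def)
 have Hijb [measurable]: "(%p. H p $ i $ j) \<in> borel_measurable borel" for i j unfolding Hij by (cases "j = 3") simp_all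
 have hi: "\<bar>h t $ i\<bar> <= M" for t i using component_le_norm_cart[of "h t" i] hM[of t] by linarith
 have M0: "M \<ge> 0" using hM[of 0] norm_ge_zero[of "h 0"] by linarith
 have Hint: "integrable lborel (%p. H p $ i $ j)" for i j
  by (rule integrable_dominated[OF iM[of M]]) (use hi M0 in \<open>auto simp: Hij indicator_def\<close>)
 have Hb [measurable]: "H \<in> borel_measurable borel"
 proof -
  have "(%p. H p \<bullet> b) \<in> borel_measurable borel" if "b \<in> Basis" for b
  proof -
   obtain i j where "b = axis i (axis j 1)" using \<open>b \<in> Basis\<close> by (auto simp: Basis_vec_def)
   then have "(%p. H p \<bullet> b) = (%p. H p $ i $ j)" by (simp add: inner_axis fun_eq_iff)
   then show ?thesis by simp
  qed
  then show ?thesis by (subst borel_measurable_euclidean_space) auto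
 qed
 have uparts: "(LBINT x. u x $ i * g x $ j) = - (LBINT x. \<phi> x * H x $ i $ j)"
  if t: "test_function \<Omega> \<phi> g" for \<phi> g i j
 proof -
  note t' = t[unfolded \<Omega>_def]
  have vB: "\<bar>v t $ i\<bar> <= 1" for t using component_le_norm_cart[of "v t" i] v1[of t] by linarith
  obtain Cg where Cg: "compact Cg" "Cg \<subseteq> \<Omega>" "!!x. x \<notin> Cg ==> \<phi> x = 0" "continuous_on UNIV \<phi>"
   using test_function_facts[OF t] by blast
  have [measurable]: "\<phi> \<in> borel_measurable borel" using Cg(4) by (rule continuous_borel)
  show ?thesis
  proof (cases "j = 3")
   case False
   then show ?thesis using vertical_flux(1)[OF t' vib vB False] by (simp add: u_def Hij)
  next
   case True
   have \<phi>H: "\<phi> p * H p $ i $ 3 = \<phi> p * h (p $ 3) $ i" for p using Cg(2,3) by (cases "p \<in> \<Omega>") (auto simp: Hij)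
   have slice: "(LBINT t. v t $ i * g (shear 0 0 (z, t)) $ 3) = - (LBINT t. \<phi> (shear 0 0 (z, t)) * h t $ i)" for z
   proof -
    define q where "q t = \<phi> (shear 0 0 (z, t))" for t
    define q' where "q' t = g (shear 0 0 (z, t)) $ 3" for t
    have q: "(q has_real_derivative q' t) (at t)" "continuous_on UNIV q'" "\<not> (z0 < t & t < z1) ==> q t = 0"
      "\<not> (z0 < t & t < z1) ==> q' t = 0" for t using slice_test_function[OF t', where z=z] by (auto simp: q_def[abs_def] q'_def[abs_def])
    have hiI: "integrable lborel (%t. indicator {z0..z1} t * h t $ i)"
    proof (rule integrable_dominated)
     show "integrable lborel (%t. M * indicat_real {z0..z1} t)" using z by simp
    qed (use hi M0 in \<open>auto simp: indicator_def\<close>)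
    have qi: "integrable lborel (%t. indicator {z0..z1} t * q' t)" using z q(1) continuous_on_subset[OF q(2)] by (intro primitive_of_deriv) auto
    have Q: "q t = 0 + (LBINT s. indicator {z0..t} s * q' s)" if "z0 <= t" "t <= z1" for t
     using primitive_of_deriv(1)[of z0 t q q'] q(1) q(3)[of z0] continuous_on_subset[OF q(2)] that by auto
    have zz: "z0 <= z1" using z by simp
    note P = integral_by_parts_primitive[OF zz hiI qi prim Q]
    have sum0: "(LBINT t. indicator {z0..z1} t * (v t $ i * q' t)) + (LBINT t. indicator {z0..z1} t * (h t $ i * q t)) = 0"
     using P(2,3,4) q(3)[of z1] by (simp add: distrib_left)
    have e: "indicator {z0..z1} t * (v t $ i * q' t) = v t $ i * q' t" "indicator {z0..z1} t * (h t $ i * q t) = q t * h t $ i" for t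
     using q(3,4)[of t] by (cases "z0 < t & t < z1"; simp)+
    show ?thesis using sum0 unfolding e by (simp add: q_def q'_def)
   qed
   have i1: "integrable lborel (%p. \<phi> p * h (p $ 3) $ i)"
   proof (rule integrable_dominated)
    show "integrable lborel (%p. M * \<phi> p)"
     by (rule integrable_continuous_compact_support[OF Cg(1)]) (auto intro!: continuous_intros Cg(4) simp: Cg(3))
    show "AE p in lborel. norm (\<phi> p * h (p $ 3) $ i) <= norm (M * \<phi> p)"
    proof (rule AE_I2)
     fix p :: "real^3"
     have "\<bar>\<phi> p\<bar> * \<bar>h (p $ 3) $ i\<bar> <= \<bar>\<phi> p\<bar> * M" by (intro mult_left_mono hi) auto
     then show "norm (\<phi> p * h (p $ 3) $ i) <= norm (M * \<phi> p)" using M0 by (simp add: abs_mult mult.commute)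
    qed
    have [measurable]: "(%p :: real^3. h (p $ 3) $ i) \<in> borel_measurable borel" by (rule measurable_compose[OF n3 hib])
    show "(%p. \<phi> p * h (p $ 3) $ i) \<in> borel_measurable lborel" by measurable
   qed
   have "(LBINT x. u x $ i * g x $ j) = (LBINT z. LBINT t. v t $ i * g (shear 0 0 (z, t)) $ 3)"
    unfolding u_def True by (rule vertical_flux(2)[OF t' vib vB])
   also have "... = - (LBINT z. LBINT t. \<phi> (shear 0 0 (z, t)) * h t $ i)" unfolding slice by simp
   also have "(LBINT z. LBINT t. \<phi> (shear 0 0 (z, t)) * h t $ i) = (LBINT x. \<phi> x * H x $ i $ j)"
    unfolding True \<phi>H using integral_shear_iterated(2)[OF i1, of 0 0] by simp
   finally show ?thesis .
  qed
 qed
 have sl: "slicing L1 L2 z0 z1 u H (null_measure borel) (%_. 0) (%_. {})"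
 proof (rule slicing.intro)
  show "finite_measure (null_measure borel :: (real^3) measure)" by (rule finite_measureI) simp
 qed (use v1 Hint uparts in \<open>auto simp: u_def \<Omega>_def null_sets_def\<close>)
 interpret slicing L1 L2 z0 z1 u H "null_measure borel" "%_. 0" "%_. {}" by (rule sl)
 have cu: "isCont u p" for p
 proof -
  have "continuous_on UNIV u" unfolding u_def by (rule continuous_on_compose2[OF cont]) (auto intro!: continuous_intros)
  then show ?thesis by (simp add: continuous_on_eq_continuous_at)
 qed
 then have disc: "approx_discontinuity_set \<Omega> u = {}" using has_approx_limit_of_isCont[where u=u] by (auto simp: approx_discontinuity_set_def)
 have grad: "AE x in lborel. x \<in> \<Omega> --> has_approx_gradient u x (H x)"
 proof -
  have "AE p in lborel. \<forall>c\<in>E. (p :: real^3) $ 3 ~= c" by (intro AE_finite_allI E(1) AE_component_neq)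
  then show ?thesis
  proof eventually_elim
   case (elim x)
   show ?case
   proof
    assume x: "x \<in> \<Omega>"
    have "(v has_derivative (%s. s *\<^sub>R h (x $ 3))) (at (x $ 3))" using E(2)[of "x $ 3"] elim by (auto simp: has_vector_derivative_def)
    from has_derivative_compose[OF has_derivative_nth[of 3 x] this]
    have "(u has_derivative (%k. k $ 3 *\<^sub>R h (x $ 3))) (at x)" by (simp add: u_def[abs_def])
    moreover have "(%k. k $ 3 *\<^sub>R h (x $ 3)) = (%k. H x *v k)"
     using x by (simp add: fun_eq_iff vec_eq_iff matrix_vector_mult_def Hij sum_3 mult.commute)
    ultimately show "has_approx_gradient u x (H x)" by (intro has_approx_gradient_of_derivative) simp
   qed
  qed
 qed
 have nH: "norm (H p) = indicator \<Omega> p * norm (h (p $ 3))" for p by (simp add: H_def norm_vertical_gradient)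
 have nHi: "integrable lborel (%p. norm (H p))" by (rule integrable_dominated[OF iM[of M]])
   (use hM M0 in \<open>auto simp: nH indicator_def intro!: AE_I2 order_trans[OF _ abs_ge_self]\<close>)
 \<comment> \<open>Any matrix of norm 1: it fills in the polar density where H = 0 and the direction
   is undefined.\<close>
 define E0 where "E0 = (axis 1 (axis 1 1) :: real^3 ^ 3)"
 have E0: "norm E0 = 1" by (simp add: E0_def)
 define \<mu>' where "\<mu>' = density lborel (%p. ennreal (norm (H p)))"
 define \<sigma>' where "\<sigma>' p = (if H p = 0 then E0 else H p /\<^sub>R norm (H p))" for p
 have [measurable]: "\<sigma>' \<in> borel_measurable borel" unfolding \<sigma>'_def[abs_def] by measurable
 have \<sigma>ij [measurable]: "(%x. \<sigma>' x $ i $ j) \<in> borel_measurable borel" for i j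
  by (rule measurable_compose[OF _ mat_nth_borel]) measurable
 have D: "has_measure_derivative \<Omega> u \<mu>' \<sigma>'" unfolding has_measure_derivative_def
 proof (intro conjI allI impI)
  show "sets \<mu>' = sets borel" by (simp add: \<mu>'_def)
  show "finite_measure \<mu>'"
  proof (rule finite_measureI)
   have "emeasure \<mu>' (space \<mu>') = (\<integral>\<^sup>+p. ennreal (norm (H p)) \<partial>lborel)" by (simp add: \<mu>'_def emeasure_density)
   also have "... < \<infinity>" using nHi by (simp add: integrable_iff_bounded)
   finally show "emeasure \<mu>' (space \<mu>') ~= \<infinity>" by simp
  qed
  have "emeasure \<mu>' (- \<Omega>) = (\<integral>\<^sup>+p. ennreal (norm (H p)) * indicator (- \<Omega>) p \<partial>lborel)"
   by (simp add: \<mu>'_def emeasure_density)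
  also have "... = (\<integral>\<^sup>+(p :: real^3). 0 \<partial>lborel)" by (intro nn_integral_cong) (auto simp: nH indicator_def)
  finally show "- \<Omega> \<in> null_sets \<mu>'" by (simp add: null_sets_def \<mu>'_def)
  show "AE x in \<mu>'. norm (\<sigma>' x) = 1" using E0 by (simp add: \<sigma>'_def)
  fix \<phi> g i j assume t: "test_function \<Omega> \<phi> g"
  obtain Cg where Cg: "continuous_on UNIV \<phi>" using test_function_facts[OF t] by blast
  have [measurable]: "\<phi> \<in> borel_measurable borel" using Cg by (rule continuous_borel)
  have "(LINT x : \<Omega> | lebesgue. u x $ i * g x $ j) = (LBINT x. u x $ i * g x $ j)"
   by (rule set_integral_test_gradient[OF t \<Omega>(2) u_borel])
  also have "... = - (LBINT x. \<phi> x * H x $ i $ j)" by (rule uparts[OF t])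
  also have "(LBINT x. \<phi> x * H x $ i $ j) = (LBINT x. norm (H x) * (\<phi> x * \<sigma>' x $ i $ j))"
   by (intro lint_cong) (auto simp: \<sigma>'_def)
  also have "... = (LINT x|\<mu>'. \<phi> x * \<sigma>' x $ i $ j)" unfolding \<mu>'_def by (subst integral_density) auto
  finally show "(LINT x : \<Omega> | lebesgue. u x $ i * g x $ j) = - (LINT x|\<mu>'. \<phi> x * \<sigma>' x $ i $ j)" .
 qed measurable
 have dec: "lebesgue_decomposition \<mu>' \<mu>' (null_measure borel)" unfolding lebesgue_decomposition_def
 proof (intro conjI ballI)
  show "absolutely_continuous lborel \<mu>'" unfolding \<mu>'_def by (rule absolutely_continuousI_density) simp
  show "\<exists>N\<in>null_sets lborel. - N \<in> null_sets (null_measure borel)" by (intro bexI[of _ "{}"]) (auto simp: null_sets_def)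
 qed (auto simp: \<mu>'_def)
 have sing: "\<Omega> - approx_discontinuity_set \<Omega> u \<in> null_sets (null_measure borel)"
  unfolding disc using \<Omega>(1) by (simp add: null_sets_def)
 have H2: "integrable lborel (%x. indicator \<Omega> x * (norm (H x))\<^sup>2)"
 proof (rule integrable_dominated[OF iM[of "M\<^sup>2"]])
  have "(norm (h t))\<^sup>2 <= M\<^sup>2" for t using hM by (intro power_mono) auto
  then show "AE x in lborel. norm (indicator \<Omega> x * (norm (H x))\<^sup>2) <= norm (M\<^sup>2 * indicat_real \<Omega> x)"
   by (auto simp: nH indicator_def simp del: power_mono_iff abs_le_square_iff)
 qed measurable
 have fin: "hausdorff 2 (approx_discontinuity_set \<Omega> u) < \<infinity>" unfolding disc hausdorff_empty by simp
 have T: "u x \<in> sphere 0 1 \<union> {0}" for x using v1 by (simp add: u_def)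
 have N: "{} \<in> null_sets lborel" "- {} \<in> null_sets (null_measure borel :: (real^3) measure)" by (auto simp: null_sets_def)
 note S = SBV2I[OF T grad[unfolded \<Omega>_def] N H2[unfolded \<Omega>_def] D[unfolded \<Omega>_def] dec sing[unfolded \<Omega>_def] fin[unfolded \<Omega>_def], folded \<Omega>_def]
 show "(%p. v (p $ 3)) \<in> SBV2 \<Omega> (sphere 0 1 \<union> {0})" using S(1) by (simp add: u_def[abs_def])
 show "AE p in lborel. p \<in> \<Omega> --> norm (approx_gradient (%p. v (p $ 3)) p) = norm (h (p $ 3))"
  using S(2) by eventually_elim (auto simp: u_def[abs_def] nH)
 show "approx_discontinuity_set \<Omega> (%p. v (p $ 3)) = {}" using disc by (simp add: u_def[abs_def])
qed

lemma n_jump_nth: "n_jump \<alpha> p $ i = axis 1 1 $ i + (axis 3 1 - axis 1 1 :: real^3) $ i * indicator {\<alpha>..} (p $ 3)"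
 by (simp add: n_jump_def)

lemma norm_n_jump: "norm (n_jump \<alpha> p) = 1" by (simp add: n_jump_def)

lemma n_jump_locally_const:
 assumes "p $ 3 ~= \<alpha>" shows "(n_jump \<alpha> has_derivative (%_. 0)) (at p)"
proof -
 have o: "open {q :: real^3. q $ 3 < \<alpha>}" "open {q :: real^3. \<alpha> < q $ 3}" by (intro open_Collect_less continuous_intros)+
 show ?thesis
 proof (cases "p $ 3 < \<alpha>")
  case True
  show ?thesis by (rule has_derivative_transform_within_open[OF has_derivative_const o(1)]) (use True in \<open>auto simp: n_jump_def\<close>)
 next
  case False
  then show ?thesis using assms by (intro has_derivative_transform_within_open[OF has_derivative_const o(2)]) (auto simp: n_jump_def)
 qed
qed

text \<open>Every ball around a point of the plane contains a ball of half its radius on either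
  side, with value e1 below and e3 above; a limit would equal both.\<close>

lemma n_jump_no_approx_limit:
 assumes "p $ 3 = \<alpha>" shows "\<not> has_approx_limit (n_jump \<alpha>) p z"
proof
 assume L: "has_approx_limit (n_jump \<alpha>) p z"
 have sub: "ball (p + s *\<^sub>R axis 3 1) (1 / 2 * r) \<subseteq> ball p r" if "\<bar>s\<bar> = r / 2" for s r
 proof
  fix y assume "y \<in> ball (p + s *\<^sub>R axis 3 1) (1 / 2 * r)"
  then have "dist (p + s *\<^sub>R axis 3 1) y < r / 2" by simp
  moreover have "dist p (p + s *\<^sub>R axis 3 1) = r / 2" using that by (simp add: dist_norm)
  ultimately show "y \<in> ball p r" using dist_triangle[of p y "p + s *\<^sub>R axis 3 1"] by simp
 qed
 have near: "\<bar>y $ 3 - (\<alpha> + s)\<bar> < r / 2" if "y \<in> ball (p + s *\<^sub>R axis 3 1) (1 / 2 * r)" for y s r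
 proof -
  have "norm (p + s *\<^sub>R axis 3 1 - y) < r / 2" using that by (simp add: dist_norm)
  moreover have "(p + s *\<^sub>R axis 3 1 - y) $ 3 = \<alpha> + s - y $ 3" using assms by (simp add: axis_def)
  ultimately show ?thesis using component_le_norm_cart[of "p + s *\<^sub>R axis 3 1 - y" 3] by linarith
 qed
 have "z = axis 1 1"
 proof (rule approx_limit_eq_on_subballs[OF L n_jump_borel, of 1 "1 / 2" 1])
  fix r :: real assume "0 < r" "r < 1"
  have "n_jump \<alpha> y = axis 1 1" if "y \<in> ball (p + (- (r / 2)) *\<^sub>R axis 3 1) (1 / 2 * r)" for y
  proof -
   have "y $ 3 < \<alpha>" using near[OF that] unfolding abs_less_iff by linarith
   then show ?thesis by (simp add: n_jump_def)
  qed
  then show "\<exists>c. ball c (1 / 2 * r) \<subseteq> ball p r & (\<forall>y\<in>ball c (1 / 2 * r). n_jump \<alpha> y = axis 1 1)"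
   using sub[of "- (r / 2)" r] \<open>0 < r\<close> by (intro exI[of _ "p + (- (r / 2)) *\<^sub>R axis 3 1"] conjI ballI) auto
 qed (auto simp: norm_n_jump)
 moreover have "z = axis 3 1"
 proof (rule approx_limit_eq_on_subballs[OF L n_jump_borel, of 1 "1 / 2" 1])
  fix r :: real assume "0 < r" "r < 1"
  have "n_jump \<alpha> y = axis 3 1" if "y \<in> ball (p + (r / 2) *\<^sub>R axis 3 1) (1 / 2 * r)" for y
  proof -
   have "\<alpha> < y $ 3" using near[OF that] unfolding abs_less_iff by linarith
   then show ?thesis by (simp add: n_jump_def)
  qed
  then show "\<exists>c. ball c (1 / 2 * r) \<subseteq> ball p r & (\<forall>y\<in>ball c (1 / 2 * r). n_jump \<alpha> y = axis 3 1)"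
   using sub[of "r / 2" r] \<open>0 < r\<close> by (intro exI[of _ "p + (r / 2) *\<^sub>R axis 3 1"] conjI ballI) auto
 qed (auto simp: norm_n_jump)
 ultimately show False by (simp add: axis_eq_axis)
qed

text \<open>The derivative is purely singular: surface measure on the plane of height \<alpha> times
  e3 - e1 in the vertical column. Only the upper bound for the Hausdorff measure is shown here; as a
  competitor the map needs no more.\<close>

lemma jump_SBV2:
 fixes L1 L2 z0 z1 \<alpha> :: real
 defines "\<Omega> \<equiv> box (vector [- L1, - L2, z0]) (vector [L1, L2, z1]) :: (real^3) set"
 assumes \<alpha>: "z0 < \<alpha>" "\<alpha> < z1" and L: "L1 > 0" "L2 > 0"
 shows "n_jump \<alpha> \<in> SBV2 \<Omega> (sphere 0 1 \<union> {0})"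
  "AE p in lborel. p \<in> \<Omega> --> approx_gradient (n_jump \<alpha>) p = 0"
  "hausdorff 2 (approx_discontinuity_set \<Omega> (n_jump \<alpha>)) <= ennreal (4 * L1 * L2)"
proof -
 define Q where "Q = box (- L1, - L2) (L1, L2)"
 let ?s = "%z. shear 0 0 (z, \<alpha>)"
 have Q: "open Q" "bounded Q" by (auto simp: Q_def open_box bounded_box)
 have [measurable]: "Q \<in> sets borel" using Q by simp
 have areaQ: "emeasure lborel Q = ennreal (4 * L1 * L2)" unfolding Q_def using L
  by (subst emeasure_lborel_box) (auto simp: Basis_prod_def prod.union_disjoint prod.reindex inj_on_def mult_ac)
 have sQ: "?s z \<in> \<Omega> \<longleftrightarrow> z \<in> Q" for z
  using \<alpha> by (cases z) (auto simp: \<Omega>_def mem_box3 Q_def box_prod box_real)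
 have plane: "{p \<in> \<Omega>. p $ 3 = \<alpha>} = ?s ` Q"
 proof (intro set_eqI iffI)
  fix p assume p: "p \<in> {p \<in> \<Omega>. p $ 3 = \<alpha>}"
  then have "p = ?s (foot 0 0 p)" using shear_foot[of 0 0 p] by simp
  then show "p \<in> ?s ` Q" using p sQ by (metis (mono_tags, lifting) image_eqI mem_Collect_eq)
 qed (use sQ in auto)
 have haus: "hausdorff 2 {p \<in> \<Omega>. p $ 3 = \<alpha>} <= ennreal (4 * L1 * L2)"
  unfolding plane areaQ[symmetric] by (rule hausdorff_horizontal_le[OF Q])
 have disc: "approx_discontinuity_set \<Omega> (n_jump \<alpha>) = {p \<in> \<Omega>. p $ 3 = \<alpha>}"
  using n_jump_no_approx_limit has_approx_limit_of_isCont[OF has_derivative_continuous[OF n_jump_locally_const]]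
  unfolding approx_discontinuity_set_def by blast
 have cs: "continuous_on UNIV ?s" by (rule continuous_on_compose2[OF continuous_shear[of UNIV]]) (auto intro!: continuous_intros)
 then have sb [measurable]: "?s \<in> borel_measurable borel" by (rule continuous_borel)
 \<comment> \<open>Weight sqrt 2 = |e3 - e1|, the total variation per unit area of the jump;
   dividing by it makes \<sigma> a unit matrix.\<close>
 define \<mu> where "\<mu> = distr (density lborel (%z. ennreal (sqrt 2 * indicator Q z))) borel ?s"
 have s\<mu> [measurable_cong]: "sets \<mu> = sets borel" by (simp add: \<mu>_def)
 have em: "emeasure \<mu> A = (\<integral>\<^sup>+z. ennreal (sqrt 2 * indicator Q z) * indicator A (?s z) \<partial>lborel)" if [measurable]: "A \<in> sets borel" for A
 proof -
  have [measurable]: "?s -` A \<in> sets borel" using measurable_sets[OF sb that] by simp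
  have "emeasure \<mu> A = emeasure (density lborel (%z. ennreal (sqrt 2 * indicator Q z))) (?s -` A)"
   unfolding \<mu>_def by (subst emeasure_distr) auto
  also have "... = (\<integral>\<^sup>+z. ennreal (sqrt 2 * indicator Q z) * indicator (?s -` A) z \<partial>lborel)" by (rule emeasure_density) auto
  finally show ?thesis by (simp add: indicator_vimage)
 qed
 have null: "A \<in> null_sets \<mu>" if A: "A \<in> sets borel" "A \<inter> {p \<in> \<Omega>. p $ 3 = \<alpha>} = {}" for A
 proof -
  have z: "ennreal (sqrt 2 * indicator Q z) * indicator A (?s z) = 0" for z using A(2) unfolding plane by (auto simp: indicator_def)
  have "emeasure \<mu> A = 0" unfolding em[OF A(1)] z by simp
  then show ?thesis using A(1) s\<mu> by (simp add: null_sets_def)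
 qed
 have fin\<mu>: "finite_measure \<mu>"
 proof (rule finite_measureI)
  have "emeasure \<mu> (space \<mu>) = (\<integral>\<^sup>+z. ennreal (sqrt 2) * indicator Q z \<partial>lborel)"
   using em[of UNIV] sets_eq_imp_space_eq[OF s\<mu>] by (auto simp: indicator_def intro!: nn_integral_cong)
  then show "emeasure \<mu> (space \<mu>) ~= \<infinity>" by (simp add: nn_integral_cmult_indicator areaQ ennreal_mult_eq_top_iff)
 qed
 define e where "e = (axis 3 1 - axis 1 1 :: real^3)"
 have ne: "norm e = sqrt 2" by (simp add: e_def norm_vec_def L2_set_def sum_3 axis_def)
 define \<sigma> where "\<sigma> = (%_ :: real^3. vertical_gradient (%_. e) 0 /\<^sub>R sqrt 2)"
 have \<sigma>1: "norm (\<sigma> x) = 1" for x by (simp add: \<sigma>_def norm_vertical_gradient ne)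
 have \<sigma>ij: "\<sigma> x $ i $ j = (if j = 3 then e $ i / sqrt 2 else 0)" for x i j
  by (simp add: \<sigma>_def vertical_gradient_def divide_inverse mult.commute)
 have uparts: "(LBINT x. n_jump \<alpha> x $ i * g x $ j) = - (LINT x|\<mu>. \<phi> x * \<sigma> x $ i $ j)"
  if t: "test_function \<Omega> \<phi> g" for \<phi> g i j
 proof -
  note t' = t[unfolded \<Omega>_def]
  obtain Cg where Cg: "Cg \<subseteq> \<Omega>" "!!x. x \<notin> Cg ==> \<phi> x = 0" "continuous_on UNIV \<phi>"
   using test_function_facts[OF t] by blast
  have [measurable]: "\<phi> \<in> borel_measurable borel" using Cg(3) by (rule continuous_borel)
  define a where "a t = axis 1 1 $ i + e $ i * indicator {\<alpha>..} t" for t :: real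
  have ab [measurable]: "a \<in> borel_measurable borel" unfolding a_def[abs_def] by measurable
  have aB: "\<bar>a t\<bar> <= \<bar>axis 1 1 $ i\<bar> + \<bar>e $ i\<bar>" for t by (auto simp: a_def indicator_def)
  have na: "n_jump \<alpha> p $ i = a (p $ 3)" for p by (simp add: n_jump_nth a_def e_def)
  show ?thesis
  proof (cases "j = 3")
   case False
   then show ?thesis using vertical_flux(1)[OF t' ab aB False] by (simp add: na \<sigma>ij)
  next
   case True
   have slice: "(LBINT t. a t * g (shear 0 0 (z, t)) $ 3) = - e $ i * \<phi> (?s z)" for z
   proof -
    define q where "q t = \<phi> (shear 0 0 (z, t))" for t
    define q' where "q' t = g (shear 0 0 (z, t)) $ 3" for t
    have q: "(q has_real_derivative q' t) (at t)" "continuous_on UNIV q'" "\<not> (z0 < t & t < z1) ==> q t = 0"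
      "\<not> (z0 < t & t < z1) ==> q' t = 0" for t using slice_test_function[OF t', where z=z] by (auto simp: q_def[abs_def] q'_def[abs_def])
    have P: "q z1 = q l + (LBINT s. indicator {l..z1} s * q' s)" "integrable lborel (%s. indicator {l..z1} s * q' s)"
     if "l <= z1" for l using primitive_of_deriv[OF that, of q q'] q(1) continuous_on_subset[OF q(2)] by auto
    have q0: "q z0 = 0" "q z1 = 0" using q(3) by auto
    have "a t * q' t = axis 1 1 $ i * (indicator {z0..z1} t * q' t) + e $ i * (indicator {\<alpha>..z1} t * q' t)" for t
     using q(4)[of t] \<alpha> by (cases "z0 < t & t < z1") (auto simp: a_def indicator_def algebra_simps)
    then have "(LBINT t. a t * q' t) = axis 1 1 $ i * (LBINT t. indicator {z0..z1} t * q' t) + e $ i * (LBINT t. indicator {\<alpha>..z1} t * q' t)"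
     using P(2)[of z0] P(2)[of \<alpha>] \<alpha> by simp
    moreover have "(LBINT t. indicator {z0..z1} t * q' t) = 0" "(LBINT t. indicator {\<alpha>..z1} t * q' t) = - q \<alpha>"
     using P(1)[of z0] P(1)[of \<alpha>] \<alpha> q0 by linarith+
    ultimately have "(LBINT t. a t * q' t) = - e $ i * q \<alpha>" by simp
    then show ?thesis by (simp add: q_def q'_def)
   qed
   have "(LBINT x. n_jump \<alpha> x $ i * g x $ j) = (LBINT z. - e $ i * \<phi> (?s z))" unfolding na True vertical_flux(2)[OF t' ab aB] slice ..
   also have "... = - (LBINT z. sqrt 2 * indicator Q z * (\<phi> (?s z) * (e $ i / sqrt 2)))"
   proof -
    have eq: "e $ i * \<phi> (?s z) = sqrt 2 * indicator Q z * (\<phi> (?s z) * (e $ i / sqrt 2))" for z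
    proof (cases "z \<in> Q")
     case False
     then have "\<phi> (?s z) = 0" using Cg(1,2) sQ[of z] by blast
     then show ?thesis by simp
    qed simp
    have "(LBINT z. - e $ i * \<phi> (?s z)) = - (LBINT z. e $ i * \<phi> (?s z))" by simp
    then show ?thesis unfolding eq .
   qed
   also have "(LBINT z. sqrt 2 * indicator Q z * (\<phi> (?s z) * (e $ i / sqrt 2))) = (LINT x|\<mu>. \<phi> x * \<sigma> x $ i $ j)"
   proof -
    define c where "c = e $ i / sqrt 2"
    have s: "\<sigma> x $ i $ 3 = c" for x by (simp add: \<sigma>ij c_def)
    show ?thesis unfolding True s c_def[symmetric] \<mu>_def by (subst integral_distr) (simp_all add: integral_density flip: mult.assoc)
   qed
   finally show ?thesis .
  qed
 qed
 \<comment> \<open>The closed rectangle is compact and contains the carrier of \<mu>; the constant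
   sequence suffices.\<close>
 define K where "K = (%_ :: nat. ?s ` cbox (- L1, - L2) (L1, L2))"
 have sl: "slicing L1 L2 z0 z1 (n_jump \<alpha>) (%_. 0) \<mu> \<sigma> K"
 proof (rule slicing.intro)
  show "compact (K n)" for n unfolding K_def by (intro compact_continuous_image continuous_on_subset[OF cs] compact_cbox) auto
  then have "closed (?s ` cbox (- L1, - L2) (L1, L2))" unfolding K_def by (rule compact_imp_closed)
  then have "- (?s ` cbox (- L1, - L2) (L1, L2)) \<in> null_sets \<mu>"
   unfolding plane[symmetric] by (intro null) (use plane box_subset_cbox[of "(- L1, - L2)" "(L1, L2)"] in \<open>auto simp: Q_def\<close>)
  then show "- (\<Union>n. K n) \<in> null_sets \<mu>" by (simp add: K_def)
  show "\<bar>\<sigma> x $ i $ j\<bar> <= 1" for i j x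
   using component_le_norm_cart[of "\<sigma> x $ i" j] Finite_Cartesian_Product.norm_nth_le[of "\<sigma> x" i] \<sigma>1[of x] by linarith
  show "\<sigma> \<in> borel_measurable borel" by (simp add: \<sigma>_def)
 qed (use s\<mu> fin\<mu> uparts in \<open>auto simp: norm_n_jump \<Omega>_def\<close>)
 interpret slicing L1 L2 z0 z1 "n_jump \<alpha>" "%_. 0" \<mu> \<sigma> K by (rule sl)
 have \<Omega>: "\<Omega> \<in> sets borel" "open \<Omega>" by (auto simp: \<Omega>_def open_box)
 note [measurable] = \<Omega>(1)
 have D: "has_measure_derivative \<Omega> (n_jump \<alpha>) \<mu> \<sigma>" unfolding has_measure_derivative_def
 proof (intro conjI allI impI)
  show "- \<Omega> \<in> null_sets \<mu>" using \<Omega> by (intro null) auto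
  fix \<phi> g i j assume t: "test_function \<Omega> \<phi> g"
  show "(LINT x : \<Omega> | lebesgue. n_jump \<alpha> x $ i * g x $ j) = - (LINT x|\<mu>. \<phi> x * \<sigma> x $ i $ j)"
   unfolding set_integral_test_gradient[OF t \<Omega>(2) n_jump_borel] uparts[OF t] ..
 qed (use s\<mu> fin\<mu> \<sigma>1 in \<open>auto simp: \<sigma>_def\<close>)
 have N: "{p :: real^3. p $ 3 = \<alpha>} \<in> null_sets lborel" "- {p. p $ 3 = \<alpha>} \<in> null_sets \<mu>"
 proof -
  have c: "closed {p :: real^3. p $ 3 = \<alpha>}" by (intro closed_Collect_eq continuous_intros)
  then show "{p :: real^3. p $ 3 = \<alpha>} \<in> null_sets lborel" using AE_component_neq[of \<alpha>] by (subst (asm) AE_iff_null) auto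
  show "- {p. p $ 3 = \<alpha>} \<in> null_sets \<mu>" using c by (intro null) auto
 qed
 have dec: "lebesgue_decomposition \<mu> (null_measure borel) \<mu>" unfolding lebesgue_decomposition_def
 proof (intro conjI ballI)
  show "absolutely_continuous lborel (null_measure borel :: (real^3) measure)" unfolding absolutely_continuous_def null_sets_def by auto
  show "\<exists>N\<in>null_sets lborel. - N \<in> null_sets \<mu>" using N by (rule bexI[rotated])
 qed (simp_all add: s\<mu>)
 have sing: "\<Omega> - approx_discontinuity_set \<Omega> (n_jump \<alpha>) \<in> null_sets \<mu>"
 proof (rule null)
  have "closed {p :: real^3. p $ 3 = \<alpha>}" by (intro closed_Collect_eq continuous_intros)
  then have "\<Omega> - {p. p $ 3 = \<alpha>} \<in> sets borel" using \<Omega> by auto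
  then show "\<Omega> - approx_discontinuity_set \<Omega> (n_jump \<alpha>) \<in> sets borel" unfolding disc by (simp add: set_diff_eq)
 qed (auto simp: disc)
 have grad: "AE x in lborel. x \<in> \<Omega> --> has_approx_gradient (n_jump \<alpha>) x 0" using AE_component_neq[of \<alpha>]
  by eventually_elim (auto intro!: has_approx_gradient_of_derivative n_jump_locally_const)
 have T: "n_jump \<alpha> x \<in> sphere 0 1 \<union> {0}" for x by (simp add: norm_n_jump)
 have fin: "hausdorff 2 (approx_discontinuity_set \<Omega> (n_jump \<alpha>)) < \<infinity>"
  unfolding disc using haus by (rule order.strict_trans1) simp
 note S = SBV2I[OF T grad[unfolded \<Omega>_def] N _ D[unfolded \<Omega>_def] dec sing[unfolded \<Omega>_def] fin[unfolded \<Omega>_def], folded \<Omega>_def]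
 show "n_jump \<alpha> \<in> SBV2 \<Omega> (sphere 0 1 \<union> {0})" "AE p in lborel. p \<in> \<Omega> --> approx_gradient (n_jump \<alpha>) p = 0"
  using S by auto
 show "hausdorff 2 (approx_discontinuity_set \<Omega> (n_jump \<alpha>)) <= ennreal (4 * L1 * L2)" unfolding disc by (rule haus)
qed

section \<open>Admissible maps, competitors and the three regimes\<close>

context
 fixes L1 L2 d \<epsilon> :: real
 assumes pos: "L1 > 0" "L2 > 0" "d > 0" "\<epsilon> > 0"
begin

lemma cell_facts:
 "open (cell L1 L2 d)" "open (extended_cell L1 L2 d \<epsilon>)" "cell L1 L2 d \<subseteq> extended_cell L1 L2 d \<epsilon>"
 "p \<in> extended_cell L1 L2 d \<epsilon> ==> 0 < p $ 3 ==> p $ 3 < d ==> p \<in> cell L1 L2 d"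
 "p \<in> cell L1 L2 d ==> extend_director d n p = n p" using pos by (auto simp: cell_def extended_cell_def mem_box3 extend_director_def open_box)

lemma cell_volume: "emeasure lborel (cell L1 L2 d) = ennreal (4 * L1 * L2 * d)"
proof -
 have "(vector [- L1, - L2, 0] :: real^3) \<bullet> b <= vector [L1, L2, d] \<bullet> b" if "b \<in> Basis" for b
  using that pos by (auto simp: Basis_vec_def inner_axis UNIV_3)
 then show ?thesis unfolding cell_def by (subst emeasure_lborel_box) (simp_all add: prod_Basis_vec3 inner_axis mult_ac)
qed

text \<open>Changing the map on a null set of the cell changes its extension on a null set only, and
  gradients and discontinuity sets depend on averages. Minimisers can therefore be characterised
  only up to null sets.\<close>

lemma energy_cong_AE:
 assumes m: "m \<in> admissible L1 L2 d \<epsilon>" and ae: "AE x in lborel. x \<in> cell L1 L2 d --> n x = m x"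
 shows "n \<in> admissible L1 L2 d \<epsilon>" "energy L1 L2 d \<epsilon> k n = energy L1 L2 d \<epsilon> k m"
proof -
 have ae1: "AE x in lebesgue. x \<in> cell L1 L2 d --> m x = n x" using ae unfolding AE_completion_iff by eventually_elim simp
 have ae2: "AE x in lebesgue. x \<in> extended_cell L1 L2 d \<epsilon> --> extend_director d m x = extend_director d n x"
  using ae1 by eventually_elim (use cell_facts(4) in \<open>auto simp: extend_director_def\<close>)
 have m': "m \<in> SBV2 (cell L1 L2 d) (sphere 0 1 \<union> {0})"
   "extend_director d m \<in> SBV2 (extended_cell L1 L2 d \<epsilon>) (sphere 0 1 \<union> {0})" using m by (auto simp: admissible_def)
 show "n \<in> admissible L1 L2 d \<epsilon>"
  using SBV2_cong_AE[OF cell_facts(1) m'(1) ae1] SBV2_cong_AE[OF cell_facts(2) m'(2) ae2] by (simp add: admissible_def)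
 note M1 = SBV2_measurable[OF m'(1)] and M2 = SBV2_measurable[OF m'(2)]
 note C1 = approx_gradient_cong_AE[OF cell_facts(1) ae1 M1 measurable_cong_AE_on[OF M1 ae1]]
 note C2 = approx_gradient_cong_AE[OF cell_facts(2) ae2 M2 measurable_cong_AE_on[OF M2 ae2]]
 have "(\<integral>\<^sup>+ x \<in> cell L1 L2 d. ennreal ((norm (approx_gradient n x))\<^sup>2) \<partial>lebesgue)
   = (\<integral>\<^sup>+ x \<in> cell L1 L2 d. ennreal ((norm (approx_gradient m x))\<^sup>2) \<partial>lebesgue)"
  by (intro nn_integral_cong) (auto simp: indicator_def C1(1))
 then show "energy L1 L2 d \<epsilon> k n = energy L1 L2 d \<epsilon> k m" by (simp add: energy_def C2(2))
qed

text \<open>The slicing is done for the extended map, so a violated boundary condition appears as a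
  jump on a face. On the open cell the extension agrees with n, which identifies the bulk
  energies.\<close>

lemma admissible_director:
 assumes n: "n \<in> admissible L1 L2 d \<epsilon>"
 shows "\<exists>w H \<mu> \<sigma> K D C. director L1 L2 d \<epsilon> w H \<mu> \<sigma> K D C &
  (AE p in lborel. p \<in> cell L1 L2 d --> n p = w p) & (\<forall>k. director.functional L1 L2 d H D k = energy L1 L2 d \<epsilon> k n) &
  (AE p in lborel. p \<in> extended_cell L1 L2 d \<epsilon> --> p $ 3 < 0 \<or> d < p $ 3 --> H p = 0)"
proof -
 let ?T = "sphere 0 1 \<union> {0 :: real^3}" and ?E = "extended_cell L1 L2 d \<epsilon>"
 have n': "n \<in> SBV2 (cell L1 L2 d) ?T" "extend_director d n \<in> SBV2 (box (vector [- L1, - L2, - \<epsilon>]) (vector [L1, L2, d + \<epsilon>])) ?T"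
  using n by (auto simp: admissible_def extended_cell_def)
 have T: "closed ?T" "?T \<subseteq> cball 0 1" "0 \<in> ?T" by auto
 obtain w H \<mu> \<sigma> K where W: "slicing L1 L2 (- \<epsilon>) (d + \<epsilon>) w H \<mu> \<sigma> K" "\<forall>x. w x \<in> ?T"
   "AE x in lborel. x \<in> ?E --> extend_director d n x = w x" "(\<Union>n. K n) \<subseteq> approx_discontinuity_set ?E (extend_director d n)"
   "AE x in lborel. x \<in> ?E --> approx_gradient (extend_director d n) x = H x"
   "AE x in lborel. x \<in> ?E --> (\<forall>G. has_approx_gradient (extend_director d n) x G --> G = H x)"
  using SBV2_slicing[OF n'(2) T, folded extended_cell_def] by (elim exE conjE) (rule that, assumption+)
 define D where "D = approx_discontinuity_set ?E (extend_director d n)"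
 have fin: "hausdorff 2 D < \<infinity>" using n'(2) by (simp add: SBV2_def D_def extended_cell_def)
 obtain C where C: "fine_covers D C" using fine_covers_exist[OF fin] .
 have dir: "director L1 L2 d \<epsilon> w H \<mu> \<sigma> K D C"
 proof (rule director.intro[OF W(1)], rule director_axioms.intro)
  show "w x = 0 \<or> norm (w x) = 1" for x using spec[OF W(2), of x] by auto
  show "AE p in lborel. p \<in> box (vector [- L1, - L2, - \<epsilon>]) (vector [L1, L2, d + \<epsilon>]) --> p $ 3 < 0 --> w p = axis 1 1"
   using W(3) unfolding extended_cell_def by eventually_elim (auto simp: extend_director_def)
  show "AE p in lborel. p \<in> box (vector [- L1, - L2, - \<epsilon>]) (vector [L1, L2, d + \<epsilon>]) --> d < p $ 3 --> w p = axis 3 1"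
   using W(3) unfolding extended_cell_def by eventually_elim (use pos in \<open>auto simp: extend_director_def\<close>)
  show "(\<Union>n. K n) \<subseteq> D" using W(4) by (simp add: D_def)
  show "D \<subseteq> box (vector [- L1, - L2, - \<epsilon>]) (vector [L1, L2, d + \<epsilon>])"
   by (auto simp: D_def approx_discontinuity_set_def extended_cell_def)
 qed (use pos fin C in auto)
 have nw: "AE p in lborel. p \<in> cell L1 L2 d --> n p = w p" using W(3) by eventually_elim (use cell_facts(3,5) in auto)
 have M1: "(%y. indicat_real (cell L1 L2 d) y *\<^sub>R n y) \<in> borel_measurable lebesgue" by (rule SBV2_measurable[OF n'(1)])
 have eq: "AE y in lebesgue. y \<in> cell L1 L2 d --> n y = extend_director d n y" by (rule AE_I2) (simp add: cell_facts(5))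
 note G = approx_gradient_cong_AE(1)[OF cell_facts(1) eq M1 measurable_cong_AE_on[OF M1 eq]]
 have en: "director.functional L1 L2 d H D k = energy L1 L2 d \<epsilon> k n" for k
 proof -
  have b: "H \<in> borel_measurable borel" using director.H_borel[OF dir] .
  have [measurable]: "cell L1 L2 d \<in> sets borel" using cell_facts(1) by simp
  have "(\<integral>\<^sup>+ x \<in> cell L1 L2 d. ennreal ((norm (approx_gradient n x))\<^sup>2) \<partial>lebesgue)
    = (\<integral>\<^sup>+ x. ennreal ((norm (H x))\<^sup>2) * indicator (cell L1 L2 d) x \<partial>lebesgue)"
  proof (rule nn_integral_cong_AE)
   show "AE x in lebesgue. ennreal ((norm (approx_gradient n x))\<^sup>2) * indicator (cell L1 L2 d) x
     = ennreal ((norm (H x))\<^sup>2) * indicator (cell L1 L2 d) x" unfolding AE_completion_iff using W(5)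
   proof eventually_elim
    case (elim x)
    show ?case
    proof (cases "x \<in> cell L1 L2 d")
     case True
     then have "approx_gradient n x = H x" using G[OF True] elim cell_facts(3) by auto
     then show ?thesis by simp
    qed simp
   qed
  qed
  also have "... = (\<integral>\<^sup>+ x. ennreal ((norm (H x))\<^sup>2) * indicator (cell L1 L2 d) x \<partial>lborel)"
   by (rule nn_integral_completion)
  finally show ?thesis unfolding director.functional_def[OF dir] unfolding energy_def D_def by simp
 qed
 \<comment> \<open>In the open layers the extension is locally constant, so 0 is an approximate
   gradient there and must equal H.\<close>
 have lay: "AE p in lborel. p \<in> ?E --> p $ 3 < 0 \<or> d < p $ 3 --> H p = 0" using W(6)
 proof eventually_elim
  case (elim p)
  show ?case
  proof (intro impI)
   assume p: "p \<in> ?E" "p $ 3 < 0 \<or> d < p $ 3"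
   have o: "open {q :: real^3. q $ 3 < 0}" "open {q :: real^3. d < q $ 3}" by (intro open_Collect_less continuous_intros)+
   have "(extend_director d n has_derivative (%_. 0)) (at p)" using p(2)
   proof
    assume "p $ 3 < 0"
    then show ?thesis by (intro has_derivative_transform_within_open[OF has_derivative_const o(1)]) (auto simp: extend_director_def)
   next
    assume "d < p $ 3"
    then show ?thesis using pos by (intro has_derivative_transform_within_open[OF has_derivative_const o(2)]) (auto simp: extend_director_def)
   qed
   then have "has_approx_gradient (extend_director d n) p 0" by (intro has_approx_gradient_of_derivative) simp
   then show "H p = 0" using elim p(1) by auto
  qed
 qed
 show ?thesis by (intro exI conjI allI) (rule dir, rule nw, rule en, rule lay)
qed

text \<open>The extended map is a single jump across the base at every height \<alpha> from 0 to d.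
  The cell needs a case distinction because for \<alpha> = 0 or \<alpha> = d the jump plane is a
  face and lies outside the open cell.\<close>

lemma n_jump_competitor:
 assumes \<alpha>: "0 <= \<alpha>" "\<alpha> <= d"
 shows "n_jump \<alpha> \<in> admissible L1 L2 d \<epsilon>" "energy L1 L2 d \<epsilon> k (n_jump \<alpha>) <= ennreal k * ennreal (4 * L1 * L2)"
proof -
 let ?T = "sphere 0 1 \<union> {0 :: real^3}"
 have ae: "AE x in lebesgue. x \<in> extended_cell L1 L2 d \<epsilon> --> n_jump \<alpha> x = extend_director d (n_jump \<alpha>) x"
  using AE_component_neq[of \<alpha>] unfolding AE_completion_iff
  by eventually_elim (use \<alpha> pos in \<open>auto simp: n_jump_def extend_director_def\<close>)
 have J: "n_jump \<alpha> \<in> SBV2 (extended_cell L1 L2 d \<epsilon>) ?T"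
   "hausdorff 2 (approx_discontinuity_set (extended_cell L1 L2 d \<epsilon>) (n_jump \<alpha>)) <= ennreal (4 * L1 * L2)"
  unfolding extended_cell_def by (rule jump_SBV2; use \<alpha> pos in simp)+
 have cell: "n_jump \<alpha> \<in> SBV2 (cell L1 L2 d) ?T & (AE p in lborel. p \<in> cell L1 L2 d --> approx_gradient (n_jump \<alpha>) p = 0)"
 proof (cases "0 < \<alpha> & \<alpha> < d")
  case True
  then have \<alpha>': "0 < \<alpha>" "\<alpha> < d" by auto
  show ?thesis unfolding cell_def using jump_SBV2(1,2)[OF \<alpha>' pos(1,2)] by (rule conjI)
 next
  \<comment> \<open>The jump sits on a face: inside the cell the map is constant, and
    \<open>vertical_SBV2\<close> with h = 0 applies.\<close>
  case False
  define c where "c = (if \<alpha> = 0 then axis 3 1 else axis 1 1 :: real^3)"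
  have c: "norm c = 1" by (simp add: c_def)
  have V: "(%_. c) \<in> SBV2 (cell L1 L2 d) ?T" "AE p in lborel. p \<in> cell L1 L2 d --> norm (approx_gradient (%_. c) p) = norm (0 :: real^3)"
   using vertical_SBV2(1,2)[of 0 d "%_. c" "%_. 0" 0 "{}" L1 L2] pos c unfolding cell_def by auto
  have eq: "AE y in lebesgue. y \<in> cell L1 L2 d --> c = n_jump \<alpha> y"
   using False \<alpha> by (intro AE_I2) (auto simp: c_def n_jump_def cell_def mem_box3)
  note M = SBV2_measurable[OF V(1)]
  note G = approx_gradient_cong_AE(1)[OF cell_facts(1) eq M measurable_cong_AE_on[OF M eq]]
  have "AE p in lborel. p \<in> cell L1 L2 d --> approx_gradient (n_jump \<alpha>) p = 0" using V(2) by eventually_elim (use G in auto)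
  then show ?thesis using SBV2_cong_AE[OF cell_facts(1) V(1) eq] by blast
 qed
 note MJ = SBV2_measurable[OF J(1)]
 note CJ = approx_gradient_cong_AE(2)[OF cell_facts(2) ae MJ measurable_cong_AE_on[OF MJ ae]]
 show "n_jump \<alpha> \<in> admissible L1 L2 d \<epsilon>" using cell SBV2_cong_AE[OF cell_facts(2) J(1) ae] by (simp add: admissible_def)
 have "(\<integral>\<^sup>+ x \<in> cell L1 L2 d. ennreal ((norm (approx_gradient (n_jump \<alpha>) x))\<^sup>2) \<partial>lebesgue) = (\<integral>\<^sup>+ (x :: real^3). 0 \<partial>lebesgue)"
 proof (rule nn_integral_cong_AE)
  show "AE x in lebesgue. ennreal ((norm (approx_gradient (n_jump \<alpha>) x))\<^sup>2) * indicator (cell L1 L2 d) x = 0"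
   unfolding AE_completion_iff using conjunct2[OF cell] by eventually_elim (auto simp: indicator_def)
 qed
 then show "energy L1 L2 d \<epsilon> k (n_jump \<alpha>) <= ennreal k * ennreal (4 * L1 * L2)"
  unfolding energy_def CJ[symmetric] using J(2) by (simp add: mult_left_mono)
qed

text \<open>Its extension is the rotating curve N evaluated at the height clamped to [0, d],
  continuous because N meets e1 and e3 at the faces. The gradient has norm \<omega> in the cell, and
  \<omega>^2 d = pi^2 / (4 d) is the energy per unit area.\<close>

lemma n_star_competitor:
 shows "n_star d \<in> admissible L1 L2 d \<epsilon>"
  "energy L1 L2 d \<epsilon> k (n_star d) <= ennreal (pi\<^sup>2 / (4 * d)) * ennreal (4 * L1 * L2)"
proof -
 let ?T = "sphere 0 1 \<union> {0 :: real^3}"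
 define \<omega> where "\<omega> = pi / (2 * d)"
 define N where "N t = (vector [cos (\<omega> * t), 0, sin (\<omega> * t)] :: real^3)" for t
 define N' where "N' t = (vector [- (\<omega> * sin (\<omega> * t)), 0, \<omega> * cos (\<omega> * t)] :: real^3)" for t
 define v where "v t = N (max 0 (min d t))" for t
 define h where "h t = indicat_real {0<..<d} t *\<^sub>R N' t" for t
 have \<omega>: "\<omega> > 0" "\<omega> * d = pi / 2" using pos by (auto simp: \<omega>_def)
 have Nd: "((%t. N t $ i) has_real_derivative N' t $ i) (at t)" for t i
  using exhaust_3[of i] by (elim disjE) (auto simp: N_def N'_def intro!: derivative_eq_intros)
 have Nv: "(N has_vector_derivative N' t) (at t)" for t
 proof -
  have NN: "N = (%t. cos (\<omega> * t) *\<^sub>R axis 1 1 + sin (\<omega> * t) *\<^sub>R axis 3 1)"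
   by (auto simp: N_def fun_eq_iff vec_eq_iff forall_3 axis_def)
  have c: "((%t. cos (\<omega> * t)) has_real_derivative - \<omega> * sin (\<omega> * t)) (at t)"
   "((%t. sin (\<omega> * t)) has_real_derivative \<omega> * cos (\<omega> * t)) (at t)" by (auto intro!: derivative_eq_intros)
  show ?thesis unfolding NN
   by (rule has_vector_derivative_eq_rhs[OF has_vector_derivative_add[OF has_vector_derivative_scaleR[OF c(1) has_vector_derivative_const]
      has_vector_derivative_scaleR[OF c(2) has_vector_derivative_const]]])
    (auto simp: N'_def vec_eq_iff forall_3 axis_def)
 qed
 have N'i: "continuous_on A (%t. N' t $ i)" for A i using exhaust_3[of i] by (elim disjE) (auto simp: N'_def intro!: continuous_intros)
 have cN: "continuous_on UNIV N" using Nv by (intro continuous_at_imp_continuous_on ballI has_vector_derivative_continuous)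
 have nN: "norm (N t) = 1" for t by (simp add: N_def norm_vec_def L2_set_def sum_3)
 have nN': "norm (N' t) = \<omega>" for t
 proof -
  have "(\<omega> * sin (\<omega> * t))\<^sup>2 + (\<omega> * cos (\<omega> * t))\<^sup>2 = \<omega>\<^sup>2"
   by (simp add: power_mult_distrib flip: distrib_left)
  then show ?thesis using \<omega>(1) by (simp add: N'_def norm_vec_def L2_set_def sum_3)
 qed
 have "cos (\<omega> * d) = 0" "sin (\<omega> * d) = 1" unfolding \<omega>(2) by simp_all
 then have N0: "N 0 = axis 1 1" "N d = axis 3 1" by (auto simp: N_def vec_eq_iff forall_3 axis_def)
 have cv: "continuous_on UNIV v" unfolding v_def[abs_def] by (intro continuous_on_compose2[OF cN] continuous_intros) auto
 have hb: "h \<in> borel_measurable borel" unfolding nth_measurable_iff h_def using continuous_borel[OF N'i] by simp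
 have hM: "norm (h t) <= \<omega>" for t using \<omega>(1) by (simp add: h_def nN' indicator_def)
 \<comment> \<open>Stated for any starting height z0 <= 0, as it serves both the cell (z0 = 0) and
   the extended cell (z0 = - \<epsilon>).\<close>
 have prim: "v t $ i = v z0 $ i + (LBINT s. indicator {z0..t} s * h s $ i)" if z: "z0 <= 0" "z0 <= t" for z0 t i
 proof -
  define m where "m = max 0 (min d t)"
  have m: "0 <= m" "m <= d" using pos by (auto simp: m_def)
  have "(LBINT s. indicator {z0..t} s * h s $ i) = (LBINT s. indicator {0..m} s * N' s $ i)"
  proof (rule integral_cong_AE)
   show "AE s in lborel. indicator {z0..t} s * h s $ i = indicator {0..m} s * N' s $ i" using AE_lborel_singleton[of 0] AE_lborel_singleton[of d]
   proof eventually_elim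
    case (elim s)
    then show ?case using z pos by (auto simp: h_def indicator_def m_def)
   qed
   have [measurable]: "(%s. N' s $ i) \<in> borel_measurable borel" "(%s. h s $ i) \<in> borel_measurable borel"
    using continuous_borel[OF N'i] hb unfolding nth_measurable_iff by auto
   show "(%s. indicator {z0..t} s * h s $ i) \<in> borel_measurable lborel" "(%s. indicator {0..m} s * N' s $ i) \<in> borel_measurable lborel"
    by measurable
  qed
  moreover have "N m $ i = N 0 $ i + (LBINT s. indicator {0..m} s * N' s $ i)" by (rule primitive_of_deriv[OF m(1) Nd N'i])
  moreover have "v z0 = N 0" using z(1) pos by (simp add: v_def max_def min_def)
  ultimately show ?thesis by (simp add: v_def m_def)
 qed
 have der: "(v has_vector_derivative h t) (at t)" if tE: "t \<notin> {0, d}" for t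
 proof -
  consider "t < 0" | "0 < t" "t < d" | "d < t" using tE by (cases t "0 :: real" rule: linorder_cases; cases t d rule: linorder_cases) auto
  then show ?thesis
  proof cases
   case 1
   have "((%_. N 0) has_vector_derivative 0) (at t)" by simp
   then have "(v has_vector_derivative 0) (at t)"
    by (rule has_vector_derivative_transform_within_open[of _ _ _ "{..<0}"]) (use 1 pos in \<open>auto simp: v_def max_def min_def\<close>)
   then show ?thesis using 1 by (simp add: h_def)
  next
   case 2
   have "(v has_vector_derivative N' t) (at t)"
    by (rule has_vector_derivative_transform_within_open[OF Nv open_greaterThanLessThan[of 0 d]]) (use 2 in \<open>auto simp: v_def\<close>)
   then show ?thesis using 2 by (simp add: h_def)
  next
   case 3
   have "((%_. N d) has_vector_derivative 0) (at t)" by simp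
   then have "(v has_vector_derivative 0) (at t)"
    by (rule has_vector_derivative_transform_within_open[of _ _ _ "{d<..}"]) (use 3 pos in \<open>auto simp: v_def max_def min_def\<close>)
   then show ?thesis using 3 by (simp add: h_def)
  qed
 qed
 have nv: "norm (v t) = 1" for t by (simp add: v_def nN)
 have E: "finite {0, d}" by simp
 have z1: "0 < d" "- \<epsilon> < d + \<epsilon>" using pos by auto
 have p1: "v t $ i = v 0 $ i + (LBINT s. indicator {0..t} s * h s $ i)" if "0 <= t" for t i using prim[OF order_refl that] .
 have p2: "v t $ i = v (- \<epsilon>) $ i + (LBINT s. indicator {- \<epsilon>..t} s * h s $ i)" if "- \<epsilon> <= t" for t i
  using prim[OF _ that] pos by simp
 have V1: "(%p. v (p $ 3)) \<in> SBV2 (cell L1 L2 d) ?T"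
   "AE p in lborel. p \<in> cell L1 L2 d --> norm (approx_gradient (%p. v (p $ 3)) p) = norm (h (p $ 3))"
  unfolding cell_def by (rule vertical_SBV2[OF z1(1) nv cv hb hM _ E]; (rule p1 | rule der); assumption)+
 have V2: "(%p. v (p $ 3)) \<in> SBV2 (extended_cell L1 L2 d \<epsilon>) ?T"
   "approx_discontinuity_set (extended_cell L1 L2 d \<epsilon>) (%p. v (p $ 3)) = {}"
  unfolding extended_cell_def by (rule vertical_SBV2[OF z1(2) nv cv hb hM _ E]; (rule p2 | rule der); assumption)+
 have star: "n_star d p = N (p $ 3)" for p by (simp add: n_star_def N_def \<omega>_def)
 have ext: "extend_director d (n_star d) = (%p. v (p $ 3))" using N0 pos by (auto simp: fun_eq_iff extend_director_def v_def star)
 have eq: "AE y in lebesgue. y \<in> cell L1 L2 d --> v (y $ 3) = n_star d y" by (intro AE_I2) (auto simp: star v_def cell_def mem_box3)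
 note M = SBV2_measurable[OF V1(1)]
 note G = approx_gradient_cong_AE(1)[OF cell_facts(1) eq M measurable_cong_AE_on[OF M eq]]
 show "n_star d \<in> admissible L1 L2 d \<epsilon>" using SBV2_cong_AE[OF cell_facts(1) V1(1) eq] V2(1) by (simp add: admissible_def ext)
 have "(\<integral>\<^sup>+ x \<in> cell L1 L2 d. ennreal ((norm (approx_gradient (n_star d) x))\<^sup>2) \<partial>lebesgue)
   = (\<integral>\<^sup>+ x. ennreal (\<omega>\<^sup>2) * indicator (cell L1 L2 d) x \<partial>lebesgue)"
 proof (rule nn_integral_cong_AE)
  show "AE x in lebesgue. ennreal ((norm (approx_gradient (n_star d) x))\<^sup>2) * indicator (cell L1 L2 d) x
    = ennreal (\<omega>\<^sup>2) * indicator (cell L1 L2 d) x" unfolding AE_completion_iff using V1(2)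
  proof eventually_elim
   case (elim x)
   show ?case
   proof (cases "x \<in> cell L1 L2 d")
    case True
    then have "0 < x $ 3" "x $ 3 < d" by (auto simp: cell_def mem_box3)
    then have "norm (approx_gradient (n_star d) x) = \<omega>" using elim True G[OF True] by (simp add: h_def nN')
    then show ?thesis by simp
   qed simp
  qed
 qed
 also have "... = ennreal (\<omega>\<^sup>2) * ennreal (4 * L1 * L2 * d)"
  using cell_facts(1) by (simp add: nn_integral_cmult_indicator emeasure_completion cell_volume)
 also have "... = ennreal (pi\<^sup>2 / (4 * d)) * ennreal (4 * L1 * L2)" using pos by (simp add: \<omega>_def power2_eq_square flip: ennreal_mult)
 finally show "energy L1 L2 d \<epsilon> k (n_star d) <= ennreal (pi\<^sup>2 / (4 * d)) * ennreal (4 * L1 * L2)"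
  unfolding energy_def ext V2(2) hausdorff_empty by simp
qed

lemma energy_lower_bound:
 assumes "n \<in> admissible L1 L2 d \<epsilon>" "c <= k" "c <= pi\<^sup>2 / (4 * d)"
 shows "ennreal c * ennreal (4 * L1 * L2) <= energy L1 L2 d \<epsilon> k n"
proof -
 obtain w H \<mu> \<sigma> K D C where D: "director L1 L2 d \<epsilon> w H \<mu> \<sigma> K D C"
   "\<forall>k. director.functional L1 L2 d H D k = energy L1 L2 d \<epsilon> k n"
  using admissible_director[OF assms(1)] by (elim exE conjE) (rule that, assumption+)
 show ?thesis using director.functional_lower_bound[OF D(1) assms(2,3)] unfolding D(2)[rule_format] .
qed

lemma n_star_rigid:
 assumes "n \<in> admissible L1 L2 d \<epsilon>" "pi\<^sup>2 / (4 * d) < k" "energy L1 L2 d \<epsilon> k n <= ennreal (pi\<^sup>2 / (4 * d)) * ennreal (4 * L1 * L2)"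
 shows "AE x in lborel. x \<in> cell L1 L2 d --> n x = n_star d x"
proof -
 obtain w H \<mu> \<sigma> K D C where D: "director L1 L2 d \<epsilon> w H \<mu> \<sigma> K D C" "AE p in lborel. p \<in> cell L1 L2 d --> n p = w p"
   "\<forall>k. director.functional L1 L2 d H D k = energy L1 L2 d \<epsilon> k n"
  using admissible_director[OF assms(1)] by (elim exE conjE) (rule that, assumption+)
 have "AE p in lborel. p \<in> cell L1 L2 d --> w p = n_star d p"
  by (rule director.minimal_eq_n_star[OF D(1) assms(2)]) (simp only: D(3)[rule_format] assms(3))
 with D(2) show ?thesis by eventually_elim simp
qed

lemma n_jump_rigid:
 assumes "n \<in> admissible L1 L2 d \<epsilon>" "0 < k" "k < pi\<^sup>2 / (4 * d)" "energy L1 L2 d \<epsilon> k n <= ennreal k * ennreal (4 * L1 * L2)"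
 shows "\<exists>\<alpha>. 0 <= \<alpha> & \<alpha> <= d & (AE x in lborel. x \<in> cell L1 L2 d --> n x = n_jump \<alpha> x)"
proof -
 obtain w H \<mu> \<sigma> K D C where D: "director L1 L2 d \<epsilon> w H \<mu> \<sigma> K D C" "AE p in lborel. p \<in> cell L1 L2 d --> n p = w p"
   "\<forall>k. director.functional L1 L2 d H D k = energy L1 L2 d \<epsilon> k n"
   "AE p in lborel. p \<in> extended_cell L1 L2 d \<epsilon> --> p $ 3 < 0 \<or> d < p $ 3 --> H p = 0"
  using admissible_director[OF assms(1)] by (elim exE conjE) (rule that, assumption+)
 have le: "director.functional L1 L2 d H D k <= ennreal k * ennreal (4 * L1 * L2)" unfolding D(3)[rule_format] by (rule assms(4))
 from director.minimal_eq_n_jump[OF D(1) assms(2,3) le D(4)[unfolded extended_cell_def]]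
 obtain \<alpha> where \<alpha>: "0 <= \<alpha> & \<alpha> <= d & (AE p in lborel. p \<in> extended_cell L1 L2 d \<epsilon> --> w p = n_jump \<alpha> p)"
  unfolding extended_cell_def ..
 from D(2) conjunct2[OF conjunct2[OF \<alpha>]] have "AE x in lborel. x \<in> cell L1 L2 d --> n x = n_jump \<alpha> x"
  by eventually_elim (use cell_facts(3) in auto)
 then show ?thesis using \<alpha> by blast
qed

end

theorem theorem8p2:
  fixes L1 L2 d K \<epsilon> :: real
  assumes "L1 > 0" and "L2 > 0" and "d > 0" and "K > 0" and "\<epsilon> > 0"
  shows
    "(K > pi\<^sup>2 / (4 * d) \<longrightarrow>
        (\<forall>n. global_minimiser L1 L2 d \<epsilon> K n \<longleftrightarrow>
             (AE x in lebesgue_on (cell L1 L2 d). n x = n_star d x))) \<and>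
     (K < pi\<^sup>2 / (4 * d) \<longrightarrow>
        (\<forall>\<alpha>. 0 < \<alpha> \<and> \<alpha> < d \<longrightarrow> global_minimiser L1 L2 d \<epsilon> K (n_jump \<alpha>)) \<and>
        (\<forall>n. global_minimiser L1 L2 d \<epsilon> K n \<longleftrightarrow>
             (\<exists>\<alpha>. 0 \<le> \<alpha> \<and> \<alpha> \<le> d \<and>
                  (AE x in lebesgue_on (cell L1 L2 d). n x = n_jump \<alpha> x)))) \<and>
     (K = pi\<^sup>2 / (4 * d) \<longrightarrow>
        global_minimiser L1 L2 d \<epsilon> K (n_star d) \<and>
        (\<forall>\<alpha>. 0 < \<alpha> \<and> \<alpha> < d \<longrightarrow> global_minimiser L1 L2 d \<epsilon> K (n_jump \<alpha>)))"
proof -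
 note pos = assms(1,2,3,5)
 \<comment> \<open>Energy per unit area of the rotating competitor; a jump costs K per unit area,
   hence the comparison of K with c.\<close>
 define c where "c = pi\<^sup>2 / (4 * d)"
 define A where "A = ennreal (4 * L1 * L2)"
 let ?E = "energy L1 L2 d \<epsilon> K" and ?adm = "admissible L1 L2 d \<epsilon>" and ?min = "global_minimiser L1 L2 d \<epsilon> K"
 have lower: "ennreal b * A <= ?E n" if "n \<in> ?adm" "b <= K" "b <= c" for b n
  using energy_lower_bound[OF pos that(1,2)] that(3) by (simp add: c_def A_def)
 have ae: "(AE x in lebesgue_on (cell L1 L2 d). P x) \<longleftrightarrow> (AE x in lborel. x \<in> cell L1 L2 d --> P x)" for P
  by (rule AE_lebesgue_on_iff[OF cell_facts(1)[OF pos]])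
 have star: "n_star d \<in> ?adm" "?E (n_star d) <= ennreal c * A" using n_star_competitor[OF pos] by (auto simp: c_def A_def)
 have jump: "n_jump \<alpha> \<in> ?adm" "?E (n_jump \<alpha>) <= ennreal K * A" if "0 <= \<alpha>" "\<alpha> <= d" for \<alpha>
  using n_jump_competitor[OF pos that] by (auto simp: A_def)
 have star_min: "?min n" if "c <= K" "AE x in lborel. x \<in> cell L1 L2 d --> n x = n_star d x" for n unfolding global_minimiser_def
  using energy_cong_AE[OF pos star(1) that(2)] star(2) lower[OF _ that(1) order_refl] by (auto intro: order_trans)
 have jump_min: "?min n" if "K <= c" "0 <= \<alpha>" "\<alpha> <= d" "AE x in lborel. x \<in> cell L1 L2 d --> n x = n_jump \<alpha> x" for n \<alpha>
  unfolding global_minimiser_def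
  using energy_cong_AE[OF pos jump(1)[OF that(2,3)] that(4)] jump(2)[OF that(2,3)] lower[OF _ order_refl that(1)] by (auto intro: order_trans)
 have "?min n \<longleftrightarrow> (AE x in lborel. x \<in> cell L1 L2 d --> n x = n_star d x)" if K: "c < K" for n
 proof
  assume "?min n"
  then have n: "n \<in> ?adm" "?E n <= ?E (n_star d)" using star(1) by (auto simp: global_minimiser_def)
  show "AE x in lborel. x \<in> cell L1 L2 d --> n x = n_star d x"
   using n_star_rigid[OF pos n(1)] K order_trans[OF n(2) star(2)] by (simp add: c_def A_def)
 qed (use star_min K in auto)
 moreover have "?min n \<longleftrightarrow> (\<exists>\<alpha>. 0 <= \<alpha> & \<alpha> <= d & (AE x in lborel. x \<in> cell L1 L2 d --> n x = n_jump \<alpha> x))" if K: "K < c" for n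
 proof
  assume "?min n"
  \<comment> \<open>Any height in [0, d] would serve for the comparison, since all these maps
    satisfy the same energy bound.\<close>
  then have n: "n \<in> ?adm" "?E n <= ?E (n_jump 0)" using jump(1)[of 0] pos by (auto simp: global_minimiser_def)
  have "?E n <= ennreal K * A" using order_trans[OF n(2) jump(2)[of 0]] pos by simp
  then show "\<exists>\<alpha>. 0 <= \<alpha> & \<alpha> <= d & (AE x in lborel. x \<in> cell L1 L2 d --> n x = n_jump \<alpha> x)"
   using n_jump_rigid[OF pos n(1) assms(4)] K by (simp add: c_def A_def)
 qed (use jump_min K in auto)
 moreover have "?min (n_jump \<alpha>)" if "K <= c" "0 < \<alpha> & \<alpha> < d" for \<alpha> using jump_min[of \<alpha>] that by auto
 moreover have "?min (n_star d)" if "K = c" using star_min[of "n_star d"] that by auto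
 ultimately show ?thesis unfolding ae c_def[symmetric] by auto
qed

end
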